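(* Let $\Omega\subset\mathbb R^2$ be a bounded domain, and let $U[X]=\int_\Omega\big(\tfrac{\varrho^2}2-\varrho b\big)\,dx$ on $\mathsf{Diff}_{\varrho_0}(\Omega)$, $\varrho=\varrho_X$. The potential $U$ is constraining to the set $$\mathcal M=\{X\in\mathsf{Diff}_{\varrho_0}(\Omega):\varrho_X=\bar H+b\},\qquad \bar H=\frac1{|\Omega|}\int_\Omega(\varrho_0-b)\,dx.$$ The Eulerian form of the geodesic equation on $\mathcal M$ is given by the lake equation $$\partial_tu+u\cdot\nabla u=-\nabla P,\qquad\mathrm{div}\big((\bar H+b)u\big)=0.$$ The homogenized potential of $U$ is constant on $\mathcal M$, so the Takens limit system agrees with the lake equation.
   Context: $\varrho_0:\Omega\to(0,\infty)$ (initial height of the fluid layer) and $b:\Omega\to\mathbb R$ (depth of the bottom) are given smooth functions. $\mathsf{Diff}(\Omega)$ is the group of smooth diffeomorphisms of $\Omega$ leaving the boundary invariant, $T_X\mathsf{Diff}(\Omega)=\{\zeta\circ X:\zeta$ smooth, tangent to the boundary$\}$; $\mathsf{Diff}_{\varrho_0}(\Omega)$ carries the metric $(\zeta\circ X,\eta\circ X)_{\varrho_0}=\int_\Omega\langle\zeta\circ X,\eta\circ X\rangle\varrho_0\,da$. $\varrho_X=\frac{\varrho_0}{\det\nabla X}\circ X^{-1}$ is the transported density. Newton's equation $\ddot X=-\varepsilon^{-2}\operatorname{grad}_{\varrho_0}U[X]$ is the Lagrangian form of the shallow water equations $\partial_tu+u\cdot\nabla u=-\varepsilon^{-2}\nabla(\varrho-b)$,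 $\partial_t\varrho+\mathrm{div}(\varrho u)=0$, with $u=\dot X\circ X^{-1}$. $U$ is constraining to $\mathcal M$ if $\mathcal M$ is the critical set of $U$ and $\operatorname{Hess}U$ is positive definite on the normal spaces $N_X\mathcal M$ (orthogonal complement of $T_X\mathcal M$ in $T_X\mathsf{Diff}$). The geodesic equation on $\mathcal M$ is $\ddot X\in N_X\mathcal M$, $X\in\mathcal M$ (where the normal force may be any smooth field along $X$ orthogonal to $T_X\mathcal M$). A homogenized potential of $U$ is $V[X]=\sum_ic_i\sqrt{\lambda_i[X]}$ on $\mathcal M$, with constants $c_i\ge0$ and $\lambda_i[X]$ the eigenvalues of $\operatorname{Hess}U[X]|_{N_X\mathcal M}$ (sum formal); the Takens limit system of $\ddot X=-\varepsilon^{-2}\operatorname{grad}U[X]$ is $X\in\mathcal M$, $\ddot X+\operatorname{grad}V[X]\in N_X\mathcal M$. Thus "the homogenized potential is constant" means the eigenvalues $\lambda_i[X]$ do not depend on $X\in\mathcal M$.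
   Formalization: The transported density is taken with |det ∇X| instead of det ∇X; with the signed determinant an orientation-reversing diffeomorphism (a reflection of the disc with ϱ0=1, b=0) is a critical point of U outside M. For orientation-preserving X nothing changes. *)

theory Defs
  imports "HOL-Analysis.Analysis"
begin

type_synonym plane = "real ^ 2"
type_synonym field = "plane \<Rightarrow> plane"

text \<open>
  Maps of the closed domain and vector fields along them are total functions on the plane; only
  their values on \<open>closure \<Omega>\<close> matter. A function on an arbitrary set is smooth if it is the
  restriction of a smooth function on an open neighbourhood. On an open set this is the usual
  notion, on \<open>closure \<Omega>\<close> it is smoothness up to the boundary. No regularity of the boundary
  is needed for any of the definitions below.
\<close>

primrec Ck_on :: "nat \<Rightarrow> 'a::euclidean_space set \<Rightarrow> ('a \<Rightarrow> 'b::real_normed_vector) \<Rightarrow> bool" where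
  "Ck_on 0 S f \<longleftrightarrow> continuous_on S f"
| "Ck_on (Suc k) S f \<longleftrightarrow>
     (\<forall>x\<in>S. f differentiable (at x)) \<and> (\<forall>v. Ck_on k S (\<lambda>x. frechet_derivative f (at x) v))"

definition smooth_on :: "'a::euclidean_space set \<Rightarrow> ('a \<Rightarrow> 'b::real_normed_vector) \<Rightarrow> bool" where
  "smooth_on S f \<longleftrightarrow>
     (\<exists>T g. open T \<and> S \<subseteq> T \<and> (\<forall>k. Ck_on k T g) \<and> (\<forall>x\<in>S. f x = g x))"

definition divergence :: "field \<Rightarrow> plane \<Rightarrow> real" where
  "divergence v x = (\<Sum>i\<in>UNIV. frechet_derivative v (at x) (axis i 1) $ i)"

definition Diff :: "plane set \<Rightarrow> field set" where
  "Diff \<Omega> = {X. smooth_on (closure \<Omega>) X \<and> bij_betw X (closure \<Omega>) (closure \<Omega>) \<and>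
       smooth_on (closure \<Omega>) (inv_into (closure \<Omega>) X) \<and> X ` frontier \<Omega> = frontier \<Omega>}"

text \<open>A vector is tangent to the boundary if it is the velocity of a curve in the boundary.\<close>

definition tangent_to_boundary :: "plane set \<Rightarrow> field \<Rightarrow> bool" where
  "tangent_to_boundary \<Omega> \<zeta> \<longleftrightarrow> (\<forall>x\<in>frontier \<Omega>. \<exists>\<gamma> \<delta>. \<delta> > 0 \<and> \<gamma> 0 = x \<and>
       \<gamma> ` {-\<delta><..<\<delta>} \<subseteq> frontier \<Omega> \<and> (\<gamma> has_vector_derivative \<zeta> x) (at (0::real)))"

definition tangent_Diff :: "plane set \<Rightarrow> field \<Rightarrow> field set" where
  "tangent_Diff \<Omega> X = {\<xi>. \<exists>\<zeta>. smooth_on (closure \<Omega>) \<zeta> \<and> tangent_to_boundary \<Omega> \<zeta> \<and>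
       (\<forall>a\<in>closure \<Omega>. \<xi> a = \<zeta> (X a))}"

definition weighted_metric :: "plane set \<Rightarrow> (plane \<Rightarrow> real) \<Rightarrow> field \<Rightarrow> field \<Rightarrow> real" where
  "weighted_metric \<Omega> \<rho>0 \<xi> \<eta> = integral \<Omega> (\<lambda>a. (\<xi> a \<bullet> \<eta> a) * \<rho>0 a)"

definition smooth_curve :: "plane set \<Rightarrow> real set \<Rightarrow> (real \<Rightarrow> field) \<Rightarrow> bool" where
  "smooth_curve \<Omega> I X \<longleftrightarrow>
     smooth_on (I \<times> closure \<Omega>) (\<lambda>(t, a). X t a) \<and> (\<forall>t\<in>I. X t \<in> Diff \<Omega>)"

definition velocity :: "(real \<Rightarrow> field) \<Rightarrow> real \<Rightarrow> field" where
  "velocity X t a = vector_derivative (\<lambda>s. X s a) (at t)"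

definition acceleration :: "(real \<Rightarrow> field) \<Rightarrow> real \<Rightarrow> field" where
  "acceleration X t a = vector_derivative (\<lambda>s. velocity X s a) (at t)"

definition curve_through :: "plane set \<Rightarrow> field set \<Rightarrow> field \<Rightarrow> (real \<Rightarrow> field) \<Rightarrow> bool" where
  "curve_through \<Omega> M X Y \<longleftrightarrow> (\<exists>\<delta>>0. smooth_curve \<Omega> {-\<delta><..<\<delta>} Y \<and>
       (\<forall>s\<in>{-\<delta><..<\<delta>}. Y s \<in> M) \<and> (\<forall>a\<in>closure \<Omega>. Y 0 a = X a))"

definition tangent_space :: "plane set \<Rightarrow> field set \<Rightarrow> field \<Rightarrow> field set" where
  "tangent_space \<Omega> M X =
     {\<xi>. \<exists>Y. curve_through \<Omega> M X Y \<and> (\<forall>a\<in>closure \<Omega>. \<xi> a = velocity Y 0 a)}"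

definition normal_space :: "plane set \<Rightarrow> (plane \<Rightarrow> real) \<Rightarrow> field set \<Rightarrow> field \<Rightarrow> field set" where
  "normal_space \<Omega> \<rho>0 M X =
     {\<nu> \<in> tangent_Diff \<Omega> X. \<forall>\<xi>\<in>tangent_space \<Omega> M X. weighted_metric \<Omega> \<rho>0 \<nu> \<xi> = 0}"

text \<open>
  In equations of motion the constraint force may be any smooth field along \<open>X\<close> orthogonal to the
  tangent space. It need not be tangent to the boundary, since accelerations of curves in
  \<open>Diff \<Omega>\<close> are not.
\<close>

definition normal_forces :: "plane set \<Rightarrow> (plane \<Rightarrow> real) \<Rightarrow> field set \<Rightarrow> field \<Rightarrow> field set" where
  "normal_forces \<Omega> \<rho>0 M X =
     {\<nu>. smooth_on (closure \<Omega>) \<nu> \<and> (\<forall>\<xi>\<in>tangent_space \<Omega> M X. weighted_metric \<Omega> \<rho>0 \<nu> \<xi> = 0)}"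

definition critical_point :: "plane set \<Rightarrow> (field \<Rightarrow> real) \<Rightarrow> field \<Rightarrow> bool" where
  "critical_point \<Omega> U X \<longleftrightarrow> X \<in> Diff \<Omega> \<and>
     (\<forall>Y. curve_through \<Omega> (Diff \<Omega>) X Y \<longrightarrow> ((\<lambda>t. U (Y t)) has_real_derivative 0) (at 0))"

text \<open>
  At a critical point the Hessian is the mixed second derivative along two-parameter families
  \<open>Y s t\<close> in \<open>Diff \<Omega>\<close> through \<open>X\<close> with partial velocities \<open>\<xi>\<close> and \<open>\<eta>\<close>.
\<close>

definition two_parameter_family ::
    "plane set \<Rightarrow> field \<Rightarrow> field \<Rightarrow> field \<Rightarrow> real \<Rightarrow> (real \<Rightarrow> real \<Rightarrow> field) \<Rightarrow> bool" where
  "two_parameter_family \<Omega> X \<xi> \<eta> \<delta> Y \<longleftrightarrow> \<delta> > 0 \<and>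
     smooth_on (({-\<delta><..<\<delta>} \<times> {-\<delta><..<\<delta>}) \<times> closure \<Omega>) (\<lambda>((s, t), a). Y s t a) \<and>
     (\<forall>s\<in>{-\<delta><..<\<delta>}. \<forall>t\<in>{-\<delta><..<\<delta>}. Y s t \<in> Diff \<Omega>) \<and>
     (\<forall>a\<in>closure \<Omega>. Y 0 0 a = X a \<and> velocity (\<lambda>s. Y s 0) 0 a = \<xi> a \<and>
        velocity (\<lambda>t. Y 0 t) 0 a = \<eta> a)"

definition has_hessian ::
    "plane set \<Rightarrow> (field \<Rightarrow> real) \<Rightarrow> field \<Rightarrow> field \<Rightarrow> field \<Rightarrow> real \<Rightarrow> bool" where
  "has_hessian \<Omega> U X \<xi> \<eta> h \<longleftrightarrow>
     (\<exists>\<delta> Y. two_parameter_family \<Omega> X \<xi> \<eta> \<delta> Y) \<and>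
     (\<forall>\<delta> Y. two_parameter_family \<Omega> X \<xi> \<eta> \<delta> Y \<longrightarrow>
        (\<exists>g. (\<forall>s\<in>{-\<delta><..<\<delta>}. ((\<lambda>t. U (Y s t)) has_real_derivative g s) (at 0)) \<and>
             (g has_real_derivative h) (at 0)))"

definition hessian :: "plane set \<Rightarrow> (field \<Rightarrow> real) \<Rightarrow> field \<Rightarrow> field \<Rightarrow> field \<Rightarrow> real" where
  "hessian \<Omega> U X \<xi> \<eta> = (THE h. has_hessian \<Omega> U X \<xi> \<eta> h)"

definition constraining ::
    "plane set \<Rightarrow> (plane \<Rightarrow> real) \<Rightarrow> (field \<Rightarrow> real) \<Rightarrow> field set \<Rightarrow> bool" where
  "constraining \<Omega> \<rho>0 U M \<longleftrightarrow> M = {X \<in> Diff \<Omega>. critical_point \<Omega> U X} \<and>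
     (\<forall>X\<in>M. \<forall>\<nu>\<in>normal_space \<Omega> \<rho>0 M X. (\<exists>a\<in>\<Omega>. \<nu> a \<noteq> 0) \<longrightarrow> hessian \<Omega> U X \<nu> \<nu> > 0)"

definition geodesic ::
    "plane set \<Rightarrow> (plane \<Rightarrow> real) \<Rightarrow> field set \<Rightarrow> real set \<Rightarrow> (real \<Rightarrow> field) \<Rightarrow> bool" where
  "geodesic \<Omega> \<rho>0 M I X \<longleftrightarrow>
     (\<forall>t\<in>I. X t \<in> M \<and> acceleration X t \<in> normal_forces \<Omega> \<rho>0 M (X t))"

text \<open>
  \<open>\<mu> 0, \<dots>, \<mu> (n - 1)\<close> are eigenvalues, counted with multiplicity, of the Hessian restricted to
  the normal space: they have an orthonormal system of eigenvectors.
\<close>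

definition eigenvalue_system :: "plane set \<Rightarrow> (plane \<Rightarrow> real) \<Rightarrow> (field \<Rightarrow> real) \<Rightarrow> field set \<Rightarrow>
    field \<Rightarrow> nat \<Rightarrow> (nat \<Rightarrow> real) \<Rightarrow> bool" where
  "eigenvalue_system \<Omega> \<rho>0 U M X n \<mu> \<longleftrightarrow> (\<exists>e.
     (\<forall>i<n. e i \<in> normal_space \<Omega> \<rho>0 M X \<and>
        (\<forall>\<eta>\<in>normal_space \<Omega> \<rho>0 M X. hessian \<Omega> U X (e i) \<eta> = \<mu> i * weighted_metric \<Omega> \<rho>0 (e i) \<eta>)) \<and>
     (\<forall>i<n. \<forall>j<n. weighted_metric \<Omega> \<rho>0 (e i) (e j) = (if i = j then 1 else 0)))"

text \<open>The eigenvalues in nondecreasing order, repeated according to multiplicity.\<close>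

definition eigval :: "plane set \<Rightarrow> (plane \<Rightarrow> real) \<Rightarrow> (field \<Rightarrow> real) \<Rightarrow> field set \<Rightarrow>
    nat \<Rightarrow> field \<Rightarrow> real" where
  "eigval \<Omega> \<rho>0 U M i X =
     Inf {m. \<exists>\<mu>. eigenvalue_system \<Omega> \<rho>0 U M X (Suc i) \<mu> \<and> (\<forall>j\<le>i. \<mu> j \<le> m)}"

text \<open>
  The homogenized potential \<open>V = (\<Sum>i. c i * sqrt (\<lambda>\<^sub>i))\<close> is a formal sum. It is therefore
  represented by its sequence of summands and is differentiated term by term.
\<close>

definition homogenized_potential :: "plane set \<Rightarrow> (plane \<Rightarrow> real) \<Rightarrow> (field \<Rightarrow> real) \<Rightarrow> field set \<Rightarrow>
    (nat \<Rightarrow> real) \<Rightarrow> nat \<Rightarrow> field \<Rightarrow> real" where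
  "homogenized_potential \<Omega> \<rho>0 U M c i X = c i * sqrt (eigval \<Omega> \<rho>0 U M i X)"

definition is_formal_gradient :: "plane set \<Rightarrow> (plane \<Rightarrow> real) \<Rightarrow> field set \<Rightarrow>
    (nat \<Rightarrow> field \<Rightarrow> real) \<Rightarrow> field \<Rightarrow> field \<Rightarrow> bool" where
  "is_formal_gradient \<Omega> \<rho>0 M V X G \<longleftrightarrow> G \<in> tangent_space \<Omega> M X \<and>
     (\<forall>Y. curve_through \<Omega> M X Y \<longrightarrow>
        (\<exists>d. (\<forall>i. ((\<lambda>s. V i (Y s)) has_real_derivative d i) (at 0)) \<and>
             d sums weighted_metric \<Omega> \<rho>0 G (velocity Y 0)))"

definition takens_limit_system :: "plane set \<Rightarrow> (plane \<Rightarrow> real) \<Rightarrow> field set \<Rightarrow>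
    (nat \<Rightarrow> field \<Rightarrow> real) \<Rightarrow> real set \<Rightarrow> (real \<Rightarrow> field) \<Rightarrow> bool" where
  "takens_limit_system \<Omega> \<rho>0 M V I X \<longleftrightarrow>
     (\<forall>t\<in>I. X t \<in> M \<and> (\<exists>G. is_formal_gradient \<Omega> \<rho>0 M V (X t) G \<and>
        (\<lambda>a. acceleration X t a + G a) \<in> normal_forces \<Omega> \<rho>0 M (X t)))"

text \<open>
  The absolute value makes this the transported density on all of \<open>Diff \<Omega>\<close>; it is redundant for
  orientation preserving \<open>X\<close>.
\<close>

definition fluid_density :: "plane set \<Rightarrow> (plane \<Rightarrow> real) \<Rightarrow> field \<Rightarrow> plane \<Rightarrow> real" where
  "fluid_density \<Omega> \<rho>0 X x =
     (let a = inv_into (closure \<Omega>) X x in \<rho>0 a / \<bar>det (jacobian X (at a))\<bar>)"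

definition potential :: "plane set \<Rightarrow> (plane \<Rightarrow> real) \<Rightarrow> (plane \<Rightarrow> real) \<Rightarrow> field \<Rightarrow> real" where
  "potential \<Omega> \<rho>0 b X =
     integral \<Omega> (\<lambda>x. (fluid_density \<Omega> \<rho>0 X x)\<^sup>2 / 2 - fluid_density \<Omega> \<rho>0 X x * b x)"

definition mean_height :: "plane set \<Rightarrow> (plane \<Rightarrow> real) \<Rightarrow> (plane \<Rightarrow> real) \<Rightarrow> real" where
  "mean_height \<Omega> \<rho>0 b = (1 / measure lebesgue \<Omega>) * integral \<Omega> (\<lambda>x. \<rho>0 x - b x)"

definition lake_manifold :: "plane set \<Rightarrow> (plane \<Rightarrow> real) \<Rightarrow> (plane \<Rightarrow> real) \<Rightarrow> field set" where
  "lake_manifold \<Omega> \<rho>0 b =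
     {X \<in> Diff \<Omega>. \<forall>x\<in>\<Omega>. fluid_density \<Omega> \<rho>0 X x = mean_height \<Omega> \<rho>0 b + b x}"

definition eulerian_velocity :: "plane set \<Rightarrow> (real \<Rightarrow> field) \<Rightarrow> real \<Rightarrow> field" where
  "eulerian_velocity \<Omega> X t x = velocity X t (inv_into (closure \<Omega>) (X t) x)"

text \<open>
  The boundary condition (tangency of \<open>u\<close>) holds for every Eulerian velocity of a curve in
  \<open>Diff \<Omega>\<close>. The pressure is required to be smooth inside \<open>\<Omega>\<close>; up to the boundary its gradient
  is as smooth as the left-hand side.
\<close>

definition lake_equation ::
    "plane set \<Rightarrow> (plane \<Rightarrow> real) \<Rightarrow> real \<Rightarrow> real set \<Rightarrow> (real \<Rightarrow> field) \<Rightarrow> bool" where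
  "lake_equation \<Omega> b H I u \<longleftrightarrow> smooth_on (I \<times> \<Omega>) (\<lambda>(t, x). u t x) \<and>
     (\<exists>P :: real \<Rightarrow> plane \<Rightarrow> real. smooth_on (I \<times> \<Omega>) (\<lambda>(t, x). P t x) \<and>
        (\<forall>t\<in>I. \<forall>x\<in>\<Omega>.
           GDERIV (P t) x :>
             - (vector_derivative (\<lambda>s. u s x) (at t) + frechet_derivative (u t) (at x) (u t x)))) \<and>
     (\<forall>t\<in>I. \<forall>x\<in>\<Omega>. divergence (\<lambda>y. (H + b y) *\<^sub>R u t y) x = 0)"

end

theory Submission
  imports Defs
begin

text \<open>
  Write \<open>r = H + b\<close> and let \<open>N = \<rho>0 - (r \<circ> X) \<bar>det DX\<bar>\<close> be the density defect of \<open>X\<close>. Then \<open>U\<close> is a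
  constant plus the integral of \<open>N\<^sup>2 / (2 \<bar>det DX\<bar>)\<close>, so the lake manifold \<open>N = 0\<close> consists of critical
  points. Conversely, moving a critical point along a compactly supported multiple of
  \<open>\<nabla>(\<rho> - b)\<close> shows that \<open>\<rho> - b\<close> is constant. On the lake manifold the Hessian is the integral of
  \<open>(DN)\<^sup>2 / \<bar>det DX\<bar>\<close>. If it vanishes at a normal vector \<open>w \<circ> X\<close>, then \<open>div (r w) = 0\<close>, so the flow
  of \<open>w\<close> stays in the lake manifold and the vector is both normal and tangent, hence zero.

  The acceleration of a geodesic is orthogonal to \<open>w \<circ> X\<close> for all compactly supported \<open>w\<close> with
  \<open>div (r w) = 0\<close>. In Eulerian coordinates it is therefore orthogonal to all compactly supported
  divergence-free fields, so its circulation around closed polygons vanishes and it is a gradient.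

  Any two points of the lake manifold differ by a right translation by a diffeomorphism preserving
  \<open>\<rho>0\<close>. Such translations are isometries that preserve \<open>U\<close> and the lake manifold. Hence the
  eigenvalues do not depend on the point, and the formal gradient of the homogenized potential is zero.
\<close>

section \<open>Calculus of functions of class C k\<close>

text \<open>The boundary of \<Omega> is arbitrary, so boundary normals, traces and elliptic
  estimates up to the boundary cannot be used. Integration by parts is extracted from flows that map
  the domain to itself (\<open>integral_divergence_zero\<close>), and the pressure is built from
  test fields with compact support inside \<Omega>. For this reason flows with smooth dependence on
  initial data are constructed for compactly supported fields on the whole plane. Maps are smooth on
  the closed domain only through extensions. A family is therefore carried together with an
  extension \<open>G\<close>, and statements about boundary points, above all the nonvanishing of
  the Jacobian, are reached by continuity from the inside. The quadratic form of the energy in the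
  defect \<open>N\<close> has a second effect: where \<open>N\<close> vanishes, a mixed second
  derivative involves first derivatives of \<open>N\<close> only. The second-order behaviour of the
  chosen family drops out, and the Hessian is a well-defined form. The value of the mean height is
  forced: a critical density differs from \<open>b\<close> by a constant, and conservation of mass
  determines that constant.\<close>

lemma Ck_on_SucI:
  assumes "open S" "\<And>x. x \<in> S \<Longrightarrow> (f has_derivative f' x) (at x)"
    and "\<And>v. Ck_on k S (\<lambda>x. f' x v)"
  shows "Ck_on (Suc k) S f"
  using assms
proof (induction k arbitrary: f f')
  case 0
  then have *: "frechet_derivative f (at x) = f' x" if "x \<in> S" for x
    using that by (metis frechet_derivative_at)
  have "continuous_on S (\<lambda>x. frechet_derivative f (at x) v)" for v
    using 0(3)[of v] * by (simp cong: continuous_on_cong)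
  then show ?case using 0 by (auto simp: differentiable_def)
next
  case (Suc k)
  then have *: "frechet_derivative f (at x) = f' x" if "x \<in> S" for x
    using that by (metis frechet_derivative_at)
  \<comment> \<open>The two derivatives agree only on \<open>S\<close>, while \<open>Ck_on\<close>
    speaks of derivatives of functions on the whole space. The passage from one to the other
    therefore uses the induction hypothesis for the function \<open>f' x v\<close>.\<close>
  have "Ck_on (Suc k) S (\<lambda>x. frechet_derivative f (at x) v)" for v
  proof (rule Suc.IH[OF Suc.prems(1)])
    fix x assume x: "x \<in> S"
    have "(\<lambda>x. f' x v) differentiable at x"
      using Suc.prems(3)[of v] x by simp
    then have "((\<lambda>x. f' x v) has_derivative frechet_derivative (\<lambda>x. f' x v) (at x)) (at x)"
      by (simp add: frechet_derivative_works)
    then show "((\<lambda>x. frechet_derivative f (at x) v) has_derivative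
        frechet_derivative (\<lambda>x. f' x v) (at x)) (at x)"
      by (rule has_derivative_transform_within_open[OF _ Suc.prems(1) x]) (simp add: *)
  next
    fix w show "Ck_on k S (\<lambda>x. frechet_derivative (\<lambda>x. f' x v) (at x) w)"
      using Suc.prems(3)[of v] by simp
  qed
  then show ?case
    unfolding Ck_on.simps(2)[of "Suc k"] using Suc.prems(2) by (blast intro: differentiableI)
qed

declare Ck_on.simps(2) [simp del]

lemma Ck_on_has_derivative:
  assumes "Ck_on (Suc k) S f" "x \<in> S"
  shows "(f has_derivative frechet_derivative f (at x)) (at x)"
  using assms by (simp add: frechet_derivative_works Ck_on.simps)

lemma Ck_on_derivative: "Ck_on (Suc k) S f \<Longrightarrow> Ck_on k S (\<lambda>x. frechet_derivative f (at x) v)"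
  by (simp add: Ck_on.simps)

lemma Ck_on_SucD: "Ck_on (Suc k) S f \<Longrightarrow> Ck_on k S f"
proof (induction k arbitrary: f)
  case 0
  then show ?case
    by (auto simp: continuous_on_eq_continuous_within intro: differentiable_imp_continuous_within
        differentiable_at_withinI simp: Ck_on.simps)
next
  case (Suc k)
  then show ?case unfolding Ck_on.simps(2)[of "Suc k"] Ck_on.simps(2)[of k] by blast
qed

lemma Ck_on_le: "Ck_on k S f \<Longrightarrow> j \<le> k \<Longrightarrow> Ck_on j S f"
  by (induction k) (auto simp: le_Suc_eq dest: Ck_on_SucD)

lemma Ck_on_continuous: "Ck_on k S f \<Longrightarrow> continuous_on S f"
  using Ck_on_le[of k S f 0] by simp

lemma Ck_on_subset: "Ck_on k S f \<Longrightarrow> T \<subseteq> S \<Longrightarrow> Ck_on k T f"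
  by (induction k arbitrary: f) (auto intro: continuous_on_subset simp: Ck_on.simps)

lemma Ck_on_cong:
  assumes "open S" "\<And>x. x \<in> S \<Longrightarrow> f x = g x" "Ck_on k S f"
  shows "Ck_on k S g"
proof (cases k)
  case 0
  then show ?thesis using assms by (simp cong: continuous_on_cong)
next
  case (Suc j)
  show ?thesis unfolding Suc
  proof (rule Ck_on_SucI[OF assms(1)])
    fix x assume x: "x \<in> S"
    show "(g has_derivative frechet_derivative f (at x)) (at x)"
      using Ck_on_has_derivative[OF assms(3)[unfolded Suc] x]
      by (rule has_derivative_transform_within_open[OF _ assms(1) x]) (rule assms(2))
  qed (use assms(3) Suc in \<open>simp add: Ck_on.simps\<close>)
qed

lemma Ck_on_Union:
  assumes "\<And>i. i \<in> I \<Longrightarrow> open (S i)" "\<And>i. i \<in> I \<Longrightarrow> Ck_on k (S i) f"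
  shows "Ck_on k (\<Union>i\<in>I. S i) f"
  using assms(2)
proof (induction k arbitrary: f)
  case 0
  then show ?case using assms(1) by (auto intro: continuous_on_open_UN)
qed (auto simp: Ck_on.simps)

lemma Ck_on_Un:
  assumes "open S" "open T" "Ck_on k S f" "Ck_on k T f"
  shows "Ck_on k (S \<union> T) f"
  using Ck_on_Union[of "{True,False}" "\<lambda>i. if i then S else T" k f] assms
  by (auto simp: Un_commute)

lemma Ck_on_const: "Ck_on k S (\<lambda>x. c)"
  by (induction k arbitrary: c) (auto simp: Ck_on.simps)

lemma Ck_on_linear:
  assumes "bounded_linear f" shows "Ck_on k S f"
proof (cases k)
  case 0
  then show ?thesis using assms by (simp add: linear_continuous_on)
next
  case (Suc j)
  have "(f has_derivative f) (at x)" for x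
    using assms by (rule bounded_linear_imp_has_derivative)
  then have "f differentiable at x" "frechet_derivative f (at x) = f" for x
    using frechet_derivative_at[of f f x] differentiableI[of f f] by auto
  then show ?thesis using Suc by (simp add: Ck_on_const Ck_on.simps)
qed

lemma Ck_on_compose_linear:
  assumes "bounded_linear L" "open S" "Ck_on k S f"
  shows "Ck_on k S (\<lambda>x. L (f x))"
  using assms(3)
proof (induction k arbitrary: f)
  case 0
  then show ?case using assms(1) by (simp add: bounded_linear.continuous_on)
next
  case (Suc k)
  show ?case
  proof (rule Ck_on_SucI[OF assms(2)])
    fix x assume "x \<in> S"
    then show "((\<lambda>x. L (f x)) has_derivative (\<lambda>v. L (frechet_derivative f (at x) v))) (at x)"
      using Ck_on_has_derivative[OF Suc.prems] bounded_linear.has_derivative[OF assms(1)] by blast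
  next
    fix v
    show "Ck_on k S (\<lambda>x. L (frechet_derivative f (at x) v))"
      using Suc by (simp add: Ck_on.simps)
  qed
qed

lemma Ck_on_add:
  assumes "open S" "Ck_on k S f" "Ck_on k S g"
  shows "Ck_on k S (\<lambda>x. f x + g x)"
  using assms(2,3)
proof (induction k arbitrary: f g)
  case 0
  then show ?case by (simp add: continuous_on_add)
next
  case (Suc k)
  show ?case
  proof (rule Ck_on_SucI[OF assms(1)])
    fix x assume "x \<in> S"
    then show "((\<lambda>x. f x + g x) has_derivative
       (\<lambda>v. frechet_derivative f (at x) v + frechet_derivative g (at x) v)) (at x)"
      using Ck_on_has_derivative Suc.prems has_derivative_add by blast
  qed (use Suc in \<open>simp add: Ck_on.simps\<close>)
qed

lemma Ck_on_bilinear: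
  assumes "bounded_bilinear B" "open S" "Ck_on k S f" "Ck_on k S g"
  shows "Ck_on k S (\<lambda>x. B (f x) (g x))"
  using assms(3,4)
proof (induction k arbitrary: f g)
  case 0
  then show ?case using assms(1) by (simp add: bounded_bilinear.continuous_on)
next
  case (Suc k)
  show ?case
  proof (rule Ck_on_SucI[OF assms(2)])
    fix x assume x: "x \<in> S"
    show "((\<lambda>x. B (f x) (g x)) has_derivative
       (\<lambda>v. B (f x) (frechet_derivative g (at x) v) + B (frechet_derivative f (at x) v) (g x))) (at x)"
      using bounded_bilinear.FDERIV[OF assms(1) Ck_on_has_derivative[OF Suc.prems(1) x]
          Ck_on_has_derivative[OF Suc.prems(2) x]] .
  next
    fix v
    show "Ck_on k S (\<lambda>x. B (f x) (frechet_derivative g (at x) v)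
        + B (frechet_derivative f (at x) v) (g x))"
      by (intro Ck_on_add Suc.IH assms Ck_on_derivative Ck_on_SucD[OF Suc.prems(1)]
          Ck_on_SucD[OF Suc.prems(2)] Suc.prems)
  qed
qed

lemma Ck_on_sum:
  assumes "open S" "\<And>i. i \<in> I \<Longrightarrow> Ck_on k S (f i)"
  shows "Ck_on k S (\<lambda>x. \<Sum>i\<in>I. f i x)"
  using assms(2)
  by (induction I rule: infinite_finite_induct) (auto intro: Ck_on_const Ck_on_add[OF assms(1)])

lemma linear_expand:
  fixes f :: "'a::euclidean_space \<Rightarrow> 'b::real_vector"
  assumes "linear f"
  shows "f v = (\<Sum>b\<in>Basis. (v \<bullet> b) *\<^sub>R f b)"
proof -
  have "f v = f (\<Sum>b\<in>Basis. (v \<bullet> b) *\<^sub>R b)"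
    by (simp add: euclidean_representation)
  also have "\<dots> = (\<Sum>b\<in>Basis. (v \<bullet> b) *\<^sub>R f b)"
    by (simp add: linear_sum[OF assms] linear_scale[OF assms])
  finally show ?thesis .
qed

text \<open>The chain rule evaluates \<open>Df\<close> in the varying direction \<open>Dg v\<close>; expanding that direction in
  the standard basis keeps the induction within directional derivatives.\<close>

lemma Ck_on_compose:
  fixes g :: "'a::euclidean_space \<Rightarrow> 'b::euclidean_space"
  assumes "open S" "open T" "\<And>x. x \<in> S \<Longrightarrow> g x \<in> T" "Ck_on k T f" "Ck_on k S g"
  shows "Ck_on k S (\<lambda>x. f (g x))"
  using assms(4,5)
proof (induction k arbitrary: f)
  case 0
  then show ?case using assms(3) by (auto intro: continuous_on_compose2)
next
  case (Suc k)
  show ?case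
  proof (rule Ck_on_SucI[OF assms(1)])
    fix x assume x: "x \<in> S"
    show "((\<lambda>x. f (g x)) has_derivative
       (\<lambda>v. \<Sum>b\<in>Basis. (frechet_derivative g (at x) v \<bullet> b) *\<^sub>R frechet_derivative f (at (g x)) b)) (at x)"
    proof (rule has_derivative_eq_rhs)
      show "((\<lambda>x. f (g x)) has_derivative
         (\<lambda>v. frechet_derivative f (at (g x)) (frechet_derivative g (at x) v))) (at x)"
        using has_derivative_compose[OF Ck_on_has_derivative[OF Suc.prems(2) x]
            Ck_on_has_derivative[OF Suc.prems(1) assms(3)[OF x]]] .
      have "linear (frechet_derivative f (at (g x)))"
        using Ck_on_has_derivative[OF Suc.prems(1) assms(3)[OF x]] has_derivative_linear by blast
      then show "(\<lambda>v. frechet_derivative f (at (g x)) (frechet_derivative g (at x) v)) =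
        (\<lambda>v. \<Sum>b\<in>Basis. (frechet_derivative g (at x) v \<bullet> b) *\<^sub>R frechet_derivative f (at (g x)) b)"
        using linear_expand by blast
    qed
  next
    fix v
    show "Ck_on k S (\<lambda>x. \<Sum>b\<in>Basis. (frechet_derivative g (at x) v \<bullet> b) *\<^sub>R
        frechet_derivative f (at (g x)) b)"
      by (intro Ck_on_sum Ck_on_bilinear[OF bounded_bilinear_scaleR] assms(1)
          Ck_on_bilinear[OF bounded_bilinear_inner] Ck_on_const Suc.IH Ck_on_derivative
          Suc.prems Ck_on_SucD[OF Suc.prems(2)])
  qed
qed

lemma Ck_on_Pair:
  fixes f :: "'a::euclidean_space \<Rightarrow> 'b::euclidean_space" and g :: "'a \<Rightarrow> 'c::euclidean_space"
  assumes "open S" "Ck_on k S f" "Ck_on k S g"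
  shows "Ck_on k S (\<lambda>x. (f x, g x))"
proof -
  have "Ck_on k S (\<lambda>x. (f x, 0) + (0, g x))"
    by (intro Ck_on_add assms Ck_on_compose_linear[of "\<lambda>y. (y, 0)"] Ck_on_compose_linear[of "\<lambda>y. (0, y)"]
        bounded_linear_Pair bounded_linear_ident bounded_linear_zero)
  then show ?thesis by simp
qed

text \<open>The derivative of the inverse is minus its own square, so the product rule alone carries
  the induction.\<close>

lemma Ck_on_real_inverse: "Ck_on k (- {0::real}) inverse"
proof (induction k)
  case (Suc k)
  show ?case
  proof (rule Ck_on_SucI)
    fix x :: real assume "x \<in> - {0}"
    then show "(inverse has_derivative (\<lambda>h. - (inverse x * h * inverse x))) (at x)"
      using has_derivative_inverse' by auto
  next
    fix v :: real
    have *: "Ck_on k (- {0::real}) (\<lambda>x. inverse x * inverse x)"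
      by (rule Ck_on_bilinear[OF bounded_bilinear_mult _ Suc Suc]) auto
    have "Ck_on k (- {0}) (\<lambda>x. - v * (inverse x * inverse x))"
      by (rule Ck_on_compose_linear[OF bounded_linear_mult_right _ *]) auto
    then show "Ck_on k (- {0}) (\<lambda>x. - (inverse x * v * inverse x))"
      by (simp add: ac_simps)
  qed auto
next
  case 0
  have "continuous_on (- {0::real}) (\<lambda>x. inverse x)"
    by (rule continuous_on_inverse) (auto intro: continuous_on_id)
  then show ?case by simp
qed

text \<open>Away from zero the sign is locally constant. This is how absolute values of nonvanishing
  functions, in particular of Jacobians, are differentiated.\<close>

lemma open_sgn_set: "x \<noteq> 0 \<Longrightarrow> open {y::real. sgn y = sgn x}"
proof -
  assume "x \<noteq> 0"
  then have "{y. sgn y = sgn x} = (if x > 0 then {0<..} else {..<0})"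
    by (auto simp: sgn_real_def split: if_splits)
  then show ?thesis by simp
qed

lemma Ck_on_abs: "Ck_on k (- {0::real}) abs"
proof (cases k)
  case (Suc j)
  show ?thesis unfolding Suc
  proof (rule Ck_on_SucI)
    fix x :: real assume "x \<in> - {0}"
    then show "(abs has_derivative (\<lambda>h. h * sgn x)) (at x)"
      by (intro has_derivative_transform_within_open[of "\<lambda>y. y * sgn x" "\<lambda>h. h * sgn x" x UNIV
            "{y. sgn y = sgn x}" abs] open_sgn_set)
        (auto simp: abs_sgn intro!: bounded_linear_imp_has_derivative bounded_linear_mult_left)
  next
    fix v :: real
    have "Ck_on j ({0<..} \<union> {..<0}) (\<lambda>x. v * sgn x)"
    proof (rule Ck_on_Un)
      show "Ck_on j {0<..} (\<lambda>x. v * sgn x)"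
        by (rule Ck_on_cong[of _ "\<lambda>x. v"]) (auto intro: Ck_on_const)
      show "Ck_on j {..<0} (\<lambda>x. v * sgn x)"
        by (rule Ck_on_cong[of _ "\<lambda>x. -v"]) (auto intro: Ck_on_const)
    qed auto
    moreover have "{0<..} \<union> {..<0::real} = - {0}" by auto
    ultimately show "Ck_on j (- {0}) (\<lambda>x. v * sgn x)" by simp
  qed auto
next
  case 0
  then show ?thesis by (simp add: continuous_on_rabs)
qed

text \<open>Derivatives are full derivatives at the points of the set, so the notion is meant for
  open sets. \<open>smooth_on\<close> asks for an extension in this class.\<close>

definition Cinf_on :: "'a::euclidean_space set \<Rightarrow> ('a \<Rightarrow> 'b::real_normed_vector) \<Rightarrow> bool" where
  "Cinf_on S f \<longleftrightarrow> (\<forall>k. Ck_on k S f)"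

lemma smooth_on_Cinf_on:
  "smooth_on S f \<longleftrightarrow> (\<exists>T g. open T \<and> S \<subseteq> T \<and> Cinf_on T g \<and> (\<forall>x\<in>S. f x = g x))"
  by (simp add: smooth_on_def Cinf_on_def)

lemma Cinf_on_const: "Cinf_on S (\<lambda>x. c)"
  by (simp add: Cinf_on_def Ck_on_const)

lemma Cinf_on_linear: "bounded_linear f \<Longrightarrow> Cinf_on S f"
  by (simp add: Cinf_on_def Ck_on_linear)

lemma Cinf_on_ident: "Cinf_on S (\<lambda>x. x)"
  by (simp add: Cinf_on_linear)

lemma Cinf_on_compose_linear: "bounded_linear L \<Longrightarrow> open S \<Longrightarrow> Cinf_on S f \<Longrightarrow> Cinf_on S (\<lambda>x. L (f x))"
  by (simp add: Cinf_on_def Ck_on_compose_linear)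

lemma Cinf_on_add: "open S \<Longrightarrow> Cinf_on S f \<Longrightarrow> Cinf_on S g \<Longrightarrow> Cinf_on S (\<lambda>x. f x + g x)"
  by (simp add: Cinf_on_def Ck_on_add)

lemma Cinf_on_uminus: "open S \<Longrightarrow> Cinf_on S f \<Longrightarrow> Cinf_on S (\<lambda>x. - f x)"
  using Cinf_on_compose_linear[OF bounded_linear_minus[OF bounded_linear_ident]] .

lemma Cinf_on_diff: "open S \<Longrightarrow> Cinf_on S f \<Longrightarrow> Cinf_on S g \<Longrightarrow> Cinf_on S (\<lambda>x. f x - g x)"
  using Cinf_on_add[of S f "\<lambda>x. - g x"] by (simp add: Cinf_on_uminus)

lemma Cinf_on_bilinear:
  "bounded_bilinear B \<Longrightarrow> open S \<Longrightarrow> Cinf_on S f \<Longrightarrow> Cinf_on S g \<Longrightarrow> Cinf_on S (\<lambda>x. B (f x) (g x))"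
  by (simp add: Cinf_on_def Ck_on_bilinear)

lemmas Cinf_on_scaleR = Cinf_on_bilinear[OF bounded_bilinear_scaleR]
lemmas Cinf_on_inner = Cinf_on_bilinear[OF bounded_bilinear_inner]

lemma Cinf_on_mult:
  fixes f g :: "'a::euclidean_space \<Rightarrow> real"
  shows "open S \<Longrightarrow> Cinf_on S f \<Longrightarrow> Cinf_on S g \<Longrightarrow> Cinf_on S (\<lambda>x. f x * g x)"
  using Cinf_on_bilinear[OF bounded_bilinear_mult] .

lemma Cinf_on_sum:
  "open S \<Longrightarrow> (\<And>i. i \<in> I \<Longrightarrow> Cinf_on S (f i)) \<Longrightarrow> Cinf_on S (\<lambda>x. \<Sum>i\<in>I. f i x)"
  by (simp add: Cinf_on_def Ck_on_sum)

lemma Cinf_on_fst: "open S \<Longrightarrow> Cinf_on S f \<Longrightarrow> Cinf_on S (\<lambda>x. fst (f x))"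
  using Cinf_on_compose_linear[OF bounded_linear_fst] .

lemma Cinf_on_snd: "open S \<Longrightarrow> Cinf_on S f \<Longrightarrow> Cinf_on S (\<lambda>x. snd (f x))"
  using Cinf_on_compose_linear[OF bounded_linear_snd] .

lemma Cinf_on_nth: "open S \<Longrightarrow> Cinf_on S f \<Longrightarrow> Cinf_on S (\<lambda>x. f x $ i)"
  using Cinf_on_compose_linear[OF bounded_linear_vec_nth] .

lemma Cinf_on_Pair:
  fixes f :: "'a::euclidean_space \<Rightarrow> 'b::euclidean_space" and g :: "'a \<Rightarrow> 'c::euclidean_space"
  shows "open S \<Longrightarrow> Cinf_on S f \<Longrightarrow> Cinf_on S g \<Longrightarrow> Cinf_on S (\<lambda>x. (f x, g x))"
  by (simp add: Cinf_on_def Ck_on_Pair)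

lemma Cinf_on_compose:
  fixes g :: "'a::euclidean_space \<Rightarrow> 'b::euclidean_space"
  assumes "Cinf_on T f" "open T" "open S" "\<And>x. x \<in> S \<Longrightarrow> g x \<in> T" "Cinf_on S g"
  shows "Cinf_on S (\<lambda>x. f (g x))"
  unfolding Cinf_on_def
proof
  fix k show "Ck_on k S (\<lambda>x. f (g x))"
    by (rule Ck_on_compose[of S T g]) (use assms in \<open>auto simp: Cinf_on_def\<close>)
qed

lemma Cinf_on_inverse:
  fixes f :: "'a::euclidean_space \<Rightarrow> real"
  assumes "open S" "Cinf_on S f" "\<And>x. x \<in> S \<Longrightarrow> f x \<noteq> 0"
  shows "Cinf_on S (\<lambda>x. inverse (f x))"
  by (rule Cinf_on_compose[of "- {0}" inverse])
    (use assms in \<open>auto simp: Cinf_on_def Ck_on_real_inverse\<close>)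

lemma Cinf_on_divide:
  fixes f g :: "'a::euclidean_space \<Rightarrow> real"
  assumes "open S" "Cinf_on S f" "Cinf_on S g" "\<And>x. x \<in> S \<Longrightarrow> g x \<noteq> 0"
  shows "Cinf_on S (\<lambda>x. f x / g x)"
  unfolding divide_inverse by (intro Cinf_on_mult Cinf_on_inverse assms)

lemma Cinf_on_abs:
  fixes f :: "'a::euclidean_space \<Rightarrow> real"
  assumes "open S" "Cinf_on S f" "\<And>x. x \<in> S \<Longrightarrow> f x \<noteq> 0"
  shows "Cinf_on S (\<lambda>x. \<bar>f x\<bar>)"
  by (rule Cinf_on_compose[of "- {0}" abs])
    (use assms in \<open>auto simp: Cinf_on_def Ck_on_abs\<close>)

lemma Cinf_on_subset: "Cinf_on S f \<Longrightarrow> T \<subseteq> S \<Longrightarrow> Cinf_on T f"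
  by (auto simp: Cinf_on_def intro: Ck_on_subset)

lemma Cinf_on_cong: "open S \<Longrightarrow> (\<And>x. x \<in> S \<Longrightarrow> f x = g x) \<Longrightarrow> Cinf_on S f \<Longrightarrow> Cinf_on S g"
  unfolding Cinf_on_def using Ck_on_cong[of S f g] by simp

lemma Cinf_on_Un: "open S \<Longrightarrow> open T \<Longrightarrow> Cinf_on S f \<Longrightarrow> Cinf_on T f \<Longrightarrow> Cinf_on (S \<union> T) f"
  by (simp add: Cinf_on_def Ck_on_Un)

lemma Cinf_on_continuous: "Cinf_on S f \<Longrightarrow> continuous_on S f"
  using Ck_on_continuous Cinf_on_def by blast

lemma Cinf_on_has_derivative:
  "Cinf_on S f \<Longrightarrow> x \<in> S \<Longrightarrow> (f has_derivative frechet_derivative f (at x)) (at x)"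
  unfolding Cinf_on_def by (rule Ck_on_has_derivative) auto

lemma Cinf_on_differentiable: "Cinf_on S f \<Longrightarrow> x \<in> S \<Longrightarrow> f differentiable at x"
  using Cinf_on_has_derivative differentiableI by blast

lemma Cinf_on_linear_derivative: "Cinf_on S f \<Longrightarrow> x \<in> S \<Longrightarrow> linear (frechet_derivative f (at x))"
  using Cinf_on_has_derivative has_derivative_linear by blast

lemma Cinf_on_derivative: "Cinf_on S f \<Longrightarrow> Cinf_on S (\<lambda>x. frechet_derivative f (at x) v)"
  unfolding Cinf_on_def by (intro allI Ck_on_derivative) simp

text \<open>\<open>S\<close> and the complement of \<open>K\<close> are open, cover the space, and
  the extension is smooth on each. Cut-off fields become fields on the whole plane in this way, so
  that their flows exist for all times.\<close>

lemma Cinf_on_extend_zero: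
  assumes "open S" "closed K" "K \<subseteq> S" "Cinf_on S f" "\<And>x. x \<in> S - K \<Longrightarrow> f x = 0"
  shows "Cinf_on UNIV (\<lambda>x. if x \<in> S then f x else 0)"
proof -
  let ?g = "\<lambda>x. if x \<in> S then f x else 0"
  have "Cinf_on S ?g"
    by (rule Cinf_on_cong[OF assms(1) _ assms(4)]) simp
  moreover have "Cinf_on (- K) ?g"
    by (rule Cinf_on_cong[OF _ _ Cinf_on_const[of _ 0]])
      (use \<open>closed K\<close> assms(5) in \<open>simp_all add: open_Compl\<close>)
  ultimately have "Cinf_on (S \<union> - K) ?g"
    using assms(1,2) by (intro Cinf_on_Un) (simp_all add: open_Compl)
  moreover have "S \<union> - K = UNIV" using \<open>K \<subseteq> S\<close> by blast
  ultimately show ?thesis by simp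
qed

section \<open>Differentiation under the integral sign\<close>

lemma compact_neighbourhood:
  fixes K :: "'a::euclidean_space set"
  assumes "compact K" "K \<subseteq> T" "open T"
  obtains r K' where "r > 0" "compact K'" "K' \<subseteq> T" "\<And>x. x \<in> K \<Longrightarrow> cball x r \<subseteq> K'"
proof -
  obtain r where r: "r > 0" "(\<Union>x\<in>K. cball x r) \<subseteq> T"
    using compact_subset_open_imp_cball_epsilon_subset[OF assms(1,3,2)] by blast
  have eq: "(\<Union>x\<in>K. cball x r) = {x + y | x y. x \<in> K \<and> y \<in> cball 0 r}"
  proof safe
    fix x y assume "x \<in> K" "y \<in> cball x r"
    then show "\<exists>x' z. y = x' + z \<and> x' \<in> K \<and> z \<in> cball 0 r"
      by (intro exI[of _ x] exI[of _ "y - x"]) (auto simp: dist_norm norm_minus_commute)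
  next
    fix x y assume "x \<in> K" "y \<in> cball (0::'a) r"
    then show "x + y \<in> (\<Union>x\<in>K. cball x r)"
      by (intro UN_I[of x]) (auto simp: dist_norm)
  qed
  have "compact (\<Union>x\<in>K. cball x r)"
    unfolding eq by (rule compact_sums) (use assms in auto)
  then show ?thesis using r that by blast
qed

text \<open>Directional derivatives are uniformly continuous on a compact neighbourhood, and the
  mean value inequality turns this into a linearization error with one radius for all base points.
  This uniformity serves both parameter integrals and the variational equation of an ODE.\<close>

lemma uniformly_differentiable_on_compact:
  fixes f :: "'a::euclidean_space \<Rightarrow> 'b::real_normed_vector"
  assumes "open T" "Ck_on (Suc 0) T f" "compact K" "K \<subseteq> T" "e > 0"
  obtains d where "d > 0"
    "\<And>p q. p \<in> K \<Longrightarrow> norm q \<le> d \<Longrightarrow> p + q \<in> T \<and>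
       norm (f (p + q) - f p - frechet_derivative f (at p) q) \<le> e * norm q"
proof -
  define D where "D x = frechet_derivative f (at x)" for x
  have der: "(f has_derivative D x) (at x)" if "x \<in> T" for x
    using Ck_on_has_derivative[OF assms(2) that] by (simp add: D_def)
  have lin: "linear (D x)" if "x \<in> T" for x
    using der[OF that] has_derivative_linear by blast
  have cont: "continuous_on T (\<lambda>x. D x b)" for b
    using Ck_on_derivative[OF assms(2), of b] by (simp add: D_def)
  obtain r K' where r: "r > 0" "compact K'" "K' \<subseteq> T" "\<And>x. x \<in> K \<Longrightarrow> cball x r \<subseteq> K'"
    using compact_neighbourhood[OF assms(3,4,1)] by metis
  \<comment> \<open>The operator norm is estimated by a sum over the basis, so each direction
    receives an equal share of the error.\<close>
  define e' where "e' = e / DIM('a)"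
  have e': "e' > 0" using \<open>e > 0\<close> by (simp add: e'_def)
  have "\<exists>d>0. \<forall>x\<in>K'. \<forall>y\<in>K'. dist y x < d \<longrightarrow> dist (D y b) (D x b) < e'" for b
    using compact_uniformly_continuous[OF continuous_on_subset[OF cont r(3)] r(2)] e'
    unfolding uniformly_continuous_on_def by blast
  then obtain d where d: "\<And>b. d b > 0"
    "\<And>b x y. x \<in> K' \<Longrightarrow> y \<in> K' \<Longrightarrow> dist y x < d b \<Longrightarrow> dist (D y b) (D x b) < e'"
    by metis
  \<comment> \<open>Halving makes the radius strictly smaller than every modulus: the moduli control
    strict distances, whereas the ball below is closed.\<close>
  define d0 where "d0 = min r (Min (d ` Basis) / 2)"
  have "Min (d ` (Basis :: 'a set)) > 0" using d(1) by (subst Min_gr_iff) auto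
  then have d0: "d0 > 0" "d0 \<le> r" using r(1) by (auto simp: d0_def)
  have d0': "d0 < d b" if "b \<in> Basis" for b
  proof -
    have "d0 \<le> Min (d ` Basis) / 2" unfolding d0_def by (rule min.cobounded2)
    also have "\<dots> < Min (d ` Basis)" using \<open>Min (d ` Basis) > 0\<close> by simp
    also have "\<dots> \<le> d b" using that by simp
    finally show ?thesis .
  qed
  show ?thesis
  proof (rule that[OF d0(1)])
    fix p q :: 'a assume p: "p \<in> K" and q: "norm q \<le> d0"
    have sub: "cball p d0 \<subseteq> K'" using r(4)[OF p] d0(2) by (meson order_trans subset_cball)
    have "norm (f (p + q) - f p - D p (p + q - p)) \<le> norm (p + q - p) * e"
    proof (rule differentiable_bound_linearization[of p "p + q" "cball p d0"])
      fix t :: real assume "t \<in> {0..1}"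
      then have "norm (t *\<^sub>R q) \<le> d0"
        using q mult_left_le_one_le[of "norm q" t] by simp
      then show "p + t *\<^sub>R (p + q - p) \<in> cball p d0" by (simp add: dist_norm)
    next
      fix x assume x: "x \<in> cball p d0"
      have "p \<in> cball p d0" using d0 by simp
      then have xT: "x \<in> K'" "x \<in> T" "p \<in> K'" "p \<in> T" using x sub r(3) by blast+
      show "(f has_derivative D x) (at x within cball p d0)"
        using der[OF xT(2)] has_derivative_at_withinI by blast
      show "onorm (D x - D p) \<le> e"
      proof (rule onorm_le)
        fix v :: 'a
        have "(D x - D p) v = (\<Sum>b\<in>Basis. (v \<bullet> b) *\<^sub>R (D x b - D p b))"
          using linear_expand[OF lin[OF xT(2)], of v] linear_expand[OF lin[OF xT(4)], of v]
          by (simp add: scaleR_diff_right sum_subtractf)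
        also have "norm \<dots> \<le> (\<Sum>b\<in>(Basis::'a set). norm v * e')"
        proof (rule sum_norm_le)
          fix b :: 'a assume b: "b \<in> Basis"
          have "dist x p < d b" using x d0'[OF b] by (simp add: dist_commute)
          then have "norm (D x b - D p b) \<le> e'"
            using d(2)[OF xT(3) xT(1)] by (simp add: dist_norm less_imp_le)
          then show "norm ((v \<bullet> b) *\<^sub>R (D x b - D p b)) \<le> norm v * e'"
            using Basis_le_norm[OF b, of v] by (auto intro!: mult_mono)
        qed
        also have "\<dots> = e * norm v" by (simp add: e'_def)
        finally show "norm ((D x - D p) v) \<le> e * norm v" .
      qed
    qed (use d0 in auto)
    then show "p + q \<in> T \<and> norm (f (p + q) - f p - frechet_derivative f (at p) q) \<le> e * norm q"
      using sub q r(3) by (auto simp: D_def mult.commute dist_norm subset_iff)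
  qed
qed

text \<open>Continuity up to a compact superset bounds the integrand on a set of finite measure;
  this works for domains with any boundary.\<close>

lemma absolutely_integrable_continuous_subset_compact:
  fixes f :: "'a::euclidean_space \<Rightarrow> real"
  assumes "compact K" "\<Omega> \<subseteq> K" "\<Omega> \<in> sets lebesgue" "continuous_on K f"
  shows "f absolutely_integrable_on \<Omega>"
proof -
  have "bounded (f ` K)" using assms compact_continuous_image compact_imp_bounded by blast
  then obtain B where B: "\<And>x. x \<in> K \<Longrightarrow> norm (f x) \<le> B" unfolding bounded_iff by blast
  have "bounded \<Omega>" using assms compact_imp_bounded bounded_subset by blast
  then have fin: "\<Omega> \<in> lmeasurable" using assms(3) by (rule bounded_set_imp_lmeasurable)
  show ?thesis
  proof (rule measurable_bounded_by_integrable_imp_absolutely_integrable[where g="\<lambda>x. B"])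
    show "f \<in> borel_measurable (lebesgue_on \<Omega>)"
      using assms by (intro continuous_imp_measurable_on_sets_lebesgue) (auto intro: continuous_on_subset)
    show "(\<lambda>x. B) integrable_on \<Omega>"
      using fin by (rule integrable_on_const)
  qed (use assms B in auto)
qed

text \<open>The linearization error of the integrand is uniform over \<open>K\<close>, hence its
  integral is at most that error times the finite measure of \<Omega>.\<close>

lemma has_derivative_parameter_integral:
  fixes F :: "'p::euclidean_space \<times> 'a::euclidean_space \<Rightarrow> real"
  assumes "open T" "Ck_on (Suc 0) T F" "compact K" "\<Omega> \<subseteq> K" "\<Omega> \<in> sets lebesgue" "{p} \<times> K \<subseteq> T"
  shows "((\<lambda>p. integral \<Omega> (\<lambda>a. F (p, a))) has_derivative
     (\<lambda>v. integral \<Omega> (\<lambda>a. frechet_derivative F (at (p, a)) (v, 0)))) (at p)"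
proof -
  let ?D = "\<lambda>v a. frechet_derivative F (at (p, a)) (v, 0)"
  have lin: "linear (frechet_derivative F (at x))" if "x \<in> T" for x
    using Ck_on_has_derivative[OF assms(2) that] has_derivative_linear by blast
  have bO: "\<Omega> \<in> lmeasurable"
    using assms bounded_set_imp_lmeasurable bounded_subset compact_imp_bounded by blast
  have inD: "?D v integrable_on \<Omega>" for v
  proof (intro set_lebesgue_integral_eq_integral(1) absolutely_integrable_continuous_subset_compact[OF assms(3-5)])
    have "continuous_on T (\<lambda>x. frechet_derivative F (at x) (v, 0))"
      using Ck_on_derivative[OF assms(2), of "(v,0)"] by simp
    then have "continuous_on K ((\<lambda>x. frechet_derivative F (at x) (v, 0)) \<circ> (\<lambda>a. (p, a)))"
      using assms(6) by (intro continuous_on_compose continuous_intros) (auto elim!: continuous_on_subset)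
    then show "continuous_on K (?D v)" by (simp add: o_def)
  qed
  have linD: "linear (\<lambda>v. integral \<Omega> (?D v))"
  proof (rule linearI)
    fix v w
    have "integral \<Omega> (?D (v + w)) = integral \<Omega> (\<lambda>a. ?D v a + ?D w a)"
    proof (rule integral_cong)
      fix a assume "a \<in> \<Omega>"
      then have "linear (frechet_derivative F (at (p, a)))" using lin assms by blast
      from linear_add[OF this, of "(v,0)" "(w,0)"] show "?D (v + w) a = ?D v a + ?D w a" by simp
    qed
    then show "integral \<Omega> (?D (v + w)) = integral \<Omega> (?D v) + integral \<Omega> (?D w)"
      using integral_add[OF inD inD] by simp
  next
    fix c v
    have "integral \<Omega> (?D (c *\<^sub>R v)) = integral \<Omega> (\<lambda>a. c * ?D v a)"
    proof (rule integral_cong)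
      fix a assume "a \<in> \<Omega>"
      then have "linear (frechet_derivative F (at (p, a)))" using lin assms by blast
      from linear_scale[OF this, of c "(v,0)"] show "?D (c *\<^sub>R v) a = c * ?D v a" by simp
    qed
    then show "integral \<Omega> (?D (c *\<^sub>R v)) = c *\<^sub>R integral \<Omega> (?D v)" by simp
  qed
  have cK: "compact ({p} \<times> K)" using assms by (intro compact_Times) auto
  show ?thesis
    unfolding has_derivative_at_alt
  proof (intro conjI allI impI)
    show "bounded_linear (\<lambda>v. integral \<Omega> (?D v))"
      using linD linear_conv_bounded_linear by blast
  next
    fix e :: real assume e: "e > 0"
    define m where "m = measure lebesgue \<Omega>"
    have m: "m \<ge> 0" by (simp add: m_def)
    \<comment> \<open>Dividing by \<open>m + 1\<close> also covers a set of measure zero.\<close>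
    define e' where "e' = e / (m + 1)"
    have e': "e' > 0" using e m by (simp add: e'_def)
    obtain d where d: "d > 0" "\<And>x q. x \<in> {p} \<times> K \<Longrightarrow> norm q \<le> d \<Longrightarrow> x + q \<in> T \<and>
       norm (F (x + q) - F x - frechet_derivative F (at x) q) \<le> e' * norm q"
      using uniformly_differentiable_on_compact[OF assms(1,2) cK assms(6) e'] by blast
    have inF: "(\<lambda>a. F (y, a)) integrable_on \<Omega>" if "norm (y - p) \<le> d" for y
    proof (intro set_lebesgue_integral_eq_integral(1) absolutely_integrable_continuous_subset_compact[OF assms(3-5)])
      have "(y, a) \<in> T" if "a \<in> K" for a
        using d(2)[of "(p, a)" "(y - p, 0)"] that \<open>norm (y - p) \<le> d\<close> by (auto simp: norm_Pair)
      then have "continuous_on K (F \<circ> (\<lambda>a. (y, a)))"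
        using Ck_on_continuous[OF assms(2)]
        by (intro continuous_on_compose continuous_intros) (auto elim!: continuous_on_subset)
      then show "continuous_on K (\<lambda>a. F (y, a))" by (simp add: o_def)
    qed
    show "\<exists>d>0. \<forall>y. norm (y - p) < d \<longrightarrow>
        norm (integral \<Omega> (\<lambda>a. F (y, a)) - integral \<Omega> (\<lambda>a. F (p, a)) - integral \<Omega> (?D (y - p)))
        \<le> e * norm (y - p)"
    proof (intro exI[of _ d] conjI allI impI d(1))
      fix y assume y: "norm (y - p) < d"
      have i1: "(\<lambda>a. F (y, a)) integrable_on \<Omega>" "(\<lambda>a. F (p, a)) integrable_on \<Omega>"
        using inF[of y] inF[of p] y d(1) by auto
      have "norm (integral \<Omega> (\<lambda>a. F (y, a) - F (p, a) - ?D (y - p) a))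
          \<le> integral \<Omega> (\<lambda>a. e' * norm (y - p))"
      proof (rule integral_norm_bound_integral)
        show "(\<lambda>a. F (y, a) - F (p, a) - ?D (y - p) a) integrable_on \<Omega>"
          by (intro integrable_diff i1 inD)
        show "(\<lambda>a. e' * norm (y - p)) integrable_on \<Omega>"
          using bO by (rule integrable_on_const)
        fix a assume "a \<in> \<Omega>"
        then show "norm (F (y, a) - F (p, a) - ?D (y - p) a) \<le> e' * norm (y - p)"
          using d(2)[of "(p, a)" "(y - p, 0)"] y assms(4) by (auto simp: norm_Pair)
      qed
      also have "integral \<Omega> (\<lambda>a. e' * norm (y - p)) = m * (e' * norm (y - p))"
        using lmeasure_integral[OF bO] integral_mult_right[of \<Omega> "e' * norm (y - p)" "\<lambda>x. 1"] m_def
        by (simp add: mult.commute)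
      also have "\<dots> \<le> e * norm (y - p)"
      proof -
        have "m * e' \<le> e" using m e by (simp add: e'_def field_simps)
        then have "(m * e') * norm (y - p) \<le> e * norm (y - p)"
          by (intro mult_right_mono) auto
        then show ?thesis by (simp add: mult.assoc)
      qed
      also have "integral \<Omega> (\<lambda>a. F (y, a) - F (p, a) - ?D (y - p) a) =
          integral \<Omega> (\<lambda>a. F (y, a)) - integral \<Omega> (\<lambda>a. F (p, a)) - integral \<Omega> (?D (y - p))"
        by (simp add: integral_diff i1 inD integrable_diff)
      finally show "norm (integral \<Omega> (\<lambda>a. F (y, a)) - integral \<Omega> (\<lambda>a. F (p, a)) -
          integral \<Omega> (?D (y - p))) \<le> e * norm (y - p)" .
    qed
  qed
qed

section \<open>Symmetry of second derivatives\<close>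

lemma norm_increment_le:
  fixes f :: "real \<Rightarrow> 'a::real_normed_vector"
  assumes "a \<le> b" "\<And>s. s \<in> {a..b} \<Longrightarrow> (f has_vector_derivative f' s) (at s)"
    "\<And>s. s \<in> {a..b} \<Longrightarrow> norm (f' s) \<le> B"
  shows "norm (f b - f a) \<le> B * (b - a)"
proof (cases "a = b")
  case False
  have "norm (f b - f a) \<le> B * b - B * a"
  proof (rule differentiable_bound_general[of a b f "\<lambda>x. B * x" f' "\<lambda>x. B"])
    show "continuous_on {a..b} f"
      using assms(2) by (meson continuous_on_eq_continuous_within has_vector_derivative_continuous
          has_vector_derivative_at_within)
    fix x
    show "((\<lambda>x. B * x) has_vector_derivative B) (at x)"
      by (auto intro!: derivative_eq_intros)
  qed (use False assms in \<open>auto intro!: continuous_intros\<close>)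
  then show ?thesis by (simp add: right_diff_distrib)
qed simp

text \<open>The second difference of \<open>f\<close> is symmetric in the two increments.\<close>

lemma frechet_derivative_commute:
  fixes f :: "'a::euclidean_space \<Rightarrow> 'b::real_normed_vector"
  assumes "open T" "Ck_on (Suc (Suc 0)) T f" "x \<in> T"
  shows "frechet_derivative (\<lambda>y. frechet_derivative f (at y) u) (at x) v =
         frechet_derivative (\<lambda>y. frechet_derivative f (at y) v) (at x) u"
proof -
  define D where "D y = frechet_derivative f (at y)" for y
  have derf: "(f has_derivative D y) (at y)" if "y \<in> T" for y
    using Ck_on_has_derivative[OF assms(2) that] by (simp add: D_def)
  define A where "A u v = frechet_derivative (\<lambda>y. D y u) (at x) v" for u v
  have derD: "((\<lambda>y. D y u) has_derivative A u) (at x)" for u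
    using Ck_on_has_derivative[OF Ck_on_derivative[OF assms(2), of u] assms(3)]
    by (simp add: D_def A_def[abs_def])
  define \<Delta> where "\<Delta> u v h = f (x + h *\<^sub>R u + h *\<^sub>R v) - f (x + h *\<^sub>R u) - f (x + h *\<^sub>R v) + f x" for u v h
  obtain r where r: "r > 0" "ball x r \<subseteq> T" using assms(1,3) openE by blast
  have key: "\<exists>h0>0. \<forall>h. 0 < h \<and> h < h0 \<longrightarrow> norm (\<Delta> u v h - h\<^sup>2 *\<^sub>R A u v) \<le> e * h\<^sup>2" if "e > 0" for e u v
  proof -
    define n where "n = norm u + norm v + 1"
    have n: "n > 0" "norm u \<le> n" "norm u + norm v \<le> n" by (auto simp: n_def add_nonneg_pos)
    \<comment> \<open>Two linearization errors occur, each of size at most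
      \<open>e' * (h * n)\<close>; together they give \<open>e * h\<close>.\<close>
    define e' where "e' = e / (2 * n)"
    have e': "e' > 0" using \<open>e > 0\<close> n by (simp add: e'_def)
    obtain d where d: "d > 0" "\<And>y. norm (y - x) < d \<Longrightarrow> norm (D y u - D x u - A u (y - x)) \<le> e' * norm (y - x)"
      using derD[of u] e' unfolding has_derivative_at_alt by blast
    interpret A: bounded_linear "A u" using derD has_derivative_bounded_linear by blast
    show ?thesis
    proof (intro exI[of _ "min r d / n"] conjI allI impI)
      show "min r d / n > 0" using r d n by simp
      fix h assume h: "0 < h \<and> h < min r d / n"
      then have hn: "h * n < r" "h * n < d" using n by (auto simp: field_simps)
      have small: "norm (s *\<^sub>R u + c *\<^sub>R v) \<le> h * n" if "0 \<le> s" "s \<le> h" "0 \<le> c" "c \<le> h" for s c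
      proof -
        have "norm (s *\<^sub>R u + c *\<^sub>R v) \<le> s * norm u + c * norm v"
          using norm_triangle_ineq[of "s *\<^sub>R u" "c *\<^sub>R v"] that by simp
        also have "\<dots> \<le> h * norm u + h * norm v" using that by (intro add_mono mult_right_mono) auto
        also have "\<dots> \<le> h * n" using h n(3) by (metis distrib_left less_imp_le mult_left_mono)
        finally show ?thesis .
      qed
      \<comment> \<open>The increment of \<open>\<psi>\<close> over \<open>[0, h]\<close> is the
        second difference minus its expected value. Its derivative in \<open>s\<close> compares
        \<open>D\<close> at two points near \<open>x\<close>, so differentiability of
        \<open>D\<close> at \<open>x\<close> controls it.\<close>
      define \<psi> where "\<psi> s = f (x + s *\<^sub>R u + h *\<^sub>R v) - f (x + s *\<^sub>R u) - (s * h) *\<^sub>R A u v" for s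
      have inT: "x + (s *\<^sub>R u + c *\<^sub>R v) \<in> T" if "0 \<le> s" "s \<le> h" "0 \<le> c" "c \<le> h" for s c
      proof -
        have "x + (s *\<^sub>R u + c *\<^sub>R v) \<in> ball x r" using small[OF that] hn unfolding mem_ball dist_commute[of x]
          by (simp add: dist_norm)
        then show ?thesis using r(2) by blast
      qed
      have "norm (\<psi> h - \<psi> 0) \<le> (e * h) * (h - 0)"
      proof (rule norm_increment_le)
        fix s assume s: "s \<in> {0..h}"
        have T1: "x + s *\<^sub>R u + h *\<^sub>R v \<in> T" using inT[of s h] s h by (simp add: add.assoc)
        have T2: "x + s *\<^sub>R u \<in> T" using inT[of s 0] s h by simp
        have lin1: "linear (D (x + s *\<^sub>R u + h *\<^sub>R v))" "linear (D (x + s *\<^sub>R u))"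
          using derf T1 T2 has_derivative_linear by blast+
        show "(\<psi> has_vector_derivative D (x + s *\<^sub>R u + h *\<^sub>R v) u - D (x + s *\<^sub>R u) u - h *\<^sub>R A u v) (at s)"
        proof -
          have l1: "((\<lambda>s. x + s *\<^sub>R u + h *\<^sub>R v) has_derivative (\<lambda>t. t *\<^sub>R u)) (at s)"
            and l2: "((\<lambda>s. x + s *\<^sub>R u) has_derivative (\<lambda>t. t *\<^sub>R u)) (at s)"
            and l3: "((\<lambda>s. (s * h) *\<^sub>R A u v) has_derivative (\<lambda>t. (t * h) *\<^sub>R A u v)) (at s)"
            by (auto intro!: derivative_eq_intros)
          show ?thesis
            unfolding has_vector_derivative_def \<psi>_def
            by (rule has_derivative_eq_rhs[OF has_derivative_diff[OF has_derivative_diff[OF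
                has_derivative_compose[of _ _ s UNIV f, OF l1 derf[OF T1]]
                has_derivative_compose[of _ _ s UNIV f, OF l2 derf[OF T2]]] l3]])
              (simp add: fun_eq_iff linear_scale[OF lin1(1)] linear_scale[OF lin1(2)] scaleR_diff_right)
        qed
        have b1: "norm (D (x + s *\<^sub>R u + h *\<^sub>R v) u - D x u - A u (s *\<^sub>R u + h *\<^sub>R v)) \<le> e' * (h * n)"
          using d(2)[of "x + s *\<^sub>R u + h *\<^sub>R v"] small[of s h] s h hn e'
          by (fastforce simp: add.assoc intro: order_trans[OF _ mult_left_mono])
        have b2: "norm (D (x + s *\<^sub>R u) u - D x u - A u (s *\<^sub>R u)) \<le> e' * (h * n)"
          using d(2)[of "x + s *\<^sub>R u"] small[of s 0] s h hn e'
          by (fastforce intro: order_trans[OF _ mult_left_mono])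
        have "D (x + s *\<^sub>R u + h *\<^sub>R v) u - D (x + s *\<^sub>R u) u - h *\<^sub>R A u v =
          (D (x + s *\<^sub>R u + h *\<^sub>R v) u - D x u - A u (s *\<^sub>R u + h *\<^sub>R v))
          - (D (x + s *\<^sub>R u) u - D x u - A u (s *\<^sub>R u))"
          by (simp add: A.add A.scaleR)
        also have "norm \<dots> \<le> e' * (h * n) + e' * (h * n)"
          using b1 b2 by (rule order_trans[OF norm_triangle_ineq4 add_mono])
        also have "\<dots> = e * h" using n by (simp add: e'_def)
        finally show "norm (D (x + s *\<^sub>R u + h *\<^sub>R v) u - D (x + s *\<^sub>R u) u - h *\<^sub>R A u v) \<le> e * h" .
      qed (use h in auto)
      moreover have "\<psi> h - \<psi> 0 = \<Delta> u v h - h\<^sup>2 *\<^sub>R A u v"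
        by (simp add: \<psi>_def \<Delta>_def power2_eq_square)
      ultimately show "norm (\<Delta> u v h - h\<^sup>2 *\<^sub>R A u v) \<le> e * h\<^sup>2"
        by (simp add: power2_eq_square mult.assoc)
    qed
  qed
  have "norm (A u v - A v u) \<le> 2 * e" if e0: "e > 0" for e
  proof -
    obtain h1 h2 where hh: "h1 > 0" "h2 > 0"
      "\<And>h. 0 < h \<Longrightarrow> h < h1 \<Longrightarrow> norm (\<Delta> u v h - h\<^sup>2 *\<^sub>R A u v) \<le> e * h\<^sup>2"
      "\<And>h. 0 < h \<Longrightarrow> h < h2 \<Longrightarrow> norm (\<Delta> v u h - h\<^sup>2 *\<^sub>R A v u) \<le> e * h\<^sup>2"
      using key[OF e0, of u v] key[OF e0, of v u] by blast
    define h where "h = min h1 h2 / 2"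
    have h: "0 < h" "h < h1" "h < h2" using hh by (auto simp: h_def)
    have "\<Delta> u v h = \<Delta> v u h" by (simp add: \<Delta>_def algebra_simps)
    then have "h\<^sup>2 *\<^sub>R (A u v - A v u) = (\<Delta> v u h - h\<^sup>2 *\<^sub>R A v u) - (\<Delta> u v h - h\<^sup>2 *\<^sub>R A u v)"
      by (simp add: scaleR_diff_right)
    also have "norm \<dots> \<le> e * h\<^sup>2 + e * h\<^sup>2"
      using hh(4)[OF h(1,3)] hh(3)[OF h(1,2)]
      by (rule order_trans[OF norm_triangle_ineq4 add_mono])
    finally have "h\<^sup>2 * norm (A u v - A v u) \<le> h\<^sup>2 * (2 * e)" by (simp add: mult.commute mult.left_commute)
    then show ?thesis using h(1) by simp
  qed
  \<comment> \<open>For this \<open>e\<close> the bound says that the norm is at most half of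
    itself.\<close>
  from this[of "norm (A u v - A v u) / 4"] have "A u v = A v u"
    by (cases "A u v = A v u") auto
  then show ?thesis by (simp add: A_def D_def)
qed

section \<open>Bump functions and cutoffs\<close>

definition flat_exp :: "nat \<Rightarrow> real \<Rightarrow> real" where
  "flat_exp n s = (if s \<le> 0 then 0 else (1 / s) ^ n * exp (- 1 / s))"

text \<open>The quadratic bound makes the difference quotient at 0 tend to 0. With
  \<open>y = 1 / s\<close> and \<open>k = n + 2\<close> it is the inequality y/k \<le> exp(y/k)
  raised to the power \<open>k\<close>.\<close>

lemma flat_exp_bounds:
  shows "0 \<le> flat_exp n s" "flat_exp n s \<le> real (Suc (Suc n)) ^ Suc (Suc n) * s\<^sup>2"
proof -
  show "0 \<le> flat_exp n s" by (simp add: flat_exp_def)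
  show "flat_exp n s \<le> real (Suc (Suc n)) ^ Suc (Suc n) * s\<^sup>2"
  proof (cases "s \<le> 0")
    case False
    define y where "y = 1 / s"
    have y: "y > 0" using False by (simp add: y_def)
    define k where "k = Suc (Suc n)"
    have k: "real k > 0" by (simp add: k_def)
    have "y / real k \<le> exp (y / real k)" using exp_ge_add_one_self[of "y / real k"] by linarith
    then have "(y / real k) ^ k \<le> exp (y / real k) ^ k" using y k by (intro power_mono) auto
    also have "\<dots> = exp y" using k by (simp flip: exp_of_nat_mult)
    finally have "y ^ k \<le> real k ^ k * exp y" using k by (simp add: power_divide field_simps)
    then have "y ^ n * exp (- y) \<le> real k ^ k * s\<^sup>2"
      using y by (simp add: k_def y_def exp_minus field_simps power2_eq_square power_add)
    then show ?thesis using False by (simp add: flat_exp_def y_def k_def)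
  qed (simp add: flat_exp_def)
qed

text \<open>Allowing every power of 1/s in front of the exponential closes the family under
  differentiation, so smoothness of all members follows by one induction.\<close>

lemma flat_exp_has_derivative:
  "(flat_exp n has_real_derivative (flat_exp (n + 2) s - real n * flat_exp (n + 1) s)) (at s)"
proof -
  consider "s < 0" | "s = 0" | "s > 0" by linarith
  then show ?thesis
  proof cases
    case 1
    have "((\<lambda>_. 0) has_real_derivative 0) (at s)" by simp
    then have "(flat_exp n has_real_derivative 0) (at s)"
      by (rule has_field_derivative_transform_within_open[of _ _ _ "{..<0}"])
        (use 1 in \<open>auto simp: flat_exp_def\<close>)
    then show ?thesis using 1 by (simp add: flat_exp_def)
  next
    case 2
    define C where "C = real (Suc (Suc n)) ^ Suc (Suc n)"
    have "((\<lambda>h. (flat_exp n (0 + h) - flat_exp n 0) / h) \<longlongrightarrow> 0) (at 0)"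
    proof (rule Lim_null_comparison)
      show "\<forall>\<^sub>F h in at 0. norm ((flat_exp n (0 + h) - flat_exp n 0) / h) \<le> C * \<bar>h\<bar>"
      proof (rule always_eventually, rule allI)
        fix h :: real
        have "\<bar>flat_exp n h\<bar> \<le> C * h\<^sup>2" using flat_exp_bounds[of n h] by (simp add: C_def)
        also have "\<dots> = (C * \<bar>h\<bar>) * \<bar>h\<bar>" by (simp add: power2_eq_square)
        finally have "\<bar>flat_exp n h\<bar> / \<bar>h\<bar> \<le> C * \<bar>h\<bar>"
          by (cases "h = 0") (auto simp: field_simps)
        then show "norm ((flat_exp n (0 + h) - flat_exp n 0) / h) \<le> C * \<bar>h\<bar>"
          by (simp add: flat_exp_def[of n 0])
      qed
      show "((\<lambda>h. C * \<bar>h\<bar>) \<longlongrightarrow> 0) (at 0)"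
        by (rule tendsto_eq_intros refl | simp)+
    qed
    then show ?thesis using 2 by (simp add: DERIV_def flat_exp_def[of _ 0])
  next
    case 3
    have "((\<lambda>s. (1 / s) ^ n * exp (- 1 / s)) has_real_derivative
        (flat_exp (n + 2) s - real n * flat_exp (n + 1) s)) (at s)"
    proof -
      have d: "((\<lambda>s. 1 / s) has_real_derivative - ((1 / s) * (1 / s))) (at s)"
        using 3 by (auto intro!: derivative_eq_intros)
      have "real n * (1 / s) ^ (n - 1) * ((1 / s) * (1 / s)) = real n * (1 / s) ^ (n + 1)"
        by (cases n) (auto simp: power_add)
      moreover have "((\<lambda>s. (1 / s) ^ n * exp (- (1 / s))) has_real_derivative
          (1 / s) ^ n * (exp (- (1 / s)) * (1 / s * (1 / s)))
          - real n * (1 / s) ^ (n - 1) * ((1 / s) * (1 / s)) * exp (- (1 / s))) (at s)"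
        by (rule derivative_eq_intros d refl)+ (simp add: algebra_simps)
      ultimately show ?thesis using 3
        by (simp add: flat_exp_def algebra_simps)
    qed
    then show ?thesis
      by (rule has_field_derivative_transform_within_open[of _ _ _ "{0<..}"])
        (use 3 in \<open>auto simp: flat_exp_def\<close>)
  qed
qed

lemma Ck_on_flat_exp: "Ck_on k UNIV (flat_exp n)"
proof (induction k arbitrary: n)
  case 0
  then show ?case
    unfolding Ck_on.simps by (rule DERIV_continuous_on) (rule has_field_derivative_at_within[OF flat_exp_has_derivative])
next
  case (Suc k)
  show ?case
  proof (rule Ck_on_SucI)
    fix s
    show "(flat_exp n has_derivative (\<lambda>v. (flat_exp (n + 2) s - real n * flat_exp (n + 1) s) * v)) (at s)"
      using flat_exp_has_derivative by (simp add: has_field_derivative_def)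
  next
    fix v
    have *: "Ck_on k UNIV (\<lambda>s. real n * flat_exp (n + 1) s)"
      by (rule Ck_on_compose_linear[OF bounded_linear_mult_right _ Suc]) simp
    have "Ck_on k UNIV (\<lambda>s. v * (flat_exp (n + 2) s + - 1 * (real n * flat_exp (n + 1) s)))"
      by (intro Ck_on_compose_linear[OF bounded_linear_mult_right] Ck_on_add Suc * open_UNIV)
    then show "Ck_on k UNIV (\<lambda>s. (flat_exp (n + 2) s - real n * flat_exp (n + 1) s) * v)"
      by (simp add: mult.commute)
  qed simp
qed

definition bump :: "real \<Rightarrow> 'a::euclidean_space \<Rightarrow> 'a \<Rightarrow> real" where
  "bump r c x = flat_exp 0 (r\<^sup>2 - (x - c) \<bullet> (x - c))"

lemma Cinf_on_flat_exp: "open S \<Longrightarrow> Cinf_on S f \<Longrightarrow> Cinf_on S (\<lambda>x. flat_exp n (f x))"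
  by (rule Cinf_on_compose[of UNIV "flat_exp n"]) (auto simp: Cinf_on_def Ck_on_flat_exp)

lemma Cinf_on_bump: "Cinf_on UNIV (bump r c)"
  unfolding bump_def[abs_def]
  by (intro Cinf_on_flat_exp Cinf_on_diff Cinf_on_inner Cinf_on_const Cinf_on_ident open_UNIV)

lemma bump_nonneg: "bump r c x \<ge> 0"
  by (simp add: bump_def flat_exp_bounds)

lemma bump_pos_iff: "r > 0 \<Longrightarrow> bump r c x > 0 \<longleftrightarrow> x \<in> ball c r"
proof -
  assume "r > 0"
  have "(x - c) \<bullet> (x - c) < r\<^sup>2 \<longleftrightarrow> norm (x - c) < r"
    using power_mono_iff[of r "norm (x - c)" 2] \<open>r > 0\<close>
    by (simp add: dot_square_norm flip: not_le)
  then show ?thesis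
    by (auto simp: bump_def flat_exp_def dist_norm norm_minus_commute not_le)
qed

lemma bump_eq_0: "r > 0 \<Longrightarrow> x \<notin> ball c r \<Longrightarrow> bump r c x = 0"
  using bump_pos_iff[of r c x] bump_nonneg[of r c x] by linarith

text \<open>A finite sum \<open>s\<close> of bumps is at least \<open>m > 0\<close> on
  \<open>K\<close> and vanishes off \<open>K'\<close>. The transition function f(s) / (f(s) + f(m -
  s)), with f the flat exponential, equals 1 for s \<ge> m and 0 for s \<le> 0; its denominator is
  positive because one of s and m - s is.\<close>

lemma smooth_cutoff:
  fixes K :: "'a::euclidean_space set"
  assumes "compact K" "open T" "K \<subseteq> T"
  obtains \<theta> :: "'a \<Rightarrow> real" and L where "Cinf_on UNIV \<theta>" "\<And>x. x \<in> K \<Longrightarrow> \<theta> x = 1"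
    "compact L" "L \<subseteq> T" "\<And>x. x \<notin> L \<Longrightarrow> \<theta> x = 0"
proof (cases "K = {}")
  case True
  show ?thesis by (rule that[of "\<lambda>x. 0" "{}"]) (use True in \<open>auto intro: Cinf_on_const\<close>)
next
  case False
  obtain r K' where r: "r > 0" "compact K'" "K' \<subseteq> T" "\<And>x. x \<in> K \<Longrightarrow> cball x r \<subseteq> K'"
    using compact_neighbourhood[OF assms(1,3,2)] by metis
  have "K \<subseteq> (\<Union>x\<in>K. ball x r)" using r(1) by auto
  from compactE_image[OF assms(1) _ this] obtain I where I: "I \<subseteq> K" "finite I" "K \<subseteq> (\<Union>x\<in>I. ball x r)"
    by (metis open_ball)
  define s where "s y = (\<Sum>x\<in>I. bump r x y)" for y
  have sC: "Cinf_on UNIV s" unfolding s_def[abs_def] by (intro Cinf_on_sum Cinf_on_bump open_UNIV)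
  have spos: "s y > 0" if y: "y \<in> K" for y
  proof -
    obtain x where x: "x \<in> I" "y \<in> ball x r" using I(3) y by blast
    have "0 < bump r x y" using x r(1) by (simp add: bump_pos_iff del: mem_ball)
    also have "\<dots> \<le> s y" unfolding s_def using x I(2) by (intro member_le_sum bump_nonneg)
    finally show ?thesis .
  qed
  have s0: "s y = 0" if "y \<notin> K'" for y
    unfolding s_def
  proof (rule sum.neutral, rule ballI)
    fix x assume "x \<in> I"
    then have "y \<notin> ball x r" using r(4)[of x] I(1) that ball_subset_cball[of x r] by blast
    then show "bump r x y = 0" using r(1) bump_eq_0 by blast
  qed
  obtain y0 where y0: "y0 \<in> K" "\<And>y. y \<in> K \<Longrightarrow> s y0 \<le> s y"
    using continuous_attains_inf[OF assms(1) False continuous_on_subset[OF Cinf_on_continuous[OF sC]]] by auto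
  define m where "m = s y0"
  have m: "m > 0" using spos y0 by (simp add: m_def)
  have den: "flat_exp 0 t + flat_exp 0 (m - t) > 0" for t
    using m by (auto simp: flat_exp_def intro!: add_pos_pos)
  show ?thesis
  proof (rule that[of "\<lambda>y. flat_exp 0 (s y) / (flat_exp 0 (s y) + flat_exp 0 (m - s y))" K'])
    show "Cinf_on UNIV (\<lambda>y. flat_exp 0 (s y) / (flat_exp 0 (s y) + flat_exp 0 (m - s y)))"
      by (intro Cinf_on_divide Cinf_on_add Cinf_on_diff Cinf_on_flat_exp Cinf_on_const sC open_UNIV)
        (rule less_imp_neq[OF den, symmetric])
  next
    fix x assume "x \<in> K"
    then have "flat_exp 0 (m - s x) = 0" "flat_exp 0 (s x) \<noteq> 0"
      using y0(2)[of x] spos[of x] by (auto simp: m_def flat_exp_def)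
    then show "flat_exp 0 (s x) / (flat_exp 0 (s x) + flat_exp 0 (m - s x)) = 1" by simp
  next
    fix x assume "x \<notin> K'"
    then show "flat_exp 0 (s x) / (flat_exp 0 (s x) + flat_exp 0 (m - s x)) = 0"
      by (simp add: s0) (simp add: flat_exp_def)
  qed (use r in auto)
qed

section \<open>Ordinary differential equations\<close>

lemma continuous_antiderivative:
  fixes c :: "real \<Rightarrow> 'a::euclidean_space"
  assumes "continuous_on UNIV c"
  obtains C where "C 0 = 0" "\<And>s. (C has_vector_derivative c s) (at s)"
proof (rule that[of "\<lambda>u. LBINT y=ereal 0..ereal u. c y"])
  show "(LBINT y=ereal 0..ereal 0. c y) = 0" by simp
  fix s :: real
  define b where "b = \<bar>s\<bar> + 1"
  have "((\<lambda>u. LBINT y=ereal 0..ereal u. c y) has_vector_derivative c s) (at s within {-b..b})"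
    by (rule interval_integral_FTC2) (use assms in \<open>auto simp: b_def intro: continuous_on_subset\<close>)
  moreover have "at s within {-b..b} = at s"
    by (rule at_within_interior) (auto simp: b_def)
  ultimately show "((\<lambda>u. LBINT y=ereal 0..ereal u. c y) has_vector_derivative c s) (at s)" by simp
qed

lemma has_vector_derivative_reflect:
  assumes "(y has_vector_derivative v) (at (- r))"
  shows "((\<lambda>r. y (- r)) has_vector_derivative - v) (at r)"
  using vector_diff_chain_at[OF has_vector_derivative_minus[OF has_vector_derivative_id] assms]
  by (simp add: o_def)

text \<open>The squared norm is differentiable even where the norm is not. With the weight exp(-K s)
  the quantity |y|^2 + C^2 does not increase: in K = 2 L + 1 the term 2 L absorbs the Lipschitz
  part, and 1 absorbs 2 |y| C \<le> |y|^2 + C^2.\<close>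

lemma gronwall_forward:
  fixes y :: "real \<Rightarrow> 'a::real_inner"
  assumes "0 \<le> N" "0 \<le> L"
    and der: "\<And>s. s \<in> {0..N} \<Longrightarrow> (y has_vector_derivative v s) (at s)"
    and bnd: "\<And>s. s \<in> {0..N} \<Longrightarrow> norm (v s) \<le> L * norm (y s) + C"
  shows "(norm (y N))\<^sup>2 \<le> exp ((2 * L + 1) * N) * ((norm (y 0))\<^sup>2 + C\<^sup>2)"
proof -
  define K where "K = 2 * L + 1"
  define g where "g s = exp (- K * s) * (y s \<bullet> y s + C\<^sup>2)" for s
  have "g N \<le> g 0"
  proof (rule DERIV_nonpos_imp_nonincreasing[OF \<open>0 \<le> N\<close>])
    fix s assume s: "0 \<le> s" "s \<le> N"
    then have s': "s \<in> {0..N}" by simp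
    have "((\<lambda>s. y s \<bullet> y s) has_real_derivative 2 * (y s \<bullet> v s)) (at s)"
      using bounded_bilinear.has_vector_derivative[OF bounded_bilinear_inner der[OF s'] der[OF s']]
      by (simp add: has_real_derivative_iff_has_vector_derivative inner_commute)
    then have "(g has_real_derivative exp (- K * s) * (2 * (y s \<bullet> v s) - K * (y s \<bullet> y s + C\<^sup>2))) (at s)"
      unfolding g_def by (auto intro!: derivative_eq_intros simp: algebra_simps)
    moreover have "2 * (y s \<bullet> v s) \<le> K * (y s \<bullet> y s + C\<^sup>2)"
    proof -
      let ?n = "norm (y s)"
      have "y s \<bullet> v s \<le> ?n * norm (v s)" by (rule norm_cauchy_schwarz)
      also have "\<dots> \<le> ?n * (L * ?n + C)" by (intro mult_left_mono bnd s') auto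
      finally have "2 * (y s \<bullet> v s) \<le> 2 * L * ?n\<^sup>2 + 2 * ?n * C"
        by (simp add: power2_eq_square algebra_simps)
      also have "2 * ?n * C \<le> ?n\<^sup>2 + C\<^sup>2" using sum_squares_bound[of ?n C] by simp
      also have "2 * L * ?n\<^sup>2 + (?n\<^sup>2 + C\<^sup>2) \<le> K * (?n\<^sup>2 + C\<^sup>2)"
        using \<open>0 \<le> L\<close> by (simp add: K_def algebra_simps)
      finally show ?thesis by (simp add: dot_square_norm)
    qed
    ultimately show "\<exists>d. (g has_real_derivative d) (at s) \<and> d \<le> 0"
      by (intro exI conjI) (auto simp: mult_le_0_iff)
  qed
  then have "y N \<bullet> y N + C\<^sup>2 \<le> exp (K * N) * (y 0 \<bullet> y 0 + C\<^sup>2)"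
    by (simp add: g_def exp_minus field_simps)
  moreover have "y N \<bullet> y N \<le> y N \<bullet> y N + C\<^sup>2" by simp
  ultimately have "y N \<bullet> y N \<le> exp (K * N) * (y 0 \<bullet> y 0 + C\<^sup>2)" by (rule order_trans[rotated])
  then show ?thesis by (simp add: K_def dot_square_norm)
qed

lemma gronwall:
  fixes y :: "real \<Rightarrow> 'a::real_inner"
  assumes "0 \<le> L" "0 \<le> C" "\<bar>s\<bar> \<le> N"
    and der: "\<And>s. \<bar>s\<bar> \<le> N \<Longrightarrow> (y has_vector_derivative v s) (at s)"
    and bnd: "\<And>s. \<bar>s\<bar> \<le> N \<Longrightarrow> norm (v s) \<le> L * norm (y s) + C"
  shows "norm (y s) \<le> exp ((2 * L + 1) * N) * (norm (y 0) + C)"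
proof -
  define E where "E = exp ((2 * L + 1) * N)"
  have N: "0 \<le> N" using assms(3) by linarith
  have "(norm (y s))\<^sup>2 \<le> exp ((2 * L + 1) * \<bar>s\<bar>) * ((norm (y 0))\<^sup>2 + C\<^sup>2)"
  proof (cases "0 \<le> s")
    case True
    then show ?thesis using gronwall_forward[of s L y v C] assms by simp
  next
    case False
    have "((\<lambda>r. y (- r)) has_vector_derivative - v (- r)) (at r)" if "r \<in> {0..- s}" for r
      using der[of "- r"] that assms(3) False by (intro has_vector_derivative_reflect) auto
    then show ?thesis
      using gronwall_forward[of "- s" L "\<lambda>r. y (- r)" "\<lambda>r. - v (- r)" C] assms False by simp
  qed
  also have "\<dots> \<le> E * ((norm (y 0))\<^sup>2 + C\<^sup>2)"
    using assms by (intro mult_right_mono) (auto simp: E_def mult_left_mono)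
  \<comment> \<open>Since \<open>E\<close> is at least 1, replacing it by its square produces a
    perfect square, whose root can then be taken.\<close>
  also have "\<dots> \<le> E\<^sup>2 * (norm (y 0) + C)\<^sup>2"
  proof (rule mult_mono)
    have "1 \<le> E" using assms(1) N by (simp add: E_def)
    then show "E \<le> E\<^sup>2" by (simp add: power2_eq_square)
    show "(norm (y 0))\<^sup>2 + C\<^sup>2 \<le> (norm (y 0) + C)\<^sup>2" using assms(2) by (simp add: power2_sum)
  qed (auto simp: E_def)
  finally have "(norm (y s))\<^sup>2 \<le> (E * (norm (y 0) + C))\<^sup>2" by (simp add: power_mult_distrib)
  then have "norm (y s) \<le> E * (norm (y 0) + C)"
    by (rule power2_le_imp_le) (use assms(2) in \<open>simp add: E_def\<close>)
  then show ?thesis by (simp add: E_def)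
qed

text \<open>Measured against the weight exp(\<kappa> |s|), integration in time gains a factor
  1/\<kappa>. This makes the Picard map a contraction on every bounded time interval at
  once.\<close>

lemma exponential_comparison:
  fixes d :: "real \<Rightarrow> 'a::real_normed_vector"
  assumes "d 0 = 0" "\<bar>s\<bar> \<le> N"
    and der: "\<And>s. \<bar>s\<bar> \<le> N \<Longrightarrow> (d has_vector_derivative d' s) (at s)"
    and bnd: "\<And>s. \<bar>s\<bar> \<le> N \<Longrightarrow> norm (d' s) \<le> c * \<kappa> * exp (\<kappa> * \<bar>s\<bar>)"
    and "c \<ge> 0"
  shows "norm (d s) \<le> c * exp (\<kappa> * \<bar>s\<bar>)"
proof -
  have fwd: "norm (e r) \<le> c * exp (\<kappa> * r)"
    if "e 0 = 0" "0 \<le> r" and der: "\<And>s. 0 \<le> s \<Longrightarrow> s \<le> r \<Longrightarrow> (e has_vector_derivative e' s) (at s)"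
      and bnd: "\<And>s. 0 \<le> s \<Longrightarrow> s \<le> r \<Longrightarrow> norm (e' s) \<le> c * \<kappa> * exp (\<kappa> * s)"
    for e e' :: "real \<Rightarrow> 'a" and r
  proof (cases "r = 0")
    case False
    have "norm (e r - e 0) \<le> c * exp (\<kappa> * r) - c * exp (\<kappa> * 0)"
    proof (rule differentiable_bound_general[where f' = e' and \<phi>' = "\<lambda>s. c * \<kappa> * exp (\<kappa> * s)"])
      show "continuous_on {0..r} e"
        using der by (meson atLeastAtMost_iff continuous_on_eq_continuous_within
            has_vector_derivative_continuous has_vector_derivative_at_within)
      show "continuous_on {0..r} (\<lambda>s. c * exp (\<kappa> * s))" by (intro continuous_intros)
      show "((\<lambda>s. c * exp (\<kappa> * s)) has_vector_derivative c * \<kappa> * exp (\<kappa> * x)) (at x)" for x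
        unfolding has_real_derivative_iff_has_vector_derivative[symmetric]
        by (auto intro!: derivative_eq_intros)
    qed (use False that in auto)
    then show ?thesis using that(1) \<open>c \<ge> 0\<close> by simp
  qed (use that \<open>c \<ge> 0\<close> in auto)
  show ?thesis
  proof (cases "0 \<le> s")
    case True
    have "norm (d s) \<le> c * exp (\<kappa> * s)"
    proof (rule fwd[of d s d'])
      show "norm (d' r) \<le> c * \<kappa> * exp (\<kappa> * r)" if "0 \<le> r" "r \<le> s" for r
        using bnd[of r] that assms(2) True by simp
      show "(d has_vector_derivative d' r) (at r)" if "0 \<le> r" "r \<le> s" for r
        using der[of r] that assms(2) True by simp
    qed (use assms True in auto)
    then show ?thesis using True by simp
  next
    case False
    have "norm (d (- (- s))) \<le> c * exp (\<kappa> * (- s))"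
    proof (rule fwd[of "\<lambda>r. d (- r)" "- s" "\<lambda>r. - d' (- r)"])
      show "norm (- d' (- r)) \<le> c * \<kappa> * exp (\<kappa> * r)" if "0 \<le> r" "r \<le> - s" for r
        using bnd[of "- r"] that assms(2) False by simp
      show "((\<lambda>r. d (- r)) has_vector_derivative - d' (- r)) (at r)" if "0 \<le> r" "r \<le> - s" for r
        using der[of "- r"] that assms(2) False by (intro has_vector_derivative_reflect) auto
    qed (use assms False in auto)
    then show ?thesis using False by simp
  qed
qed

text \<open>Picard iteration in the exponentially weighted norm. The iterates converge uniformly on
  each bounded interval, their derivatives converge uniformly by the Lipschitz bound, and so the
  limit solves the equation.\<close>

lemma ode_solution_exists:
  fixes f :: "real \<Rightarrow> 'a::euclidean_space \<Rightarrow> 'a"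
  assumes cont: "continuous_on UNIV (\<lambda>(s, x). f s x)"
    and lip: "\<And>s x y. norm (f s x - f s y) \<le> L * norm (x - y)" and L: "L \<ge> 0"
  obtains y where "y 0 = x0" "\<And>s. (y has_vector_derivative f s (y s)) (at s)"
proof -
  define prim where "prim c = (SOME C. C 0 = 0 \<and> (\<forall>s. (C has_vector_derivative c s) (at s)))"
    for c :: "real \<Rightarrow> 'a"
  have prim: "prim c 0 = 0" "(prim c has_vector_derivative c s) (at s)" if "continuous_on UNIV c" for c s
  proof -
    have "\<exists>C. C 0 = 0 \<and> (\<forall>s. (C has_vector_derivative c s) (at s))"
      using continuous_antiderivative[OF that] by metis
    from someI_ex[OF this] show "prim c 0 = 0" "(prim c has_vector_derivative c s) (at s)"
      by (auto simp: prim_def)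
  qed
  define Y where "Y = rec_nat (\<lambda>s. x0) (\<lambda>n y s. x0 + prim (\<lambda>r. f r (y r)) s)"
  have Y0: "Y 0 = (\<lambda>s. x0)" and YS: "Y (Suc n) = (\<lambda>s. x0 + prim (\<lambda>r. f r (Y n r)) s)" for n
    by (simp_all add: Y_def)
  have contf: "continuous_on UNIV (\<lambda>r. f r (y r))" if "continuous_on UNIV y" for y
    using continuous_on_compose2[OF cont, of UNIV "\<lambda>r. (r, y r)"] that
    by (simp add: continuous_on_Pair)
  have vcont: "continuous_on S y" if "\<And>s. (y has_vector_derivative y' s) (at s)"
    for y y' :: "real \<Rightarrow> 'a" and S
    using that by (meson continuous_at_imp_continuous_on has_vector_derivative_continuous)
  have Yder': "(Y (Suc n) has_vector_derivative f s (Y n s)) (at s)" if "continuous_on UNIV (Y n)" for n s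
    unfolding YS using prim(2)[OF contf[OF that], of s] by (auto intro!: derivative_eq_intros)
  have Yc: "continuous_on UNIV (Y n)" for n
  proof (induction n)
    case (Suc n)
    show ?case by (rule vcont[OF Yder'[OF Suc]])
  qed (simp add: Y0)
  note Yder = Yder'[OF Yc]
  have Yat0: "Y n 0 = x0" for n
    by (cases n) (simp_all add: Y0 YS prim(1)[OF contf[OF Yc]])
  define d where "d n s = Y (Suc n) s - Y n s" for n s
  define y where "y s = x0 + suminf (\<lambda>n. d n s)" for s
  have tele: "(\<Sum>i<n. d i s) = Y n s - x0" for n s
    using sum_lessThan_telescope[of "\<lambda>i. Y i s" n] by (simp add: d_def Y0)
  have lim: "uniform_limit {-N..N} (\<lambda>n s. Y n s - x0) (\<lambda>s. y s - x0) sequentially" if N: "N \<ge> 0" for N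
  proof -
    have "bounded ((\<lambda>s. d 0 s) ` {-N..N})"
      unfolding d_def by (intro compact_imp_bounded compact_continuous_image continuous_intros
          continuous_on_subset[OF Yc]) auto
    then obtain M where M: "M > 0" "\<And>s. s \<in> {-N..N} \<Longrightarrow> norm (d 0 s) \<le> M"
      unfolding bounded_pos by auto
    \<comment> \<open>With twice the Lipschitz constant in the exponent, successive differences
      shrink by the factor 1/2.\<close>
    define \<kappa> where "\<kappa> = 2 * L"
    have dn: "norm (d n s) \<le> (M * (1/2) ^ n) * exp (\<kappa> * \<bar>s\<bar>)" if "\<bar>s\<bar> \<le> N" for n s
      using that
    proof (induction n arbitrary: s)
      case 0
      have "norm (d 0 s) \<le> M * 1" using M(2)[of s] 0 by (auto simp: abs_le_iff)
      also have "\<dots> \<le> M * exp (\<kappa> * \<bar>s\<bar>)" using M L by (intro mult_left_mono) (auto simp: \<kappa>_def)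
      finally show ?case by simp
    next
      case (Suc n)
      show ?case
      proof (rule exponential_comparison[OF _ Suc.prems, where d' = "\<lambda>s. f s (Y (Suc n) s) - f s (Y n s)"])
        show "d (Suc n) 0 = 0" by (simp add: d_def Yat0)
        fix r :: real assume r: "\<bar>r\<bar> \<le> N"
        show "(d (Suc n) has_vector_derivative f r (Y (Suc n) r) - f r (Y n r)) (at r)"
          unfolding d_def[abs_def] by (intro has_vector_derivative_diff Yder)
        have "norm (f r (Y (Suc n) r) - f r (Y n r)) \<le> L * norm (d n r)"
          unfolding d_def by (rule lip)
        also have "\<dots> \<le> L * ((M * (1/2) ^ n) * exp (\<kappa> * \<bar>r\<bar>))"
          by (intro mult_left_mono Suc.IH r L)
        finally show "norm (f r (Y (Suc n) r) - f r (Y n r)) \<le> M * (1/2) ^ Suc n * \<kappa> * exp (\<kappa> * \<bar>r\<bar>)"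
          by (simp add: \<kappa>_def mult_ac)
      qed (use M in auto)
    qed
    have "uniform_limit {-N..N} (\<lambda>n s. \<Sum>i<n. d i s) (\<lambda>s. suminf (\<lambda>i. d i s)) sequentially"
    proof (rule Weierstrass_m_test)
      show "norm (d n s) \<le> (M * exp (\<kappa> * N)) * (1/2) ^ n" if "s \<in> {-N..N}" for n s
      proof -
        have "norm (d n s) \<le> (M * (1/2) ^ n) * exp (\<kappa> * \<bar>s\<bar>)" using dn[of s n] that by auto
        also have "\<dots> \<le> (M * (1/2) ^ n) * exp (\<kappa> * N)"
          using M L that by (intro mult_left_mono) (auto simp: \<kappa>_def mult_left_mono)
        finally show ?thesis by (simp add: mult_ac)
      qed
      show "summable (\<lambda>n. (M * exp (\<kappa> * N)) * (1/2) ^ n)"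
        by (intro summable_mult summable_geometric) auto
    qed
    then show ?thesis by (simp add: tele y_def)
  qed
  have der: "(y has_vector_derivative f s (y s)) (at s)" for s
  proof -
    define N where "N = \<bar>s\<bar> + 1"
    have N: "N \<ge> 0" "s \<in> {-N<..<N}" by (auto simp: N_def)
    have pt: "(\<lambda>n. Y (Suc n) r) \<longlonglongrightarrow> y r" if "r \<in> {-N..N}" for r
    proof -
      have "(\<lambda>n. (Y n r - x0) + x0) \<longlonglongrightarrow> (y r - x0) + x0"
        by (intro tendsto_add tendsto_uniform_limitI[OF lim[OF N(1)] that] tendsto_const)
      then have "(\<lambda>n. Y n r) \<longlonglongrightarrow> y r" by simp
      then show ?thesis by (rule LIMSEQ_Suc)
    qed
    \<comment> \<open>The index is shifted by one because the derivative of \<open>Y (Suc n)\<close>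
      is expressed by \<open>Y n\<close>.\<close>
    have "\<exists>g. \<forall>x\<in>{-N..N}. (\<lambda>n. Y (Suc n) x) \<longlonglongrightarrow> g x \<and>
        (g has_derivative (\<lambda>h. h *\<^sub>R f x (y x))) (at x within {-N..N})"
    proof (rule has_derivative_sequence[where f' = "\<lambda>n x h. h *\<^sub>R f x (Y n x)"])
      show "(Y (Suc n) has_derivative (\<lambda>h. h *\<^sub>R f x (Y n x))) (at x within {-N..N})" for n x
        using Yder[of n x] has_vector_derivative_at_within has_vector_derivative_def by blast
      show "(\<lambda>n. Y (Suc n) s) \<longlonglongrightarrow> y s" using pt N by auto
      fix e :: real assume e: "e > 0"
      have e': "e / (L + 1) > 0" using e L by simp
      have "\<forall>\<^sub>F n in sequentially. \<forall>x\<in>{-N..N}. dist (Y n x - x0) (y x - x0) < e / (L + 1)"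
        using lim[OF N(1)] e' unfolding uniform_limit_iff by blast
      then show "\<forall>\<^sub>F n in sequentially. \<forall>x\<in>{-N..N}. \<forall>h. norm (h *\<^sub>R f x (Y n x) - h *\<^sub>R f x (y x)) \<le> e * norm h"
      proof (rule eventually_mono, intro ballI allI)
        fix n x h assume *: "\<forall>x\<in>{-N..N}. dist (Y n x - x0) (y x - x0) < e / (L + 1)" "x \<in> {-N..N}"
        then have "norm (Y n x - y x) < e / (L + 1)" by (simp add: dist_norm)
        then have "L * norm (Y n x - y x) \<le> L * (e / (L + 1))" using L by (intro mult_left_mono) auto
        also have "\<dots> \<le> e" using L e by (simp add: field_simps)
        finally have "norm (f x (Y n x) - f x (y x)) \<le> e" using lip[of x "Y n x" "y x"] by linarith
        then have "\<bar>h\<bar> * norm (f x (Y n x) - f x (y x)) \<le> \<bar>h\<bar> * e" by (intro mult_left_mono) auto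
        then show "norm (h *\<^sub>R f x (Y n x) - h *\<^sub>R f x (y x)) \<le> e * norm h"
          by (simp flip: scaleR_diff_right add: mult.commute)
      qed
    qed (use N in auto)
    then obtain g where g: "\<And>x. x \<in> {-N..N} \<Longrightarrow> (\<lambda>n. Y (Suc n) x) \<longlonglongrightarrow> g x"
      "\<And>x. x \<in> {-N..N} \<Longrightarrow> (g has_derivative (\<lambda>h. h *\<^sub>R f x (y x))) (at x within {-N..N})" by blast
    have gy: "g x = y x" if "x \<in> {-N..N}" for x
      using LIMSEQ_unique[OF g(1)[OF that] pt[OF that]] .
    have "(g has_derivative (\<lambda>h. h *\<^sub>R f s (y s))) (at s)"
      using g(2)[of s] N(2) at_within_interior[of s "{-N..N}"] by auto
    then have "(y has_derivative (\<lambda>h. h *\<^sub>R f s (y s))) (at s)"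
      by (rule has_derivative_transform_within_open[of _ _ _ _ "{-N<..<N}"]) (use gy N(2) in auto)
    then show ?thesis by (simp add: has_vector_derivative_def)
  qed
  have "y 0 = x0" by (simp add: y_def d_def Yat0)
  then show ?thesis using der that by blast
qed

section \<open>Uniqueness and smooth dependence on parameters\<close>

lemma ode_solution_unique:
  fixes f :: "real \<Rightarrow> 'a::euclidean_space \<Rightarrow> 'a"
  assumes lip: "\<And>s x y. norm (f s x - f s y) \<le> L * norm (x - y)" and L: "L \<ge> 0"
    and "\<And>s. (y has_vector_derivative f s (y s)) (at s)"
    and "\<And>s. (z has_vector_derivative f s (z s)) (at s)"
    and "y 0 = z 0"
  shows "y s = z s"
proof -
  have "norm (y s - z s) \<le> exp ((2 * L + 1) * \<bar>s\<bar>) * (norm (y 0 - z 0) + 0)"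
    by (rule gronwall[OF L order_refl order_refl, where v = "\<lambda>s. f s (y s) - f s (z s)"])
      (use lip assms(3,4) in \<open>auto intro: has_vector_derivative_diff\<close>)
  then show ?thesis using assms(5) by simp
qed

text \<open>Along the fixed solution through \<open>x0\<close>, the right-hand sides for
  \<open>x\<close> and \<open>x0\<close> are uniformly close on a compact time interval. Gronwall's
  inequality transfers this closeness, together with that of the initial values, to the
  solutions.\<close>

lemma ode_solution_continuous:
  fixes f :: "(real \<times> 'x::euclidean_space) \<times> 'a::euclidean_space \<Rightarrow> 'a"
  assumes lip: "\<And>p u v. norm (f (p, u) - f (p, v)) \<le> L * norm (u - v)" and L: "L \<ge> 0"
    and cf: "continuous_on UNIV f" and cy0: "continuous_on UNIV y0"
    and init: "\<And>x. y (0, x) = y0 x"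
    and der: "\<And>s x. ((\<lambda>s. y (s, x)) has_vector_derivative f ((s, x), y (s, x))) (at s)"
  shows "continuous_on UNIV y"
proof (rule continuous_at_imp_continuous_on, safe)
  fix s0 :: real and x0 :: 'x
  have cs: "continuous_on S (\<lambda>s. y (s, x))" for x S
    by (intro continuous_at_imp_continuous_on ballI has_vector_derivative_continuous[OF der])
  define N where "N = \<bar>s0\<bar> + 1"
  define E where "E = exp ((2 * L + 1) * N)"
  have E: "E > 0" by (simp add: E_def)
  show "isCont y (s0, x0)"
    unfolding continuous_at_eps_delta
  proof (intro allI impI)
    fix e :: real assume e: "e > 0"
    \<comment> \<open>Initial error and source error contribute \<open>c\<close> each, so Gronwall
      yields \<open>E * (c + c) = e / 2\<close>; the other half is left for the variation in
      time.\<close>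
    define c where "c = e / (4 * E)"
    have c: "c > 0" using e E by (simp add: c_def)
    have c1: "continuous_on (UNIV \<times> {-N..N}) (\<lambda>p::'x \<times> real. y (snd p, x0))"
      by (rule continuous_on_compose2[OF cs[of UNIV x0] continuous_on_snd[OF continuous_on_id]]) simp
    have "continuous_on (UNIV \<times> {-N..N}) (\<lambda>p::'x \<times> real. f ((snd p, fst p), y (snd p, x0)))"
      by (rule continuous_on_compose2[OF cf])
        (auto intro!: continuous_on_Pair continuous_on_fst continuous_on_snd continuous_on_id c1)
    then have "continuous_on (UNIV \<times> {-N..N}) (\<lambda>(x, s). f ((s, x), y (s, x0)))"
      by (simp add: split_beta)
    note prodE = continuous_on_prod_compactE[OF this compact_Icc UNIV_I c, of x0]
    obtain X0 where X0: "x0 \<in> X0" "open X0" and X0': "\<forall>x\<in>X0 \<inter> UNIV. \<forall>s\<in>{-N..N}.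
        dist ((\<lambda>(x, s). f ((s, x), y (s, x0))) (x, s)) ((\<lambda>(x, s). f ((s, x), y (s, x0))) (x0, s)) \<le> c"
      by (rule prodE) blast
    obtain d1 where d1: "d1 > 0" "\<And>x. dist x x0 < d1 \<Longrightarrow> dist (y0 x) (y0 x0) < c"
      using cy0[unfolded continuous_on_iff, rule_format, OF UNIV_I c, of x0] by auto
    obtain d2 where d2: "d2 > 0" "ball x0 d2 \<subseteq> X0" using X0 open_contains_ball by blast
    have near: "norm (y (s, x) - y (s, x0)) \<le> e / 2" if "dist x x0 < min d1 d2" "\<bar>s\<bar> \<le> N" for x s
    proof -
      have "norm (y (s, x) - y (s, x0)) \<le> exp ((2 * L + 1) * N) * (norm (y (0, x) - y (0, x0)) + c)"
      proof (rule gronwall[OF L less_imp_le[OF c] that(2),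
            where v = "\<lambda>s. f ((s, x), y (s, x)) - f ((s, x0), y (s, x0))"])
        fix r :: real assume r: "\<bar>r\<bar> \<le> N"
        show "((\<lambda>s. y (s, x) - y (s, x0)) has_vector_derivative
            f ((r, x), y (r, x)) - f ((r, x0), y (r, x0))) (at r)"
          by (intro has_vector_derivative_diff der)
        have "norm (f ((r, x), y (r, x)) - f ((r, x0), y (r, x0))) \<le>
          norm (f ((r, x), y (r, x)) - f ((r, x), y (r, x0))) + norm (f ((r, x), y (r, x0)) - f ((r, x0), y (r, x0)))"
          using norm_triangle_ineq[of "f ((r, x), y (r, x)) - f ((r, x), y (r, x0))"
              "f ((r, x), y (r, x0)) - f ((r, x0), y (r, x0))"] by simp
        also have "\<dots> \<le> L * norm (y (r, x) - y (r, x0)) + c"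
        proof (intro add_mono lip)
          have "x \<in> ball x0 d2" using that(1) by (simp add: dist_commute)
          then have "x \<in> X0" using d2(2) by blast
          moreover have "r \<in> {-N..N}" using r by (simp add: abs_le_iff)
          ultimately show "norm (f ((r, x), y (r, x0)) - f ((r, x0), y (r, x0))) \<le> c"
            using X0' by (simp add: dist_norm)
        qed
        finally show "norm (f ((r, x), y (r, x)) - f ((r, x0), y (r, x0))) \<le>
            L * norm (y (r, x) - y (r, x0)) + c" .
      qed
      also have "\<dots> \<le> E * (c + c)"
      proof -
        have "norm (y (0, x) - y (0, x0)) \<le> c" using d1(2)[of x] that(1) by (simp add: init dist_norm)
        then show ?thesis unfolding E_def by (intro mult_left_mono add_right_mono) simp_all
      qed
      also have "\<dots> = e / 2" using E by (simp add: c_def field_simps)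
      finally show ?thesis .
    qed
    obtain d3 where d3: "d3 > 0" "\<And>s. dist s s0 < d3 \<Longrightarrow> dist (y (s, x0)) (y (s0, x0)) < e / 2"
      using cs[of UNIV x0, unfolded continuous_on_iff, rule_format, OF UNIV_I half_gt_zero[OF e], of s0] by auto
    show "\<exists>d>0. \<forall>p. dist p (s0, x0) < d \<longrightarrow> dist (y p) (y (s0, x0)) < e"
    proof (intro exI[of _ "min (min d1 d2) (min d3 1)"] conjI allI impI)
      fix p :: "real \<times> 'x" assume p: "dist p (s0, x0) < min (min d1 d2) (min d3 1)"
      obtain s x where sx: "p = (s, x)" by force
      have ds: "dist s s0 < min d3 1" and dx: "dist x x0 < min d1 d2"
        using p dist_fst_le[of p "(s0, x0)"] dist_snd_le[of p "(s0, x0)"] by (auto simp: sx)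
      have "\<bar>s\<bar> \<le> N" using ds by (auto simp: N_def dist_real_def)
      then have "dist (y (s, x)) (y (s, x0)) \<le> e / 2" using near[OF dx] by (simp add: dist_norm)
      moreover have "dist (y (s, x0)) (y (s0, x0)) < e / 2" using d3 ds by simp
      ultimately show "dist (y p) (y (s0, x0)) < e"
        unfolding sx using dist_triangle[of "y (s, x)" "y (s0, x0)" "y (s, x0)"] by linarith
    qed (use d1 d2 d3 in auto)
  qed
qed

lemma has_derivative_le_lipschitz:
  fixes f :: "'a::real_normed_vector \<Rightarrow> 'b::real_normed_vector"
  assumes "(f has_derivative f') (at x)"
    and "\<And>t. norm (f (x + t *\<^sub>R v) - f x) \<le> B * \<bar>t\<bar>"
  shows "norm (f' v) \<le> B"
proof (rule field_le_epsilon)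
  fix e :: real assume e: "e > 0"
  interpret f': bounded_linear f' using assms(1) by (rule has_derivative_bounded_linear)
  define m where "m = norm v + 1"
  have n1: "m > 0" "norm v \<le> m" by (simp_all add: m_def add_nonneg_pos)
  define e' where "e' = e / m"
  have e': "e' > 0" using e n1 by (simp add: e'_def)
  obtain d where d: "d > 0" "\<And>y. norm (y - x) < d \<Longrightarrow> norm (f y - f x - f' (y - x)) \<le> e' * norm (y - x)"
    using assms(1) e' unfolding has_derivative_at_alt by blast
  define t where "t = d / (2 * m)"
  have t: "t > 0" using d(1) n1 by (simp add: t_def)
  have "t * norm v \<le> t * m" using t n1 by simp
  also have "\<dots> < d" using d(1) n1 by (simp add: t_def)
  finally have "norm ((x + t *\<^sub>R v) - x) < d" using t by simp
  from d(2)[OF this] have "norm (f (x + t *\<^sub>R v) - f x - t *\<^sub>R f' v) \<le> e' * (t * norm v)"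
    using t by (simp add: f'.scaleR)
  moreover have "norm (t *\<^sub>R f' v) \<le> norm (f (x + t *\<^sub>R v) - f x) + norm (f (x + t *\<^sub>R v) - f x - t *\<^sub>R f' v)"
    using norm_triangle_ineq4[of "f (x + t *\<^sub>R v) - f x" "f (x + t *\<^sub>R v) - f x - t *\<^sub>R f' v"] by simp
  moreover have "e' * (t * norm v) \<le> t * e"
  proof -
    have "e' * norm v \<le> e' * m" using e' n1 by simp
    also have "\<dots> = e" using n1 by (simp add: e'_def)
    finally have "e' * norm v \<le> e" .
    then have "t * (e' * norm v) \<le> t * e" using t by (intro mult_left_mono) auto
    then show ?thesis by (simp add: mult_ac)
  qed
  moreover have "norm (t *\<^sub>R f' v) = t * norm (f' v)" using t by simp
  moreover have "norm (f (x + t *\<^sub>R v) - f x) \<le> B * t" using assms(2)[of t] t by simp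
  ultimately have "t * norm (f' v) \<le> B * t + t * e" by linarith
  then have "t * norm (f' v) \<le> t * (B + e)" by (simp add: algebra_simps)
  then show "norm (f' v) \<le> B + e" using t by simp
qed

lemma Ck_on_derivative_along:
  fixes v :: "'a::euclidean_space \<Rightarrow> 'b::euclidean_space"
  assumes "Ck_on (Suc k) T f" "open T" "open S" "Ck_on k S v" "Ck_on k S g" "\<And>x. x \<in> S \<Longrightarrow> g x \<in> T"
  shows "Ck_on k S (\<lambda>x. frechet_derivative f (at (g x)) (v x))"
proof (rule Ck_on_cong[OF \<open>open S\<close>])
  have "Ck_on k S (\<lambda>x. frechet_derivative f (at (g x)) b)" for b
    using Ck_on_compose[of S T g k "\<lambda>y. frechet_derivative f (at y) b"] assms Ck_on_derivative[OF assms(1)]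
    by simp
  then show "Ck_on k S (\<lambda>x. \<Sum>b\<in>Basis. (v x \<bullet> b) *\<^sub>R frechet_derivative f (at (g x)) b)"
    by (intro Ck_on_sum Ck_on_bilinear[OF bounded_bilinear_scaleR]
        Ck_on_bilinear[OF bounded_bilinear_inner] Ck_on_const assms(3,4))
  show "(\<Sum>b\<in>Basis. (v x \<bullet> b) *\<^sub>R frechet_derivative f (at (g x)) b) =
      frechet_derivative f (at (g x)) (v x)" if "x \<in> S" for x
    by (rule linear_expand[symmetric])
      (rule has_derivative_linear[OF Ck_on_has_derivative[OF assms(1) assms(6)[OF that]]])
qed

text \<open>The derivative in the state variable inherits the Lipschitz constant. Hence the
  variational equation has global solutions and satisfies the same hypotheses as the original
  equation.\<close>

lemma ode_derivative_bound:
  fixes f :: "'p::euclidean_space \<times> 'a::euclidean_space \<Rightarrow> 'a"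
  assumes lip: "\<And>p u v. norm (f (p, u) - f (p, v)) \<le> L * norm (u - v)"
    and cf: "Ck_on (Suc 0) UNIV f"
  shows "norm (frechet_derivative f (at (p, u)) (0, w)) \<le> L * norm w"
proof (rule has_derivative_le_lipschitz[OF Ck_on_has_derivative[OF cf UNIV_I]])
  fix t :: real
  show "norm (f ((p, u) + t *\<^sub>R (0, w)) - f (p, u)) \<le> L * norm w * \<bar>t\<bar>"
    using lip[of p "u + t *\<^sub>R w" u] by (simp add: mult_ac)
qed

text \<open>The candidate derivative \<open>z v\<close> solves the variational equation. The
  remainder \<open>y (s, w) - y (s, x) - z (w - x) s\<close> satisfies a Gronwall inequality whose
  source is the linearization error of \<open>f\<close> along the compact trajectory.\<close>

lemma ode_solution_has_derivative:
  fixes f :: "(real \<times> 'x::euclidean_space) \<times> 'a::euclidean_space \<Rightarrow> 'a"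
  assumes lip: "\<And>p u v. norm (f (p, u) - f (p, v)) \<le> L * norm (u - v)" and L: "L \<ge> 0"
    and cf: "Ck_on (Suc 0) UNIV f" and cy0: "Ck_on (Suc 0) UNIV y0"
    and init: "\<And>x. y (0, x) = y0 x"
    and der: "\<And>s x. ((\<lambda>s. y (s, x)) has_vector_derivative f ((s, x), y (s, x))) (at s)"
    and zinit: "\<And>v. z v 0 = frechet_derivative y0 (at x) v"
    and zder: "\<And>v s. (z v has_vector_derivative
        frechet_derivative f (at ((s, x), y (s, x))) ((0, v), z v s)) (at s)"
  shows "((\<lambda>x. y (s, x)) has_derivative (\<lambda>v. z v s)) (at x)"
proof -
  define P where "P r = ((r, x), y (r, x))" for r
  define D where "D r = frechet_derivative f (at (P r))" for r
  have linD: "linear (D r)" for r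
    unfolding D_def using Ck_on_has_derivative[OF cf UNIV_I] has_derivative_linear by blast
  have Dadd: "D r (a + b) = D r a + D r b" and Dscale: "D r (c *\<^sub>R a) = c *\<^sub>R D r a" for r a b c
    using linear_add[OF linD] linear_scale[OF linD] by auto
  have Dbound: "norm (D r (0, w)) \<le> L * norm w" for r w
    unfolding D_def P_def by (rule ode_derivative_bound[OF lip cf])
  have zder: "(z v has_vector_derivative D r ((0, v), z v r)) (at r)" for v r
    using zder by (simp add: D_def P_def)
  have lin0: "linear (frechet_derivative y0 (at x))"
    using Ck_on_has_derivative[OF cy0 UNIV_I] has_derivative_linear by blast
  \<comment> \<open>Uniqueness for the homogeneous linear equation; it will show that the solutions
    depend linearly on \<open>v\<close>.\<close>
  have zero: "d r = 0" if "d 0 = 0" "\<And>r. (d has_vector_derivative D r (0, d r)) (at r)" for d :: "real \<Rightarrow> 'a" and r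
  proof -
    have "norm (d r) \<le> exp ((2 * L + 1) * \<bar>r\<bar>) * (norm (d 0) + 0)"
      by (rule gronwall[OF L order_refl order_refl that(2)]) (simp add: Dbound)
    then show ?thesis using that(1) by simp
  qed
  have linz: "linear (\<lambda>v. z v r)" for r
  proof (rule linearI)
    fix v w
    have "z (v + w) r - z v r - z w r = 0"
    proof (rule zero[of "\<lambda>r. z (v + w) r - z v r - z w r"])
      fix r
      have "D r ((0, v + w), z (v + w) r) - D r ((0, v), z v r) - D r ((0, w), z w r) =
          D r (0, z (v + w) r - z v r - z w r)"
        using Dadd[of r "((0, v), z v r) + ((0, w), z w r)" "(0, z (v + w) r - z v r - z w r)"]
          Dadd[of r "((0, v), z v r)" "((0, w), z w r)"] by (simp add: zero_prod_def)
      then show "((\<lambda>r. z (v + w) r - z v r - z w r) has_vector_derivative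
          D r (0, z (v + w) r - z v r - z w r)) (at r)"
        using has_vector_derivative_diff[OF has_vector_derivative_diff[OF zder[of "v + w" r] zder[of v r]]
            zder[of w r]] by simp
    qed (simp add: zinit linear_add[OF lin0])
    then show "z (v + w) r = z v r + z w r" by (simp add: algebra_simps)
  next
    fix c v
    have "z (c *\<^sub>R v) r - c *\<^sub>R z v r = 0"
    proof (rule zero[of "\<lambda>r. z (c *\<^sub>R v) r - c *\<^sub>R z v r"])
      fix r
      have "D r ((0, c *\<^sub>R v), z (c *\<^sub>R v) r) - c *\<^sub>R D r ((0, v), z v r) =
          D r (0, z (c *\<^sub>R v) r - c *\<^sub>R z v r)"
        using Dadd[of r "c *\<^sub>R ((0, v), z v r)" "(0, z (c *\<^sub>R v) r - c *\<^sub>R z v r)"]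
          Dscale[of r c "((0, v), z v r)"] by (simp add: zero_prod_def)
      moreover have "((\<lambda>r. c *\<^sub>R z v r) has_vector_derivative c *\<^sub>R D r ((0, v), z v r)) (at r)"
        by (rule bounded_linear.has_vector_derivative[OF bounded_linear_scaleR_right zder])
      ultimately show "((\<lambda>r. z (c *\<^sub>R v) r - c *\<^sub>R z v r) has_vector_derivative
          D r (0, z (c *\<^sub>R v) r - c *\<^sub>R z v r)) (at r)"
        using has_vector_derivative_diff[OF zder[of "c *\<^sub>R v" r]] by fastforce
    qed (simp add: zinit linear_scale[OF lin0])
    then show "z (c *\<^sub>R v) r = c *\<^sub>R z v r" by simp
  qed
  define N where "N = \<bar>s\<bar>"
  have ivl: "r \<in> {-N..N} \<longleftrightarrow> \<bar>r\<bar> \<le> N" for r by auto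
  have cz: "continuous_on {-N..N} (z v)" for v
    by (intro continuous_at_imp_continuous_on ballI has_vector_derivative_continuous[OF zder])
  have "\<exists>B. \<forall>r\<in>{-N..N}. norm (z b r) \<le> B" for b
    using compact_imp_bounded[OF compact_continuous_image[OF cz compact_Icc]]
    unfolding bounded_iff by blast
  then obtain B where B: "\<And>b r. r \<in> {-N..N} \<Longrightarrow> norm (z b r) \<le> B b" by metis
  define C where "C = (\<Sum>b\<in>Basis. \<bar>B b\<bar>)"
  have C0: "C \<ge> 0" by (simp add: C_def sum_nonneg)
  have zb: "norm (z v r) \<le> C * norm v" if "r \<in> {-N..N}" for v r
  proof -
    have "norm (z v r) = norm (\<Sum>b\<in>Basis. (v \<bullet> b) *\<^sub>R z b r)"
      using linear_expand[OF linz, of v r] by simp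
    also have "\<dots> \<le> (\<Sum>b\<in>Basis. norm v * \<bar>B b\<bar>)"
    proof (rule sum_norm_le)
      fix b :: 'x assume b: "b \<in> Basis"
      have "norm (z b r) \<le> \<bar>B b\<bar>" using B[OF that, of b] by linarith
      then show "norm ((v \<bullet> b) *\<^sub>R z b r) \<le> norm v * \<bar>B b\<bar>"
        using Basis_le_norm[OF b, of v] by (auto intro!: mult_mono)
    qed
    also have "\<dots> = C * norm v" by (simp add: C_def sum_distrib_left mult.commute)
    finally show ?thesis .
  qed
  define E where "E = exp ((2 * L + 1) * N)"
  have E: "E > 0" by (simp add: E_def)
  have "continuous_on {-N..N} P"
    unfolding P_def
    by (intro continuous_on_Pair continuous_on_id continuous_on_const continuous_at_imp_continuous_on
        ballI has_vector_derivative_continuous[OF der])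
  then have cK: "compact (P ` {-N..N})" by (rule compact_continuous_image) simp
  show ?thesis
    unfolding has_derivative_at_alt
  proof (intro conjI allI impI)
    show "bounded_linear (\<lambda>v. z v s)" using linz linear_conv_bounded_linear by blast
    fix e :: real assume e: "e > 0"
    \<comment> \<open>In \<open>2 + C\<close> one unit pays for the error of the initial values and
      \<open>1 + C\<close> for the length of the increment \<open>q\<close>.\<close>
    define e' where "e' = e / (E * (2 + C))"
    have e': "e' > 0" using e E C0 by (simp add: e'_def)
    obtain d1 where d1: "d1 > 0" "\<And>p q. p \<in> P ` {-N..N} \<Longrightarrow> norm q \<le> d1 \<Longrightarrow> p + q \<in> UNIV \<and>
       norm (f (p + q) - f p - frechet_derivative f (at p) q) \<le> e' * norm q"
      using uniformly_differentiable_on_compact[OF open_UNIV cf cK subset_UNIV e'] by blast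
    obtain d2 where d2: "d2 > 0" "\<And>w. norm (w - x) < d2 \<Longrightarrow>
       norm (y0 w - y0 x - frechet_derivative y0 (at x) (w - x)) \<le> e' * norm (w - x)"
      using Ck_on_has_derivative[OF cy0 UNIV_I, of x] e' unfolding has_derivative_at_alt by blast
    show "\<exists>d>0. \<forall>w. norm (w - x) < d \<longrightarrow> norm (y (s, w) - y (s, x) - z (w - x) s) \<le> e * norm (w - x)"
    proof (intro exI[of _ "min (d1 / (1 + C)) d2"] conjI allI impI)
      show "min (d1 / (1 + C)) d2 > 0" using d1 d2 C0 by simp
      fix w assume w: "norm (w - x) < min (d1 / (1 + C)) d2"
      define h where "h = w - x"
      have hd: "norm h * (1 + C) \<le> d1" using w C0 by (simp add: h_def field_simps)
      have "norm (y (s, w) - y (s, x) - z h s) \<le>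
          exp ((2 * L + 1) * N) * (norm (y (0, w) - y (0, x) - z h 0) + e' * ((1 + C) * norm h))"
      proof (rule gronwall[OF L, where v = "\<lambda>r. f ((r, w), y (r, w)) - f (P r) - D r ((0, h), z h r)"])
        show "0 \<le> e' * ((1 + C) * norm h)" using e' C0 by simp
        show "\<bar>s\<bar> \<le> N" by (simp add: N_def)
        fix r assume r: "\<bar>r\<bar> \<le> N"
        show "((\<lambda>s. y (s, w) - y (s, x) - z h s) has_vector_derivative
            f ((r, w), y (r, w)) - f (P r) - D r ((0, h), z h r)) (at r)"
          unfolding P_def by (intro has_vector_derivative_diff der zder[unfolded P_def])
        define q where "q = ((0::real, h), z h r)"
        have "norm q \<le> norm h + norm (z h r)"
          unfolding q_def using norm_Pair_le[of "(0::real, h)" "z h r"] norm_Pair_le[of "0::real" h] by simp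
        also have "\<dots> \<le> (1 + C) * norm h" using zb[OF ivl[THEN iffD2, OF r], of h] by (simp add: algebra_simps)
        finally have q: "norm q \<le> (1 + C) * norm h" .
        have "norm (f (P r + q) - f (P r) - D r q) \<le> e' * norm q"
          using d1(2)[OF imageI[OF ivl[THEN iffD2, OF r]], of q] q hd by (simp add: D_def mult.commute)
        also have "\<dots> \<le> e' * ((1 + C) * norm h)" using q e' by (intro mult_left_mono) auto
        finally have 1: "norm (f (P r + q) - f (P r) - D r q) \<le> e' * ((1 + C) * norm h)" .
        have Pq: "P r + q = ((r, w), y (r, x) + z h r)" by (simp add: P_def q_def h_def)
        have 2: "norm (f ((r, w), y (r, w)) - f (P r + q)) \<le> L * norm (y (r, w) - y (r, x) - z h r)"
          using lip[of "(r, w)" "y (r, w)" "y (r, x) + z h r"] by (simp add: Pq diff_diff_eq)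
        have "f ((r, w), y (r, w)) - f (P r) - D r q =
           (f ((r, w), y (r, w)) - f (P r + q)) + (f (P r + q) - f (P r) - D r q)" by simp
        then show "norm (f ((r, w), y (r, w)) - f (P r) - D r ((0, h), z h r)) \<le>
            L * norm (y (r, w) - y (r, x) - z h r) + e' * ((1 + C) * norm h)"
          using norm_triangle_le[OF add_mono[OF 2 1]] unfolding q_def by metis
      qed
      also have "\<dots> \<le> E * (e' * norm h + e' * ((1 + C) * norm h))"
        unfolding E_def using d2(2)[of w] w
        by (intro mult_left_mono add_right_mono) (auto simp: init zinit h_def)
      also have "\<dots> = (E * (2 + C)) * e' * norm h" by (simp add: algebra_simps)
      also have "\<dots> = e * norm h" using E C0 by (simp add: e'_def)
      finally show "norm (y (s, w) - y (s, x) - z (w - x) s) \<le> e * norm (w - x)"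
        by (simp add: h_def)
    qed
  qed
qed

text \<open>The derivative of a solution with respect to the parameter solves an equation of the same
  form, with the same Lipschitz constant. Hence smoothness follows by induction on \<open>k\<close> for all such
  equations simultaneously.\<close>

lemma Ck_on_ode_solution:
  fixes f :: "(real \<times> 'x::euclidean_space) \<times> 'a::euclidean_space \<Rightarrow> 'a"
  assumes L: "L \<ge> 0"
    and "\<And>p u v. norm (f (p, u) - f (p, v)) \<le> L * norm (u - v)"
    and "Ck_on k UNIV f" "Ck_on k UNIV y0" "\<And>x. y (0, x) = y0 x"
    and "\<And>s x. ((\<lambda>s. y (s, x)) has_vector_derivative f ((s, x), y (s, x))) (at s)"
  shows "Ck_on k UNIV y"
  using assms(2-)
proof (induction k arbitrary: f y0 y)
  case 0
  show ?case unfolding Ck_on.simps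
    by (rule ode_solution_continuous[OF 0(1) L _ _ 0(4,5)]) (use 0 in auto)
next
  case (Suc k)
  note lip = Suc.prems(1) and cf = Suc.prems(2) and cy0 = Suc.prems(3) and init = Suc.prems(4)
    and der = Suc.prems(5)
  have cf1: "Ck_on (Suc 0) UNIV f" and cy01: "Ck_on (Suc 0) UNIV y0"
    using Ck_on_le[OF cf, of "Suc 0"] Ck_on_le[OF cy0, of "Suc 0"] by auto
  have y: "Ck_on k UNIV y"
    by (rule Suc.IH[OF lip Ck_on_SucD[OF cf] Ck_on_SucD[OF cy0] init der])
  \<comment> \<open>The right-hand side of the variational equation. The solution \<open>y\<close>
    enters as a coefficient, of class \<open>k\<close> by the induction hypothesis for the original
    equation.\<close>
  define F where "F v = (\<lambda>(p, u). frechet_derivative f (at (p, y p)) ((0, v), u))" for v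
  have linf: "linear (frechet_derivative f (at p))" for p
    using Ck_on_has_derivative[OF cf UNIV_I] has_derivative_linear by blast
  have fst: "Ck_on k UNIV fst" and snd: "Ck_on k UNIV snd"
    for k by (simp_all add: Ck_on_linear bounded_linear_fst bounded_linear_snd)
  have Fc: "Ck_on k UNIV (F v)" for v
  proof -
    have "Ck_on k UNIV (\<lambda>q. y (fst q))"
      by (rule Ck_on_compose[OF open_UNIV open_UNIV _ y fst]) simp
    then have "Ck_on k UNIV (\<lambda>q. frechet_derivative f (at (fst q, y (fst q))) ((0, v), snd q))"
      by (intro Ck_on_derivative_along[OF cf] Ck_on_Pair Ck_on_const fst snd) auto
    then show ?thesis by (simp add: F_def case_prod_unfold)
  qed
  have Flip: "norm (F v (p, u) - F v (p, w)) \<le> L * norm (u - w)" for v p u w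
  proof -
    have "F v (p, u) - F v (p, w) = frechet_derivative f (at (p, y p)) (0, u - w)"
      using linear_diff[OF linf, of "(p, y p)" "((0, v), u)" "((0, v), w)"] by (simp add: F_def zero_prod_def)
    then show ?thesis using ode_derivative_bound[OF lip cf1] by simp
  qed
  have "\<exists>\<zeta>. \<zeta> 0 = frechet_derivative y0 (at x) v \<and>
      (\<forall>s. (\<zeta> has_vector_derivative F v ((s, x), \<zeta> s)) (at s))" for v x
  proof -
    have "continuous_on UNIV (\<lambda>p. F v ((fst p, x), snd p))"
      by (rule continuous_on_compose2[OF Ck_on_continuous[OF Fc[of v]]])
        (auto intro!: continuous_on_Pair continuous_on_fst continuous_on_snd continuous_on_id continuous_on_const)
    then have "continuous_on UNIV (\<lambda>(s, u). F v ((s, x), u))" by (simp add: split_beta)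
    from this Flip L obtain \<zeta> where "\<zeta> 0 = frechet_derivative y0 (at x) v"
      "\<And>s. (\<zeta> has_vector_derivative F v ((s, x), \<zeta> s)) (at s)"
      by (rule ode_solution_exists[where f = "\<lambda>s u. F v ((s, x), u)"]) blast
    then show ?thesis by blast
  qed
  then have "\<exists>z. \<forall>v x. z v x 0 = frechet_derivative y0 (at x) v \<and>
      (\<forall>s. (z v x has_vector_derivative F v ((s, x), z v x s)) (at s))"
    by (intro choice allI)
  then obtain z where z: "\<And>v x. z v x 0 = frechet_derivative y0 (at x) v"
    "\<And>v x s. (z v x has_vector_derivative F v ((s, x), z v x s)) (at s)" by blast
  have zc: "Ck_on k UNIV (\<lambda>p. z v (snd p) (fst p))" for v
    by (rule Suc.IH[OF Flip Fc, where ?y0.0 = "\<lambda>x. frechet_derivative y0 (at x) v"])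
      (use z Ck_on_derivative[OF cy0] in auto)
  have dx: "((\<lambda>x. y (s, x)) has_derivative (\<lambda>v. z v x s)) (at x)" for s x
    by (rule ode_solution_has_derivative[OF lip L cf1 cy01 init der, where z = "\<lambda>v. z v x"])
      (use z in \<open>auto simp: F_def\<close>)
  have cfy: "Ck_on k UNIV (\<lambda>p. f (p, y p))"
    by (rule Ck_on_compose[OF open_UNIV open_UNIV _ Ck_on_SucD[OF cf]])
      (intro UNIV_I Ck_on_Pair y open_UNIV Ck_on_linear[OF bounded_linear_ident])+
  show ?case
  proof (rule Ck_on_SucI[OF open_UNIV])
    fix p :: "real \<times> 'x"
    obtain s x where p: "p = (s, x)" by force
    \<comment> \<open>Existence of one partial derivative and continuity of the other give the total
      derivative. The time derivative is the continuous one, being \<open>f\<close> along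
      \<open>y\<close>; the criterion wants it second, hence the exchanged variables.\<close>
    have "((\<lambda>(x, s). y (s, x)) has_derivative
        (\<lambda>(v, t). z v x s + blinfun_scaleR_left (f ((s, x), y (s, x))) t)) (at (x, s) within UNIV \<times> UNIV)"
    proof (rule has_derivative_partialsI)
      show "((\<lambda>x. y (s, x)) has_derivative (\<lambda>v. z v x s)) (at x within UNIV)" using dx by simp
      show "((\<lambda>s. y (s, x')) has_derivative blinfun_apply (blinfun_scaleR_left (f ((s', x'), y (s', x')))))
          (at s' within UNIV)" for x' s'
        using der[of x' s'] by (simp add: has_vector_derivative_def blinfun_scaleR_left.rep_eq)
      have "continuous_on UNIV (\<lambda>q::'x \<times> real. f ((snd q, fst q), y (snd q, fst q)))"
        by (rule continuous_on_compose2[OF Ck_on_continuous[OF cfy], of _ "\<lambda>q. (snd q, fst q)"])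
          (auto intro!: continuous_on_Pair continuous_on_fst continuous_on_snd continuous_on_id)
      then have "isCont (\<lambda>q::'x \<times> real. blinfun_scaleR_left (f ((snd q, fst q), y (snd q, fst q)))) (x, s)"
        by (intro bounded_linear.isCont[OF bounded_linear_blinfun_scaleR_left])
          (simp add: continuous_on_eq_continuous_at)
      then show "continuous (at (x, s) within UNIV \<times> UNIV)
          (\<lambda>(x, s). blinfun_scaleR_left (f ((s, x), y (s, x))))"
        by (simp add: case_prod_unfold)
    qed auto
    then have 1: "((\<lambda>q. y (snd q, fst q)) has_derivative
        (\<lambda>q. z (fst q) x s + snd q *\<^sub>R f ((s, x), y (s, x)))) (at (x, s))"
      by (simp add: case_prod_unfold)
    have 2: "((\<lambda>p. (snd p, fst p)) has_derivative (\<lambda>p. (snd p, fst p))) (at (s, x))"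
      by (intro bounded_linear_imp_has_derivative bounded_linear_Pair bounded_linear_fst bounded_linear_snd)
    have "((\<lambda>p. y (snd (snd p, fst p), fst (snd p, fst p))) has_derivative
        (\<lambda>q. z (fst (snd q, fst q)) x s + snd (snd q, fst q) *\<^sub>R f ((s, x), y (s, x)))) (at (s, x))"
      by (rule has_derivative_compose[OF 2, of "\<lambda>q. y (snd q, fst q)"]) (use 1 in simp)
    then show "(y has_derivative (\<lambda>q. z (snd q) (snd p) (fst p) + fst q *\<^sub>R f (p, y p))) (at p)"
      by (simp add: p)
  next
    fix v :: "real \<times> 'x"
    show "Ck_on k UNIV (\<lambda>p. z (snd v) (snd p) (fst p) + fst v *\<^sub>R f (p, y p))"
      by (intro Ck_on_add zc Ck_on_compose_linear[OF bounded_linear_scaleR_right] cfy open_UNIV)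
  qed
qed

section \<open>Complete flows of vector fields\<close>

lemma compact_support_lipschitz:
  fixes w :: "'a::euclidean_space \<Rightarrow> 'b::euclidean_space"
  assumes "Cinf_on UNIV w" "compact S" "\<And>x. x \<notin> S \<Longrightarrow> w x = 0"
  obtains L where "L \<ge> 0" "\<And>x y. norm (w x - w y) \<le> L * norm (x - y)"
proof -
  define D where "D x = frechet_derivative w (at x)" for x
  have der: "(w has_derivative D x) (at x)" for x
    using Cinf_on_has_derivative[OF assms(1) UNIV_I] by (simp add: D_def)
  have zero: "D x = (\<lambda>v. 0)" if "x \<notin> S" for x
  proof -
    have "((\<lambda>x. 0) has_derivative (\<lambda>v. 0)) (at x)" by simp
    then have "(w has_derivative (\<lambda>v. 0)) (at x)"
      by (rule has_derivative_transform_within_open[of _ _ _ _ "- S"])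
        (use assms that in \<open>auto intro: compact_imp_closed\<close>)
    then show ?thesis using der has_derivative_unique by blast
  qed
  have "\<exists>B. \<forall>x. norm (D x b) \<le> B" for b
  proof -
    have "bounded ((\<lambda>x. D x b) ` S)"
      unfolding D_def
      by (intro compact_imp_bounded compact_continuous_image assms(2)
          continuous_on_subset[OF Cinf_on_continuous[OF Cinf_on_derivative[OF assms(1)]]]) simp
    then obtain B where "B > 0" "\<And>x. x \<in> S \<Longrightarrow> norm (D x b) \<le> B" unfolding bounded_pos by auto
    then show ?thesis using zero by (intro exI[of _ B] allI) (case_tac "x \<in> S"; simp add: less_imp_le)
  qed
  then have "\<exists>B. \<forall>b x. norm (D x b) \<le> B b" by (intro choice allI)
  then obtain B where B: "\<And>b x. norm (D x b) \<le> B b" by blast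
  define L where "L = (\<Sum>b\<in>Basis. B b)"
  have "onorm (D x) \<le> L" for x
  proof (rule onorm_le)
    fix v :: 'a
    have "norm (D x v) = norm (\<Sum>b\<in>Basis. (v \<bullet> b) *\<^sub>R D x b)"
      using linear_expand[OF has_derivative_linear[OF der[of x]], of v] by simp
    also have "\<dots> \<le> (\<Sum>b\<in>Basis. norm v * B b)"
    proof (rule sum_norm_le)
      fix b :: 'a assume b: "b \<in> Basis"
      show "norm ((v \<bullet> b) *\<^sub>R D x b) \<le> norm v * B b"
        using Basis_le_norm[OF b, of v] B[of x b] by (auto intro!: mult_mono)
    qed
    also have "\<dots> = L * norm v" by (simp add: L_def sum_distrib_left mult.commute)
    finally show "norm (D x v) \<le> L * norm v" .
  qed
  then have "norm (w x - w y) \<le> L * norm (x - y)" for x y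
    using differentiable_bound[of UNIV w D L x y] der by auto
  moreover have "L \<ge> 0" unfolding L_def by (intro sum_nonneg order_trans[OF norm_ge_zero B])
  ultimately show ?thesis using that by blast
qed

text \<open>The global Lipschitz bound is kept as an axiom because uniqueness, and with it the group
  law, rests on it. In this form the reversed field is again an instance.\<close>

locale flow =
  fixes w :: "'a::euclidean_space \<Rightarrow> 'a" and \<phi> :: "real \<Rightarrow> 'a \<Rightarrow> 'a"
  assumes w_lipschitz: "\<exists>L\<ge>0. \<forall>x y. norm (w x - w y) \<le> L * norm (x - y)"
    and flow_0 [simp]: "\<phi> 0 x = x"
    and flow_derivative: "((\<lambda>s. \<phi> s x) has_vector_derivative w (\<phi> s x)) (at s)"
    and flow_smooth: "Cinf_on UNIV (\<lambda>p. \<phi> (fst p) (snd p))"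

lemma flow_exists:
  fixes w :: "'a::euclidean_space \<Rightarrow> 'a"
  assumes "Cinf_on UNIV w" "compact S" "\<And>x. x \<notin> S \<Longrightarrow> w x = 0"
  obtains \<phi> where "flow w \<phi>"
proof -
  obtain L where L: "L \<ge> 0" "\<And>x y. norm (w x - w y) \<le> L * norm (x - y)"
    using compact_support_lipschitz[OF assms] by blast
  have "\<exists>y. y 0 = x \<and> (\<forall>s. (y has_vector_derivative w (y s)) (at s))" for x
  proof -
    have c: "continuous_on UNIV (\<lambda>(s::real, x). w x)"
      unfolding case_prod_unfold
      by (rule continuous_on_compose2[OF Cinf_on_continuous[OF assms(1)] continuous_on_snd[OF continuous_on_id]]) simp
    show ?thesis
      using ode_solution_exists[where f = "\<lambda>s x. w x" and L = L, OF c L(2) L(1), of x] by blast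
  qed
  then have "\<exists>\<phi>. \<forall>x. \<phi> x 0 = x \<and> (\<forall>s. (\<phi> x has_vector_derivative w (\<phi> x s)) (at s))"
    by (intro choice allI)
  then obtain \<phi> where \<phi>: "\<And>x. \<phi> x 0 = x" "\<And>x s. (\<phi> x has_vector_derivative w (\<phi> x s)) (at s)"
    by blast
  have "Ck_on k UNIV (\<lambda>p. \<phi> (snd p) (fst p))" for k
  proof (rule Ck_on_ode_solution[OF L(1), where f = "\<lambda>q. w (snd q)" and ?y0.0 = "\<lambda>x. x"])
    show "Ck_on k UNIV (\<lambda>q::(real \<times> 'a) \<times> 'a. w (snd q))"
      by (rule Ck_on_compose[OF open_UNIV open_UNIV UNIV_I])
        (use assms(1) in \<open>simp_all add: Cinf_on_def Ck_on_linear bounded_linear_snd\<close>)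
  qed (use L \<phi> in \<open>simp_all add: Ck_on_linear\<close>)
  then have "flow w (\<lambda>s x. \<phi> x s)"
    using L \<phi> by unfold_locales (auto simp: Cinf_on_def)
  then show ?thesis by (rule that)
qed

context flow
begin

lemma flow_unique:
  assumes "\<And>s. (y has_vector_derivative w (y s)) (at s)" "y 0 = x"
  shows "y s = \<phi> s x"
proof -
  obtain L where L: "L \<ge> 0" "\<And>x y. norm (w x - w y) \<le> L * norm (x - y)"
    using w_lipschitz by blast
  show ?thesis
    by (rule ode_solution_unique[where f = "\<lambda>s. w" and L = L])
      (use L assms flow_derivative in auto)
qed

lemma flow_add: "\<phi> (s + t) x = \<phi> s (\<phi> t x)"
proof -
  have "((\<lambda>s. \<phi> (s + t) x) has_vector_derivative w (\<phi> (s + t) x)) (at s)" for s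
  proof -
    have "((\<lambda>s. s + t) has_vector_derivative 1) (at s)" by (auto intro!: derivative_eq_intros)
    from vector_diff_chain_at[OF this flow_derivative] show ?thesis by (simp add: o_def)
  qed
  from flow_unique[OF this] show ?thesis by simp
qed

lemma flow_inverse [simp]: "\<phi> (- s) (\<phi> s x) = x" "\<phi> s (\<phi> (- s) x) = x"
  using flow_add[of "- s" s x] flow_add[of s "- s" x] by simp_all

lemma flow_smooth_time: "Cinf_on UNIV (\<phi> s)"
  using Cinf_on_compose[OF flow_smooth open_UNIV open_UNIV UNIV_I, of "\<lambda>x. (s, x)"]
  by (simp add: Cinf_on_Pair Cinf_on_const Cinf_on_ident)

lemma flow_continuous_path: "continuous_on S (\<lambda>s. \<phi> s x)"
  by (intro continuous_at_imp_continuous_on ballI has_vector_derivative_continuous[OF flow_derivative])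

lemma flow_reverse: "flow (\<lambda>x. - w x) (\<lambda>s. \<phi> (- s))"
proof
  show "\<exists>L\<ge>0. \<forall>x y. norm (- w x - - w y) \<le> L * norm (x - y)"
    using w_lipschitz by (simp add: norm_minus_commute)
  show "((\<lambda>s. \<phi> (- s) x) has_vector_derivative - w (\<phi> (- s) x)) (at s)" for s x
    by (rule has_vector_derivative_reflect) (rule flow_derivative)
  show "Cinf_on UNIV (\<lambda>p. \<phi> (- fst p) (snd p))"
    using Cinf_on_compose[OF flow_smooth open_UNIV open_UNIV UNIV_I, of "\<lambda>p. (- fst p, snd p)"]
    by (simp add: Cinf_on_Pair Cinf_on_uminus Cinf_on_fst Cinf_on_snd Cinf_on_ident)
qed simp

end

section \<open>Diffeomorphisms of the domain\<close>

text \<open>An invariance principle of Nagumo type. At a point of \<open>F\<close> nearest to the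
  orbit the field is the velocity of a curve inside \<open>F\<close>; moving along both for a short
  time, the distance \<open>d\<close> grows at rate at most \<open>L * d\<close>. Starting from 0 it
  must stay 0. The comparison uses the rate L + 1, which leaves room for the first-order errors of
  the two motions.\<close>

lemma (in flow) flow_invariant_closed:
  assumes F: "closed F"
    and tan: "\<And>x. x \<in> F \<Longrightarrow> \<exists>\<gamma> \<delta>. \<delta> > 0 \<and> \<gamma> 0 = x \<and> \<gamma> ` {-\<delta><..<\<delta>} \<subseteq> F \<and>
       (\<gamma> has_vector_derivative w x) (at (0::real))"
    and x: "x \<in> F" and s: "0 \<le> s"
  shows "\<phi> s x \<in> F"
proof (rule ccontr)
  assume nF: "\<phi> s x \<notin> F"
  obtain L where L: "L \<ge> 0" "\<And>x y. norm (w x - w y) \<le> L * norm (x - y)"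
    using w_lipschitz by blast
  define d where "d r = infdist (\<phi> r x) F" for r
  have ne: "F \<noteq> {}" using x by auto
  have ds: "d s > 0"
    using infdist_pos_not_in_closed[OF F ne nF] by (simp add: d_def)
  \<comment> \<open>The comparison function reaches only half of \<open>d s\<close> at time
    \<open>s\<close>, so \<open>g\<close> is negative at 0 and positive at \<open>s\<close>.\<close>
  define \<epsilon> where "\<epsilon> = d s * exp (- (L + 1) * s) / 2"
  have \<epsilon>: "\<epsilon> > 0" using ds by (simp add: \<epsilon>_def)
  define g where "g r = d r - \<epsilon> * exp ((L + 1) * r)" for r
  have cg: "continuous_on A g" for A
    unfolding g_def d_def by (intro continuous_intros continuous_on_infdist flow_continuous_path)
  have g0: "g 0 < 0" using \<epsilon> x by (simp add: g_def d_def)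
  have "\<epsilon> * exp ((L + 1) * s) = d s / 2"
    by (simp add: \<epsilon>_def mult.assoc exp_add[symmetric] algebra_simps)
  then have gs: "g s > 0" using ds by (simp add: g_def)
  define Z where "Z = {r \<in> {0..s}. g r \<le> 0}"
  have Zne: "Z \<noteq> {}" using g0 s by (auto simp: Z_def intro!: exI[of _ 0])
  have "compact Z"
  proof -
    have "closed Z" unfolding Z_def
      using continuous_closed_preimage[OF cg[of "{0..s}"] closed_atLeastAtMost closed_atMost, of 0]
      by (simp add: vimage_def Int_def)
    moreover have "bounded Z" by (rule bounded_subset[of "{0..s}"]) (auto simp: Z_def)
    ultimately show ?thesis by (simp add: compact_eq_bounded_closed)
  qed
  \<comment> \<open>The last time at which the distance is below the comparison function; there the
    two agree, and a further short step contradicts maximality.\<close>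
  then obtain r where r: "r \<in> Z" "\<And>t. t \<in> Z \<Longrightarrow> t \<le> r"
    using compact_attains_sup[OF _ Zne] by blast
  have rs: "0 \<le> r" "r < s" "g r \<le> 0"
    using r(1) gs by (auto simp: Z_def order.strict_iff_order)
  have after: "g t > 0" if "r < t" "t \<le> s" for t
    using r(2)[of t] that rs by (auto simp: Z_def not_le[symmetric])
  have "g r = 0"
  proof (rule ccontr)
    assume "g r \<noteq> 0"
    then have "g r < 0" using rs by simp
    then obtain t where t: "r \<le> t" "t \<le> s" "g t = 0"
      using IVT'[of g r 0 s, OF _ _ _ cg] gs rs by auto
    then have "t \<in> Z" using rs by (auto simp: Z_def)
    then show False using r(2)[of t] t \<open>g r < 0\<close> by auto
  qed
  then have dr: "d r = \<epsilon> * exp ((L + 1) * r)" by (simp add: g_def)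
  then have drpos: "d r > 0" using \<epsilon> by simp
  obtain y where y: "y \<in> F" "d r = dist (\<phi> r x) y"
    using infdist_attains_inf[OF F ne] d_def by metis
  obtain \<gamma> \<delta> where \<gamma>: "\<delta> > 0" "\<gamma> 0 = y" "\<gamma> ` {-\<delta><..<\<delta>} \<subseteq> F"
     "(\<gamma> has_vector_derivative w y) (at (0::real))"
    using tan[OF y(1)] by blast
  define e where "e h = \<phi> h (\<phi> r x) - \<gamma> h" for h
  have e0: "norm (e 0) = d r" using y by (simp add: e_def \<gamma> dist_norm)
  have "(e has_vector_derivative w (\<phi> r x) - w y) (at 0)"
    unfolding e_def using has_vector_derivative_diff[OF flow_derivative[of "\<phi> r x" 0] \<gamma>(4)] by simp
  then obtain d1 where d1: "d1 > 0"
    "\<And>h. norm (h - 0) < d1 \<Longrightarrow> norm (e h - e 0 - (h - 0) *\<^sub>R (w (\<phi> r x) - w y)) \<le> (d r / 2) * norm (h - 0)"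
    unfolding has_vector_derivative_def has_derivative_at_alt using drpos
    by (meson half_gt_zero)
  define h where "h = min (min \<delta> d1) (s - r) / 2"
  have h: "0 < h" "h < \<delta>" "h < d1" "r + h \<le> s" "r < r + h"
  proof -
    have "h > 0" "h \<le> \<delta> / 2" "h \<le> d1 / 2" "h \<le> (s - r) / 2"
      using \<gamma>(1) d1(1) rs unfolding h_def by simp_all
    moreover have "(s - r) / 2 \<le> s - r" "\<delta> / 2 < \<delta>" "d1 / 2 < d1" using \<gamma>(1) d1(1) rs by simp_all
    ultimately show "0 < h" "h < \<delta>" "h < d1" "r + h \<le> s" "r < r + h" by simp_all
  qed
  have "d (r + h) \<le> dist (\<phi> (r + h) x) (\<gamma> h)"
    unfolding d_def using h \<gamma>(3) by (intro infdist_le) auto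
  also have "\<dots> = norm (e h)"
    using flow_add[of h r x] by (simp add: e_def dist_norm add.commute)
  also have "\<dots> \<le> norm (e h - e 0 - h *\<^sub>R (w (\<phi> r x) - w y)) + norm (e 0) + norm (h *\<^sub>R (w (\<phi> r x) - w y))"
    using norm_triangle_ineq[of "e h - e 0 - h *\<^sub>R (w (\<phi> r x) - w y)" "e 0 + h *\<^sub>R (w (\<phi> r x) - w y)"]
      norm_triangle_ineq[of "e 0" "h *\<^sub>R (w (\<phi> r x) - w y)"] by simp
  also have "\<dots> \<le> d r / 2 * h + d r + h * (L * d r)"
    using d1(2)[of h] h L(2)[of "\<phi> r x" y] y(2) e0 by (intro add_mono) (auto simp: dist_norm)
  also have "\<dots> < d r * (1 + (L + 1) * h)"
    using drpos h by (simp add: algebra_simps)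
  also have "\<dots> \<le> d r * exp ((L + 1) * h)"
    using drpos by (intro mult_left_mono exp_ge_add_one_self) auto
  also have "\<dots> = \<epsilon> * exp ((L + 1) * (r + h))"
    by (simp add: dr mult.assoc exp_add[symmetric] algebra_simps)
  finally have "g (r + h) < 0" by (simp add: g_def)
  then show False using after[OF h(5,4)] by simp
qed

section \<open>Maps that are smooth up to the boundary\<close>

lemma smooth_on_cong: "smooth_on S f \<Longrightarrow> (\<And>x. x \<in> S \<Longrightarrow> f x = g x) \<Longrightarrow> smooth_on S g"
  unfolding smooth_on_def by metis

lemma smooth_on_subset: "smooth_on S f \<Longrightarrow> T \<subseteq> S \<Longrightarrow> smooth_on T f"
  unfolding smooth_on_def by (metis subset_eq)

lemma smooth_on_open: "open S \<Longrightarrow> smooth_on S f \<longleftrightarrow> Cinf_on S f"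
proof
  assume "open S" "smooth_on S f"
  then obtain T g where "open T" "S \<subseteq> T" "Cinf_on T g" "\<And>x. x \<in> S \<Longrightarrow> f x = g x"
    unfolding smooth_on_Cinf_on by blast
  then show "Cinf_on S f"
    using Cinf_on_cong[OF \<open>open S\<close>, of g f] Cinf_on_subset by metis
qed (auto simp: smooth_on_Cinf_on)

lemma smooth_onI: "open T \<Longrightarrow> S \<subseteq> T \<Longrightarrow> Cinf_on T g \<Longrightarrow> (\<And>x. x \<in> S \<Longrightarrow> f x = g x) \<Longrightarrow> smooth_on S f"
  unfolding smooth_on_Cinf_on by blast

lemma smooth_on_compose:
  fixes f :: "'b::euclidean_space \<Rightarrow> 'c::real_normed_vector" and g :: "'a::euclidean_space \<Rightarrow> 'b"
  assumes "smooth_on S f" "smooth_on R g" "g ` R \<subseteq> S"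
  shows "smooth_on R (\<lambda>x. f (g x))"
proof -
  obtain T f' where f: "open T" "S \<subseteq> T" "Cinf_on T f'" "\<And>x. x \<in> S \<Longrightarrow> f x = f' x"
    using assms(1) unfolding smooth_on_Cinf_on by blast
  obtain U g' where g: "open U" "R \<subseteq> U" "Cinf_on U g'" "\<And>x. x \<in> R \<Longrightarrow> g x = g' x"
    using assms(2) unfolding smooth_on_Cinf_on by blast
  define W where "W = U \<inter> g' -` T"
  have W: "open W"
    unfolding W_def by (rule continuous_open_preimage[OF Cinf_on_continuous[OF g(3)] g(1) f(1)])
  show ?thesis
  proof (rule smooth_onI[OF W])
    show "R \<subseteq> W" using assms(3) f(2) g(2,4) by (force simp: W_def)
    show "Cinf_on W (\<lambda>x. f' (g' x))"
      by (rule Cinf_on_compose[OF f(3,1) W])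
        (use Cinf_on_subset[OF g(3), of W] in \<open>auto simp: W_def\<close>)
    show "f (g x) = f' (g' x)" if "x \<in> R" for x
      using that assms(3) f(4) g(4) by force
  qed
qed

lemma smooth_on_continuous: "smooth_on S f \<Longrightarrow> continuous_on S f"
  unfolding smooth_on_Cinf_on
  by (metis Cinf_on_continuous continuous_on_cong continuous_on_subset)

lemma DiffI:
  assumes "smooth_on (closure \<Omega>) X" "smooth_on (closure \<Omega>) Z"
    "\<And>a. a \<in> closure \<Omega> \<Longrightarrow> X a \<in> closure \<Omega> \<and> Z (X a) = a"
    "\<And>a. a \<in> closure \<Omega> \<Longrightarrow> Z a \<in> closure \<Omega> \<and> X (Z a) = a"
    "X ` frontier \<Omega> = frontier \<Omega>"
  shows "X \<in> Diff \<Omega>" "\<And>a. a \<in> closure \<Omega> \<Longrightarrow> inv_into (closure \<Omega>) X a = Z a"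
proof -
  have bij: "bij_betw X (closure \<Omega>) (closure \<Omega>)"
    by (rule bij_betw_byWitness[where f' = Z]) (use assms in auto)
  show inv: "inv_into (closure \<Omega>) X a = Z a" if "a \<in> closure \<Omega>" for a
    using assms(4)[OF that] bij by (metis bij_betw_imp_inj_on inv_into_f_f)
  show "X \<in> Diff \<Omega>"
    unfolding Diff_def using assms bij smooth_on_cong[OF assms(2)] inv by simp
qed

lemma DiffD:
  assumes "X \<in> Diff \<Omega>"
  shows "smooth_on (closure \<Omega>) X" "smooth_on (closure \<Omega>) (inv_into (closure \<Omega>) X)"
    "X ` frontier \<Omega> = frontier \<Omega>" "bij_betw X (closure \<Omega>) (closure \<Omega>)"
    "\<And>a. a \<in> closure \<Omega> \<Longrightarrow> X a \<in> closure \<Omega>"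
    "\<And>a. a \<in> closure \<Omega> \<Longrightarrow> inv_into (closure \<Omega>) X (X a) = a"
    "\<And>a. a \<in> closure \<Omega> \<Longrightarrow> inv_into (closure \<Omega>) X a \<in> closure \<Omega>"
    "\<And>a. a \<in> closure \<Omega> \<Longrightarrow> X (inv_into (closure \<Omega>) X a) = a"
  using assms unfolding Diff_def
  by (auto simp: bij_betw_def inv_into_into f_inv_into_f)

lemma Diff_cong:
  assumes "X \<in> Diff \<Omega>" "\<And>a. a \<in> closure \<Omega> \<Longrightarrow> Y a = X a"
  shows "Y \<in> Diff \<Omega>"
proof (rule DiffI(1)[where Z = "inv_into (closure \<Omega>) X"])
  show "smooth_on (closure \<Omega>) Y" by (rule smooth_on_cong[OF DiffD(1)[OF assms(1)]]) (simp add: assms(2))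
  have "Y ` frontier \<Omega> = X ` frontier \<Omega>"
    by (intro image_cong refl assms(2)) (simp add: frontier_def)
  then show "Y ` frontier \<Omega> = frontier \<Omega>" using DiffD(3)[OF assms(1)] by simp
qed (use DiffD[OF assms(1)] assms(2) in auto)

lemma Diff_compose:
  assumes "X \<in> Diff \<Omega>" "Y \<in> Diff \<Omega>"
  shows "(\<lambda>a. X (Y a)) \<in> Diff \<Omega>"
proof (rule DiffI(1)[where Z = "\<lambda>a. inv_into (closure \<Omega>) Y (inv_into (closure \<Omega>) X a)"])
  note X = DiffD[OF assms(1)] and Y = DiffD[OF assms(2)]
  show "smooth_on (closure \<Omega>) (\<lambda>a. X (Y a))"
    by (rule smooth_on_compose[OF X(1) Y(1)]) (use Y(5) in auto)
  show "smooth_on (closure \<Omega>) (\<lambda>a. inv_into (closure \<Omega>) Y (inv_into (closure \<Omega>) X a))"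
    by (rule smooth_on_compose[OF Y(2) X(2)]) (use X(7) in auto)
  show "(\<lambda>a. X (Y a)) ` frontier \<Omega> = frontier \<Omega>"
    using X(3) Y(3) by (metis image_image)
qed (use DiffD[OF assms(1)] DiffD[OF assms(2)] in auto)

lemma Diff_inverse:
  assumes "X \<in> Diff \<Omega>"
  shows "inv_into (closure \<Omega>) X \<in> Diff \<Omega>"
    "\<And>a. a \<in> closure \<Omega> \<Longrightarrow> inv_into (closure \<Omega>) (inv_into (closure \<Omega>) X) a = X a"
proof -
  note X = DiffD[OF assms]
  have "inv_into (closure \<Omega>) X ` frontier \<Omega> = frontier \<Omega>"
  proof -
    have "inv_into (closure \<Omega>) X ` (X ` frontier \<Omega>) = frontier \<Omega>"
      unfolding image_image using X(6) by (auto simp: frontier_def image_iff)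
    then show ?thesis using X(3) by simp
  qed
  note D = DiffI[OF X(2) X(1) _ _ this]
  show "inv_into (closure \<Omega>) X \<in> Diff \<Omega>" by (rule D(1)) (use X in auto)
  show "inv_into (closure \<Omega>) (inv_into (closure \<Omega>) X) a = X a" if "a \<in> closure \<Omega>" for a
    by (rule D(2)) (use X that in auto)
qed

lemma closure_open_frontier: "open \<Omega> \<Longrightarrow> closure \<Omega> = \<Omega> \<union> frontier \<Omega>" "open \<Omega> \<Longrightarrow> \<Omega> \<inter> frontier \<Omega> = {}"
  using closure_subset by (auto simp: frontier_def interior_open)

text \<open>An interior point sent to the boundary would share its image with a boundary point,
  because the boundary is mapped onto itself; injectivity forbids this.\<close>

lemma Diff_interior:
  assumes "X \<in> Diff \<Omega>" "open \<Omega>"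
  shows "X ` \<Omega> = \<Omega>" "\<And>a. a \<in> \<Omega> \<Longrightarrow> X a \<in> \<Omega>" "\<And>a. a \<in> \<Omega> \<Longrightarrow> inv_into (closure \<Omega>) X a \<in> \<Omega>"
    "\<And>a. a \<in> \<Omega> \<Longrightarrow> inv_into (closure \<Omega>) X (X a) = a" "\<And>a. a \<in> \<Omega> \<Longrightarrow> X (inv_into (closure \<Omega>) X a) = a"
    "inj_on X \<Omega>" "Cinf_on \<Omega> X" "Cinf_on \<Omega> (inv_into (closure \<Omega>) X)"
proof -
  have *: "Z a \<in> \<Omega>" if Z: "Z \<in> Diff \<Omega>" and a: "a \<in> \<Omega>" for Z a
  proof (rule ccontr)
    note Z = DiffD[OF Z]
    have ac: "a \<in> closure \<Omega>" using a closure_subset by blast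
    assume "Z a \<notin> \<Omega>"
    then have "Z a \<in> frontier \<Omega>" using Z(5)[OF ac] closure_open_frontier(1)[OF assms(2)] by blast
    then obtain c where c: "c \<in> frontier \<Omega>" "Z c = Z a" using Z(3) by (metis imageE)
    then have "c = a" using Z(6)[OF ac] Z(6)[of c] by (auto simp: frontier_def)
    then show False using c(1) a closure_open_frontier(2)[OF assms(2)] by blast
  qed
  have sub: "a \<in> closure \<Omega>" if "a \<in> \<Omega>" for a using that closure_subset by blast
  note X = DiffD[OF assms(1)]
  show i: "X a \<in> \<Omega>" "inv_into (closure \<Omega>) X a \<in> \<Omega>" "inv_into (closure \<Omega>) X (X a) = a"
    "X (inv_into (closure \<Omega>) X a) = a" if "a \<in> \<Omega>" for a
    using *[OF assms(1) that] *[OF Diff_inverse(1)[OF assms(1)] that] X sub[OF that] by auto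
  show "X ` \<Omega> = \<Omega>" using i by (force simp: image_iff)
  show "inj_on X \<Omega>" using i by (metis inj_onI)
  show "Cinf_on \<Omega> X" "Cinf_on \<Omega> (inv_into (closure \<Omega>) X)"
    using smooth_on_subset[OF X(1) closure_subset] smooth_on_subset[OF X(2) closure_subset]
      smooth_on_open[OF assms(2)] by auto
qed

text \<open>The frontier is closed and tangent to the field in both time directions, hence
  invariant. A connected orbit leaving \<Omega> would meet the frontier and, flowing back, would
  have started there.\<close>

lemma (in flow) flow_in_domain:
  fixes \<Omega> :: "'a set"
  assumes "open \<Omega>" and bdry: "\<forall>x\<in>frontier \<Omega>. \<exists>\<gamma> \<delta>. \<delta> > 0 \<and> \<gamma> 0 = x \<and>
      \<gamma> ` {-\<delta><..<\<delta>} \<subseteq> frontier \<Omega> \<and> (\<gamma> has_vector_derivative w x) (at (0::real))"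
  shows "\<And>x s. x \<in> frontier \<Omega> \<Longrightarrow> \<phi> s x \<in> frontier \<Omega>" "\<And>x s. x \<in> \<Omega> \<Longrightarrow> \<phi> s x \<in> \<Omega>"
    "\<And>x s. x \<in> closure \<Omega> \<Longrightarrow> \<phi> s x \<in> closure \<Omega>"
proof -
 note tan = bdry[rule_format]
  interpret rev: flow "\<lambda>x. - w x" "\<lambda>s. \<phi> (- s)" by (rule flow_reverse)
  have tan': "\<exists>\<gamma> \<delta>. \<delta> > 0 \<and> \<gamma> 0 = x \<and>
      \<gamma> ` {-\<delta><..<\<delta>} \<subseteq> frontier \<Omega> \<and> (\<gamma> has_vector_derivative - w x) (at (0::real))" if xf: "x \<in> frontier \<Omega>" for x
  proof -
    obtain \<gamma> \<delta> where \<gamma>: "\<delta> > 0" "\<gamma> 0 = x" "\<gamma> ` {-\<delta><..<\<delta>} \<subseteq> frontier \<Omega>"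
      "(\<gamma> has_vector_derivative w x) (at (0::real))" using tan[OF xf] by blast
    have "((\<lambda>r. \<gamma> (- r)) has_vector_derivative - w x) (at 0)"
      by (rule has_vector_derivative_reflect) (use \<gamma> in simp)
    moreover have "(\<lambda>r. \<gamma> (- r)) ` {-\<delta><..<\<delta>} \<subseteq> frontier \<Omega>" using \<gamma>(3) by force
    ultimately show ?thesis using \<gamma>(1,2) by (intro exI[of _ "\<lambda>r. \<gamma> (- r)"] exI[of _ \<delta>]) auto
  qed
  show fr: "\<phi> s x \<in> frontier \<Omega>" if "x \<in> frontier \<Omega>" for x s
  proof (cases "0 \<le> s")
    case True
    then show ?thesis using flow_invariant_closed[OF frontier_closed tan that] by blast
  next
    case False
    then show ?thesis using rev.flow_invariant_closed[OF frontier_closed tan' that, of "- s"] by simp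
  qed
  show op: "\<phi> s x \<in> \<Omega>" if x: "x \<in> \<Omega>" for x s
  proof (rule ccontr)
    assume "\<phi> s x \<notin> \<Omega>"
    have "connected ((\<lambda>s. \<phi> s x) ` UNIV)"
      by (rule connected_continuous_image[OF flow_continuous_path connected_UNIV])
    moreover have "x \<in> (\<lambda>s. \<phi> s x) ` UNIV" by (rule image_eqI[of _ _ 0]) simp_all
    then have "(\<lambda>s. \<phi> s x) ` UNIV \<inter> \<Omega> \<noteq> {}" using x by blast
    moreover have "(\<lambda>s. \<phi> s x) ` UNIV - \<Omega> \<noteq> {}" using \<open>\<phi> s x \<notin> \<Omega>\<close> by auto
    ultimately have "(\<lambda>s. \<phi> s x) ` UNIV \<inter> frontier \<Omega> \<noteq> {}"
      by (rule connected_Int_frontier)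
    then obtain r where "\<phi> r x \<in> frontier \<Omega>" by auto
    from fr[OF this, of "- r"] show False using x closure_open_frontier(2)[OF assms(1)] by auto
  qed
  show "\<phi> s x \<in> closure \<Omega>" if "x \<in> closure \<Omega>" for x s
    using that fr op closure_open_frontier(1)[OF assms(1)] by auto
qed

lemma flow_Diff:
  assumes "flow w \<phi>" "open \<Omega>" "tangent_to_boundary \<Omega> w"
  shows "\<phi> s \<in> Diff \<Omega>" "\<And>a. a \<in> closure \<Omega> \<Longrightarrow> \<phi> s a \<in> closure \<Omega>" "\<And>a. a \<in> \<Omega> \<Longrightarrow> \<phi> s a \<in> \<Omega>"
proof -
  interpret flow w \<phi> by fact
  note dom = flow_in_domain[OF assms(2) assms(3)[unfolded tangent_to_boundary_def]]
  have "smooth_on (closure \<Omega>) (\<phi> s)" for s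
    by (rule smooth_onI[OF open_UNIV subset_UNIV flow_smooth_time]) simp
  moreover have "\<phi> s ` frontier \<Omega> = frontier \<Omega>"
  proof safe
    fix x assume "x \<in> frontier \<Omega>"
    then have "\<phi> (- s) x \<in> frontier \<Omega>" by (rule dom(1))
    then show "x \<in> \<phi> s ` frontier \<Omega>" by (metis flow_inverse(2) image_eqI)
  qed (rule dom(1))
  ultimately show "\<phi> s \<in> Diff \<Omega>"
    by (intro DiffI(1)[where Z = "\<phi> (- s)"]) (use dom(3) in auto)
  show "\<And>a. a \<in> closure \<Omega> \<Longrightarrow> \<phi> s a \<in> closure \<Omega>" "\<And>a. a \<in> \<Omega> \<Longrightarrow> \<phi> s a \<in> \<Omega>"
    using dom by auto
qed

section \<open>Jacobians\<close>

definition det2 :: "plane \<Rightarrow> plane \<Rightarrow> real" where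
  "det2 u v = u $ 1 * v $ 2 - v $ 1 * u $ 2"

lemma det_matrix: "det (matrix f) = det2 (f (axis 1 1)) (f (axis 2 1))"
  by (simp add: det_2 matrix_def det2_def mult.commute)

lemma plane_expand: "x = x $ 1 *\<^sub>R axis 1 1 + x $ 2 *\<^sub>R (axis 2 1 :: plane)"
  by (simp add: vec_eq_iff forall_2 axis_def)

text \<open>Jacobi's formula for the derivative of a determinant, in the plane. The trace on the
  right becomes the divergence of a velocity field.\<close>

lemma det2_linear_trace:
  assumes "linear C"
  shows "det2 (C u) v + det2 u (C v) = (C (axis 1 1) $ 1 + C (axis 2 1) $ 2) * det2 u v"
proof -
  have C: "C x = x $ 1 *\<^sub>R C (axis 1 1) + x $ 2 *\<^sub>R C (axis 2 1)" for x
    by (subst plane_expand[of x]) (simp add: linear_add[OF assms] linear_scale[OF assms])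
  show ?thesis
    unfolding det2_def C[of u] C[of v] by (simp add: algebra_simps)
qed

lemma det2_compose:
  assumes "linear C"
  shows "det2 (C u) (C v) = det2 (C (axis 1 1)) (C (axis 2 1)) * det2 u v"
proof -
  have C: "C x = x $ 1 *\<^sub>R C (axis 1 1) + x $ 2 *\<^sub>R C (axis 2 1)" for x
    by (subst plane_expand[of x]) (simp add: linear_add[OF assms] linear_scale[OF assms])
  show ?thesis
    unfolding det2_def C[of u] C[of v] by (simp add: algebra_simps)
qed

lemma Cinf_on_det2: "open S \<Longrightarrow> Cinf_on S f \<Longrightarrow> Cinf_on S g \<Longrightarrow> Cinf_on S (\<lambda>x. det2 (f x) (g x))"
  unfolding det2_def by (intro Cinf_on_diff Cinf_on_mult Cinf_on_nth)

text \<open>The spatial Jacobian determinant of the extension. It coincides with that of the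
  diffeomorphism inside the domain and is smooth on a neighbourhood of the closed domain.\<close>

definition jac :: "('p::euclidean_space \<times> plane \<Rightarrow> plane) \<Rightarrow> 'p \<times> plane \<Rightarrow> real" where
  "jac G z = det2 (frechet_derivative G (at z) (0, axis 1 1)) (frechet_derivative G (at z) (0, axis 2 1))"

text \<open>A family of diffeomorphisms with its smooth extension \<open>G\<close> to a neighbourhood of the closed
  domain. The parameter space is \<open>\<real>\<close> for curves and \<open>\<real>\<^sup>2\<close> for the families defining the Hessian.\<close>

locale deformation =
  fixes \<Omega> :: "plane set" and P :: "'p::euclidean_space set" and Y :: "'p \<Rightarrow> field"
    and G :: "'p \<times> plane \<Rightarrow> plane" and T :: "('p \<times> plane) set"
  assumes open_\<Omega>: "open \<Omega>" and bounded_\<Omega>: "bounded \<Omega>" and open_P: "open P" and open_T: "open T"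
    and sub_T: "P \<times> closure \<Omega> \<subseteq> T" and smooth_G: "Cinf_on T G"
    and Y_eq: "\<And>p a. p \<in> P \<Longrightarrow> a \<in> closure \<Omega> \<Longrightarrow> Y p a = G (p, a)"
    and Y_Diff: "\<And>p. p \<in> P \<Longrightarrow> Y p \<in> Diff \<Omega>"
begin

lemma in_T: "p \<in> P \<Longrightarrow> a \<in> closure \<Omega> \<Longrightarrow> (p, a) \<in> T"
  using sub_T by auto

lemma in_closure: "a \<in> \<Omega> \<Longrightarrow> a \<in> closure \<Omega>"
  using closure_subset by blast

lemma space_derivative_G:
  assumes "(p, a) \<in> T"
  shows "((\<lambda>x. G (p, x)) has_derivative (\<lambda>v. frechet_derivative G (at (p, a)) (0, v))) (at a)"
proof -
  have "((\<lambda>x. (p, x)) has_derivative (\<lambda>v. (0, v))) (at a)"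
    by (auto intro!: derivative_eq_intros)
  from has_derivative_compose[OF this Cinf_on_has_derivative[OF smooth_G assms]] show ?thesis .
qed

lemma space_derivative_Y:
  assumes "p \<in> P" "a \<in> \<Omega>"
  shows "(Y p has_derivative (\<lambda>v. frechet_derivative G (at (p, a)) (0, v))) (at a)"
  by (rule has_derivative_transform_within_open[OF space_derivative_G open_\<Omega> assms(2)])
    (use assms Y_eq in_T in_closure in auto)

lemma jacobian_Y:
  assumes "p \<in> P" "a \<in> \<Omega>"
  shows "det (jacobian (Y p) (at a)) = jac G (p, a)"
  unfolding jacobian_def det_matrix jac_def
  unfolding frechet_derivative_at[OF space_derivative_Y[OF assms], symmetric] ..

lemma smooth_jac: "Cinf_on T (jac G)"
  unfolding jac_def[abs_def]
  by (intro Cinf_on_det2 open_T Cinf_on_derivative smooth_G)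

text \<open>Inside \<Omega> the Jacobians of the map and of its inverse have product 1. At a
  boundary point the extensions need not be inverse to each other nearby, so the identity is carried
  there by continuity.\<close>

lemma jac_nonzero:
  assumes p: "p \<in> P" and a: "a \<in> closure \<Omega>"
  shows "jac G (p, a) \<noteq> 0"
proof -
  note X = DiffD[OF Y_Diff[OF p]]
  obtain U h where h: "open U" "closure \<Omega> \<subseteq> U" "Cinf_on U h"
    "\<And>x. x \<in> closure \<Omega> \<Longrightarrow> inv_into (closure \<Omega>) (Y p) x = h x"
    using X(2) unfolding smooth_on_Cinf_on by blast
  define A where "A x = det2 (frechet_derivative h (at x) (axis 1 1)) (frechet_derivative h (at x) (axis 2 1))" for x
  define f where "f x = A (G (p, x)) * jac G (p, x)" for x
  have "continuous_on (closure \<Omega>) f"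
    unfolding f_def
  proof (intro continuous_on_mult)
    have "continuous_on U A"
      unfolding A_def[abs_def] by (intro Cinf_on_continuous Cinf_on_det2 h Cinf_on_derivative)
    moreover have "continuous_on (closure \<Omega>) (\<lambda>x. G (p, x))"
      by (rule continuous_on_compose2[OF Cinf_on_continuous[OF smooth_G], of _ "\<lambda>x. (p, x)"])
        (use p in_T in \<open>auto intro!: continuous_intros\<close>)
    moreover have "(\<lambda>x. G (p, x)) ` closure \<Omega> \<subseteq> U"
    proof (rule image_subsetI)
      fix x assume x: "x \<in> closure \<Omega>"
      then show "G (p, x) \<in> U" using Y_eq[OF p x] X(5)[OF x] h(2) by auto
    qed
    ultimately show "continuous_on (closure \<Omega>) (\<lambda>x. A (G (p, x)))"
      by (rule continuous_on_compose2)
    show "continuous_on (closure \<Omega>) (\<lambda>x. jac G (p, x))"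
      by (rule continuous_on_compose2[OF Cinf_on_continuous[OF smooth_jac], of _ "\<lambda>x. (p, x)"])
        (use p in_T in \<open>auto intro!: continuous_intros\<close>)
  qed
  moreover have "f x = 1" if x: "x \<in> \<Omega>" for x
  proof -
    have xc: "x \<in> closure \<Omega>" using x by (rule in_closure)
    have Gx: "G (p, x) \<in> closure \<Omega>" using X(5)[OF xc] Y_eq[OF p xc] by simp
    have "((\<lambda>y. h (G (p, y))) has_derivative (\<lambda>v. frechet_derivative h (at (G (p, x)))
        (frechet_derivative G (at (p, x)) (0, v)))) (at x)"
      by (rule has_derivative_compose[OF space_derivative_G[OF in_T[OF p xc]]])
        (use Cinf_on_has_derivative[OF h(3)] Gx h(2) in blast)
    moreover have "h (G (p, y)) = y" if "y \<in> \<Omega>" for y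
      using in_closure[OF that] X(5,6) h(4) Y_eq[OF p] by metis
    ultimately have "((\<lambda>y. y) has_derivative (\<lambda>v. frechet_derivative h (at (G (p, x)))
        (frechet_derivative G (at (p, x)) (0, v)))) (at x)"
      by (rule has_derivative_transform_within_open[OF _ open_\<Omega> x])
    then have id: "frechet_derivative h (at (G (p, x))) (frechet_derivative G (at (p, x)) (0, v)) = v" for v
      using has_derivative_unique[OF has_derivative_ident] by metis
    have "linear (frechet_derivative h (at (G (p, x))))"
      using Cinf_on_linear_derivative[OF h(3)] Gx h(2) by blast
    from det2_compose[OF this, of "frechet_derivative G (at (p, x)) (0, axis 1 1)"
        "frechet_derivative G (at (p, x)) (0, axis 2 1)"]
    show "f x = 1" by (simp add: id f_def A_def jac_def det2_def axis_def)
  qed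
  ultimately have "f a = 1" using continuous_constant_on_closure[of \<Omega> f 1 a] a by blast
  then show ?thesis by (auto simp: f_def)
qed

text \<open>Symmetry of second derivatives moves the parameter derivative inside: what varies the
  determinant is the spatial derivative of the velocity.\<close>

lemma jac_derivative:
  assumes "z \<in> T"
  shows "frechet_derivative (jac G) (at z) (\<pi>, 0) =
     det2 (frechet_derivative (\<lambda>z. frechet_derivative G (at z) (\<pi>, 0)) (at z) (0, axis 1 1))
          (frechet_derivative G (at z) (0, axis 2 1)) +
     det2 (frechet_derivative G (at z) (0, axis 1 1))
          (frechet_derivative (\<lambda>z. frechet_derivative G (at z) (\<pi>, 0)) (at z) (0, axis 2 1))"
proof -
  have d: "((\<lambda>z. frechet_derivative G (at z) v) has_derivative
      frechet_derivative (\<lambda>z. frechet_derivative G (at z) v) (at z)) (at z)" for v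
    using Cinf_on_has_derivative[OF Cinf_on_derivative[OF smooth_G] assms] .
  have swap: "frechet_derivative (\<lambda>z. frechet_derivative G (at z) v) (at z) u =
      frechet_derivative (\<lambda>z. frechet_derivative G (at z) u) (at z) v" for u v
    by (rule frechet_derivative_commute[OF open_T _ assms]) (use smooth_G in \<open>simp add: Cinf_on_def\<close>)
  have n: "((\<lambda>z. frechet_derivative G (at z) v $ i) has_derivative
      (\<lambda>w. frechet_derivative (\<lambda>z. frechet_derivative G (at z) v) (at z) w $ i)) (at z)" for v i
    by (rule bounded_linear.has_derivative[OF bounded_linear_vec_nth d])
  have J: "(jac G has_derivative (\<lambda>w.
     det2 (frechet_derivative (\<lambda>z. frechet_derivative G (at z) (0, axis 1 1)) (at z) w)
          (frechet_derivative G (at z) (0, axis 2 1)) +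
     det2 (frechet_derivative G (at z) (0, axis 1 1))
          (frechet_derivative (\<lambda>z. frechet_derivative G (at z) (0, axis 2 1)) (at z) w))) (at z)"
    unfolding jac_def[abs_def] det2_def
    by (rule derivative_eq_intros n refl)+ (simp add: fun_eq_iff algebra_simps)
  show ?thesis
    unfolding frechet_derivative_at[OF J, symmetric]
      swap[where v = "(0, axis 1 1)" and u = "(\<pi>, 0)"] swap[where v = "(0, axis 2 1)" and u = "(\<pi>, 0)"] ..
qed

text \<open>Liouville's formula. Writing the velocity as \<open>u\<close> composed with the map, its
  spatial derivative is the derivative of \<open>u\<close> applied to the two columns, and Jacobi's
  formula yields the divergence.\<close>

lemma jac_derivative_divergence:
  assumes p: "p \<in> P" and a: "a \<in> \<Omega>"
    and u: "\<And>x. x \<in> \<Omega> \<Longrightarrow> frechet_derivative G (at (p, x)) (\<pi>, 0) = u (Y p x)"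
    and diff: "u differentiable (at (Y p a))"
  shows "frechet_derivative (jac G) (at (p, a)) (\<pi>, 0) = divergence u (Y p a) * jac G (p, a)"
proof -
  have z: "(p, a) \<in> T" using in_T[OF p in_closure[OF a]] .
  define C where "C = frechet_derivative u (at (Y p a))"
  have uC: "(u has_derivative C) (at (Y p a))" using diff by (simp add: C_def frechet_derivative_works)
  have 1: "((\<lambda>x. u (Y p x)) has_derivative (\<lambda>v. C (frechet_derivative G (at (p, a)) (0, v)))) (at a)"
    by (rule has_derivative_compose[OF space_derivative_Y[OF p a] uC])
  have "((\<lambda>x. (p, x)) has_derivative (\<lambda>v. (0, v))) (at a)"
    by (auto intro!: derivative_eq_intros)
  from has_derivative_compose[OF this Cinf_on_has_derivative[OF Cinf_on_derivative[OF smooth_G] z]]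
  have "((\<lambda>x. frechet_derivative G (at (p, x)) (\<pi>, 0)) has_derivative
      (\<lambda>v. frechet_derivative (\<lambda>z. frechet_derivative G (at z) (\<pi>, 0)) (at (p, a)) (0, v))) (at a)" .
  then have 2: "((\<lambda>x. u (Y p x)) has_derivative
      (\<lambda>v. frechet_derivative (\<lambda>z. frechet_derivative G (at z) (\<pi>, 0)) (at (p, a)) (0, v))) (at a)"
    by (rule has_derivative_transform_within_open[OF _ open_\<Omega> a]) (rule u)
  have eq: "frechet_derivative (\<lambda>z. frechet_derivative G (at z) (\<pi>, 0)) (at (p, a)) (0, v) =
      C (frechet_derivative G (at (p, a)) (0, v))" for v
    using has_derivative_unique[OF 2 1] by metis
  show ?thesis
    unfolding jac_derivative[OF z] eq
    using det2_linear_trace[OF has_derivative_linear[OF uC]]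
    by (simp add: jac_def divergence_def C_def UNIV_2)
qed

end

section \<open>Change of variables and the potential\<close>

lemma open_sets_lebesgue: "open S \<Longrightarrow> S \<in> sets lebesgue"
  by (rule sets_completionI_sets) simp

text \<open>The reals are identified with one-dimensional vectors to reach the vector-valued
  theorem. The equivalence for a given value \<open>c\<close> treats integrability and the value
  together, so either side may be the one that is known.\<close>

lemma change_of_variables_real:
  fixes X :: "plane \<Rightarrow> plane" and f :: "plane \<Rightarrow> real"
  assumes "S \<in> sets lebesgue" "\<And>x. x \<in> S \<Longrightarrow> (X has_derivative X' x) (at x within S)" "inj_on X S"
  shows "(\<lambda>x. \<bar>det (matrix (X' x))\<bar> * f (X x)) absolutely_integrable_on S \<and>
      integral S (\<lambda>x. \<bar>det (matrix (X' x))\<bar> * f (X x)) = c \<longleftrightarrow>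
    f absolutely_integrable_on (X ` S) \<and> integral (X ` S) f = c"
proof -
  let ?l = "\<lambda>y::real. vec y :: real ^ 1"
  have bl: "bounded_linear ?l" and bd: "bounded_linear (\<lambda>x::real^1. x $ 1)"
    by (simp_all add: linear_iff vec_eq_iff bounded_linear_vec_nth flip: linear_conv_bounded_linear)
  have *: "g absolutely_integrable_on R \<and> integral R g = c \<longleftrightarrow>
      (\<lambda>x. ?l (g x)) absolutely_integrable_on R \<and> integral R (\<lambda>x. ?l (g x)) = ?l c" for g :: "plane \<Rightarrow> real" and R
  proof
    assume A: "g absolutely_integrable_on R \<and> integral R g = c"
    then show "(\<lambda>x. ?l (g x)) absolutely_integrable_on R \<and> integral R (\<lambda>x. ?l (g x)) = ?l c"
      using absolutely_integrable_linear[where f = g, OF _ bl]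
        integral_linear[where f = g, OF _ bl]
        set_lebesgue_integral_eq_integral(1)[where f = g] by (simp add: o_def)
  next
    assume A: "(\<lambda>x. ?l (g x)) absolutely_integrable_on R \<and> integral R (\<lambda>x. ?l (g x)) = ?l c"
    then show "g absolutely_integrable_on R \<and> integral R g = c"
      using absolutely_integrable_linear[where f = "\<lambda>x. ?l (g x)", OF _ bd]
        integral_linear[where f = "\<lambda>x. ?l (g x)", OF _ bd]
        set_lebesgue_integral_eq_integral(1)[where f = "\<lambda>x. ?l (g x)"] by (simp add: o_def)
  qed
  have l: "?l (a * d) = a *\<^sub>R ?l d" for a d :: real by (simp add: vec_eq_iff)
  show ?thesis
    unfolding * l by (rule has_absolute_integral_change_of_variables[OF assms])
qed

lemma Diff_change_of_variables:
  fixes f :: "plane \<Rightarrow> real"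
  assumes "X \<in> Diff \<Omega>" "open \<Omega>"
    and "f absolutely_integrable_on \<Omega> \<or> (\<lambda>a. \<bar>det (jacobian X (at a))\<bar> * f (X a)) absolutely_integrable_on \<Omega>"
  shows "f absolutely_integrable_on \<Omega>"
    "(\<lambda>a. \<bar>det (jacobian X (at a))\<bar> * f (X a)) absolutely_integrable_on \<Omega>"
    "integral \<Omega> f = integral \<Omega> (\<lambda>a. \<bar>det (jacobian X (at a))\<bar> * f (X a))"
proof -
  have der: "(X has_derivative frechet_derivative X (at x)) (at x within \<Omega>)" if "x \<in> \<Omega>" for x
    using Cinf_on_has_derivative[OF Diff_interior(7)[OF assms(1,2)] that] has_derivative_at_withinI by blast
  have \<Omega>: "\<Omega> \<in> sets lebesgue" using assms(2) by (rule open_sets_lebesgue)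
  have "(\<lambda>a. \<bar>det (jacobian X (at a))\<bar> * f (X a)) absolutely_integrable_on \<Omega> \<and>
      integral \<Omega> (\<lambda>a. \<bar>det (jacobian X (at a))\<bar> * f (X a)) = c \<longleftrightarrow>
      f absolutely_integrable_on \<Omega> \<and> integral \<Omega> f = c" for c
    using change_of_variables_real[OF \<Omega> der Diff_interior(6)[OF assms(1,2)], of f c]
    unfolding Diff_interior(1)[OF assms(1,2)] jacobian_def .
  then show "f absolutely_integrable_on \<Omega>"
    "(\<lambda>a. \<bar>det (jacobian X (at a))\<bar> * f (X a)) absolutely_integrable_on \<Omega>"
    "integral \<Omega> f = integral \<Omega> (\<lambda>a. \<bar>det (jacobian X (at a))\<bar> * f (X a))"
    using assms(3) by blast+
qed

lemma fluid_density_image: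
  assumes "X \<in> Diff \<Omega>" "open \<Omega>" "a \<in> \<Omega>"
  shows "fluid_density \<Omega> \<rho>0 X (X a) = \<rho>0 a / \<bar>det (jacobian X (at a))\<bar>"
  using Diff_interior(4)[OF assms] by (simp add: fluid_density_def Let_def)

lemma integral_zero_imp_zero:
  fixes g :: "'a::euclidean_space \<Rightarrow> real"
  assumes "open \<Omega>" "continuous_on \<Omega> g" "g integrable_on \<Omega>" "\<And>x. x \<in> \<Omega> \<Longrightarrow> 0 \<le> g x"
    "integral \<Omega> g = 0" "x \<in> \<Omega>"
  shows "g x = 0"
proof (rule ccontr)
  assume "g x \<noteq> 0"
  then have gx: "g x > 0" using assms(4)[OF assms(6)] by simp
  have "isCont g x" using assms by (simp add: continuous_on_eq_continuous_at)
  then obtain d where d: "d > 0" "\<And>y. dist y x < d \<Longrightarrow> dist (g y) (g x) < g x / 2"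
    unfolding continuous_at_eps_delta using gx half_gt_zero by blast
  obtain e where e: "e > 0" "ball x e \<subseteq> \<Omega>" using assms(1,6) open_contains_ball by blast
  define B where "B = ball x (min d e)"
  have B: "B \<subseteq> \<Omega>" "B \<in> lmeasurable" "measure lebesgue B > 0"
    using e d(1) by (auto simp: B_def content_ball_pos subset_iff)
  have "g x / 2 * measure lebesgue B = integral B (\<lambda>y. g x / 2)"
    using lmeasure_integral[OF B(2)] integral_mult_right[of B "g x / 2" "\<lambda>x. 1"] by simp
  also have "\<dots> = integral \<Omega> (\<lambda>y. if y \<in> B then g x / 2 else 0)"
    using integral_restrict_Int[of \<Omega> B "\<lambda>y. g x / 2"] Int_absorb2[OF B(1)] by simp
  also have "\<dots> \<le> integral \<Omega> g"
  proof (rule integral_le[OF _ assms(3)])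
    have "(\<lambda>y. g x / 2) integrable_on B" using B(2) by (rule integrable_on_const)
    then show "(\<lambda>y. if y \<in> B then g x / 2 else 0) integrable_on \<Omega>"
      using integrable_restrict_Int[of B "\<lambda>y. g x / 2" \<Omega>] Int_absorb2[OF B(1)] by simp
    show "(if y \<in> B then g x / 2 else 0) \<le> g y" if "y \<in> \<Omega>" for y
    proof (cases "y \<in> B")
      case True
      then have "dist (g y) (g x) < g x / 2" using d(2)[of y] by (simp add: B_def dist_commute)
      then have "g x / 2 \<le> g y" unfolding dist_real_def by linarith
      then show ?thesis using True by simp
    qed (use assms(4)[OF that] in simp)
  qed
  also have "\<dots> = 0" by (rule assms(5))
  finally show False using gx B(3) by (simp add: mult_le_0_iff)
qed

lemma divergence_scaleR:
  fixes f :: "plane \<Rightarrow> real"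
  assumes "f differentiable at x" "u differentiable at x"
  shows "divergence (\<lambda>y. f y *\<^sub>R u y) x = frechet_derivative f (at x) (u x) + f x * divergence u x"
proof -
  have f: "(f has_derivative frechet_derivative f (at x)) (at x)"
    and u: "(u has_derivative frechet_derivative u (at x)) (at x)"
    using assms by (simp_all add: frechet_derivative_works)
  have "linear (frechet_derivative f (at x))" using f has_derivative_linear by blast
  then have *: "frechet_derivative f (at x) (u x) =
      u x $ 1 * frechet_derivative f (at x) (axis 1 1) + u x $ 2 * frechet_derivative f (at x) (axis 2 1)"
    by (subst plane_expand[of "u x"]) (simp add: linear_add linear_scale)
  show ?thesis
    unfolding divergence_def frechet_derivative_at[OF has_derivative_scaleR[OF f u], symmetric]
    by (simp add: * UNIV_2 algebra_simps)
qed

lemma divergence_cong: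
  assumes "open S" "x \<in> S" "\<And>y. y \<in> S \<Longrightarrow> f y = g y" "f differentiable at x"
  shows "divergence f x = divergence g x"
proof -
  have "(f has_derivative frechet_derivative f (at x)) (at x)"
    using assms(4) by (simp add: frechet_derivative_works)
  then have "(g has_derivative frechet_derivative f (at x)) (at x)"
    by (rule has_derivative_transform_within_open[OF _ assms(1,2)]) (rule assms(3))
  then have "frechet_derivative f (at x) = frechet_derivative g (at x)" by (rule frechet_derivative_at)
  then show ?thesis by (simp add: divergence_def)
qed

lemma Cinf_on_divergence: "open S \<Longrightarrow> Cinf_on S u \<Longrightarrow> Cinf_on S (divergence u)"
  unfolding divergence_def[abs_def] by (intro Cinf_on_sum Cinf_on_nth Cinf_on_derivative)

section \<open>Extensions of curves and of flows\<close>

lemma Diff_deformation: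
  assumes "open \<Omega>" "bounded \<Omega>" "X \<in> Diff \<Omega>"
  obtains g T where "open T" "closure \<Omega> \<subseteq> T" "Cinf_on T g" "\<And>a. a \<in> closure \<Omega> \<Longrightarrow> X a = g a"
  using DiffD(1)[OF assms(3)] unfolding smooth_on_Cinf_on by blast

lemma smooth_curve_deformation:
  assumes "open \<Omega>" "bounded \<Omega>" "open I" "smooth_curve \<Omega> I X"
  obtains G T where "deformation \<Omega> I X G T"
proof -
  obtain T G where "open T" "I \<times> closure \<Omega> \<subseteq> T" "Cinf_on T G"
    "\<And>z. z \<in> I \<times> closure \<Omega> \<Longrightarrow> (\<lambda>(t, a). X t a) z = G z"
    using assms(4) unfolding smooth_curve_def smooth_on_Cinf_on by blast
  then have "deformation \<Omega> I X G T"
    using assms unfolding smooth_curve_def by unfold_locales auto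
  then show ?thesis by (rule that)
qed

text \<open>The functional \<open>\<tau>\<close> turns the flow parameter into one or several family parameters.\<close>

lemma flow_deformation:
  fixes \<tau> :: "'p::euclidean_space \<Rightarrow> real"
  assumes "open \<Omega>" "bounded \<Omega>" "X \<in> Diff \<Omega>" "flow w \<phi>" "Cinf_on UNIV w" "tangent_to_boundary \<Omega> w" "bounded_linear \<tau>"
  obtains G T where "deformation \<Omega> UNIV (\<lambda>p a. \<phi> (\<tau> p) (X a)) G T"
    "\<And>p \<pi> a. a \<in> closure \<Omega> \<Longrightarrow> frechet_derivative G (at (p, a)) (\<pi>, 0) = \<tau> \<pi> *\<^sub>R w (\<phi> (\<tau> p) (X a))"
proof -
  interpret flow w \<phi> by fact
  obtain g U where g: "open U" "closure \<Omega> \<subseteq> U" "Cinf_on U g" "\<And>a. a \<in> closure \<Omega> \<Longrightarrow> X a = g a"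
    using Diff_deformation[OF assms(1-3)] by metis
  define T where "T = (UNIV :: 'p set) \<times> U"
  define G where "G z = \<phi> (\<tau> (fst z)) (g (snd z))" for z :: "'p \<times> plane"
  have oT: "open T" unfolding T_def using g(1) by (simp add: open_Times)
  have cg: "Cinf_on T (\<lambda>z. g (snd z))"
    by (rule Cinf_on_compose[OF g(3,1) oT])
      (auto simp: T_def intro: Cinf_on_linear bounded_linear_snd)
  have ct: "Cinf_on T (\<lambda>z. \<tau> (fst z))"
    by (rule Cinf_on_compose_linear[OF assms(7) oT]) (rule Cinf_on_linear[OF bounded_linear_fst])
  have sG: "Cinf_on T G"
    unfolding G_def
    using Cinf_on_compose[OF flow_smooth open_UNIV oT UNIV_I Cinf_on_Pair[OF oT ct cg]] by simp
  have D: "deformation \<Omega> UNIV (\<lambda>p a. \<phi> (\<tau> p) (X a)) G T"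
  proof
    show "(\<lambda>a. \<phi> (\<tau> p) (X a)) \<in> Diff \<Omega>" for p
      by (rule Diff_compose[OF flow_Diff(1)[OF assms(4,1,6)] assms(3)])
  qed (use assms oT sG g in \<open>auto simp: T_def G_def\<close>)
  moreover have "frechet_derivative G (at (p, a)) (\<pi>, 0) = \<tau> \<pi> *\<^sub>R w (\<phi> (\<tau> p) (X a))"
    if a: "a \<in> closure \<Omega>" for p \<pi> a
  proof -
    have z: "(p, a) \<in> T" using a g(2) by (auto simp: T_def)
    have "((\<lambda>q. (q, a)) has_derivative (\<lambda>v. (v, 0))) (at p)"
      by (auto intro!: derivative_eq_intros)
    from has_derivative_compose[OF this Cinf_on_has_derivative[OF sG z]]
    have 1: "((\<lambda>q. G (q, a)) has_derivative (\<lambda>v. frechet_derivative G (at (p, a)) (v, 0))) (at p)" .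
    have "((\<lambda>q. \<phi> (\<tau> q) (X a)) has_derivative (\<lambda>v. \<tau> v *\<^sub>R w (\<phi> (\<tau> p) (X a)))) (at p)"
      using has_derivative_compose[OF bounded_linear_imp_has_derivative[OF assms(7)]
          flow_derivative[of "X a" "\<tau> p", unfolded has_vector_derivative_def], of UNIV] by simp
    then have 2: "((\<lambda>q. G (q, a)) has_derivative (\<lambda>v. \<tau> v *\<^sub>R w (\<phi> (\<tau> p) (X a)))) (at p)"
      using g(4)[OF a] by (simp add: G_def)
    show ?thesis using has_derivative_unique[OF 1 2] by metis
  qed
  ultimately show ?thesis by (rule that)
qed

context deformation
begin

lemma param_derivative_G:
  assumes "(p, a) \<in> T"
  shows "((\<lambda>q. G (q, a)) has_derivative (\<lambda>v. frechet_derivative G (at (p, a)) (v, 0))) (at p)"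
proof -
  have "((\<lambda>q. (q, a)) has_derivative (\<lambda>v. (v, 0))) (at p)"
    by (auto intro!: derivative_eq_intros)
  from has_derivative_compose[OF this Cinf_on_has_derivative[OF smooth_G assms]] show ?thesis .
qed

lemma compact_closure: "compact (closure \<Omega>)"
  using bounded_\<Omega> by simp

lemma integrable_section:
  assumes "continuous_on S h" "P \<times> closure \<Omega> \<subseteq> S" "p \<in> P"
  shows "(\<lambda>a. h (p, a) :: real) absolutely_integrable_on \<Omega>"
proof (rule absolutely_integrable_continuous_subset_compact[OF compact_closure closure_subset])
  show "\<Omega> \<in> sets lebesgue" using open_\<Omega> by (rule open_sets_lebesgue)
  show "continuous_on (closure \<Omega>) (\<lambda>a. h (p, a))"
    by (rule continuous_on_compose2[OF assms(1), of _ "\<lambda>a. (p, a)"])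
      (use assms in \<open>auto intro!: continuous_intros\<close>)
qed

lemma has_derivative_integral_section:
  assumes "open S" "Cinf_on S F" "P \<times> closure \<Omega> \<subseteq> S" "p \<in> P"
  shows "((\<lambda>p. integral \<Omega> (\<lambda>a. F (p, a) :: real)) has_derivative
     (\<lambda>v. integral \<Omega> (\<lambda>a. frechet_derivative F (at (p, a)) (v, 0)))) (at p)"
  by (rule has_derivative_parameter_integral[OF assms(1) _ compact_closure closure_subset])
    (use assms open_sets_lebesgue[OF open_\<Omega>] in \<open>auto simp: Cinf_on_def\<close>)

lemma abs_jac_derivative:
  assumes p: "p \<in> P" and a: "a \<in> closure \<Omega>"
  shows "((\<lambda>z. \<bar>jac G z\<bar>) has_derivative (\<lambda>v. sgn (jac G (p, a)) * frechet_derivative (jac G) (at (p, a)) v))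
     (at (p, a))"
proof -
  have j: "(jac G has_derivative frechet_derivative (jac G) (at (p, a))) (at (p, a))"
    by (rule Cinf_on_has_derivative[OF smooth_jac in_T[OF p a]])
  let ?s = "sgn (jac G (p, a))"
  have nz: "jac G (p, a) \<noteq> 0" by (rule jac_nonzero[OF p a])
  have "open (jac G -` {y. sgn y = ?s} \<inter> T)"
    using continuous_open_preimage[OF Cinf_on_continuous[OF smooth_jac] open_T open_sgn_set[OF nz]]
    by (simp add: Int_commute)
  then show ?thesis
    by (rule has_derivative_transform_within_open[OF has_derivative_mult_right[OF j, of ?s]])
      (use in_T[OF p a] in \<open>auto simp: abs_sgn mult.commute\<close>)
qed

text \<open>The transport formula for a density \<open>r\<close> carried by the velocity
  \<open>u\<close>, seen from a fixed label: Liouville's formula supplies r div u and the chain rule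
  the derivative of r along u.\<close>

lemma weighted_jac_derivative:
  assumes p: "p \<in> P" and a: "a \<in> \<Omega>"
    and u: "\<And>x. x \<in> \<Omega> \<Longrightarrow> frechet_derivative G (at (p, x)) (\<pi>, 0) = u (Y p x)"
    and du: "u differentiable (at (Y p a))" and dr: "r differentiable (at (Y p a))"
  shows "frechet_derivative (\<lambda>z. r (G z) * \<bar>jac G z\<bar>) (at (p, a)) (\<pi>, 0) =
     divergence (\<lambda>x. r x *\<^sub>R u x) (Y p a) * \<bar>jac G (p, a)\<bar>"
proof -
  have ac: "a \<in> closure \<Omega>" using a by (rule in_closure)
  have Gp: "G (p, a) = Y p a" using Y_eq[OF p ac] by simp
  have r: "(r has_derivative frechet_derivative r (at (Y p a))) (at (G (p, a)))"
    using dr by (simp add: frechet_derivative_works Gp)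
  have 1: "((\<lambda>z. r (G z)) has_derivative (\<lambda>v. frechet_derivative r (at (Y p a))
      (frechet_derivative G (at (p, a)) v))) (at (p, a))"
    by (rule has_derivative_compose[OF Cinf_on_has_derivative[OF smooth_G in_T[OF p ac]] r])
  have jd: "frechet_derivative (jac G) (at (p, a)) (\<pi>, 0) = divergence u (Y p a) * jac G (p, a)"
    by (rule jac_derivative_divergence[OF p a _ du]) (rule u)
  have sg: "sgn (jac G (p, a)) * jac G (p, a) = \<bar>jac G (p, a)\<bar>" by (simp add: abs_sgn mult.commute)
  have "frechet_derivative (\<lambda>z. r (G z) * \<bar>jac G z\<bar>) (at (p, a)) (\<pi>, 0) =
      r (Y p a) * (sgn (jac G (p, a)) * (divergence u (Y p a) * jac G (p, a))) +
      frechet_derivative r (at (Y p a)) (u (Y p a)) * \<bar>jac G (p, a)\<bar>"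
    unfolding frechet_derivative_at[OF has_derivative_mult[OF 1 abs_jac_derivative[OF p ac]], symmetric]
      jd u[OF a] Gp ..
  then show ?thesis
    unfolding divergence_scaleR[OF dr du] by (simp add: algebra_simps flip: sg)
qed

end

text \<open>The flow of a field tangent to the boundary maps the domain to itself, so the measure of the
  image is constant. This replaces the divergence theorem on domains without boundary regularity.\<close>

lemma integral_divergence_zero:
  assumes "open \<Omega>" "bounded \<Omega>" "Cinf_on UNIV w" "compact S" "\<And>x. x \<notin> S \<Longrightarrow> w x = 0" "tangent_to_boundary \<Omega> w"
  shows "integral \<Omega> (divergence w) = 0"
proof -
  obtain \<phi> where fl: "flow w \<phi>" using flow_exists[OF assms(3-5)] by blast
  interpret flow w \<phi> by fact
  have id: "(\<lambda>a. a) \<in> Diff \<Omega>"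
    by (rule DiffI(1)[where Z = "\<lambda>a. a"])
      (auto intro!: smooth_onI[OF open_UNIV subset_UNIV Cinf_on_ident])
  obtain G T where D: "deformation \<Omega> UNIV (\<lambda>p::real. \<lambda>a. \<phi> p a) G T"
    and G: "\<And>p \<pi> a. a \<in> closure \<Omega> \<Longrightarrow> frechet_derivative G (at (p, a)) (\<pi>, 0) = \<pi> *\<^sub>R w (\<phi> p a)"
    using flow_deformation[OF assms(1,2) id fl assms(3,6) bounded_linear_ident] by metis
  interpret deformation \<Omega> UNIV "\<lambda>p::real. \<lambda>a. \<phi> p a" G T by fact
  \<comment> \<open>The neighbourhood of the closed domain on which the absolute value of the
    Jacobian is smooth.\<close>
  define S' where "S' = T \<inter> jac G -` (- {0})"
  have S': "open S'" unfolding S'_def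
    by (rule continuous_open_preimage[OF Cinf_on_continuous[OF smooth_jac] open_T]) auto
  have sub: "UNIV \<times> closure \<Omega> \<subseteq> S'" using jac_nonzero in_T by (auto simp: S'_def)
  have cS: "Cinf_on S' (\<lambda>z. \<bar>jac G z\<bar>)"
    by (rule Cinf_on_abs[OF S' Cinf_on_subset[OF smooth_jac]]) (auto simp: S'_def)
  have vol: "integral \<Omega> (\<lambda>a. \<bar>jac G (p, a)\<bar>) = integral \<Omega> (\<lambda>a. 1)" for p
  proof -
    have "(\<lambda>a. 1::real) absolutely_integrable_on \<Omega>"
      using absolutely_integrable_continuous_subset_compact[OF compact_closure closure_subset open_sets_lebesgue[OF assms(1)]
          continuous_on_const] .
    then have "integral \<Omega> (\<lambda>a. 1::real) = integral \<Omega> (\<lambda>a. \<bar>det (jacobian (\<phi> p) (at a))\<bar> * 1)"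
      using Diff_change_of_variables(3)[OF Y_Diff[of p] assms(1), of "\<lambda>a. 1"] by simp
    also have "\<dots> = integral \<Omega> (\<lambda>a. \<bar>jac G (p, a)\<bar>)"
      by (rule integral_cong) (simp add: jacobian_Y)
    finally show ?thesis by simp
  qed
  have "((\<lambda>p. integral \<Omega> (\<lambda>a. 1::real)) has_derivative
     (\<lambda>v. integral \<Omega> (\<lambda>a. frechet_derivative (\<lambda>z. \<bar>jac G z\<bar>) (at (0, a)) (v, 0)))) (at 0)"
    using has_derivative_integral_section[OF S' cS sub UNIV_I, of 0] by (simp add: vol)
  then have "(\<lambda>v. integral \<Omega> (\<lambda>a. frechet_derivative (\<lambda>z. \<bar>jac G z\<bar>) (at (0::real, a)) (v, 0))) = (\<lambda>v. 0)"
    using has_derivative_unique has_derivative_const by blast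
  from fun_cong[OF this, of 1]
  have int0: "integral \<Omega> (\<lambda>a. frechet_derivative (\<lambda>z. \<bar>jac G z\<bar>) (at (0::real, a)) (1, 0)) = 0" .
  have div: "frechet_derivative (\<lambda>z. \<bar>jac G z\<bar>) (at (0::real, a)) (1, 0) = divergence w a" if a: "a \<in> \<Omega>" for a
  proof -
    have "frechet_derivative (\<lambda>z. (\<lambda>x. 1) (G z) * \<bar>jac G z\<bar>) (at (0, a)) (1, 0) =
        divergence (\<lambda>x. (\<lambda>x. 1) x *\<^sub>R w x) (\<phi> 0 a) * \<bar>jac G (0, a)\<bar>"
      by (rule weighted_jac_derivative[OF UNIV_I a])
        (use G in_closure Cinf_on_differentiable[OF assms(3)] in auto)
    moreover have "jac G (0, a) = 1"
    proof -
      have "((\<lambda>x. x) has_derivative (\<lambda>v. frechet_derivative G (at (0, a)) (0, v))) (at a)"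
        using space_derivative_Y[OF UNIV_I a, of 0] by simp
      then have "frechet_derivative G (at (0, a)) (0, v) = v" for v
        using has_derivative_unique[OF has_derivative_ident] by metis
      then show ?thesis by (simp add: jac_def det2_def axis_def)
    qed
    ultimately show ?thesis by simp
  qed
  have "integral \<Omega> (divergence w) =
      integral \<Omega> (\<lambda>a. frechet_derivative (\<lambda>z. \<bar>jac G z\<bar>) (at (0::real, a)) (1, 0))"
    by (rule integral_cong) (simp add: div)
  then show ?thesis using int0 by simp
qed

lemma tangent_to_boundary_zero:
  assumes "\<And>x. x \<in> frontier \<Omega> \<Longrightarrow> w x = 0"
  shows "tangent_to_boundary \<Omega> w"
  unfolding tangent_to_boundary_def
proof
  fix x assume x: "x \<in> frontier \<Omega>"
  show "\<exists>\<gamma> \<delta>. \<delta> > 0 \<and> \<gamma> 0 = x \<and> \<gamma> ` {- \<delta><..<\<delta>} \<subseteq> frontier \<Omega> \<and>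
      (\<gamma> has_vector_derivative w x) (at (0::real))"
    by (rule exI[of _ "\<lambda>t. x"], rule exI[of _ 1]) (use x assms in auto)
qed

section \<open>Critical points and the Hessian of the potential\<close>

lemma has_real_derivative_along:
  assumes "(f has_derivative f') (at (c t))" "(c has_vector_derivative c') (at t)"
  shows "((\<lambda>s. f (c s)) has_real_derivative f' c') (at t)"
proof -
  have "((\<lambda>s. f (c s)) has_derivative (\<lambda>h. f' (h *\<^sub>R c'))) (at t)"
    using has_derivative_compose[OF assms(2)[unfolded has_vector_derivative_def] assms(1)] .
  moreover have "f' (h *\<^sub>R c') = f' c' * h" for h
    using linear_scale[OF has_derivative_linear[OF assms(1)], of h c'] by simp
  ultimately show ?thesis by (simp add: has_field_derivative_def)
qed

lemma (in deformation) curve_velocity: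
  assumes "(c has_vector_derivative c') (at t)" "c t \<in> P" "a \<in> closure \<Omega>"
  shows "((\<lambda>s. Y (c s) a) has_vector_derivative frechet_derivative G (at (c t, a)) (c', 0)) (at t)"
proof -
  have z: "(c t, a) \<in> T" using in_T assms by blast
  have "((\<lambda>s. G (c s, a)) has_derivative (\<lambda>h. frechet_derivative G (at (c t, a)) (h *\<^sub>R c', 0))) (at t)"
    using has_derivative_compose[OF assms(1)[unfolded has_vector_derivative_def] param_derivative_G[OF z]] .
  moreover have "frechet_derivative G (at (c t, a)) (h *\<^sub>R c', 0) = h *\<^sub>R frechet_derivative G (at (c t, a)) (c', 0)" for h
    using linear_scale[OF Cinf_on_linear_derivative[OF smooth_G z], of h "(c', 0)"] by simp
  ultimately have d: "((\<lambda>s. G (c s, a)) has_derivative (\<lambda>h. h *\<^sub>R frechet_derivative G (at (c t, a)) (c', 0))) (at t)"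
    by simp
  have "(c \<longlongrightarrow> c t) (at t)"
    using has_vector_derivative_continuous[OF assms(1)] by (simp add: continuous_within)
  then have "\<forall>\<^sub>F s in at t. c s \<in> P" using topological_tendstoD[OF _ open_P assms(2)] by blast
  then have "\<forall>\<^sub>F s in at t. G (c s, a) = Y (c s) a"
    by eventually_elim (simp add: Y_eq assms)
  from has_derivative_transform_eventually[OF d this] show ?thesis
    using Y_eq[OF assms(2,3)] by (simp add: has_vector_derivative_def)
qed

lemma (in deformation) velocity_Y:
  assumes "(c has_vector_derivative c') (at t)" "c t \<in> P" "a \<in> closure \<Omega>"
  shows "velocity (\<lambda>s. Y (c s)) t a = frechet_derivative G (at (c t, a)) (c', 0)"
  unfolding velocity_def by (rule vector_derivative_at[OF curve_velocity[OF assms]])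

text \<open>The constant family makes results about deformations, such as the nonvanishing Jacobian,
  available for a single diffeomorphism.\<close>

lemma Diff_const_deformation:
  assumes "open \<Omega>" "bounded \<Omega>" "X \<in> Diff \<Omega>"
  obtains G T where "deformation \<Omega> (UNIV :: real set) (\<lambda>p. X) G T"
proof -
  obtain g U where g: "open U" "closure \<Omega> \<subseteq> U" "Cinf_on U g" "\<And>a. a \<in> closure \<Omega> \<Longrightarrow> X a = g a"
    using Diff_deformation[OF assms] by metis
  have oT: "open ((UNIV :: real set) \<times> U)" using g(1) by (simp add: open_Times)
  have "Cinf_on (UNIV \<times> U) (\<lambda>z::real \<times> plane. g (snd z))"
    by (rule Cinf_on_compose[OF g(3,1) oT]) (auto intro: Cinf_on_linear bounded_linear_snd)
  then have "deformation \<Omega> (UNIV :: real set) (\<lambda>p. X) (\<lambda>z. g (snd z)) (UNIV \<times> U)"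
    using assms g oT by unfold_locales auto
  then show ?thesis by (rule that)
qed

lemma Diff_det_nonzero:
  assumes "open \<Omega>" "bounded \<Omega>" "X \<in> Diff \<Omega>" "a \<in> \<Omega>"
  shows "det (jacobian X (at a)) \<noteq> 0"
proof -
  obtain G T where "deformation \<Omega> (UNIV :: real set) (\<lambda>p. X) G T"
    by (rule Diff_const_deformation[OF assms(1-3)])
  then interpret deformation \<Omega> "UNIV :: real set" "\<lambda>p. X" G T .
  show ?thesis using jacobian_Y[OF UNIV_I assms(4)] jac_nonzero[OF UNIV_I in_closure[OF assms(4)]] by simp
qed

text \<open>The data are accompanied by smooth extensions to one common neighbourhood, so that
  integrands built from them can be differentiated at boundary points as well.\<close>

locale fluid =
  fixes \<Omega> :: "plane set" and \<rho>0 b \<rho>e be :: "plane \<Rightarrow> real" and T0 :: "plane set"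
  assumes open_dom: "open \<Omega>" and connected_dom: "connected \<Omega>" and nonempty_dom: "\<Omega> \<noteq> {}"
    and bounded_dom: "bounded \<Omega>" and open_T0: "open T0" and closure_T0: "closure \<Omega> \<subseteq> T0"
    and smooth_\<rho>e: "Cinf_on T0 \<rho>e" and smooth_be: "Cinf_on T0 be"
    and \<rho>_eq: "\<And>x. x \<in> closure \<Omega> \<Longrightarrow> \<rho>0 x = \<rho>e x" and b_eq: "\<And>x. x \<in> closure \<Omega> \<Longrightarrow> b x = be x"
    and \<rho>_pos: "\<And>x. x \<in> \<Omega> \<Longrightarrow> \<rho>0 x > 0"
begin

abbreviation "H \<equiv> mean_height \<Omega> \<rho>0 b"
abbreviation "U \<equiv> potential \<Omega> \<rho>0 b"
abbreviation "M \<equiv> lake_manifold \<Omega> \<rho>0 b"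

definition r :: "plane \<Rightarrow> real" where "r x = H + be x"

lemma smooth_r: "Cinf_on T0 r"
  unfolding r_def[abs_def] by (intro Cinf_on_add Cinf_on_const open_T0 smooth_be)

lemma dom_T0: "x \<in> \<Omega> \<Longrightarrow> x \<in> T0" and dom_closure: "x \<in> \<Omega> \<Longrightarrow> x \<in> closure \<Omega>"
  using closure_subset closure_T0 by blast+

lemma r_eq: "x \<in> closure \<Omega> \<Longrightarrow> r x = H + b x"
  by (simp add: r_def b_eq)

text \<open>In label coordinates the inverse of \<open>X\<close> disappears, and the condition
  becomes the vanishing of an expression that is smooth in the parameters of a family.\<close>

lemma lake_iff:
  "X \<in> M \<longleftrightarrow> X \<in> Diff \<Omega> \<and> (\<forall>a\<in>\<Omega>. \<rho>0 a = r (X a) * \<bar>det (jacobian X (at a))\<bar>)"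
proof -
  have "(\<forall>x\<in>\<Omega>. fluid_density \<Omega> \<rho>0 X x = H + b x) \<longleftrightarrow> (\<forall>a\<in>\<Omega>. \<rho>0 a = r (X a) * \<bar>det (jacobian X (at a))\<bar>)"
    if X: "X \<in> Diff \<Omega>"
  proof -
    have "(\<forall>x\<in>\<Omega>. fluid_density \<Omega> \<rho>0 X x = H + b x) \<longleftrightarrow>
        (\<forall>a\<in>\<Omega>. fluid_density \<Omega> \<rho>0 X (X a) = H + b (X a))"
    proof -
      have "(\<forall>x\<in>X ` \<Omega>. fluid_density \<Omega> \<rho>0 X x = H + b x) \<longleftrightarrow>
          (\<forall>a\<in>\<Omega>. fluid_density \<Omega> \<rho>0 X (X a) = H + b (X a))" by blast
      then show ?thesis by (simp only: Diff_interior(1)[OF X open_dom])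
    qed
    also have "\<dots> \<longleftrightarrow> (\<forall>a\<in>\<Omega>. \<rho>0 a = r (X a) * \<bar>det (jacobian X (at a))\<bar>)"
    proof (rule ball_cong[OF refl])
      fix a assume a: "a \<in> \<Omega>"
      have "\<bar>det (jacobian X (at a))\<bar> > 0" using Diff_det_nonzero[OF open_dom bounded_dom X a] by simp
      moreover have "H + b (X a) = r (X a)"
        using r_eq[OF dom_closure[OF Diff_interior(2)[OF X open_dom a]]] by simp
      ultimately show "fluid_density \<Omega> \<rho>0 X (X a) = H + b (X a) \<longleftrightarrow> \<rho>0 a = r (X a) * \<bar>det (jacobian X (at a))\<bar>"
        unfolding fluid_density_image[OF X open_dom a] by (auto simp: divide_eq_eq)
    qed
    finally show ?thesis .
  qed
  then show ?thesis by (auto simp: lake_manifold_def)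
qed

lemma lake_Diff: "X \<in> M \<Longrightarrow> X \<in> Diff \<Omega>"
  by (simp add: lake_iff)

text \<open>A point of the lake manifold transports \<open>\<rho>0\<close> to \<open>r\<close>, and
  positivity is transported with it.\<close>

lemma r_pos:
  assumes "X \<in> M" "x \<in> \<Omega>"
  shows "r x > 0"
proof -
  have X: "X \<in> Diff \<Omega>" using assms by (simp add: lake_iff)
  define a where "a = inv_into (closure \<Omega>) X x"
  have a: "a \<in> \<Omega>" "X a = x" using Diff_interior(3,5)[OF X open_dom assms(2)] by (auto simp: a_def)
  then have "\<rho>0 a = r x * \<bar>det (jacobian X (at a))\<bar>" using assms(1) by (auto simp: lake_iff)
  then have "0 < r x * \<bar>det (jacobian X (at a))\<bar>" using \<rho>_pos[OF a(1)] by simp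
  then show ?thesis by (simp add: zero_less_mult_iff)
qed

end

section \<open>The potential along a family of diffeomorphisms\<close>

locale fluid_deformation = fluid \<Omega> \<rho>0 b \<rho>e be T0 + deformation \<Omega> P Y G T
  for \<Omega> :: "plane set" and \<rho>0 b \<rho>e be :: "plane \<Rightarrow> real" and T0 :: "plane set"
    and P :: "'p::euclidean_space set" and Y G T
begin

text \<open>The open set on which every ingredient of the energy density is smooth: the Jacobian is
  nonzero, for the absolute value and the quotient, and label and image lie where the data are
  extended.\<close>

definition "T1 = T \<inter> (\<lambda>z. (jac G z, (snd z, G z))) -` ((- {0}) \<times> (T0 \<times> T0))"

definition "N z = \<rho>e (snd z) - r (G z) * \<bar>jac G z\<bar>"
definition "K z = inverse \<bar>jac G z\<bar>"
definition "F z = 1/2 * (N z * N z) * K z"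

lemma open_T1: "open T1"
  unfolding T1_def
  by (rule continuous_open_preimage[OF _ open_T])
    (auto intro!: continuous_on_Pair continuous_on_snd continuous_on_id open_Times open_T0
      Cinf_on_continuous[OF smooth_jac] Cinf_on_continuous[OF smooth_G])

lemma G_closure: "p \<in> P \<Longrightarrow> a \<in> closure \<Omega> \<Longrightarrow> G (p, a) \<in> closure \<Omega>"
  using DiffD(5)[OF Y_Diff[of p], of a] Y_eq[of p a] by simp

lemma sub_T1: "P \<times> closure \<Omega> \<subseteq> T1"
proof safe
  fix p a assume "p \<in> P" "a \<in> closure \<Omega>"
  then show "(p, a) \<in> T1"
    using in_T jac_nonzero G_closure[of p a] closure_T0 by (simp add: T1_def subset_iff)
qed

lemma in_T1: "p \<in> P \<Longrightarrow> a \<in> closure \<Omega> \<Longrightarrow> (p, a) \<in> T1"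
  using sub_T1 by auto

lemma T1_sub: "T1 \<subseteq> T"
  by (auto simp: T1_def)

lemma smooth_T1:
  "Cinf_on T1 G" "Cinf_on T1 (\<lambda>z. \<bar>jac G z\<bar>)" "Cinf_on T1 (\<lambda>z. r (G z))" "Cinf_on T1 (\<lambda>z. \<rho>e (snd z))"
  "Cinf_on T1 (\<lambda>z. be (G z))" "Cinf_on T1 N" "Cinf_on T1 K" "Cinf_on T1 F"
proof -
  show G: "Cinf_on T1 G" by (rule Cinf_on_subset[OF smooth_G T1_sub])
  show j: "Cinf_on T1 (\<lambda>z. \<bar>jac G z\<bar>)"
    by (rule Cinf_on_abs[OF open_T1 Cinf_on_subset[OF smooth_jac T1_sub]]) (auto simp: T1_def)
  show r: "Cinf_on T1 (\<lambda>z. r (G z))"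
    by (rule Cinf_on_compose[OF smooth_r open_T0 open_T1 _ G]) (auto simp: T1_def)
  show "Cinf_on T1 (\<lambda>z. be (G z))"
    by (rule Cinf_on_compose[OF smooth_be open_T0 open_T1 _ G]) (auto simp: T1_def)
  show \<rho>: "Cinf_on T1 (\<lambda>z. \<rho>e (snd z))"
    by (rule Cinf_on_compose[OF smooth_\<rho>e open_T0 open_T1])
      (auto simp: T1_def intro: Cinf_on_linear bounded_linear_snd)
  show N: "Cinf_on T1 N"
    unfolding N_def[abs_def] by (intro Cinf_on_diff Cinf_on_mult open_T1 j r \<rho>)
  show K: "Cinf_on T1 K"
    unfolding K_def[abs_def] by (rule Cinf_on_inverse[OF open_T1 j]) (auto simp: T1_def)
  show "Cinf_on T1 F"
    unfolding F_def[abs_def] by (intro Cinf_on_mult Cinf_on_const open_T1 N K)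
qed

text \<open>The factor \<open>N\<close> is kept in front. Where the defect vanishes, so does the
  first derivative, and the product rule leaves only one term in the second.\<close>

lemma F_derivative:
  assumes "z \<in> T1"
  shows "frechet_derivative F (at z) v = N z * (frechet_derivative N (at z) v * K z +
      1/2 * N z * frechet_derivative K (at z) v)"
proof -
  have N: "(N has_derivative frechet_derivative N (at z)) (at z)"
    and K: "(K has_derivative frechet_derivative K (at z)) (at z)"
    using Cinf_on_has_derivative smooth_T1(6,7) assms by blast+
  have "(F has_derivative (\<lambda>v. N z * (frechet_derivative N (at z) v * K z +
      1/2 * N z * frechet_derivative K (at z) v))) (at z)"
    unfolding F_def by (rule derivative_eq_intros N K refl)+ (simp add: fun_eq_iff algebra_simps)
  from fun_cong[OF frechet_derivative_at[OF this]] show ?thesis by simp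
qed

lemma F_second_derivative:
  assumes "z \<in> T1" "N z = 0"
  shows "frechet_derivative (\<lambda>z. frechet_derivative F (at z) v) (at z) u =
     frechet_derivative N (at z) u * frechet_derivative N (at z) v * K z"
proof -
  define c where "c z = frechet_derivative N (at z) v * K z + 1/2 * N z * frechet_derivative K (at z) v" for z
  have "Cinf_on T1 c"
    unfolding c_def[abs_def]
    by (intro Cinf_on_add Cinf_on_mult Cinf_on_const Cinf_on_derivative open_T1 smooth_T1)
  then have c: "(c has_derivative frechet_derivative c (at z)) (at z)"
    using Cinf_on_has_derivative assms by blast
  have N: "(N has_derivative frechet_derivative N (at z)) (at z)"
    using Cinf_on_has_derivative smooth_T1(6) assms by blast
  have "((\<lambda>z. N z * c z) has_derivative (\<lambda>u. frechet_derivative N (at z) u * c z)) (at z)"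
    using has_derivative_mult[OF N c] assms(2) by simp
  then have "((\<lambda>z. frechet_derivative F (at z) v) has_derivative
      (\<lambda>u. frechet_derivative N (at z) u * c z)) (at z)"
    by (rule has_derivative_transform_within_open[OF _ open_T1 assms(1)]) (simp add: F_derivative c_def)
  from frechet_derivative_at[OF this, symmetric] show ?thesis by (simp add: c_def assms(2))
qed

lemma lake_N: "p \<in> P \<Longrightarrow> Y p \<in> M \<longleftrightarrow> (\<forall>a\<in>\<Omega>. N (p, a) = 0)"
  using Y_Diff Y_eq \<rho>_eq in_closure by (simp add: lake_iff N_def jacobian_Y)

lemma integrable_T1: "Cinf_on T1 h \<Longrightarrow> p \<in> P \<Longrightarrow> (\<lambda>a. h (p, a) :: real) absolutely_integrable_on \<Omega>"
  by (rule integrable_section[OF Cinf_on_continuous sub_T1])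

lemma integrable_dom: "continuous_on (closure \<Omega>) f \<Longrightarrow> f absolutely_integrable_on \<Omega>" for f :: "plane \<Rightarrow> real"
  using absolutely_integrable_continuous_subset_compact[OF compact_closure closure_subset
      open_sets_lebesgue[OF open_\<Omega>]] .

text \<open>Completing the square in the integrand exhibits the density defect \<open>N\<close>.\<close>

lemma potential_eq:
  assumes p: "p \<in> P"
  shows "U (Y p) = integral \<Omega> (\<lambda>a. F (p, a)) + (H * integral \<Omega> \<rho>0 - 1/2 * integral \<Omega> (\<lambda>x. r x * r x))"
proof -
  note X = Y_Diff[OF p]
  let ?d = "\<lambda>a. \<bar>det (jacobian (Y p) (at a))\<bar>"
  have aint: "(\<lambda>a. h a) integrable_on \<Omega>" if "h absolutely_integrable_on \<Omega>" for h :: "plane \<Rightarrow> real"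
    using that set_lebesgue_integral_eq_integral(1) by blast
  define f where "f x = (fluid_density \<Omega> \<rho>0 (Y p) x)\<^sup>2 / 2 - fluid_density \<Omega> \<rho>0 (Y p) x * b x" for x
  define h where "h z = 1/2 * (\<rho>e (snd z) * \<rho>e (snd z)) * K z - \<rho>e (snd z) * be (G z)" for z
  have sh: "Cinf_on T1 h"
    unfolding h_def[abs_def] by (intro Cinf_on_diff Cinf_on_mult Cinf_on_const open_T1 smooth_T1)
  have fh: "?d a * f (Y p a) = h (p, a)" if a: "a \<in> \<Omega>" for a
  proof -
    have ac: "a \<in> closure \<Omega>" using a by (rule in_closure)
    have "?d a \<noteq> 0" using Diff_det_nonzero[OF open_dom bounded_dom X a] by simp
    then show ?thesis
      using Y_eq[OF p ac] b_eq[OF G_closure[OF p ac]] \<rho>_eq[OF ac]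
      unfolding f_def fluid_density_image[OF X open_dom a] h_def K_def jacobian_Y[OF p a, symmetric]
      by (simp add: field_simps power2_eq_square)
  qed
  have "(\<lambda>a. ?d a * f (Y p a)) absolutely_integrable_on \<Omega> \<longleftrightarrow> (\<lambda>a. h (p, a)) absolutely_integrable_on \<Omega>"
    by (rule set_integrable_cong[OF refl refl]) (rule fh)
  then have "(\<lambda>a. ?d a * f (Y p a)) absolutely_integrable_on \<Omega>"
    using integrable_T1[OF sh p] by simp
  then have "U (Y p) = integral \<Omega> (\<lambda>a. ?d a * f (Y p a))"
    using Diff_change_of_variables(3)[OF X open_dom] by (simp add: potential_def f_def)
  also have "\<dots> = integral \<Omega> (\<lambda>a. h (p, a))"
    by (rule integral_cong) (rule fh)
  \<comment> \<open>The square adds the cross term \<rho> r; since r - b = H, it combines with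
    -\<rho> b to H \<rho>, whose integral is H times the total mass.\<close>
  also have "\<dots> = integral \<Omega> (\<lambda>a. F (p, a) + (H * \<rho>e a - 1/2 * (r (G (p, a)) * r (G (p, a)) * \<bar>jac G (p, a)\<bar>)))"
  proof (rule integral_cong)
    fix a assume a: "a \<in> \<Omega>"
    have "jac G (p, a) \<noteq> 0" using jac_nonzero[OF p in_closure[OF a]] .
    then show "h (p, a) = F (p, a) + (H * \<rho>e a - 1/2 * (r (G (p, a)) * r (G (p, a)) * \<bar>jac G (p, a)\<bar>))"
      by (simp add: h_def F_def N_def K_def r_def field_simps)
  qed
  also have "\<dots> = integral \<Omega> (\<lambda>a. F (p, a)) + (H * integral \<Omega> \<rho>e -
      1/2 * integral \<Omega> (\<lambda>a. r (G (p, a)) * r (G (p, a)) * \<bar>jac G (p, a)\<bar>))"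
  proof -
    have i1: "(\<lambda>a. F (p, a)) integrable_on \<Omega>" by (rule aint[OF integrable_T1[OF smooth_T1(8) p]])
    have i2: "\<rho>e integrable_on \<Omega>" using aint[OF integrable_T1[OF smooth_T1(4) p]] by simp
    have i3: "(\<lambda>a. r (G (p, a)) * r (G (p, a)) * \<bar>jac G (p, a)\<bar>) integrable_on \<Omega>"
      by (rule aint[OF integrable_T1[OF Cinf_on_mult[OF open_T1 Cinf_on_mult[OF open_T1 smooth_T1(3,3)] smooth_T1(2)] p]])
    have i2': "(\<lambda>a. H * \<rho>e a) integrable_on \<Omega>" and i3': "(\<lambda>a. 1/2 * (r (G (p, a)) * r (G (p, a)) * \<bar>jac G (p, a)\<bar>)) integrable_on \<Omega>"
      using integrable_cmul[OF i2, of H] integrable_cmul[OF i3, of "1/2"] by simp_all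
    have "integral \<Omega> (\<lambda>a. F (p, a) + (H * \<rho>e a - 1/2 * (r (G (p, a)) * r (G (p, a)) * \<bar>jac G (p, a)\<bar>))) =
        integral \<Omega> (\<lambda>a. F (p, a)) + (integral \<Omega> (\<lambda>a. H * \<rho>e a) -
        integral \<Omega> (\<lambda>a. 1/2 * (r (G (p, a)) * r (G (p, a)) * \<bar>jac G (p, a)\<bar>)))"
      unfolding integral_add[OF i1 integrable_diff[OF i2' i3']] integral_diff[OF i2' i3'] ..
    then show ?thesis by (simp only: integral_mult_right)
  qed
  also have "integral \<Omega> \<rho>e = integral \<Omega> \<rho>0"
    by (rule integral_cong) (simp add: \<rho>_eq in_closure)
  \<comment> \<open>In Eulerian coordinates the remaining term no longer contains the
    diffeomorphism, so it too is a constant.\<close>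
  also have "integral \<Omega> (\<lambda>a. r (G (p, a)) * r (G (p, a)) * \<bar>jac G (p, a)\<bar>) = integral \<Omega> (\<lambda>x. r x * r x)"
  proof -
    have "continuous_on (closure \<Omega>) r"
      using continuous_on_subset[OF Cinf_on_continuous[OF smooth_r] closure_T0] .
    then have "integral \<Omega> (\<lambda>x. r x * r x) = integral \<Omega> (\<lambda>a. ?d a * (r (Y p a) * r (Y p a)))"
      by (intro Diff_change_of_variables(3)[OF X open_dom] disjI1 integrable_dom continuous_on_mult)
    also have "\<dots> = integral \<Omega> (\<lambda>a. r (G (p, a)) * r (G (p, a)) * \<bar>jac G (p, a)\<bar>)"
      by (rule integral_cong) (simp add: jacobian_Y[OF p] Y_eq[OF p] in_closure)
    finally show ?thesis by simp
  qed
  finally show ?thesis .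
qed

lemma potential_derivative:
  assumes p: "p \<in> P"
  shows "((\<lambda>p. U (Y p)) has_derivative (\<lambda>v. integral \<Omega> (\<lambda>a. frechet_derivative F (at (p, a)) (v, 0)))) (at p)"
proof -
  have "((\<lambda>p. integral \<Omega> (\<lambda>a. F (p, a)) + (H * integral \<Omega> \<rho>0 - 1/2 * integral \<Omega> (\<lambda>x. r x * r x)))
      has_derivative (\<lambda>v. integral \<Omega> (\<lambda>a. frechet_derivative F (at (p, a)) (v, 0)))) (at p)"
    using has_derivative_add[OF has_derivative_integral_section[OF open_T1 smooth_T1(8) sub_T1 p] has_derivative_const]
    by simp
  then show ?thesis
    by (rule has_derivative_transform_within_open[OF _ open_P p]) (simp add: potential_eq)
qed

lemma potential_along:
  assumes "(c has_vector_derivative c') (at t)" "c t \<in> P"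
  shows "((\<lambda>s. U (Y (c s))) has_real_derivative
     integral \<Omega> (\<lambda>a. frechet_derivative F (at (c t, a)) (c', 0))) (at t)"
  by (rule has_real_derivative_along[OF potential_derivative[OF assms(2)] assms(1)])

text \<open>The linearized continuity equation: the density of labels is independent of the
  parameter, and the transport formula gives the rest.\<close>

lemma N_derivative_flow:
  assumes p: "p \<in> P" and a: "a \<in> \<Omega>"
    and u: "\<And>x. x \<in> \<Omega> \<Longrightarrow> frechet_derivative G (at (p, x)) (\<pi>, 0) = u (Y p x)"
    and du: "u differentiable (at (Y p a))"
  shows "frechet_derivative N (at (p, a)) (\<pi>, 0) = - (divergence (\<lambda>x. r x *\<^sub>R u x) (Y p a) * \<bar>jac G (p, a)\<bar>)"
proof -
  have z: "(p, a) \<in> T1" using in_T1[OF p in_closure[OF a]] .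
  let ?m = "\<lambda>z. r (G z) * \<bar>jac G z\<bar>"
  have m: "(?m has_derivative frechet_derivative ?m (at (p, a))) (at (p, a))"
    by (rule Cinf_on_has_derivative[OF Cinf_on_mult[OF open_T1 smooth_T1(3,2)] z])
  have "(\<rho>e has_derivative frechet_derivative \<rho>e (at a)) (at (snd (p, a)))"
    using Cinf_on_has_derivative[OF smooth_\<rho>e dom_T0[OF a]] by simp
  from has_derivative_compose[OF bounded_linear_imp_has_derivative[OF bounded_linear_snd] this, of UNIV]
  have \<rho>: "((\<lambda>z::'p \<times> plane. \<rho>e (snd z)) has_derivative (\<lambda>v. frechet_derivative \<rho>e (at a) (snd v))) (at (p, a))" .
  have "frechet_derivative \<rho>e (at a) 0 = 0"
    by (rule linear_0[OF Cinf_on_linear_derivative[OF smooth_\<rho>e dom_T0[OF a]]])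
  moreover have "frechet_derivative ?m (at (p, a)) (\<pi>, 0) = divergence (\<lambda>x. r x *\<^sub>R u x) (Y p a) * \<bar>jac G (p, a)\<bar>"
  proof (rule weighted_jac_derivative[OF p a _ du])
    show "r differentiable at (Y p a)"
      using Cinf_on_differentiable[OF smooth_r dom_T0[OF Diff_interior(2)[OF Y_Diff[OF p] open_dom a]]] .
  qed (rule u)
  ultimately show ?thesis
    unfolding N_def[abs_def] frechet_derivative_at[OF has_derivative_diff[OF \<rho> m], symmetric] by simp
qed

end

lemma has_vector_derivative_Pair_left: "((\<lambda>s. (s, c)) has_vector_derivative (1, 0)) (at (t::real))"
  by (auto intro!: derivative_eq_intros simp: has_vector_derivative_def)

lemma has_vector_derivative_Pair_right: "((\<lambda>s. (c, s)) has_vector_derivative (0, 1)) (at (t::real))"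
  by (auto intro!: derivative_eq_intros simp: has_vector_derivative_def)

lemma flow_smooth_curve:
  assumes "deformation \<Omega> UNIV (\<lambda>p a. \<phi> p (X a)) G T"
  shows "smooth_curve \<Omega> J (\<lambda>p a. \<phi> p (X a))"
proof -
  interpret deformation \<Omega> UNIV "\<lambda>p a. \<phi> p (X a)" G T by fact
  have "smooth_on (J \<times> closure \<Omega>) (\<lambda>(t, a). \<phi> t (X a))"
    by (rule smooth_onI[OF open_T _ smooth_G]) (use in_T Y_eq in auto)
  then show ?thesis using Y_Diff by (simp add: smooth_curve_def)
qed

context fluid
begin

lemma fluid_deformationI: "deformation \<Omega> P Y G T \<Longrightarrow> fluid_deformation \<Omega> \<rho>0 b \<rho>e be T0 P Y G T"
  by (simp add: fluid_deformation_def fluid_axioms)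

lemma curve_deformation:
  assumes "curve_through \<Omega> A X Y"
  obtains \<delta> G T where "\<delta> > 0" "fluid_deformation \<Omega> \<rho>0 b \<rho>e be T0 {-\<delta><..<\<delta>} Y G T"
    "\<And>s. s \<in> {-\<delta><..<\<delta>} \<Longrightarrow> Y s \<in> A" "\<And>a. a \<in> closure \<Omega> \<Longrightarrow> Y 0 a = X a"
proof -
  obtain \<delta> where \<delta>: "\<delta> > 0" "smooth_curve \<Omega> {-\<delta><..<\<delta>} Y" "\<And>s. s \<in> {-\<delta><..<\<delta>} \<Longrightarrow> Y s \<in> A"
    "\<And>a. a \<in> closure \<Omega> \<Longrightarrow> Y 0 a = X a"
    using assms unfolding curve_through_def by blast
  obtain G T where "deformation \<Omega> {-\<delta><..<\<delta>} Y G T"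
    by (rule smooth_curve_deformation[OF open_dom bounded_dom _ \<delta>(2)]) auto
  then have "fluid_deformation \<Omega> \<rho>0 b \<rho>e be T0 {-\<delta><..<\<delta>} Y G T"
    by (rule fluid_deformationI)
  then show ?thesis by (rule that[OF \<delta>(1) _ \<delta>(3,4)])
qed

text \<open>Maps are total functions of which only the values on the closed domain matter. A curve
  through \<open>X\<close> agrees with \<open>X\<close> only there, so derivatives must be
  insensitive to other values.\<close>

lemma frechet_derivative_cong_dom:
  assumes "Cinf_on \<Omega> f" "a \<in> \<Omega>" "\<And>x. x \<in> \<Omega> \<Longrightarrow> g x = f x"
  shows "frechet_derivative g (at a) = frechet_derivative f (at a)"
proof -
  have "(g has_derivative frechet_derivative f (at a)) (at a)"
    by (rule has_derivative_transform_within_open[OF Cinf_on_has_derivative[OF assms(1,2)] open_dom assms(2)])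
      (simp add: assms(3))
  then show ?thesis by (rule frechet_derivative_at[symmetric])
qed

lemma jacobian_cong_dom:
  assumes "X \<in> Diff \<Omega>" "a \<in> \<Omega>" "\<And>x. x \<in> closure \<Omega> \<Longrightarrow> Y x = X x"
  shows "frechet_derivative Y (at a) = frechet_derivative X (at a)" "jacobian Y (at a) = jacobian X (at a)"
proof -
  show "frechet_derivative Y (at a) = frechet_derivative X (at a)"
    by (rule frechet_derivative_cong_dom[OF Diff_interior(7)[OF assms(1) open_dom] assms(2)])
      (simp add: assms(3) dom_closure)
  then show "jacobian Y (at a) = jacobian X (at a)" by (simp add: jacobian_def)
qed

lemma lake_cong:
  assumes "X \<in> M" "\<And>a. a \<in> closure \<Omega> \<Longrightarrow> Y a = X a"
  shows "Y \<in> M"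
proof -
  have X: "X \<in> Diff \<Omega>" by (rule lake_Diff[OF assms(1)])
  then have "Y \<in> Diff \<Omega>" by (rule Diff_cong) (rule assms(2))
  then show ?thesis
    using assms(1) jacobian_cong_dom(2)[OF X _ assms(2)] assms(2) dom_closure by (simp add: lake_iff)
qed

section \<open>Critical points of the potential\<close>

lemma lake_imp_critical:
  assumes "X \<in> M"
  shows "critical_point \<Omega> U X"
  unfolding critical_point_def
proof (intro conjI allI impI)
  show "X \<in> Diff \<Omega>" by (rule lake_Diff[OF assms])
  fix Y assume Y: "curve_through \<Omega> (Diff \<Omega>) X Y"
  obtain \<delta> G T where \<delta>: "\<delta> > 0" and D: "fluid_deformation \<Omega> \<rho>0 b \<rho>e be T0 {-\<delta><..<\<delta>} Y G T"
    and Y0: "\<And>a. a \<in> closure \<Omega> \<Longrightarrow> Y 0 a = X a"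
    using curve_deformation[OF Y] by metis
  interpret D: fluid_deformation \<Omega> \<rho>0 b \<rho>e be T0 "{-\<delta><..<\<delta>}" Y G T by (rule D)
  have 0: "0 \<in> {-\<delta><..<\<delta>}" using \<delta> by simp
  have "Y 0 \<in> M" by (rule lake_cong[OF assms Y0])
  then have N: "D.N (0, a) = 0" if "a \<in> \<Omega>" for a using D.lake_N[OF 0] that by blast
  have "((\<lambda>s. U (Y s)) has_real_derivative
     integral \<Omega> (\<lambda>a. frechet_derivative D.F (at (0, a)) (1, 0))) (at 0)"
    by (rule D.potential_along[where c = "\<lambda>s. s" and c' = 1, OF _ 0]) (rule has_vector_derivative_id)
  also have "integral \<Omega> (\<lambda>a. frechet_derivative D.F (at (0, a)) (1, 0)) = integral \<Omega> (\<lambda>a. 0)"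
    by (rule integral_cong) (simp add: D.F_derivative D.in_T1[OF 0] dom_closure N)
  finally show "((\<lambda>s. U (Y s)) has_real_derivative 0) (at 0)" by simp
qed

lemma integrable_continuous_dom:
  fixes f :: "plane \<Rightarrow> real"
  assumes "continuous_on (closure \<Omega>) f"
  shows "f absolutely_integrable_on \<Omega>" "f integrable_on \<Omega>"
proof -
  show "f absolutely_integrable_on \<Omega>"
    by (rule absolutely_integrable_continuous_subset_compact[OF _ closure_subset open_sets_lebesgue[OF open_dom] assms])
      (use bounded_dom in simp)
  then show "f integrable_on \<Omega>" by (rule set_lebesgue_integral_eq_integral(1))
qed

lemma continuous_on_data: "continuous_on (closure \<Omega>) \<rho>0" "continuous_on (closure \<Omega>) b" "continuous_on (closure \<Omega>) r"
  using continuous_on_subset[OF Cinf_on_continuous closure_T0] smooth_\<rho>e smooth_be smooth_r \<rho>_eq b_eq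
  by (auto cong: continuous_on_cong)

lemma measure_dom: "\<Omega> \<in> lmeasurable" "measure lebesgue \<Omega> > 0"
proof -
  show l: "\<Omega> \<in> lmeasurable" by (rule bounded_set_imp_lmeasurable[OF bounded_dom open_sets_lebesgue[OF open_dom]])
  have "\<not> negligible \<Omega>" using open_dom nonempty_dom open_not_negligible by blast
  then show "measure lebesgue \<Omega> > 0"
    using l negligible_iff_measure0[OF l] measure_nonneg[of lebesgue \<Omega>] by (simp add: less_le)
qed

lemma integral_const_dom: "integral \<Omega> (\<lambda>x. c) = c * measure lebesgue \<Omega>" for c :: real
  using lmeasure_integral[OF measure_dom(1)] integral_mult_right[of \<Omega> c "\<lambda>x. 1"] by simp

lemma grad_expand:
  fixes q :: "plane \<Rightarrow> real"
  assumes "Cinf_on S q" "x \<in> S"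
  shows "frechet_derivative q (at x) v = (frechet_derivative q (at x) (axis 1 1) *\<^sub>R axis 1 1 +
     frechet_derivative q (at x) (axis 2 1) *\<^sub>R axis 2 1) \<bullet> v"
proof -
  note lin = Cinf_on_linear_derivative[OF assms]
  have "frechet_derivative q (at x) v = frechet_derivative q (at x) (v $ 1 *\<^sub>R axis 1 1 + v $ 2 *\<^sub>R axis 2 1)"
    using plane_expand[of v] by simp
  also have "\<dots> = v $ 1 * frechet_derivative q (at x) (axis 1 1) + v $ 2 * frechet_derivative q (at x) (axis 2 1)"
    by (simp add: linear_add[OF lin] linear_scale[OF lin])
  finally show ?thesis by (simp add: inner_add_left inner_axis' mult.commute)
qed

text \<open>With q = \<rho> - r, the first variation along \<zeta> is the integral of \<rho> times
  the derivative of q in direction \<zeta>, after an integration by parts. For \<zeta> a bump times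
  the gradient of q the integrand is nonnegative, so the gradient vanishes at the centre of the
  bump.\<close>

lemma critical_imp_lake:
  assumes crit: "critical_point \<Omega> U X"
  shows "X \<in> M"
proof -
  have X: "X \<in> Diff \<Omega>" using crit by (simp add: critical_point_def)
  note int = Diff_interior[OF X open_dom]
  define J where "J a = det (jacobian X (at a))" for a
  have J0: "J a \<noteq> 0" if "a \<in> \<Omega>" for a using Diff_det_nonzero[OF open_dom bounded_dom X that] by (simp add: J_def)
  have sJ: "Cinf_on \<Omega> J"
    unfolding J_def[abs_def] jacobian_def det_matrix
    by (intro Cinf_on_det2 open_dom Cinf_on_derivative int(7))
  define R where "R = fluid_density \<Omega> \<rho>0 X"
  have RX: "R (X a) * \<bar>J a\<bar> = \<rho>0 a" if "a \<in> \<Omega>" for a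
    using fluid_density_image[OF X open_dom that, of \<rho>0] J0[OF that] by (simp add: R_def J_def)
  have Rpos: "R x > 0" if x: "x \<in> \<Omega>" for x
    using RX[OF int(3)[OF x]] \<rho>_pos[OF int(3)[OF x]] int(5)[OF x] by (metis abs_ge_zero zero_less_mult_pos2 zero_less_abs_iff J0 int(3) x)
  have sR: "Cinf_on \<Omega> R"
  proof (rule Cinf_on_cong[OF open_dom])
    let ?i = "inv_into (closure \<Omega>) X"
    have s1: "Cinf_on \<Omega> (\<lambda>x. \<rho>e (?i x))"
      by (rule Cinf_on_compose[OF smooth_\<rho>e open_T0 open_dom _ int(8)]) (simp add: dom_T0 int(3))
    have s2: "Cinf_on \<Omega> (\<lambda>x. J (?i x))"
      by (rule Cinf_on_compose[OF sJ open_dom open_dom int(3) int(8)])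
    show "Cinf_on \<Omega> (\<lambda>x. \<rho>e (?i x) / \<bar>J (?i x)\<bar>)"
      by (intro Cinf_on_divide Cinf_on_abs open_dom s1 s2) (simp_all add: J0 int(3))
    show "\<rho>e (?i x) / \<bar>J (?i x)\<bar> = R x" if "x \<in> \<Omega>" for x
      using that by (simp add: R_def fluid_density_def Let_def J_def \<rho>_eq dom_closure int(3))
  qed
  define q where "q x = R x - r x" for x
  have rO: "Cinf_on \<Omega> r" by (rule Cinf_on_subset[OF smooth_r]) (use dom_T0 in auto)
  have sq: "Cinf_on \<Omega> q"
    unfolding q_def[abs_def] by (intro Cinf_on_diff open_dom sR rO)
  define gq where "gq x = frechet_derivative q (at x) (axis 1 1) *\<^sub>R axis 1 1 +
     frechet_derivative q (at x) (axis 2 1) *\<^sub>R (axis 2 1 :: plane)" for x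
  have sgq: "Cinf_on \<Omega> gq"
    unfolding gq_def[abs_def] by (intro Cinf_on_add Cinf_on_scaleR Cinf_on_const open_dom Cinf_on_derivative sq)
  have Dq: "frechet_derivative q (at x) v = gq x \<bullet> v" if "x \<in> \<Omega>" for x v
    unfolding gq_def by (rule grad_expand[OF sq that])
  have zero: "gq x0 = 0" if x0: "x0 \<in> \<Omega>" for x0
  proof -
    obtain e where e: "e > 0" "cball x0 e \<subseteq> \<Omega>" using open_dom x0 open_contains_cball by blast
    define \<theta> where "\<theta> = bump e x0"
    have \<theta>0: "\<theta> x = 0" if "x \<notin> cball x0 e" for x
      using bump_eq_0[OF e(1), of x x0] that by (auto simp: \<theta>_def)
    have s\<theta>: "Cinf_on \<Omega> \<theta>" unfolding \<theta>_def by (rule Cinf_on_subset[OF Cinf_on_bump]) simp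
    define \<zeta> where "\<zeta> x = (if x \<in> \<Omega> then \<theta> x *\<^sub>R gq x else 0)" for x
    have s\<zeta>: "Cinf_on UNIV \<zeta>"
      unfolding \<zeta>_def[abs_def]
      by (rule Cinf_on_extend_zero[OF open_dom closed_cball e(2)])
        (use \<theta>0 in \<open>auto intro!: Cinf_on_scaleR open_dom s\<theta> sgq\<close>)
    have \<zeta>0: "\<zeta> x = 0" if "x \<notin> cball x0 e" for x using \<theta>0[OF that] by (simp add: \<zeta>_def)
    have tan: "tangent_to_boundary \<Omega> \<zeta>"
      by (rule tangent_to_boundary_zero) (use closure_open_frontier(2)[OF open_dom] in \<open>auto simp: \<zeta>_def\<close>)
    obtain \<phi> where fl: "flow \<zeta> \<phi>" using flow_exists[OF s\<zeta> compact_cball \<zeta>0] by blast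
    interpret flow \<zeta> \<phi> by fact
    obtain G T where D: "deformation \<Omega> UNIV (\<lambda>p::real. \<lambda>a. \<phi> p (X a)) G T"
      and G: "\<And>p \<pi> a. a \<in> closure \<Omega> \<Longrightarrow> frechet_derivative G (at (p, a)) (\<pi>, 0) = \<pi> *\<^sub>R \<zeta> (\<phi> p (X a))"
      by (rule flow_deformation[OF open_dom bounded_dom X fl s\<zeta> tan bounded_linear_ident]) (rule that)
    interpret D: fluid_deformation \<Omega> \<rho>0 b \<rho>e be T0 UNIV "\<lambda>p::real. \<lambda>a. \<phi> p (X a)" G T
      by (rule fluid_deformationI[OF D])
    have "curve_through \<Omega> (Diff \<Omega>) X (\<lambda>p a. \<phi> p (X a))"
      unfolding curve_through_def
      by (intro exI[of _ 1] conjI flow_smooth_curve[of \<Omega> \<phi> X, OF D]) (use D.Y_Diff in auto)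
    then have "((\<lambda>s. U (\<lambda>a. \<phi> s (X a))) has_real_derivative 0) (at 0)"
      using crit by (simp add: critical_point_def)
    moreover have "((\<lambda>s. U (\<lambda>a. \<phi> s (X a))) has_real_derivative
        integral \<Omega> (\<lambda>a. frechet_derivative D.F (at (0, a)) (1, 0))) (at 0)"
      by (rule D.potential_along[where c = "\<lambda>s. s" and c' = 1, OF _ UNIV_I]) (rule has_vector_derivative_id)
    ultimately have int0: "integral \<Omega> (\<lambda>a. frechet_derivative D.F (at (0, a)) (1, 0)) = 0"
      using DERIV_unique by blast
    \<comment> \<open>Up to sign, the first variation as a density in Eulerian coordinates: the two
      terms come from varying \<open>N\<close> and \<open>K\<close> in \<open>F\<close>.\<close>
    define E where "E x = q x * divergence (\<lambda>x. r x *\<^sub>R \<zeta> x) x + 1/2 * (q x * q x) * divergence \<zeta> x" for x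
    have d\<zeta>: "\<zeta> differentiable at x" for x by (rule Cinf_on_differentiable[OF s\<zeta> UNIV_I])
    have FE: "frechet_derivative D.F (at (0, a)) (1, 0) = - (\<bar>J a\<bar> * E (X a))" if a: "a \<in> \<Omega>" for a
    proof -
      have ac: "a \<in> closure \<Omega>" by (rule dom_closure[OF a])
      have u: "frechet_derivative G (at (0, x)) (1, 0) = \<zeta> (\<phi> 0 (X x))" if "x \<in> \<Omega>" for x
        using G[OF dom_closure[OF that], of 0 1] by simp
      have jJ: "jac G (0, a) = J a" using D.jacobian_Y[OF UNIV_I a, of 0] by (simp add: J_def)
      have GX: "G (0, a) = X a" using D.Y_eq[OF UNIV_I ac, of 0] by simp
      have z: "(0, a) \<in> D.T1" by (rule D.in_T1[OF UNIV_I ac])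
      have N: "D.N (0, a) = q (X a) * \<bar>J a\<bar>"
        using RX[OF a] \<rho>_eq[OF ac] by (simp add: D.N_def q_def jJ GX left_diff_distrib)
      have DN: "frechet_derivative D.N (at (0, a)) (1, 0) = - (divergence (\<lambda>x. r x *\<^sub>R \<zeta> x) (X a) * \<bar>J a\<bar>)"
        using D.N_derivative_flow[OF UNIV_I a, of 0 1 \<zeta>] u d\<zeta> by (simp add: jJ)
      have Dj: "frechet_derivative (\<lambda>z. \<bar>jac G z\<bar>) (at (0, a)) (1, 0) = divergence \<zeta> (X a) * \<bar>J a\<bar>"
        using D.weighted_jac_derivative[OF UNIV_I a, of 0 1 \<zeta> "\<lambda>x. 1"] u d\<zeta> by (simp add: jJ)
      have j: "((\<lambda>z. \<bar>jac G z\<bar>) has_derivative frechet_derivative (\<lambda>z. \<bar>jac G z\<bar>) (at (0, a))) (at (0, a))"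
        by (rule Cinf_on_has_derivative[OF D.smooth_T1(2) z])
      have Kd: "(D.K has_derivative (\<lambda>v. - (inverse \<bar>jac G (0, a)\<bar> *
          frechet_derivative (\<lambda>z. \<bar>jac G z\<bar>) (at (0, a)) v * inverse \<bar>jac G (0, a)\<bar>))) (at (0, a))"
        unfolding D.K_def[abs_def] by (rule Deriv.has_derivative_inverse[OF _ j]) (simp add: jJ J0[OF a])
      have DK: "frechet_derivative D.K (at (0, a)) (1, 0) = - (inverse \<bar>J a\<bar> * divergence \<zeta> (X a))"
        unfolding frechet_derivative_at[OF Kd, symmetric] Dj jJ using J0[OF a] by simp
      have K: "D.K (0, a) = inverse \<bar>J a\<bar>" by (simp add: D.K_def jJ)
      show ?thesis
        unfolding D.F_derivative[OF z] N DN DK K E_def using J0[OF a] by (simp add: field_simps)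
    qed
    have "(\<lambda>a. - frechet_derivative D.F (at (0, a)) (1, 0)) absolutely_integrable_on \<Omega>"
      by (rule D.integrable_T1[OF Cinf_on_uminus[OF D.open_T1 Cinf_on_derivative[OF D.smooth_T1(8)]] UNIV_I])
    moreover have "(\<lambda>a. - frechet_derivative D.F (at (0, a)) (1, 0)) absolutely_integrable_on \<Omega> \<longleftrightarrow>
        (\<lambda>a. \<bar>det (jacobian X (at a))\<bar> * E (X a)) absolutely_integrable_on \<Omega>"
      by (rule set_integrable_cong[OF refl refl]) (simp add: FE J_def)
    ultimately have Eint: "E absolutely_integrable_on \<Omega>"
      "integral \<Omega> E = integral \<Omega> (\<lambda>a. \<bar>det (jacobian X (at a))\<bar> * E (X a))"
      using Diff_change_of_variables(1,3)[OF X open_dom, of E] by blast+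
    have "integral \<Omega> (\<lambda>a. \<bar>det (jacobian X (at a))\<bar> * E (X a)) =
        integral \<Omega> (\<lambda>a. - frechet_derivative D.F (at (0, a)) (1, 0))"
      by (rule integral_cong) (simp add: FE J_def)
    then have E0: "integral \<Omega> E = 0" using Eint(2) int0 by simp
    \<comment> \<open>The factor for which div(c \<zeta>) - E is (r + q) times the derivative of q
      along \<zeta>: all terms with div \<zeta> cancel. As div(c \<zeta>) has integral zero, this is
      the integration by parts.\<close>
    define c where "c x = q x * r x + 1/2 * (q x * q x)" for x
    have sc: "Cinf_on \<Omega> c"
      unfolding c_def[abs_def] by (intro Cinf_on_add Cinf_on_mult Cinf_on_const open_dom sq rO)
    define v where "v x = (if x \<in> \<Omega> then c x *\<^sub>R \<zeta> x else 0)" for x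
    have sv: "Cinf_on UNIV v"
      unfolding v_def[abs_def]
      by (rule Cinf_on_extend_zero[OF open_dom closed_cball e(2)])
        (use \<zeta>0 in \<open>auto intro!: Cinf_on_scaleR open_dom sc Cinf_on_subset[OF s\<zeta>]\<close>)
    have v0: "v x = 0" if "x \<notin> cball x0 e" for x using \<zeta>0[OF that] by (simp add: v_def)
    have tanv: "tangent_to_boundary \<Omega> v"
      by (rule tangent_to_boundary_zero) (use closure_open_frontier(2)[OF open_dom] in \<open>auto simp: v_def\<close>)
    have divv0: "integral \<Omega> (divergence v) = 0"
      by (rule integral_divergence_zero[OF open_dom bounded_dom sv compact_cball v0 tanv])
    have divv: "divergence v x - E x = R x * \<theta> x * (gq x \<bullet> gq x)" if x: "x \<in> \<Omega>" for x
    proof -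
      have dq: "(q has_derivative frechet_derivative q (at x)) (at x)"
        and dr: "(r has_derivative frechet_derivative r (at x)) (at x)"
        using Cinf_on_has_derivative sq rO x by blast+
      have dc: "(c has_derivative (\<lambda>h. frechet_derivative q (at x) h * r x + q x * frechet_derivative r (at x) h
           + q x * frechet_derivative q (at x) h)) (at x)"
        unfolding c_def by (rule derivative_eq_intros dq dr refl)+ (simp add: fun_eq_iff algebra_simps)
      have "divergence v x = divergence (\<lambda>y. c y *\<^sub>R \<zeta> y) x"
        by (rule divergence_cong[OF open_dom x]) (auto simp: v_def Cinf_on_differentiable[OF sv])
      also have "\<dots> = frechet_derivative c (at x) (\<zeta> x) + c x * divergence \<zeta> x"
        by (rule divergence_scaleR[OF Cinf_on_differentiable[OF sc x] d\<zeta>])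
      also have "\<dots> - E x = (r x + q x) * frechet_derivative q (at x) (\<zeta> x)"
        unfolding E_def divergence_scaleR[OF Cinf_on_differentiable[OF rO x] d\<zeta>]
          frechet_derivative_at[OF dc, symmetric] c_def by (simp add: algebra_simps)
      also have "r x + q x = R x" by (simp add: q_def)
      finally show ?thesis using x by (simp add: Dq \<zeta>_def)
    qed
    have iv: "divergence v integrable_on \<Omega>"
      by (rule integrable_continuous_dom(2)) (rule continuous_on_subset[OF Cinf_on_continuous[OF Cinf_on_divergence[OF open_UNIV sv]]], simp)
    have iE: "E integrable_on \<Omega>" using Eint(1) set_lebesgue_integral_eq_integral(1) by blast
    have "R x0 * \<theta> x0 * (gq x0 \<bullet> gq x0) = 0"
    proof (rule integral_zero_imp_zero[OF open_dom, where x = x0, OF _ _ _ _ x0])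
      show "continuous_on \<Omega> (\<lambda>x. R x * \<theta> x * (gq x \<bullet> gq x))"
        by (intro Cinf_on_continuous Cinf_on_mult Cinf_on_inner open_dom sR s\<theta> sgq)
      show "0 \<le> R x * \<theta> x * (gq x \<bullet> gq x)" if "x \<in> \<Omega>" for x
        using Rpos[OF that] bump_nonneg[of e x0 x] by (simp add: \<theta>_def)
      have i: "(\<lambda>x. divergence v x - E x) integrable_on \<Omega>" by (rule integrable_diff[OF iv iE])
      then show "(\<lambda>x. R x * \<theta> x * (gq x \<bullet> gq x)) integrable_on \<Omega>"
        by (rule integrable_eq) (simp add: divv)
      have "integral \<Omega> (\<lambda>x. R x * \<theta> x * (gq x \<bullet> gq x)) = integral \<Omega> (\<lambda>x. divergence v x - E x)"
        by (rule integral_cong) (simp add: divv)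
      also have "\<dots> = 0" using integral_diff[OF iv iE] divv0 E0 by simp
      finally show "integral \<Omega> (\<lambda>x. R x * \<theta> x * (gq x \<bullet> gq x)) = 0" .
    qed
    moreover have "\<theta> x0 > 0" using bump_pos_iff[OF e(1), of x0 x0] e(1) by (simp add: \<theta>_def)
    ultimately show "gq x0 = 0" using Rpos[OF x0] by simp
  qed
  have "(q has_derivative (\<lambda>h. 0)) (at x within \<Omega>)" if x: "x \<in> \<Omega>" for x
  proof -
    have "frechet_derivative q (at x) = (\<lambda>h. 0)" using Dq[OF x] zero[OF x] by (simp add: fun_eq_iff)
    then show ?thesis using Cinf_on_has_derivative[OF sq x] has_derivative_at_withinI by metis
  qed
  then have const: "q x = q y" if "x \<in> \<Omega>" "y \<in> \<Omega>" for x y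
    using has_derivative_zero_unique_connected[OF open_dom connected_dom _ that(1)] Cinf_on_has_derivative[OF sq]
      that at_within_open[OF _ open_dom] by metis
  \<comment> \<open>It remains to see that the constant is zero. Mass conservation gives
    \<open>R\<close> the integral of \<open>\<rho>0\<close>, and the definition of the mean height
    gives \<open>r\<close> the same integral.\<close>
  obtain x1 where x1: "x1 \<in> \<Omega>" using nonempty_dom by blast
  have ir: "r integrable_on \<Omega>" and ib: "b integrable_on \<Omega>" and i\<rho>: "\<rho>0 integrable_on \<Omega>"
    by (rule integrable_continuous_dom(2)[OF continuous_on_data(3)] integrable_continuous_dom(2)[OF continuous_on_data(2)]
      integrable_continuous_dom(2)[OF continuous_on_data(1)])+
  have "(\<lambda>a. \<bar>det (jacobian X (at a))\<bar> * R (X a)) absolutely_integrable_on \<Omega> \<longleftrightarrow> \<rho>0 absolutely_integrable_on \<Omega>"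
    by (rule set_integrable_cong[OF refl refl]) (simp add: RX[symmetric] J_def mult.commute)
  then have "R absolutely_integrable_on \<Omega>" and IR: "integral \<Omega> R = integral \<Omega> (\<lambda>a. \<bar>det (jacobian X (at a))\<bar> * R (X a))"
    using Diff_change_of_variables(1,3)[OF X open_dom, of R] integrable_continuous_dom(1)[OF continuous_on_data(1)] by blast+
  then have iR: "R integrable_on \<Omega>" using set_lebesgue_integral_eq_integral(1) by blast
  have "integral \<Omega> (\<lambda>a. \<bar>det (jacobian X (at a))\<bar> * R (X a)) = integral \<Omega> \<rho>0"
    by (rule integral_cong) (simp add: RX[symmetric] J_def mult.commute)
  then have IR': "integral \<Omega> R = integral \<Omega> \<rho>0" using IR by simp
  have "integral \<Omega> r = integral \<Omega> (\<lambda>x. H + b x)" by (rule integral_cong) (simp add: r_eq dom_closure)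
  also have "\<dots> = H * measure lebesgue \<Omega> + integral \<Omega> b"
    using integral_add[OF integrable_on_const[OF measure_dom(1)] ib] by (simp add: integral_const_dom)
  also have "H * measure lebesgue \<Omega> = integral \<Omega> \<rho>0 - integral \<Omega> b"
    using measure_dom(2) integral_diff[OF i\<rho> ib] by (simp add: mean_height_def)
  finally have Ir: "integral \<Omega> r = integral \<Omega> \<rho>0" by simp
  have "q x1 * measure lebesgue \<Omega> = integral \<Omega> (\<lambda>x. q x1)" by (simp add: integral_const_dom)
  also have "\<dots> = integral \<Omega> (\<lambda>x. R x - r x)"
    by (rule integral_cong) (metis const x1 q_def)
  also have "\<dots> = 0" using integral_diff[OF iR ir] IR' Ir by simp
  finally have "q x1 = 0" using measure_dom(2) by simp
  then have "R x = r x" if "x \<in> \<Omega>" for x using const[OF that x1] by (simp add: q_def)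
  then show "X \<in> M" using X by (simp add: lake_manifold_def R_def r_eq dom_closure)
qed

text \<open>The derivative of \<open>N\<close> at \<open>X\<close> in the direction \<open>\<xi>\<close>; in Eulerian terms it is
  \<open>- div (r \<zeta>) \<circ> X\<close> times the Jacobian if \<open>\<xi> = \<zeta> \<circ> X\<close>.\<close>

definition defect_derivative :: "field \<Rightarrow> field \<Rightarrow> plane \<Rightarrow> real" where
  "defect_derivative X \<xi> a = - (frechet_derivative r (at (X a)) (\<xi> a) * \<bar>det (jacobian X (at a))\<bar> +
     r (X a) * (sgn (det (jacobian X (at a))) *
       (det2 (frechet_derivative \<xi> (at a) (axis 1 1)) (frechet_derivative X (at a) (axis 2 1)) +
        det2 (frechet_derivative X (at a) (axis 1 1)) (frechet_derivative \<xi> (at a) (axis 2 1)))))"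

lemma defect_derivative_cong:
  assumes "X \<in> Diff \<Omega>" "a \<in> \<Omega>" "\<And>x. x \<in> closure \<Omega> \<Longrightarrow> Y x = X x"
  shows "defect_derivative Y \<xi> a = defect_derivative X \<xi> a"
  using jacobian_cong_dom[OF assms] assms(3)[OF dom_closure[OF assms(2)]] by (simp add: defect_derivative_def)

definition hessian_form :: "field \<Rightarrow> field \<Rightarrow> field \<Rightarrow> real" where
  "hessian_form X \<xi> \<eta> = integral \<Omega> (\<lambda>a. defect_derivative X \<xi> a * defect_derivative X \<eta> a *
     inverse \<bar>det (jacobian X (at a))\<bar>)"

end

text \<open>The derivative of the defect depends on the family only through the point and the
  velocity there. The velocity is not written as an Eulerian field here, so arbitrary families for
  the Hessian are covered.\<close>

lemma (in fluid_deformation) N_derivative: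
  assumes p: "p \<in> P" and a: "a \<in> \<Omega>"
    and \<xi>: "\<And>x. x \<in> \<Omega> \<Longrightarrow> \<xi> x = frechet_derivative G (at (p, x)) (\<pi>, 0)"
  shows "frechet_derivative N (at (p, a)) (\<pi>, 0) = defect_derivative (Y p) \<xi> a"
proof -
  have ac: "a \<in> closure \<Omega>" by (rule in_closure[OF a])
  have z: "(p, a) \<in> T1" "(p, a) \<in> T" using in_T1[OF p ac] in_T[OF p ac] .
  have Gp: "G (p, a) = Y p a" using Y_eq[OF p ac] by simp
  have "r differentiable at (Y p a)"
    using Cinf_on_differentiable[OF smooth_r dom_T0[OF Diff_interior(2)[OF Y_Diff[OF p] open_dom a]]] .
  then have r: "(r has_derivative frechet_derivative r (at (Y p a))) (at (G (p, a)))"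
    by (simp add: frechet_derivative_works Gp)
  have 1: "((\<lambda>z. r (G z)) has_derivative (\<lambda>v. frechet_derivative r (at (Y p a))
      (frechet_derivative G (at (p, a)) v))) (at (p, a))"
    by (rule has_derivative_compose[OF Cinf_on_has_derivative[OF smooth_G z(2)] r])
  have "(\<rho>e has_derivative frechet_derivative \<rho>e (at a)) (at (snd (p, a)))"
    using Cinf_on_has_derivative[OF smooth_\<rho>e dom_T0[OF a]] by simp
  from has_derivative_compose[OF bounded_linear_imp_has_derivative[OF bounded_linear_snd] this, of UNIV]
  have \<rho>: "((\<lambda>z::'p \<times> plane. \<rho>e (snd z)) has_derivative (\<lambda>v. frechet_derivative \<rho>e (at a) (snd v))) (at (p, a))" .
  have \<rho>0: "frechet_derivative \<rho>e (at a) 0 = 0"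
    by (rule linear_0[OF Cinf_on_linear_derivative[OF smooth_\<rho>e dom_T0[OF a]]])
  have "((\<lambda>x. (p, x)) has_derivative (\<lambda>v. (0, v))) (at a)"
    by (auto intro!: derivative_eq_intros)
  from has_derivative_compose[OF this Cinf_on_has_derivative[OF Cinf_on_derivative[OF smooth_G] z(2)]]
  have "((\<lambda>x. frechet_derivative G (at (p, x)) (\<pi>, 0)) has_derivative
      (\<lambda>v. frechet_derivative (\<lambda>z. frechet_derivative G (at z) (\<pi>, 0)) (at (p, a)) (0, v))) (at a)" .
  then have "(\<xi> has_derivative
      (\<lambda>v. frechet_derivative (\<lambda>z. frechet_derivative G (at z) (\<pi>, 0)) (at (p, a)) (0, v))) (at a)"
    by (rule has_derivative_transform_within_open[OF _ open_dom a]) (simp add: \<xi>)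
  from fun_cong[OF frechet_derivative_at[OF this]]
  have D\<xi>: "frechet_derivative (\<lambda>z. frechet_derivative G (at z) (\<pi>, 0)) (at (p, a)) (0, v) =
      frechet_derivative \<xi> (at a) v" for v .
  from fun_cong[OF frechet_derivative_at[OF space_derivative_Y[OF p a]]]
  have DY: "frechet_derivative G (at (p, a)) (0, v) = frechet_derivative (Y p) (at a) v" for v .
  show ?thesis
    unfolding N_def[abs_def]
      frechet_derivative_at[OF has_derivative_diff[OF \<rho> has_derivative_mult[OF 1 abs_jac_derivative[OF p ac]]], symmetric]
      jac_derivative[OF z(2)] D\<xi> DY \<xi>[OF a, symmetric]
    by (simp add: \<rho>0 defect_derivative_def jacobian_Y[OF p a] Gp)
qed

context fluid
begin

section \<open>The Hessian on the lake manifold\<close>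

lemma family_deformation:
  assumes "two_parameter_family \<Omega> X \<xi> \<eta> \<delta> Y"
  obtains G T where "fluid_deformation \<Omega> \<rho>0 b \<rho>e be T0 ({-\<delta><..<\<delta>} \<times> {-\<delta><..<\<delta>}) (\<lambda>p. Y (fst p) (snd p)) G T"
proof -
  have sm: "smooth_on (({-\<delta><..<\<delta>} \<times> {-\<delta><..<\<delta>}) \<times> closure \<Omega>) (\<lambda>((s, t), a). Y s t a)"
    and Y: "\<forall>s\<in>{-\<delta><..<\<delta>}. \<forall>t\<in>{-\<delta><..<\<delta>}. Y s t \<in> Diff \<Omega>"
    using assms unfolding two_parameter_family_def by simp_all
  obtain T G where G: "open T" "({-\<delta><..<\<delta>} \<times> {-\<delta><..<\<delta>}) \<times> closure \<Omega> \<subseteq> T" "Cinf_on T G"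
    "\<And>z. z \<in> ({-\<delta><..<\<delta>} \<times> {-\<delta><..<\<delta>}) \<times> closure \<Omega> \<Longrightarrow> (\<lambda>((s, t), a). Y s t a) z = G z"
    using sm unfolding smooth_on_Cinf_on by blast
  have "deformation \<Omega> ({-\<delta><..<\<delta>} \<times> {-\<delta><..<\<delta>}) (\<lambda>p. Y (fst p) (snd p)) G T"
  proof
    show "Y (fst p) (snd p) a = G (p, a)" if "p \<in> {-\<delta><..<\<delta>} \<times> {-\<delta><..<\<delta>}" "a \<in> closure \<Omega>" for p a
      using G(4)[of "(p, a)"] that by (auto simp: case_prod_unfold)
  qed (use G(1-3) Y open_dom bounded_dom in \<open>auto intro: open_Times\<close>)
  then show ?thesis by (intro that fluid_deformationI)
qed

text \<open>Since \<open>N\<close> vanishes at the base point, the mixed second derivative of the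
  energy density is a product of two first derivatives of \<open>N\<close>. It is therefore the same
  for all families with the given velocities.\<close>

lemma family_hessian:
  assumes X: "X \<in> M" and fam: "two_parameter_family \<Omega> X \<xi> \<eta> \<delta> Y"
  shows "\<exists>g. (\<forall>s\<in>{-\<delta><..<\<delta>}. ((\<lambda>t. U (Y s t)) has_real_derivative g s) (at 0)) \<and>
     (g has_real_derivative hessian_form X \<xi> \<eta>) (at 0)"
proof -
  let ?P = "{-\<delta><..<\<delta>} \<times> {-\<delta><..<\<delta>}"
  have \<delta>: "\<delta> > 0" and Y0: "\<And>a. a \<in> closure \<Omega> \<Longrightarrow> Y 0 0 a = X a"
    and v\<xi>: "\<And>a. a \<in> closure \<Omega> \<Longrightarrow> velocity (\<lambda>s. Y s 0) 0 a = \<xi> a"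
    and v\<eta>: "\<And>a. a \<in> closure \<Omega> \<Longrightarrow> velocity (\<lambda>t. Y 0 t) 0 a = \<eta> a"
    using fam unfolding two_parameter_family_def by simp_all
  obtain G T where D: "fluid_deformation \<Omega> \<rho>0 b \<rho>e be T0 ?P (\<lambda>p. Y (fst p) (snd p)) G T"
    by (rule family_deformation[OF fam])
  interpret D: fluid_deformation \<Omega> \<rho>0 b \<rho>e be T0 ?P "\<lambda>p. Y (fst p) (snd p)" G T by (rule D)
  have 0: "(0, 0) \<in> ?P" using \<delta> by simp
  define g where "g s = integral \<Omega> (\<lambda>a. frechet_derivative D.F (at ((s, 0), a)) ((0, 1), 0))" for s
  have "((\<lambda>t. U (Y s t)) has_real_derivative g s) (at 0)" if "s \<in> {-\<delta><..<\<delta>}" for s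
    using D.potential_along[where c = "\<lambda>t. (s, t)" and t = 0, OF has_vector_derivative_Pair_right] that \<delta>
    by (simp add: g_def)
  moreover have "(g has_real_derivative hessian_form X \<xi> \<eta>) (at 0)"
  proof -
    let ?F' = "\<lambda>z. frechet_derivative D.F (at z) ((0, 1), 0)"
    have "((\<lambda>p. integral \<Omega> (\<lambda>a. ?F' (p, a))) has_derivative
        (\<lambda>v. integral \<Omega> (\<lambda>a. frechet_derivative ?F' (at ((0, 0), a)) (v, 0)))) (at (0, 0))"
      by (rule D.has_derivative_integral_section[OF D.open_T1 Cinf_on_derivative[OF D.smooth_T1(8)] D.sub_T1 0])
    from has_real_derivative_along[where c = "\<lambda>s. (s, 0)" and t = 0, OF this has_vector_derivative_Pair_left]
    have "(g has_real_derivative integral \<Omega> (\<lambda>a. frechet_derivative ?F' (at ((0, 0), a)) ((1, 0), 0))) (at 0)"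
      unfolding g_def[abs_def] .
    also have "integral \<Omega> (\<lambda>a. frechet_derivative ?F' (at ((0, 0), a)) ((1, 0), 0)) = hessian_form X \<xi> \<eta>"
      unfolding hessian_form_def
    proof (rule integral_cong)
      fix a assume a: "a \<in> \<Omega>"
      have XD: "X \<in> Diff \<Omega>" by (rule lake_Diff[OF X])
      have "Y 0 0 \<in> M" by (rule lake_cong[OF X Y0])
      then have N0: "D.N ((0, 0), a) = 0" using D.lake_N[OF 0] a by simp
      have \<xi>: "\<xi> x = frechet_derivative G (at ((0, 0), x)) ((1, 0), 0)" if "x \<in> \<Omega>" for x
        using D.velocity_Y[where c = "\<lambda>s. (s, 0)" and t = 0, OF has_vector_derivative_Pair_left _ dom_closure[OF that]]
          v\<xi>[OF dom_closure[OF that]] 0 by simp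
      have \<eta>: "\<eta> x = frechet_derivative G (at ((0, 0), x)) ((0, 1), 0)" if "x \<in> \<Omega>" for x
        using D.velocity_Y[where c = "\<lambda>s. (0, s)" and t = 0, OF has_vector_derivative_Pair_right _ dom_closure[OF that]]
          v\<eta>[OF dom_closure[OF that]] 0 by simp
      have dd: "defect_derivative (Y 0 0) \<zeta> a = defect_derivative X \<zeta> a" for \<zeta>
        by (rule defect_derivative_cong[OF XD a Y0])
      have "frechet_derivative D.N (at ((0, 0), a)) ((1, 0), 0) = defect_derivative X \<xi> a"
        using D.N_derivative[OF 0 a \<xi>] dd by simp
      moreover have "frechet_derivative D.N (at ((0, 0), a)) ((0, 1), 0) = defect_derivative X \<eta> a"
        using D.N_derivative[OF 0 a \<eta>] dd by simp
      moreover have "D.K ((0, 0), a) = inverse \<bar>det (jacobian X (at a))\<bar>"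
        using D.jacobian_Y[OF 0 a] jacobian_cong_dom(2)[OF XD a Y0] by (simp add: D.K_def)
      ultimately show "frechet_derivative ?F' (at ((0, 0), a)) ((1, 0), 0) =
          defect_derivative X \<xi> a * defect_derivative X \<eta> a * inverse \<bar>det (jacobian X (at a))\<bar>"
        using D.F_second_derivative[OF D.in_T1[OF 0 dom_closure[OF a]] N0] by simp
    qed
    finally show ?thesis .
  qed
  ultimately show ?thesis by blast
qed

text \<open>One family pins down the value: the inner derivatives are unique for every
  \<open>s\<close> in the interval, and hence so is the derivative at 0 of the function they form.
  Existence of a family is what makes the description meaningful.\<close>

lemma hessian_eq:
  assumes X: "X \<in> M" and fam: "two_parameter_family \<Omega> X \<xi> \<eta> \<delta> Y"
  shows "hessian \<Omega> U X \<xi> \<eta> = hessian_form X \<xi> \<eta>"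
  unfolding hessian_def
proof (rule the_equality)
  show "has_hessian \<Omega> U X \<xi> \<eta> (hessian_form X \<xi> \<eta>)"
    unfolding has_hessian_def using fam family_hessian[OF X] by blast
  fix h assume "has_hessian \<Omega> U X \<xi> \<eta> h"
  then obtain g where g: "\<forall>s\<in>{-\<delta><..<\<delta>}. ((\<lambda>t. U (Y s t)) has_real_derivative g s) (at 0)"
    "(g has_real_derivative h) (at 0)" using fam unfolding has_hessian_def by blast
  obtain g' where g': "\<forall>s\<in>{-\<delta><..<\<delta>}. ((\<lambda>t. U (Y s t)) has_real_derivative g' s) (at 0)"
    "(g' has_real_derivative hessian_form X \<xi> \<eta>) (at 0)" using family_hessian[OF X fam] by blast
  have "(g' has_real_derivative h) (at 0)"
  proof (rule has_field_derivative_transform_within_open[OF g(2)])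
    show "0 \<in> {-\<delta><..<\<delta>}" using fam by (simp add: two_parameter_family_def)
    show "g s = g' s" if "s \<in> {-\<delta><..<\<delta>}" for s
      using g(1) g'(1) that DERIV_unique by blast
  qed simp
  then show "h = hessian_form X \<xi> \<eta>" using g'(2) DERIV_unique by blast
qed

text \<open>A cutoff near the closed domain replaces \<zeta> by a compactly supported field on the
  plane with the same values on the closure, so that a complete flow exists. The alternative in the
  last clause is there because \<open>X\<close> is not yet known to preserve the closure.\<close>

lemma tangent_Diff_flow:
  assumes "\<nu> \<in> tangent_Diff \<Omega> X"
  obtains w \<phi> where "Cinf_on UNIV w" "tangent_to_boundary \<Omega> w" "flow w \<phi>"
    "\<And>a. a \<in> closure \<Omega> \<Longrightarrow> \<nu> a = w (X a) \<or> X a \<notin> closure \<Omega>"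
proof -
  obtain \<zeta> where \<zeta>: "smooth_on (closure \<Omega>) \<zeta>" "tangent_to_boundary \<Omega> \<zeta>" "\<And>a. a \<in> closure \<Omega> \<Longrightarrow> \<nu> a = \<zeta> (X a)"
    using assms unfolding tangent_Diff_def by blast
  obtain S z where z: "open S" "closure \<Omega> \<subseteq> S" "Cinf_on S z" "\<And>x. x \<in> closure \<Omega> \<Longrightarrow> \<zeta> x = z x"
    using \<zeta>(1) unfolding smooth_on_Cinf_on by blast
  obtain \<theta> :: "plane \<Rightarrow> real" and L where \<theta>: "Cinf_on UNIV \<theta>" "\<And>x. x \<in> closure \<Omega> \<Longrightarrow> \<theta> x = 1"
    "compact L" "L \<subseteq> S" "\<And>x. x \<notin> L \<Longrightarrow> \<theta> x = 0"
    using smooth_cutoff[OF _ z(1,2)] bounded_dom by (metis compact_closure)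
  define w where "w x = (if x \<in> S then \<theta> x *\<^sub>R z x else 0)" for x
  have w: "Cinf_on UNIV w"
    unfolding w_def[abs_def]
    by (rule Cinf_on_extend_zero[OF z(1) compact_imp_closed[OF \<theta>(3)] \<theta>(4)])
      (use \<theta>(5) in \<open>auto intro!: Cinf_on_scaleR z Cinf_on_subset[OF \<theta>(1)]\<close>)
  have w0: "w x = 0" if "x \<notin> L" for x using \<theta>(5)[OF that] by (simp add: w_def)
  have wz: "w x = \<zeta> x" if "x \<in> closure \<Omega>" for x
    using z(2,4) \<theta>(2) that by (auto simp: w_def)
  have "tangent_to_boundary \<Omega> w"
    using \<zeta>(2) wz unfolding tangent_to_boundary_def by (simp add: frontier_def)
  moreover obtain \<phi> where "flow w \<phi>" using flow_exists[OF w \<theta>(3) w0] by blast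
  moreover have "\<nu> a = w (X a) \<or> X a \<notin> closure \<Omega>" if "a \<in> closure \<Omega>" for a
    using \<zeta>(3)[OF that] wz[of "X a"] by auto
  ultimately show ?thesis by (rule that[OF w])
qed

text \<open>For equal velocities both parameters may run along the same flow, through their
  sum.\<close>

lemma flow_family:
  assumes "X \<in> Diff \<Omega>" "Cinf_on UNIV w" "tangent_to_boundary \<Omega> w" "flow w \<phi>"
    "\<And>a. a \<in> closure \<Omega> \<Longrightarrow> \<nu> a = w (X a)"
  shows "two_parameter_family \<Omega> X \<nu> \<nu> 1 (\<lambda>s t a. \<phi> (s + t) (X a))"
proof -
  interpret flow w \<phi> by fact
  let ?\<tau> = "\<lambda>p :: real \<times> real. fst p + snd p"
  have \<tau>: "bounded_linear ?\<tau>"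
    by (intro bounded_linear_add bounded_linear_fst bounded_linear_snd)
  obtain G T where D: "deformation \<Omega> UNIV (\<lambda>p a. \<phi> (?\<tau> p) (X a)) G T"
    "\<And>p \<pi> a. a \<in> closure \<Omega> \<Longrightarrow> frechet_derivative G (at (p, a)) (\<pi>, 0) = ?\<tau> \<pi> *\<^sub>R w (\<phi> (?\<tau> p) (X a))"
    by (rule flow_deformation[OF open_dom bounded_dom assms(1,4,2,3) \<tau>]) (rule that)
  interpret D: deformation \<Omega> UNIV "\<lambda>p a. \<phi> (?\<tau> p) (X a)" G T by (rule D)
  have vel: "velocity (\<lambda>s a. \<phi> s (X a)) 0 a = \<nu> a" if "a \<in> closure \<Omega>" for a
    unfolding velocity_def using vector_derivative_at[OF flow_derivative[of "X a" 0]] assms(5)[OF that] by simp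
  have "smooth_on (({-1<..<1} \<times> {-1<..<1}) \<times> closure \<Omega>) (\<lambda>((s, t), a). \<phi> (s + t) (X a))"
    by (rule smooth_onI[OF D.open_T _ D.smooth_G]) (use D.in_T D.Y_eq in \<open>auto simp: case_prod_unfold\<close>)
  then show ?thesis
    unfolding two_parameter_family_def using D.Y_Diff[of "(s, t)" for s t] vel by simp
qed

text \<open>For a fixed label the defect has derivative - div(r w) times the Jacobian, which is
  zero, so it keeps its initial value 0.\<close>

lemma flow_in_lake:
  assumes X: "X \<in> M" and w: "Cinf_on UNIV w" "tangent_to_boundary \<Omega> w" "flow w \<phi>"
    and div: "\<And>x. x \<in> \<Omega> \<Longrightarrow> divergence (\<lambda>y. r y *\<^sub>R w y) x = 0"
  shows "(\<lambda>a. \<phi> s (X a)) \<in> M"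
proof -
  interpret flow w \<phi> by fact
  obtain G T where D: "deformation \<Omega> UNIV (\<lambda>p::real. \<lambda>a. \<phi> p (X a)) G T"
    and G: "\<And>p \<pi> a. a \<in> closure \<Omega> \<Longrightarrow> frechet_derivative G (at (p, a)) (\<pi>, 0) = \<pi> *\<^sub>R w (\<phi> p (X a))"
    by (rule flow_deformation[OF open_dom bounded_dom lake_Diff[OF X] w(3,1,2) bounded_linear_ident]) (rule that)
  interpret D: fluid_deformation \<Omega> \<rho>0 b \<rho>e be T0 UNIV "\<lambda>p::real. \<lambda>a. \<phi> p (X a)" G T
    by (rule fluid_deformationI[OF D])
  have "D.N (s, a) = 0" if a: "a \<in> \<Omega>" for s a
  proof -
    have "((\<lambda>t. D.N (t, a)) has_real_derivative 0) (at t)" for t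
    proof -
      have "((\<lambda>t. D.N (t, a)) has_real_derivative frechet_derivative D.N (at (t, a)) (1, 0)) (at t)"
        by (rule has_real_derivative_along[where c = "\<lambda>t. (t, a)"])
          (rule Cinf_on_has_derivative[OF D.smooth_T1(6) D.in_T1[OF UNIV_I dom_closure[OF a]]],
            rule has_vector_derivative_Pair_left)
      moreover have "frechet_derivative D.N (at (t, a)) (1, 0) =
          - (divergence (\<lambda>y. r y *\<^sub>R w y) (\<phi> t (X a)) * \<bar>jac G (t, a)\<bar>)"
        by (rule D.N_derivative_flow[OF UNIV_I a])
          (use G dom_closure Cinf_on_differentiable[OF w(1)] in auto)
      ultimately show ?thesis
        using div[OF Diff_interior(2)[OF D.Y_Diff[OF UNIV_I, of t] open_dom a]] by simp
    qed
    then have "D.N (s, a) = D.N (0, a)" using DERIV_isconst_all by blast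
    moreover have "D.N (0, a) = 0" using D.lake_N[OF UNIV_I, of 0] X a by simp
    ultimately show ?thesis by simp
  qed
  then show ?thesis using D.lake_N[OF UNIV_I, of s] by simp
qed

lemma flow_tangent:
  assumes X: "X \<in> M" and w: "Cinf_on UNIV w" "tangent_to_boundary \<Omega> w" "flow w \<phi>"
    and div: "\<And>x. x \<in> \<Omega> \<Longrightarrow> divergence (\<lambda>y. r y *\<^sub>R w y) x = 0"
    and \<nu>: "\<And>a. a \<in> closure \<Omega> \<Longrightarrow> \<nu> a = w (X a)"
  shows "\<nu> \<in> tangent_space \<Omega> M X"
proof -
  interpret flow w \<phi> by fact
  obtain G T where D: "deformation \<Omega> UNIV (\<lambda>p::real. \<lambda>a. \<phi> p (X a)) G T"
    and G: "\<And>p \<pi> a. a \<in> closure \<Omega> \<Longrightarrow> frechet_derivative G (at (p, a)) (\<pi>, 0) = \<pi> *\<^sub>R w (\<phi> p (X a))"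
    by (rule flow_deformation[OF open_dom bounded_dom lake_Diff[OF X] w(3,1,2) bounded_linear_ident]) (rule that)
  have "curve_through \<Omega> M X (\<lambda>s a. \<phi> s (X a))"
    unfolding curve_through_def
    by (intro exI[of _ 1] conjI flow_smooth_curve[of \<Omega> \<phi> X, OF D])
      (use flow_in_lake[OF X w div] in auto)
  moreover have "\<nu> a = velocity (\<lambda>s a. \<phi> s (X a)) 0 a" if "a \<in> closure \<Omega>" for a
    unfolding velocity_def using vector_derivative_at[OF flow_derivative[of "X a" 0]] \<nu>[OF that] by simp
  ultimately show ?thesis unfolding tangent_space_def by blast
qed

lemma metric_zero_imp_zero:
  assumes "continuous_on (closure \<Omega>) \<nu>" "weighted_metric \<Omega> \<rho>0 \<nu> \<nu> = 0" "a \<in> \<Omega>"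
  shows "\<nu> a = 0"
proof -
  have c: "continuous_on (closure \<Omega>) (\<lambda>a. (\<nu> a \<bullet> \<nu> a) * \<rho>0 a)"
    by (intro continuous_on_mult continuous_on_inner assms(1) continuous_on_data)
  have "(\<nu> a \<bullet> \<nu> a) * \<rho>0 a = 0"
    by (rule integral_zero_imp_zero[OF open_dom continuous_on_subset[OF c closure_subset]
          integrable_continuous_dom(2)[OF c] _ _ assms(3)])
      (use assms(2) \<rho>_pos in \<open>auto simp: weighted_metric_def less_imp_le\<close>)
  then show ?thesis using \<rho>_pos[OF assms(3)] by simp
qed

lemma hessian_positive:
  assumes X: "X \<in> M" and \<nu>: "\<nu> \<in> normal_space \<Omega> \<rho>0 M X" and nz: "\<exists>a\<in>\<Omega>. \<nu> a \<noteq> 0"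
  shows "hessian \<Omega> U X \<nu> \<nu> > 0"
proof (rule ccontr)
  assume neg: "\<not> hessian \<Omega> U X \<nu> \<nu> > 0"
  have XD: "X \<in> Diff \<Omega>" by (rule lake_Diff[OF X])
  have "\<nu> \<in> tangent_Diff \<Omega> X" using \<nu> by (simp add: normal_space_def)
  then obtain w \<phi> where w: "Cinf_on UNIV w" "tangent_to_boundary \<Omega> w" "flow w \<phi>"
    and "\<And>a. a \<in> closure \<Omega> \<Longrightarrow> \<nu> a = w (X a) \<or> X a \<notin> closure \<Omega>"
    by (rule tangent_Diff_flow) (rule that)
  then have \<nu>w: "\<nu> a = w (X a)" if "a \<in> closure \<Omega>" for a using DiffD(5)[OF XD that] that by blast
  interpret flow w \<phi> by (rule w(3))
  obtain G T where D: "deformation \<Omega> UNIV (\<lambda>p::real. \<lambda>a. \<phi> p (X a)) G T"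
    and G: "\<And>p \<pi> a. a \<in> closure \<Omega> \<Longrightarrow> frechet_derivative G (at (p, a)) (\<pi>, 0) = \<pi> *\<^sub>R w (\<phi> p (X a))"
    by (rule flow_deformation[OF open_dom bounded_dom XD w(3,1,2) bounded_linear_ident]) (rule that)
  interpret D: fluid_deformation \<Omega> \<rho>0 b \<rho>e be T0 UNIV "\<lambda>p::real. \<lambda>a. \<phi> p (X a)" G T
    by (rule fluid_deformationI[OF D])
  \<comment> \<open>On \<Omega> this is \<open>defect_derivative X \<nu>\<close>; in this form it is
    continuous up to the boundary, which provides integrability of the Hessian density.\<close>
  define L where "L z = frechet_derivative D.N (at z) (1, 0)" for z
  have L: "L (0, a) = defect_derivative X \<nu> a" if "a \<in> \<Omega>" for a
    unfolding L_def using D.N_derivative[OF UNIV_I that, of \<nu> 0 1] G \<nu>w dom_closure by simp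
  have sL: "Cinf_on D.T1 (\<lambda>z. L z * L z * D.K z)"
    unfolding L_def by (intro Cinf_on_mult Cinf_on_derivative D.open_T1 D.smooth_T1)
  have K: "D.K (0, a) > 0" if "a \<in> \<Omega>" for a
    using D.jac_nonzero[OF UNIV_I dom_closure[OF that]] by (simp add: D.K_def)
  have c: "continuous_on (closure \<Omega>) (\<lambda>a. L (0, a) * L (0, a) * D.K (0, a))"
    by (rule continuous_on_compose2[OF Cinf_on_continuous[OF sL], of _ "\<lambda>a. (0, a)"])
      (use D.in_T1 in \<open>auto intro!: continuous_on_Pair continuous_on_const continuous_on_id\<close>)
  have "hessian \<Omega> U X \<nu> \<nu> = hessian_form X \<nu> \<nu>"
    by (rule hessian_eq[OF X flow_family[OF XD w \<nu>w]])
  also have "\<dots> = integral \<Omega> (\<lambda>a. L (0, a) * L (0, a) * D.K (0, a))"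
    unfolding hessian_form_def
    by (rule integral_cong) (use L D.jacobian_Y[OF UNIV_I, of _ 0] in \<open>simp add: D.K_def\<close>)
  finally have h: "hessian \<Omega> U X \<nu> \<nu> = integral \<Omega> (\<lambda>a. L (0, a) * L (0, a) * D.K (0, a))" .
  have "integral \<Omega> (\<lambda>a. L (0, a) * L (0, a) * D.K (0, a)) \<ge> 0"
    by (rule integral_nonneg[OF integrable_continuous_dom(2)[OF c]]) (use K in \<open>simp add: less_imp_le\<close>)
  then have h0: "integral \<Omega> (\<lambda>a. L (0, a) * L (0, a) * D.K (0, a)) = 0" using h neg by simp
  have L0: "L (0, a) = 0" if "a \<in> \<Omega>" for a
  proof -
    have "L (0, a) * L (0, a) * D.K (0, a) = 0"
      by (rule integral_zero_imp_zero[OF open_dom continuous_on_subset[OF c closure_subset]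
            integrable_continuous_dom(2)[OF c] _ h0 that]) (use K in \<open>simp add: less_imp_le\<close>)
    then show ?thesis using K[OF that] by simp
  qed
  have div: "divergence (\<lambda>y. r y *\<^sub>R w y) x = 0" if x: "x \<in> \<Omega>" for x
  proof -
    define a where "a = inv_into (closure \<Omega>) X x"
    have a: "a \<in> \<Omega>" "X a = x" using Diff_interior(3,5)[OF XD open_dom x] by (auto simp: a_def)
    have "L (0, a) = - (divergence (\<lambda>y. r y *\<^sub>R w y) (\<phi> 0 (X a)) * \<bar>jac G (0, a)\<bar>)"
      unfolding L_def
      by (rule D.N_derivative_flow[OF UNIV_I a(1)])
        (use G dom_closure Cinf_on_differentiable[OF w(1)] in auto)
    then show ?thesis using L0[OF a(1)] D.jac_nonzero[OF UNIV_I dom_closure[OF a(1)], of 0] a(2) by simp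
  qed
  have "\<nu> \<in> tangent_space \<Omega> M X" by (rule flow_tangent[OF X w div \<nu>w])
  then have m0: "weighted_metric \<Omega> \<rho>0 \<nu> \<nu> = 0" using \<nu> by (simp add: normal_space_def)
  have "continuous_on (closure \<Omega>) (\<lambda>a. w (X a))"
    by (rule continuous_on_compose2[OF Cinf_on_continuous[OF w(1)] smooth_on_continuous[OF DiffD(1)[OF XD]]]) simp
  then have "continuous_on (closure \<Omega>) \<nu>" using \<nu>w by (simp cong: continuous_on_cong)
  then show False using metric_zero_imp_zero[OF _ m0] nz by blast
qed

theorem lake_constraining: "constraining \<Omega> \<rho>0 U M"
  unfolding constraining_def
  using lake_imp_critical critical_imp_lake lake_Diff hessian_positive by blast

end

section \<open>Right translations preserving the initial density\<close>

lemma Diff_det_compose: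
  assumes "X \<in> Diff \<Omega>" "\<psi> \<in> Diff \<Omega>" "open \<Omega>" "a \<in> \<Omega>"
  shows "det (jacobian (\<lambda>a. X (\<psi> a)) (at a)) = det (jacobian X (at (\<psi> a))) * det (jacobian \<psi> (at a))"
proof -
  have \<psi>a: "\<psi> a \<in> \<Omega>" by (rule Diff_interior(2)[OF assms(2-4)])
  note d\<psi> = Cinf_on_has_derivative[OF Diff_interior(7)[OF assms(2,3)] assms(4)]
  note dX = Cinf_on_has_derivative[OF Diff_interior(7)[OF assms(1,3)] \<psi>a]
  show ?thesis
    unfolding jacobian_def det_matrix frechet_derivative_at[OF has_derivative_compose[OF d\<psi> dX], symmetric]
    by (rule det2_compose[OF has_derivative_linear[OF dX]])
qed

lemma smooth_on_precompose:
  fixes Y :: "'p::euclidean_space \<times> plane \<Rightarrow> plane"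
  assumes "smooth_on (P \<times> closure \<Omega>) Y" "\<psi> \<in> Diff \<Omega>"
  shows "smooth_on (P \<times> closure \<Omega>) (\<lambda>z. Y (fst z, \<psi> (snd z)))"
proof (rule smooth_on_compose[OF assms(1)])
  obtain g U where g: "open U" "closure \<Omega> \<subseteq> U" "Cinf_on U g" "\<And>a. a \<in> closure \<Omega> \<Longrightarrow> \<psi> a = g a"
    using DiffD(1)[OF assms(2)] unfolding smooth_on_Cinf_on by blast
  have oU: "open ((UNIV :: 'p set) \<times> U)" using g(1) by (simp add: open_Times)
  have "Cinf_on (UNIV \<times> U) (\<lambda>z::'p \<times> plane. g (snd z))"
    by (rule Cinf_on_compose[OF g(3,1) oU]) (auto intro: Cinf_on_linear bounded_linear_snd)
  then have c: "Cinf_on (UNIV \<times> U) (\<lambda>z::'p \<times> plane. (fst z, g (snd z)))"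
    by (intro Cinf_on_Pair oU) (auto intro: Cinf_on_linear bounded_linear_fst)
  show "smooth_on (P \<times> closure \<Omega>) (\<lambda>z. (fst z, \<psi> (snd z)))"
    by (rule smooth_onI[OF oU _ c]) (use g in auto)
  show "(\<lambda>z. (fst z, \<psi> (snd z))) ` (P \<times> closure \<Omega>) \<subseteq> P \<times> closure \<Omega>"
    using DiffD(5)[OF assms(2)] by auto
qed

text \<open>Relabellings that preserve the mass measure, the symmetry group of the system. The
  inverse is a parameter of its own, so that each result can be applied in both directions.\<close>

locale right_translation = fluid +
  fixes \<psi> \<psi>' :: field
  assumes \<psi>_Diff: "\<psi> \<in> Diff \<Omega>" "\<psi>' \<in> Diff \<Omega>"
    and \<psi>_inverse: "\<And>a. a \<in> closure \<Omega> \<Longrightarrow> \<psi> (\<psi>' a) = a" "\<And>a. a \<in> closure \<Omega> \<Longrightarrow> \<psi>' (\<psi> a) = a"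
    and \<psi>_density: "\<And>a. a \<in> \<Omega> \<Longrightarrow> \<rho>0 a = \<rho>0 (\<psi> a) * \<bar>det (jacobian \<psi> (at a))\<bar>"
begin

lemma \<psi>_closure: "a \<in> closure \<Omega> \<Longrightarrow> \<psi> a \<in> closure \<Omega>" "a \<in> closure \<Omega> \<Longrightarrow> \<psi>' a \<in> closure \<Omega>"
  using DiffD(5) \<psi>_Diff by blast+

text \<open>A relabelling changes numerator and Jacobian by the same factor, so the Eulerian density
  does not notice it.\<close>

lemma translated_density:
  assumes Z: "Z \<in> Diff \<Omega>" and x: "x \<in> \<Omega>"
  shows "fluid_density \<Omega> \<rho>0 (\<lambda>a. Z (\<psi> a)) x = fluid_density \<Omega> \<rho>0 Z x"
proof -
  have Z\<psi>: "(\<lambda>a. Z (\<psi> a)) \<in> Diff \<Omega>" by (rule Diff_compose[OF Z \<psi>_Diff(1)])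
  define a where "a = inv_into (closure \<Omega>) (\<lambda>a. Z (\<psi> a)) x"
  have a: "a \<in> \<Omega>" "Z (\<psi> a) = x" using Diff_interior(3,5)[OF Z\<psi> open_dom x] by (auto simp: a_def)
  have \<psi>a: "\<psi> a \<in> \<Omega>" by (rule Diff_interior(2)[OF \<psi>_Diff(1) open_dom a(1)])
  have "fluid_density \<Omega> \<rho>0 (\<lambda>a. Z (\<psi> a)) x = \<rho>0 a / \<bar>det (jacobian (\<lambda>a. Z (\<psi> a)) (at a))\<bar>"
    using fluid_density_image[OF Z\<psi> open_dom a(1)] a(2) by simp
  also have "\<dots> = \<rho>0 (\<psi> a) / \<bar>det (jacobian Z (at (\<psi> a)))\<bar>"
    using \<psi>_density[OF a(1)] Diff_det_nonzero[OF open_dom bounded_dom \<psi>_Diff(1) a(1)]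
    by (simp add: Diff_det_compose[OF Z \<psi>_Diff(1) open_dom a(1)] abs_mult)
  also have "\<dots> = fluid_density \<Omega> \<rho>0 Z x"
    using fluid_density_image[OF Z open_dom \<psi>a] a(2) by simp
  finally show ?thesis .
qed

lemma translated_potential: "Z \<in> Diff \<Omega> \<Longrightarrow> U (\<lambda>a. Z (\<psi> a)) = U Z"
  unfolding potential_def by (rule integral_cong) (simp add: translated_density)

lemma translated_lake: "Z \<in> M \<Longrightarrow> (\<lambda>a. Z (\<psi> a)) \<in> M"
  using Diff_compose[OF _ \<psi>_Diff(1)] by (simp add: lake_manifold_def translated_density)

lemma translated_metric:
  assumes "continuous_on (closure \<Omega>) \<xi>" "continuous_on (closure \<Omega>) \<eta>"
    "\<And>a. a \<in> closure \<Omega> \<Longrightarrow> \<xi>' a = \<xi> (\<psi> a)" "\<And>a. a \<in> closure \<Omega> \<Longrightarrow> \<eta>' a = \<eta> (\<psi> a)"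
  shows "weighted_metric \<Omega> \<rho>0 \<xi>' \<eta>' = weighted_metric \<Omega> \<rho>0 \<xi> \<eta>"
proof -
  have "(\<lambda>a. (\<xi> a \<bullet> \<eta> a) * \<rho>0 a) absolutely_integrable_on \<Omega>"
    by (intro integrable_continuous_dom(1) continuous_on_mult continuous_on_inner assms continuous_on_data)
  then have "weighted_metric \<Omega> \<rho>0 \<xi> \<eta> =
      integral \<Omega> (\<lambda>a. \<bar>det (jacobian \<psi> (at a))\<bar> * ((\<xi> (\<psi> a) \<bullet> \<eta> (\<psi> a)) * \<rho>0 (\<psi> a)))"
    unfolding weighted_metric_def using Diff_change_of_variables(3)[OF \<psi>_Diff(1) open_dom] by blast
  also have "\<dots> = weighted_metric \<Omega> \<rho>0 \<xi>' \<eta>'"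
    unfolding weighted_metric_def
  proof (rule integral_cong)
    fix a assume "a \<in> \<Omega>"
    then show "\<bar>det (jacobian \<psi> (at a))\<bar> * ((\<xi> (\<psi> a) \<bullet> \<eta> (\<psi> a)) * \<rho>0 (\<psi> a)) = (\<xi>' a \<bullet> \<eta>' a) * \<rho>0 a"
      using \<psi>_density[of a] assms(3,4)[OF dom_closure] by (simp add: mult_ac)
  qed
  finally show ?thesis by simp
qed

lemma translated_tangent_space:
  assumes X': "\<And>a. a \<in> closure \<Omega> \<Longrightarrow> X' a = X (\<psi> a)" and \<xi>: "\<xi> \<in> tangent_space \<Omega> M X"
    and \<xi>': "\<And>a. a \<in> closure \<Omega> \<Longrightarrow> \<xi>' a = \<xi> (\<psi> a)"
  shows "\<xi>' \<in> tangent_space \<Omega> M X'"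
proof -
  obtain Y where Y: "curve_through \<Omega> M X Y" "\<And>a. a \<in> closure \<Omega> \<Longrightarrow> \<xi> a = velocity Y 0 a"
    using \<xi> unfolding tangent_space_def by blast
  obtain \<delta> where \<delta>: "\<delta> > 0" "smooth_curve \<Omega> {-\<delta><..<\<delta>} Y" "\<forall>s\<in>{-\<delta><..<\<delta>}. Y s \<in> M"
    "\<forall>a\<in>closure \<Omega>. Y 0 a = X a" using Y(1) unfolding curve_through_def by blast
  have "smooth_curve \<Omega> {-\<delta><..<\<delta>} (\<lambda>s a. Y s (\<psi> a))"
    using \<delta>(2) smooth_on_precompose[OF _ \<psi>_Diff(1), of "{-\<delta><..<\<delta>}" "\<lambda>(t, a). Y t a"] Diff_compose[OF _ \<psi>_Diff(1)]
    unfolding smooth_curve_def by (simp add: case_prod_unfold)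
  then have "curve_through \<Omega> M X' (\<lambda>s a. Y s (\<psi> a))"
    unfolding curve_through_def using \<delta> X' \<psi>_closure translated_lake by (intro exI[of _ \<delta>]) auto
  moreover have "\<xi>' a = velocity (\<lambda>s a. Y s (\<psi> a)) 0 a" if "a \<in> closure \<Omega>" for a
    using \<xi>'[OF that] Y(2)[OF \<psi>_closure(1)[OF that]] by (simp add: velocity_def)
  ultimately show ?thesis unfolding tangent_space_def by blast
qed

lemma translated_tangent_Diff:
  assumes "\<And>a. a \<in> closure \<Omega> \<Longrightarrow> X' a = X (\<psi> a)" "\<xi> \<in> tangent_Diff \<Omega> X"
    "\<And>a. a \<in> closure \<Omega> \<Longrightarrow> \<xi>' a = \<xi> (\<psi> a)"
  shows "\<xi>' \<in> tangent_Diff \<Omega> X'"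
  using assms \<psi>_closure unfolding tangent_Diff_def by fastforce

lemma translated_family:
  assumes fam: "two_parameter_family \<Omega> X \<xi> \<eta> \<delta> Y"
    and e: "\<And>a. a \<in> closure \<Omega> \<Longrightarrow> X' a = X (\<psi> a)" "\<And>a. a \<in> closure \<Omega> \<Longrightarrow> \<xi>' a = \<xi> (\<psi> a)"
      "\<And>a. a \<in> closure \<Omega> \<Longrightarrow> \<eta>' a = \<eta> (\<psi> a)"
  shows "two_parameter_family \<Omega> X' \<xi>' \<eta>' \<delta> (\<lambda>s t a. Y s t (\<psi> a))"
proof -
  let ?P = "{-\<delta><..<\<delta>} \<times> {-\<delta><..<\<delta>}"
  have f: "\<delta> > 0" "smooth_on (?P \<times> closure \<Omega>) (\<lambda>((s, t), a). Y s t a)"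
    "\<forall>s\<in>{-\<delta><..<\<delta>}. \<forall>t\<in>{-\<delta><..<\<delta>}. Y s t \<in> Diff \<Omega>"
    "\<forall>a\<in>closure \<Omega>. Y 0 0 a = X a \<and> velocity (\<lambda>s. Y s 0) 0 a = \<xi> a \<and> velocity (\<lambda>t. Y 0 t) 0 a = \<eta> a"
    using fam unfolding two_parameter_family_def by blast+
  have "smooth_on (?P \<times> closure \<Omega>) (\<lambda>((s, t), a). Y s t (\<psi> a))"
    using smooth_on_precompose[OF f(2) \<psi>_Diff(1)] by (simp add: case_prod_unfold)
  moreover have "velocity (\<lambda>s a. Y s 0 (\<psi> a)) 0 a = velocity (\<lambda>s. Y s 0) 0 (\<psi> a)"
    "velocity (\<lambda>t a. Y 0 t (\<psi> a)) 0 a = velocity (\<lambda>t. Y 0 t) 0 (\<psi> a)" for a by (simp_all add: velocity_def)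
  ultimately show ?thesis
    unfolding two_parameter_family_def using f(1,3,4) e \<psi>_closure(1) Diff_compose[OF _ \<psi>_Diff(1)] by simp
qed

end

lemma translation_inverse:
  assumes "right_translation \<Omega> \<rho>0 b \<rho>e be T0 \<psi> \<psi>'"
  shows "right_translation \<Omega> \<rho>0 b \<rho>e be T0 \<psi>' \<psi>"
proof -
  interpret right_translation \<Omega> \<rho>0 b \<rho>e be T0 \<psi> \<psi>' by fact
  show ?thesis
  proof
    fix a assume a: "a \<in> \<Omega>"
    have \<psi>a: "\<psi>' a \<in> \<Omega>" by (rule Diff_interior(2)[OF \<psi>_Diff(2) open_dom a])
    have "((\<lambda>a. a) has_derivative (\<lambda>v. v)) (at a)" by simp
    then have "((\<lambda>a. \<psi> (\<psi>' a)) has_derivative (\<lambda>v. v)) (at a)"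
      by (rule has_derivative_transform_within_open[OF _ open_dom a]) (simp add: \<psi>_inverse dom_closure)
    from frechet_derivative_at[OF this, symmetric]
    have "det (jacobian (\<lambda>a. \<psi> (\<psi>' a)) (at a)) = 1"
      by (simp add: jacobian_def det_matrix det2_def axis_def)
    then have "\<bar>det (jacobian \<psi> (at (\<psi>' a)))\<bar> * \<bar>det (jacobian \<psi>' (at a))\<bar> = 1"
      using Diff_det_compose[OF \<psi>_Diff open_dom a] by (simp flip: abs_mult)
    then show "\<rho>0 a = \<rho>0 (\<psi>' a) * \<bar>det (jacobian \<psi>' (at a))\<bar>"
      using \<psi>_density[OF \<psi>a] \<psi>_inverse(1)[OF dom_closure[OF a]] by (simp add: mult.assoc)
  qed (use \<psi>_Diff \<psi>_inverse in auto)
qed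

context fluid
begin

section \<open>Invariance of normal spaces, Hessian and eigenvalues\<close>

lemma tangent_Diff_continuous:
  assumes "X \<in> Diff \<Omega>" "\<nu> \<in> tangent_Diff \<Omega> X"
  shows "continuous_on (closure \<Omega>) \<nu>"
proof -
  obtain \<zeta> where \<zeta>: "smooth_on (closure \<Omega>) \<zeta>" "\<And>a. a \<in> closure \<Omega> \<Longrightarrow> \<nu> a = \<zeta> (X a)"
    using assms(2) unfolding tangent_Diff_def by blast
  have "continuous_on (closure \<Omega>) (\<lambda>a. \<zeta> (X a))"
    by (rule smooth_on_continuous[OF smooth_on_compose[OF \<zeta>(1) DiffD(1)[OF assms(1)]]])
      (use DiffD(5)[OF assms(1)] in auto)
  then show ?thesis using \<zeta>(2) by (simp cong: continuous_on_cong)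
qed

lemma tangent_space_continuous:
  assumes "\<xi> \<in> tangent_space \<Omega> A X"
  shows "continuous_on (closure \<Omega>) \<xi>"
proof -
  obtain Y where Y: "curve_through \<Omega> A X Y" "\<And>a. a \<in> closure \<Omega> \<Longrightarrow> \<xi> a = velocity Y 0 a"
    using assms unfolding tangent_space_def by blast
  obtain \<delta> G T where \<delta>: "\<delta> > 0" and D: "fluid_deformation \<Omega> \<rho>0 b \<rho>e be T0 {-\<delta><..<\<delta>} Y G T"
    by (rule curve_deformation[OF Y(1)]) (rule that)
  interpret D: fluid_deformation \<Omega> \<rho>0 b \<rho>e be T0 "{-\<delta><..<\<delta>}" Y G T by (rule D)
  have 0: "0 \<in> {-\<delta><..<\<delta>}" using \<delta> by simp
  have "\<xi> a = frechet_derivative G (at (0, a)) (1, 0)" if "a \<in> closure \<Omega>" for a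
    using Y(2)[OF that] D.velocity_Y[where c = "\<lambda>s. s" and t = 0, OF has_vector_derivative_id 0 that] by simp
  moreover have "continuous_on (closure \<Omega>) (\<lambda>a. frechet_derivative G (at (0, a)) (1, 0))"
    by (rule continuous_on_compose2[OF Cinf_on_continuous[OF Cinf_on_derivative[OF D.smooth_G, of "(1, 0)"]], of _ "\<lambda>a. (0, a)"])
      (use D.in_T[OF 0] in \<open>auto intro!: continuous_on_Pair continuous_on_const continuous_on_id\<close>)
  ultimately show ?thesis by (simp cong: continuous_on_cong)
qed

text \<open>Orthogonality must be tested against all tangent vectors at \<open>X'\<close>. These are
  translated back to \<open>X\<close> by the inverse relabelling, and the translation is an
  isometry.\<close>

lemma translated_normal_space:
  assumes "right_translation \<Omega> \<rho>0 b \<rho>e be T0 \<psi> \<psi>'" "X \<in> Diff \<Omega>"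
    and X': "\<And>a. a \<in> closure \<Omega> \<Longrightarrow> X' a = X (\<psi> a)" and \<nu>: "\<nu> \<in> normal_space \<Omega> \<rho>0 M X"
    and \<nu>': "\<And>a. a \<in> closure \<Omega> \<Longrightarrow> \<nu>' a = \<nu> (\<psi> a)"
  shows "\<nu>' \<in> normal_space \<Omega> \<rho>0 M X'"
proof -
  interpret r: right_translation \<Omega> \<rho>0 b \<rho>e be T0 \<psi> \<psi>' by fact
  interpret i: right_translation \<Omega> \<rho>0 b \<rho>e be T0 \<psi>' \<psi> by (rule translation_inverse) fact
  have \<nu>t: "\<nu> \<in> tangent_Diff \<Omega> X" and \<nu>n: "\<And>\<xi>. \<xi> \<in> tangent_space \<Omega> M X \<Longrightarrow> weighted_metric \<Omega> \<rho>0 \<nu> \<xi> = 0"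
    using \<nu> by (auto simp: normal_space_def)
  have "weighted_metric \<Omega> \<rho>0 \<nu>' \<xi>' = 0" if \<xi>': "\<xi>' \<in> tangent_space \<Omega> M X'" for \<xi>'
  proof -
    define \<xi> where "\<xi> a = \<xi>' (\<psi>' a)" for a
    have "\<xi> \<in> tangent_space \<Omega> M X"
      by (rule i.translated_tangent_space[OF _ \<xi>']) (simp_all add: X' r.\<psi>_closure r.\<psi>_inverse \<xi>_def)
    moreover have "weighted_metric \<Omega> \<rho>0 \<nu>' \<xi>' = weighted_metric \<Omega> \<rho>0 \<nu> \<xi>"
      by (rule r.translated_metric[OF tangent_Diff_continuous[OF assms(2) \<nu>t] tangent_space_continuous[OF calculation] \<nu>'])
        (simp_all add: \<xi>_def r.\<psi>_inverse)
    ultimately show ?thesis using \<nu>n by simp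
  qed
  then show ?thesis
    using r.translated_tangent_Diff[OF X' \<nu>t \<nu>'] by (simp add: normal_space_def)
qed

text \<open>The Hessian is a condition on all families, so each family at \<open>X'\<close> is
  translated back to \<open>X\<close>, where the potential takes the same values.\<close>

lemma translated_has_hessian:
  assumes "right_translation \<Omega> \<rho>0 b \<rho>e be T0 \<psi> \<psi>'"
    and e: "\<And>a. a \<in> closure \<Omega> \<Longrightarrow> X' a = X (\<psi> a)" "\<And>a. a \<in> closure \<Omega> \<Longrightarrow> \<xi>' a = \<xi> (\<psi> a)"
      "\<And>a. a \<in> closure \<Omega> \<Longrightarrow> \<eta>' a = \<eta> (\<psi> a)"
    and h: "has_hessian \<Omega> U X \<xi> \<eta> h"
  shows "has_hessian \<Omega> U X' \<xi>' \<eta>' h"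
proof -
  interpret r: right_translation \<Omega> \<rho>0 b \<rho>e be T0 \<psi> \<psi>' by fact
  interpret i: right_translation \<Omega> \<rho>0 b \<rho>e be T0 \<psi>' \<psi> by (rule translation_inverse) fact
  show ?thesis
    unfolding has_hessian_def
  proof (intro conjI allI impI)
    show "\<exists>\<delta> Y. two_parameter_family \<Omega> X' \<xi>' \<eta>' \<delta> Y"
      using h r.translated_family[where X' = X' and X = X and \<xi>' = \<xi>' and \<xi> = \<xi> and \<eta>' = \<eta>' and \<eta> = \<eta>, OF _ e]
      unfolding has_hessian_def by blast
    fix \<delta> Y assume fam: "two_parameter_family \<Omega> X' \<xi>' \<eta>' \<delta> Y"
    have "two_parameter_family \<Omega> X \<xi> \<eta> \<delta> (\<lambda>s t a. Y s t (\<psi>' a))"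
      by (rule i.translated_family[OF fam]) (simp_all add: e r.\<psi>_closure r.\<psi>_inverse)
    then obtain g where g: "\<forall>s\<in>{-\<delta><..<\<delta>}. ((\<lambda>t. U (\<lambda>a. Y s t (\<psi>' a))) has_real_derivative g s) (at 0)"
      "(g has_real_derivative h) (at 0)" using h unfolding has_hessian_def by blast
    have \<delta>: "0 \<in> {-\<delta><..<\<delta>}" and YD: "\<And>s t. s \<in> {-\<delta><..<\<delta>} \<Longrightarrow> t \<in> {-\<delta><..<\<delta>} \<Longrightarrow> Y s t \<in> Diff \<Omega>"
      using fam by (auto simp: two_parameter_family_def)
    have "((\<lambda>t. U (Y s t)) has_real_derivative g s) (at 0)" if s: "s \<in> {-\<delta><..<\<delta>}" for s
      by (rule has_field_derivative_transform_within_open[OF g(1)[rule_format, OF s] _ \<delta>])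
        (use i.translated_potential[OF YD[OF s]] in auto)
    then show "\<exists>g. (\<forall>s\<in>{-\<delta><..<\<delta>}. ((\<lambda>t. U (Y s t)) has_real_derivative g s) (at 0)) \<and>
        (g has_real_derivative h) (at 0)" using g(2) by blast
  qed
qed

text \<open>The defining predicates agree for every value \<open>h\<close>, so the descriptions
  agree whether or not a Hessian exists.\<close>

lemma translated_hessian:
  assumes rt: "right_translation \<Omega> \<rho>0 b \<rho>e be T0 \<psi> \<psi>'"
    and e: "\<And>a. a \<in> closure \<Omega> \<Longrightarrow> X' a = X (\<psi> a)" "\<And>a. a \<in> closure \<Omega> \<Longrightarrow> \<xi>' a = \<xi> (\<psi> a)"
      "\<And>a. a \<in> closure \<Omega> \<Longrightarrow> \<eta>' a = \<eta> (\<psi> a)"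
  shows "hessian \<Omega> U X' \<xi>' \<eta>' = hessian \<Omega> U X \<xi> \<eta>"
proof -
  interpret r: right_translation \<Omega> \<rho>0 b \<rho>e be T0 \<psi> \<psi>' by fact
  have "has_hessian \<Omega> U X \<xi> \<eta> h" if "has_hessian \<Omega> U X' \<xi>' \<eta>' h" for h
    by (rule translated_has_hessian[OF translation_inverse[OF rt] _ _ _ that])
      (simp_all add: e r.\<psi>_closure r.\<psi>_inverse)
  then have "has_hessian \<Omega> U X' \<xi>' \<eta>' h \<longleftrightarrow> has_hessian \<Omega> U X \<xi> \<eta> h" for h
    using translated_has_hessian[where X = X and \<xi> = \<xi> and \<eta> = \<eta> and X' = X' and \<xi>' = \<xi>' and \<eta>' = \<eta>', OF rt e] by blast
  then show ?thesis by (simp add: hessian_def)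
qed

lemma translated_eigenvalue_system:
  assumes rt: "right_translation \<Omega> \<rho>0 b \<rho>e be T0 \<psi> \<psi>'" and X: "X \<in> Diff \<Omega>" "X' \<in> Diff \<Omega>"
    and X': "\<And>a. a \<in> closure \<Omega> \<Longrightarrow> X' a = X (\<psi> a)"
    and ev: "eigenvalue_system \<Omega> \<rho>0 U M X n \<mu>"
  shows "eigenvalue_system \<Omega> \<rho>0 U M X' n \<mu>"
proof -
  interpret r: right_translation \<Omega> \<rho>0 b \<rho>e be T0 \<psi> \<psi>' by fact
  interpret i: right_translation \<Omega> \<rho>0 b \<rho>e be T0 \<psi>' \<psi> by (rule translation_inverse) fact
  obtain e where e: "\<And>i. i < n \<Longrightarrow> e i \<in> normal_space \<Omega> \<rho>0 M X"
    "\<And>i \<eta>. i < n \<Longrightarrow> \<eta> \<in> normal_space \<Omega> \<rho>0 M X \<Longrightarrow>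
        hessian \<Omega> U X (e i) \<eta> = \<mu> i * weighted_metric \<Omega> \<rho>0 (e i) \<eta>"
    "\<And>i j. i < n \<Longrightarrow> j < n \<Longrightarrow> weighted_metric \<Omega> \<rho>0 (e i) (e j) = (if i = j then 1 else 0)"
    using ev unfolding eigenvalue_system_def by blast
  have cont: "continuous_on (closure \<Omega>) \<nu>" if "\<nu> \<in> normal_space \<Omega> \<rho>0 M X" for \<nu>
    using tangent_Diff_continuous[OF X(1)] that by (simp add: normal_space_def)
  define e' where "e' i a = e i (\<psi> a)" for i a
  show ?thesis
    unfolding eigenvalue_system_def
  proof (intro exI[of _ e'] conjI allI impI ballI)
    fix i assume i: "i < n"
    show "e' i \<in> normal_space \<Omega> \<rho>0 M X'"
      by (rule translated_normal_space[OF rt X(1) X' e(1)[OF i]]) (simp_all add: e'_def)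
    fix \<eta>' assume \<eta>': "\<eta>' \<in> normal_space \<Omega> \<rho>0 M X'"
    define \<eta> where "\<eta> a = \<eta>' (\<psi>' a)" for a
    have \<eta>: "\<eta> \<in> normal_space \<Omega> \<rho>0 M X"
      by (rule translated_normal_space[OF translation_inverse[OF rt] X(2) _ \<eta>'])
        (simp_all add: X' r.\<psi>_closure r.\<psi>_inverse \<eta>_def)
    have "hessian \<Omega> U X' (e' i) \<eta>' = hessian \<Omega> U X (e i) \<eta>"
      by (rule translated_hessian[OF rt]) (simp_all add: X' e'_def \<eta>_def r.\<psi>_inverse)
    moreover have "weighted_metric \<Omega> \<rho>0 (e' i) \<eta>' = weighted_metric \<Omega> \<rho>0 (e i) \<eta>"
      by (rule r.translated_metric[OF cont[OF e(1)[OF i]] cont[OF \<eta>]]) (simp_all add: e'_def \<eta>_def r.\<psi>_inverse)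
    ultimately show "hessian \<Omega> U X' (e' i) \<eta>' = \<mu> i * weighted_metric \<Omega> \<rho>0 (e' i) \<eta>'"
      using e(2)[OF i \<eta>] by simp
  next
    fix i j assume ij: "i < n" "j < n"
    have "weighted_metric \<Omega> \<rho>0 (e' i) (e' j) = weighted_metric \<Omega> \<rho>0 (e i) (e j)"
      by (rule r.translated_metric[OF cont[OF e(1)[OF ij(1)]] cont[OF e(1)[OF ij(2)]]]) (simp_all add: e'_def)
    then show "weighted_metric \<Omega> \<rho>0 (e' i) (e' j) = (if i = j then 1 else 0)" using e(3)[OF ij] by simp
  qed
qed

text \<open>Both points transport \<open>\<rho>0\<close> to the same density \<open>r\<close>. The
  map X^{-1} \<circ> Y therefore transports \<open>\<rho>0\<close> to itself: the chain rule for
  determinants compares the two density identities.\<close>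

lemma lake_right_translation:
  assumes X: "X \<in> M" and Y: "Y \<in> M"
  obtains \<psi> \<psi>' where "right_translation \<Omega> \<rho>0 b \<rho>e be T0 \<psi> \<psi>'" "\<And>a. a \<in> closure \<Omega> \<Longrightarrow> Y a = X (\<psi> a)"
proof -
  note XD = lake_Diff[OF X] and YD = lake_Diff[OF Y]
  note dX = DiffD[OF XD] and dY = DiffD[OF YD]
  define \<psi> where "\<psi> a = inv_into (closure \<Omega>) X (Y a)" for a
  define \<psi>' where "\<psi>' a = inv_into (closure \<Omega>) Y (X a)" for a
  have D: "\<psi> \<in> Diff \<Omega>" "\<psi>' \<in> Diff \<Omega>"
    unfolding \<psi>_def[abs_def] \<psi>'_def[abs_def]
    by (rule Diff_compose[OF Diff_inverse(1)[OF XD] YD], rule Diff_compose[OF Diff_inverse(1)[OF YD] XD])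
  have YX: "Y a = X (\<psi> a)" if "a \<in> closure \<Omega>" for a
    using dX(8)[OF dY(5)[OF that]] by (simp add: \<psi>_def)
  have "right_translation \<Omega> \<rho>0 b \<rho>e be T0 \<psi> \<psi>'"
  proof (intro right_translation.intro fluid_axioms, unfold_locales)
    show "\<psi> (\<psi>' a) = a" "\<psi>' (\<psi> a) = a" if "a \<in> closure \<Omega>" for a
      using that dX dY by (simp_all add: \<psi>_def \<psi>'_def)
    fix a assume a: "a \<in> \<Omega>"
    have \<psi>a: "\<psi> a \<in> \<Omega>" by (rule Diff_interior(2)[OF D(1) open_dom a])
    have "\<rho>0 a = r (Y a) * \<bar>det (jacobian Y (at a))\<bar>" using Y a by (simp add: lake_iff)
    also have "jacobian Y (at a) = jacobian (\<lambda>a. X (\<psi> a)) (at a)"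
      by (rule jacobian_cong_dom(2)[OF Diff_compose[OF XD D(1)] a YX])
    also have "det \<dots> = det (jacobian X (at (\<psi> a))) * det (jacobian \<psi> (at a))"
      by (rule Diff_det_compose[OF XD D(1) open_dom a])
    also have "r (Y a) * \<bar>det (jacobian X (at (\<psi> a))) * det (jacobian \<psi> (at a))\<bar> =
        r (X (\<psi> a)) * \<bar>det (jacobian X (at (\<psi> a)))\<bar> * \<bar>det (jacobian \<psi> (at a))\<bar>"
      using YX[OF dom_closure[OF a]] by (simp add: abs_mult)
    also have "r (X (\<psi> a)) * \<bar>det (jacobian X (at (\<psi> a)))\<bar> = \<rho>0 (\<psi> a)" using X \<psi>a by (simp add: lake_iff)
    finally show "\<rho>0 a = \<rho>0 (\<psi> a) * \<bar>det (jacobian \<psi> (at a))\<bar>" .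
  qed (use D in auto)
  then show ?thesis using YX by (rule that)
qed

theorem eigenvalue_system_const:
  assumes "X \<in> M" "Y \<in> M"
  shows "eigenvalue_system \<Omega> \<rho>0 U M X n \<mu> \<longleftrightarrow> eigenvalue_system \<Omega> \<rho>0 U M Y n \<mu>"
proof -
  have "eigenvalue_system \<Omega> \<rho>0 U M Y n \<mu>" if XY: "X \<in> M" "Y \<in> M" "eigenvalue_system \<Omega> \<rho>0 U M X n \<mu>" for X Y
  proof -
    obtain \<psi> \<psi>' where "right_translation \<Omega> \<rho>0 b \<rho>e be T0 \<psi> \<psi>'" "\<And>a. a \<in> closure \<Omega> \<Longrightarrow> Y a = X (\<psi> a)"
      by (rule lake_right_translation[OF XY(1,2)]) (rule that)
    then show ?thesis
      by (rule translated_eigenvalue_system[OF _ lake_Diff[OF \<open>X \<in> M\<close>] lake_Diff[OF \<open>Y \<in> M\<close>] _ XY(3)])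
  qed
  then show ?thesis using assms by blast
qed

text \<open>The points enter only through their eigenvalue systems, so the infima are taken over the
  same set, even if it is empty.\<close>

lemma eigval_const:
  assumes "X \<in> M" "Y \<in> M"
  shows "eigval \<Omega> \<rho>0 U M i X = eigval \<Omega> \<rho>0 U M i Y"
  unfolding eigval_def eigenvalue_system_const[OF assms] ..

end

section \<open>Eulerian fields\<close>

text \<open>Cramer's rule: the coordinates of \<open>y\<close> in the basis \<open>u\<close>,
  \<open>v\<close>. The explicit formula shows smooth dependence on all three vectors.\<close>

definition cramer :: "plane \<Rightarrow> plane \<Rightarrow> plane \<Rightarrow> plane" where
  "cramer u v y = inverse (det2 u v) *\<^sub>R (det2 y v *\<^sub>R axis 1 1 + det2 u y *\<^sub>R axis 2 1)"

lemma linear_cramer: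
  assumes "linear C" "det2 (C (axis 1 1)) (C (axis 2 1)) \<noteq> 0"
  shows "C (cramer (C (axis 1 1)) (C (axis 2 1)) y) = y"
proof -
  let ?u = "C (axis 1 1)" and ?v = "C (axis 2 1)"
  have "det2 y ?v *\<^sub>R ?u + det2 ?u y *\<^sub>R ?v = det2 ?u ?v *\<^sub>R y"
    by (simp add: vec_eq_iff forall_2 det2_def algebra_simps)
  then show ?thesis
    using assms(2) by (simp add: cramer_def linear_add[OF assms(1)] linear_scale[OF assms(1)])
qed

context deformation
begin

definition Yinv :: "'p \<times> plane \<Rightarrow> plane" where
  "Yinv z = inv_into (closure \<Omega>) (Y (fst z)) (snd z)"

lemma Yinv_mem: "p \<in> P \<Longrightarrow> x \<in> \<Omega> \<Longrightarrow> Yinv (p, x) \<in> \<Omega>" "p \<in> P \<Longrightarrow> x \<in> \<Omega> \<Longrightarrow> Y p (Yinv (p, x)) = x"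
  "p \<in> P \<Longrightarrow> a \<in> \<Omega> \<Longrightarrow> Yinv (p, Y p a) = a"
  using Diff_interior[OF Y_Diff open_\<Omega>] by (simp_all add: Yinv_def)

lemma open_P\<Omega>: "open (P \<times> \<Omega>)"
  by (rule open_Times[OF open_P open_\<Omega>])

text \<open>The inverse function theorem for the map (p, a) \<mapsto> (p, G (p, a)). Keeping the
  parameter as a component gives differentiability of the inverse jointly in parameter and
  position.\<close>

lemma Yinv_has_derivative:
  assumes "p \<in> P" "x \<in> \<Omega>"
  defines "z \<equiv> (p, Yinv (p, x))"
  shows "(Yinv has_derivative (\<lambda>v. cramer (frechet_derivative G (at z) (0, axis 1 1))
     (frechet_derivative G (at z) (0, axis 2 1)) (snd v - frechet_derivative G (at z) (fst v, 0)))) (at (p, x))"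
proof -
  define a where "a = Yinv (p, x)"
  have a: "a \<in> \<Omega>" "Y p a = x" using Yinv_mem assms by (simp_all add: a_def)
  have z: "z = (p, a)" by (simp add: z_def a_def)
  have zT: "(p, a) \<in> T" by (rule in_T[OF assms(1) in_closure[OF a(1)]])
  have lin: "linear (frechet_derivative G (at (p, a)))" by (rule Cinf_on_linear_derivative[OF smooth_G zT])
  let ?D = "frechet_derivative G (at (p, a))"
  have linC: "linear (\<lambda>v. ?D (0, v))"
    using has_derivative_linear[OF space_derivative_G[OF zT]] .
  have nz: "det2 (?D (0, axis 1 1)) (?D (0, axis 2 1)) \<noteq> 0"
    using jac_nonzero[OF assms(1) in_closure[OF a(1)]] by (simp add: jac_def)
  let ?g' = "\<lambda>v. (fst v, cramer (?D (0, axis 1 1)) (?D (0, axis 2 1)) (snd v - ?D (fst v, 0)))"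
  have "((\<lambda>y. (fst y, Yinv y)) has_derivative ?g') (at (fst (p, a), G (p, a)))"
  proof (rule has_derivative_inverse_strong[OF open_P\<Omega>, where f = "\<lambda>z. (fst z, G z)" and f' = "\<lambda>v. (fst v, ?D v)"])
    show "(p, a) \<in> P \<times> \<Omega>" using assms a by simp
    show "continuous_on (P \<times> \<Omega>) (\<lambda>z. (fst z, G z))"
      by (intro continuous_on_Pair continuous_on_fst continuous_on_id continuous_on_subset[OF Cinf_on_continuous[OF smooth_G]])
        (use in_T in_closure in auto)
    show "(fst (fst z, G z), Yinv (fst z, G z)) = z" if "z \<in> P \<times> \<Omega>" for z
      using that Yinv_mem(3)[of "fst z" "snd z"] Y_eq[of "fst z" "snd z"] in_closure[of "snd z"] by (cases z) auto
    show "((\<lambda>z. (fst z, G z)) has_derivative (\<lambda>v. (fst v, ?D v))) (at (p, a))"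
      by (intro has_derivative_Pair bounded_linear_imp_has_derivative bounded_linear_fst Cinf_on_has_derivative[OF smooth_G zT])
    show "(\<lambda>v. (fst v, ?D v)) \<circ> ?g' = id"
    proof
      fix v :: "'p \<times> plane"
      let ?w = "cramer (?D (0, axis 1 1)) (?D (0, axis 2 1)) (snd v - ?D (fst v, 0))"
      have "?D (fst v, ?w) = ?D (fst v, 0) + ?D (0, ?w)"
        using linear_add[OF lin, of "(fst v, 0)" "(0, ?w)"] by simp
      also have "?D (0, ?w) = snd v - ?D (fst v, 0)" by (rule linear_cramer[OF linC nz])
      finally show "((\<lambda>v. (fst v, ?D v)) \<circ> ?g') v = id v" by simp
    qed
  qed
  then have "((\<lambda>y. snd (fst y, Yinv y)) has_derivative (\<lambda>v. snd (?g' v))) (at (p, x))"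
    using a Y_eq[OF assms(1) in_closure[OF a(1)]] by (intro bounded_linear.has_derivative[OF bounded_linear_snd]) simp
  then show ?thesis by (simp add: z)
qed

text \<open>Bootstrapping: the derivative is a smooth function of the parameter and of
  \<open>Yinv\<close> itself, so each order of regularity yields the next.\<close>

lemma smooth_Yinv: "Cinf_on (P \<times> \<Omega>) Yinv"
  unfolding Cinf_on_def
proof
  fix k show "Ck_on k (P \<times> \<Omega>) Yinv"
  proof (induction k)
    case 0
    show ?case unfolding Ck_on.simps
    proof (rule continuous_at_imp_continuous_on, rule ballI)
      fix z assume "z \<in> P \<times> \<Omega>"
      then obtain p x where z: "z = (p, x)" "p \<in> P" "x \<in> \<Omega>" by auto
      show "isCont Yinv z" unfolding z(1) by (rule has_derivative_continuous[OF Yinv_has_derivative[OF z(2,3)]])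
    qed
  next
    case (Suc k)
    show ?case
    proof (rule Ck_on_SucI[OF open_P\<Omega>])
      fix z assume "z \<in> P \<times> \<Omega>"
      then obtain p x where z: "z = (p, x)" "p \<in> P" "x \<in> \<Omega>" by auto
      show "(Yinv has_derivative (\<lambda>v. cramer (frechet_derivative G (at (fst z, Yinv z)) (0, axis 1 1))
        (frechet_derivative G (at (fst z, Yinv z)) (0, axis 2 1))
        (snd v - frechet_derivative G (at (fst z, Yinv z)) (fst v, 0)))) (at z)"
        using Yinv_has_derivative[OF z(2,3)] by (simp add: z(1))
    next
      fix v :: "'p \<times> plane"
      define c where "c y = cramer (frechet_derivative G (at y) (0, axis 1 1))
        (frechet_derivative G (at y) (0, axis 2 1)) (snd v - frechet_derivative G (at y) (fst v, 0))" for y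
      have G: "Cinf_on (P \<times> \<Omega>) G" by (rule Cinf_on_subset[OF smooth_G]) (use in_T in_closure in auto)
      have "Cinf_on (P \<times> \<Omega>) c"
        unfolding c_def[abs_def] cramer_def
        by (intro Cinf_on_scaleR Cinf_on_inverse Cinf_on_add Cinf_on_const Cinf_on_diff Cinf_on_det2 Cinf_on_derivative G open_P\<Omega>)
          (use jac_nonzero in_closure in \<open>auto simp: jac_def\<close>)
      then have c: "Ck_on k (P \<times> \<Omega>) c" by (simp add: Cinf_on_def)
      have "Ck_on k (P \<times> \<Omega>) (\<lambda>z. c (fst z, Yinv z))"
      proof (rule Ck_on_compose[OF open_P\<Omega> open_P\<Omega> _ c])
        show "Ck_on k (P \<times> \<Omega>) (\<lambda>z. (fst z, Yinv z))"
          by (rule Ck_on_Pair[OF open_P\<Omega> Ck_on_linear[OF bounded_linear_fst] Suc])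
      qed (use Yinv_mem in auto)
      then show "Ck_on k (P \<times> \<Omega>) (\<lambda>z. cramer (frechet_derivative G (at (fst z, Yinv z)) (0, axis 1 1))
        (frechet_derivative G (at (fst z, Yinv z)) (0, axis 2 1))
        (snd v - frechet_derivative G (at (fst z, Yinv z)) (fst v, 0)))"
        by (simp add: c_def)
    qed
  qed
qed

lemma smooth_eulerian:
  fixes h :: "'p \<times> plane \<Rightarrow> plane"
  assumes "Cinf_on T h"
  shows "Cinf_on (P \<times> \<Omega>) (\<lambda>z. h (fst z, Yinv z))"
proof (rule Cinf_on_compose[OF assms open_T open_P\<Omega>])
  show "Cinf_on (P \<times> \<Omega>) (\<lambda>z. (fst z, Yinv z))"
    by (intro Cinf_on_Pair open_P\<Omega> smooth_Yinv Cinf_on_linear bounded_linear_fst)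
  show "(fst z, Yinv z) \<in> T" if "z \<in> P \<times> \<Omega>" for z
    using that Yinv_mem(1) in_T in_closure by auto
qed

end

section \<open>Curves of diffeomorphisms in Eulerian coordinates\<close>

locale fluid_curve = fluid_deformation \<Omega> \<rho>0 b \<rho>e be T0 I X G T
  for \<Omega> :: "plane set" and \<rho>0 b \<rho>e be :: "plane \<Rightarrow> real" and T0 :: "plane set"
    and I :: "real set" and X G T
begin

definition "vel z = frechet_derivative G (at z) (1, 0)"
definition "acc z = frechet_derivative vel (at z) (1, 0)"

lemma smooth_vel: "Cinf_on T vel" and smooth_acc: "Cinf_on T acc"
  unfolding acc_def[abs_def] vel_def[abs_def] by (intro Cinf_on_derivative smooth_G)+

lemma velocity_eq: "t \<in> I \<Longrightarrow> a \<in> closure \<Omega> \<Longrightarrow> velocity X t a = vel (t, a)"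
  using velocity_Y[where c = "\<lambda>s. s" and c' = 1, OF has_vector_derivative_id] by (simp add: vel_def)

lemma time_derivative:
  assumes "Cinf_on S h" "(t, a) \<in> S"
  shows "((\<lambda>s. h (s, a)) has_vector_derivative frechet_derivative h (at (t, a)) (1, 0)) (at t)"
proof -
  have "((\<lambda>s. h (s, a)) has_derivative (\<lambda>v. frechet_derivative h (at (t, a)) (v *\<^sub>R (1, 0)))) (at t)"
    using has_derivative_compose[OF has_vector_derivative_Pair_left[of a t, unfolded has_vector_derivative_def]
        Cinf_on_has_derivative[OF assms]] .
  then show ?thesis
    unfolding has_vector_derivative_def linear_scale[OF Cinf_on_linear_derivative[OF assms]] .
qed

lemma velocity_derivative:
  assumes "t \<in> I" "a \<in> closure \<Omega>"
  shows "((\<lambda>s. velocity X s a) has_vector_derivative acc (t, a)) (at t)"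
  unfolding has_vector_derivative_def
  by (rule has_derivative_transform_within_open[OF
        time_derivative[OF smooth_vel in_T[OF assms], unfolded has_vector_derivative_def] open_P assms(1),
        folded acc_def])
    (simp add: velocity_eq assms(2))

lemma acceleration_eq: "t \<in> I \<Longrightarrow> a \<in> closure \<Omega> \<Longrightarrow> acceleration X t a = acc (t, a)"
  unfolding acceleration_def by (rule vector_derivative_at[OF velocity_derivative])

lemma smooth_acceleration:
  assumes t: "t \<in> I"
  shows "smooth_on (closure \<Omega>) (acceleration X t)"
proof (rule smooth_onI)
  have c: "continuous_on UNIV (\<lambda>x::plane. (t, x))" by (intro continuous_intros)
  show o: "open ((\<lambda>x. (t, x)) -` T)" by (rule open_vimage[OF open_T c])
  show "closure \<Omega> \<subseteq> (\<lambda>x. (t, x)) -` T" using in_T[OF t] by auto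
  show "Cinf_on ((\<lambda>x. (t, x)) -` T) (\<lambda>x. acc (t, x))"
    by (rule Cinf_on_compose[OF smooth_acc open_T o]) (auto intro!: Cinf_on_Pair Cinf_on_const Cinf_on_ident o)
qed (simp add: acceleration_eq t)

abbreviation "u \<equiv> eulerian_velocity \<Omega> X"

lemma u_eq: "t \<in> I \<Longrightarrow> x \<in> \<Omega> \<Longrightarrow> u t x = vel (t, Yinv (t, x))"
  using velocity_eq Yinv_mem(1) in_closure by (simp add: eulerian_velocity_def Yinv_def)

lemma u_X: "t \<in> I \<Longrightarrow> a \<in> \<Omega> \<Longrightarrow> u t (X t a) = vel (t, a)"
  using u_eq[of t "X t a"] Diff_interior(2)[OF Y_Diff open_dom] Yinv_mem(3) by simp

lemma smooth_u: "Cinf_on (I \<times> \<Omega>) (\<lambda>z. u (fst z) (snd z))"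
  by (rule Cinf_on_cong[OF open_P\<Omega> _ smooth_eulerian[OF smooth_vel]]) (auto simp: u_eq)

lemma smooth_u_space:
  assumes "t \<in> I"
  shows "Cinf_on \<Omega> (u t)"
  using Cinf_on_compose[OF smooth_u open_P\<Omega> open_dom, of "\<lambda>x. (t, x)"] assms
  by (simp add: Cinf_on_Pair Cinf_on_const Cinf_on_ident open_dom)

text \<open>The acceleration field in Eulerian coordinates, jointly smooth in time and position; its
  negative is to become the pressure gradient.\<close>

definition "A z = acc (fst z, Yinv z)"

lemma smooth_A: "Cinf_on (I \<times> \<Omega>) A"
  unfolding A_def[abs_def] by (rule smooth_eulerian[OF smooth_acc])

lemma A_X: "t \<in> I \<Longrightarrow> a \<in> \<Omega> \<Longrightarrow> A (t, X t a) = acceleration X t a"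
  by (simp add: A_def Yinv_mem(3) acceleration_eq in_closure)

text \<open>Differentiating the identity u(t, X t a) = velocity in time along a particle path: the
  chain rule produces the partial time derivative and the convective term.\<close>

lemma material_derivative:
  assumes t: "t \<in> I" and x: "x \<in> \<Omega>"
  shows "vector_derivative (\<lambda>s. u s x) (at t) + frechet_derivative (u t) (at x) (u t x) = A (t, x)"
proof -
  define a where "a = Yinv (t, x)"
  have a: "a \<in> \<Omega>" "X t a = x" using Yinv_mem[OF t x] by (simp_all add: a_def)
  have ac: "a \<in> closure \<Omega>" by (rule in_closure[OF a(1)])
  let ?u = "\<lambda>z. u (fst z) (snd z)"
  have z: "(t, x) \<in> I \<times> \<Omega>" using t x by simp
  let ?D = "frechet_derivative ?u (at (t, x))"
  have D: "(?u has_derivative ?D) (at (t, x))" by (rule Cinf_on_has_derivative[OF smooth_u z])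
  have lin: "linear ?D" by (rule Cinf_on_linear_derivative[OF smooth_u z])
  have 1: "vector_derivative (\<lambda>s. u s x) (at t) = ?D (1, 0)"
    using vector_derivative_at[OF time_derivative[OF smooth_u z]] by simp
  have "((\<lambda>y. (t, y)) has_derivative (\<lambda>v. (0, v))) (at x)" by (auto intro!: derivative_eq_intros)
  from has_derivative_compose[OF this D] have "(u t has_derivative (\<lambda>v. ?D (0, v))) (at x)" by simp
  from fun_cong[OF frechet_derivative_at[OF this]]
  have 2: "frechet_derivative (u t) (at x) v = ?D (0, v)" for v by simp
  have "((\<lambda>s. X s a) has_vector_derivative vel (t, a)) (at t)"
    using curve_velocity[where c = "\<lambda>s. s" and c' = 1, OF has_vector_derivative_id t ac] by (simp add: vel_def)
  then have "((\<lambda>s. (s, X s a)) has_vector_derivative (1, vel (t, a))) (at t)"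
    unfolding has_vector_derivative_def by (auto intro!: derivative_eq_intros)
  then have "((\<lambda>s. ?u (s, X s a)) has_derivative (\<lambda>h. ?D (h *\<^sub>R (1, vel (t, a))))) (at t)"
    unfolding has_vector_derivative_def by (rule has_derivative_compose) (use D a(2) in simp)
  then have "((\<lambda>s. velocity X s a) has_derivative (\<lambda>h. h *\<^sub>R ?D (1, vel (t, a)))) (at t)"
    unfolding linear_scale[OF lin]
    by (rule has_derivative_transform_within_open[OF _ open_P t]) (simp add: u_X a(1) velocity_eq ac)
  then have "acceleration X t a = ?D (1, vel (t, a))"
    unfolding acceleration_def by (intro vector_derivative_at) (simp add: has_vector_derivative_def)
  moreover have "?D (1, vel (t, a)) = ?D (1, 0) + ?D (0, vel (t, a))"
    using linear_add[OF lin, of "(1, 0)" "(0, vel (t, a))"] by simp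
  moreover have "u t x = vel (t, a)" using u_X[OF t a(1)] a(2) by simp
  moreover have "A (t, x) = acceleration X t a" using A_X[OF t a(1)] a(2) by simp
  ultimately show ?thesis by (simp add: 1 2)
qed

lemma N_time_derivative:
  assumes t: "t \<in> I" and a: "a \<in> \<Omega>"
  shows "((\<lambda>s. N (s, a)) has_real_derivative - (divergence (\<lambda>x. r x *\<^sub>R u t x) (X t a) * \<bar>jac G (t, a)\<bar>)) (at t)"
proof -
  have "frechet_derivative N (at (t, a)) (1, 0) = - (divergence (\<lambda>x. r x *\<^sub>R u t x) (X t a) * \<bar>jac G (t, a)\<bar>)"
  proof (rule N_derivative_flow[OF t a])
    show "frechet_derivative G (at (t, x)) (1, 0) = u t (X t x)" if "x \<in> \<Omega>" for x
      using u_X[OF t that] by (simp add: vel_def)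
    show "u t differentiable at (X t a)"
      using Cinf_on_differentiable[OF smooth_u_space[OF t] Diff_interior(2)[OF Y_Diff[OF t] open_dom a]] .
  qed
  then show ?thesis
    using time_derivative[OF smooth_T1(6) in_T1[OF t in_closure[OF a]]]
    by (simp add: has_real_derivative_iff_has_vector_derivative)
qed

lemma divergence_r:
  assumes "t \<in> I" "x \<in> \<Omega>"
  shows "divergence (\<lambda>y. (H + b y) *\<^sub>R u t y) x = divergence (\<lambda>y. r y *\<^sub>R u t y) x"
proof (rule divergence_cong[symmetric, OF open_dom assms(2)])
  show "r y *\<^sub>R u t y = (H + b y) *\<^sub>R u t y" if "y \<in> \<Omega>" for y
    using that by (simp add: r_eq in_closure)
  have "Cinf_on \<Omega> (\<lambda>y. r y *\<^sub>R u t y)"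
    by (intro Cinf_on_scaleR open_dom Cinf_on_subset[OF smooth_r] smooth_u_space assms(1)) (use dom_T0 in auto)
  then show "(\<lambda>y. r y *\<^sub>R u t y) differentiable at x" by (rule Cinf_on_differentiable[OF _ assms(2)])
qed

text \<open>The time derivative of the defect at a label is minus the weighted divergence times the
  Jacobian. Vanishing divergence therefore means that the defect is constant in time, and on an
  interval the membership at \<open>t0\<close> spreads to all times.\<close>

lemma stays_in_lake_iff:
  assumes I: "is_interval I" and t0: "t0 \<in> I"
  shows "(\<forall>t\<in>I. X t \<in> M) \<longleftrightarrow>
    X t0 \<in> M \<and> (\<forall>t\<in>I. \<forall>x\<in>\<Omega>. divergence (\<lambda>y. (H + b y) *\<^sub>R u t y) x = 0)"
proof (intro iffI conjI ballI)
  assume L: "\<forall>t\<in>I. X t \<in> M"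
  show "X t0 \<in> M" using L t0 by blast
  fix t x assume t: "t \<in> I" and x: "x \<in> \<Omega>"
  define a where "a = Yinv (t, x)"
  have a: "a \<in> \<Omega>" "X t a = x" using Yinv_mem[OF t x] by (simp_all add: a_def)
  have "((\<lambda>s. 0) has_real_derivative - (divergence (\<lambda>x. r x *\<^sub>R u t x) (X t a) * \<bar>jac G (t, a)\<bar>)) (at t)"
    by (rule has_field_derivative_transform_within_open[OF N_time_derivative[OF t a(1)] open_P t])
      (use L lake_N a(1) in auto)
  then have "divergence (\<lambda>x. r x *\<^sub>R u t x) (X t a) * \<bar>jac G (t, a)\<bar> = 0"
    using DERIV_unique[OF _ DERIV_const] by fastforce
  then show "divergence (\<lambda>y. (H + b y) *\<^sub>R u t y) x = 0"
    using jac_nonzero[OF t in_closure[OF a(1)]] a(2) divergence_r[OF t x] by simp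
next
  assume L: "X t0 \<in> M \<and> (\<forall>t\<in>I. \<forall>x\<in>\<Omega>. divergence (\<lambda>y. (H + b y) *\<^sub>R u t y) x = 0)"
  fix t assume t: "t \<in> I"
  have "N (t, a) = 0" if a: "a \<in> \<Omega>" for a
  proof -
    have "((\<lambda>s. N (s, a)) has_field_derivative 0) (at s within I)" if s: "s \<in> I" for s
    proof -
      have "X s a \<in> \<Omega>" by (rule Diff_interior(2)[OF Y_Diff[OF s] open_dom a])
      then have "divergence (\<lambda>x. r x *\<^sub>R u s x) (X s a) = 0" using L s divergence_r[OF s] by simp
      then show ?thesis using has_field_derivative_at_within[OF N_time_derivative[OF s a]] by simp
    qed
    then obtain c where "\<forall>s\<in>I. N (s, a) = c"
      using has_field_derivative_zero_constant[of I "\<lambda>s. N (s, a)"] is_interval_convex[OF I] by blast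
    moreover have "N (t0, a) = 0" using lake_N[OF t0] L a by blast
    ultimately show ?thesis using t t0 by simp
  qed
  then show "X t \<in> M" using lake_N[OF t] by blast
qed

end

text \<open>The pressure may be unbounded near the boundary, so it is truncated by
  \<open>n * arctan (p / n)\<close>, whose derivative converges boundedly to 1. For the truncated pressure the
  orthogonality expresses that curves in the lake manifold preserve the measure.\<close>

lemma (in fluid) gradient_normal:
  assumes X: "X \<in> M"
    and P: "\<And>x. x \<in> \<Omega> \<Longrightarrow> GDERIV p x :> \<gamma> x"
    and f: "continuous_on (closure \<Omega>) f" "\<And>a. a \<in> \<Omega> \<Longrightarrow> \<gamma> (X a) = f a"
    and \<xi>: "\<xi> \<in> tangent_space \<Omega> M X"
  shows "weighted_metric \<Omega> \<rho>0 f \<xi> = 0"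
proof -
  have XD: "X \<in> Diff \<Omega>" by (rule lake_Diff[OF X])
  obtain Y where Y: "curve_through \<Omega> M X Y" "\<And>a. a \<in> closure \<Omega> \<Longrightarrow> \<xi> a = velocity Y 0 a"
    using \<xi> unfolding tangent_space_def by blast
  obtain \<delta> G T where \<delta>: "\<delta> > 0" and D: "fluid_deformation \<Omega> \<rho>0 b \<rho>e be T0 {-\<delta><..<\<delta>} Y G T"
    and YM: "\<And>s. s \<in> {-\<delta><..<\<delta>} \<Longrightarrow> Y s \<in> M" and Y0: "\<And>a. a \<in> closure \<Omega> \<Longrightarrow> Y 0 a = X a"
    by (rule curve_deformation[OF Y(1)]) (rule that)
  interpret fluid_curve \<Omega> \<rho>0 b \<rho>e be T0 "{-\<delta><..<\<delta>}" Y G T using D by (simp add: fluid_curve_def)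
  have 0: "0 \<in> {-\<delta><..<\<delta>}" using \<delta> by simp
  have \<xi>v: "\<xi> a = vel (0, a)" if "a \<in> closure \<Omega>" for a using Y(2)[OF that] velocity_eq[OF 0 that] by simp
  \<comment> \<open>Although \<open>p\<close> may be unbounded, its gradient agrees after
    composition with \<open>X\<close> with a function continuous up to the boundary, and so it is
    bounded.\<close>
  obtain B where B: "B > 0" "\<And>a. a \<in> closure \<Omega> \<Longrightarrow> norm (f a) \<le> B"
    using compact_imp_bounded[OF compact_continuous_image[OF f(1) compact_closure]]
    unfolding bounded_pos by auto
  have \<gamma>B: "norm (\<gamma> x) \<le> B" if x: "x \<in> \<Omega>" for x
    using f(2)[OF Diff_interior(3)[OF XD open_dom x]] B(2)[OF dom_closure[OF Diff_interior(3)[OF XD open_dom x]]]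
      Diff_interior(5)[OF XD open_dom x] by simp
  have "compact ({-\<delta>/2..\<delta>/2} \<times> closure \<Omega>)" by (intro compact_Times compact_closure compact_Icc)
  moreover have sub: "{-\<delta>/2..\<delta>/2} \<times> closure \<Omega> \<subseteq> T" using \<delta> sub_T by auto
  ultimately have "bounded (vel ` ({-\<delta>/2..\<delta>/2} \<times> closure \<Omega>))"
    by (intro compact_imp_bounded compact_continuous_image continuous_on_subset[OF Cinf_on_continuous[OF smooth_vel]])
  then obtain V where V: "V > 0" "\<And>s a. s \<in> {-\<delta>/2..\<delta>/2} \<Longrightarrow> a \<in> closure \<Omega> \<Longrightarrow> norm (vel (s, a)) \<le> V"
    unfolding bounded_pos by auto
  have pc: "continuous_on \<Omega> p"
    by (intro continuous_at_imp_continuous_on ballI) (rule has_derivative_continuous[OF P[unfolded gderiv_def]])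
  have dp: "((\<lambda>s. p (Y s a)) has_real_derivative \<gamma> (Y s a) \<bullet> vel (s, a)) (at s)"
    if s: "s \<in> {-\<delta><..<\<delta>}" and a: "a \<in> \<Omega>" for s a
  proof -
    have "((\<lambda>s. Y s a) has_vector_derivative vel (s, a)) (at s)"
      using curve_velocity[where c = "\<lambda>s. s" and c' = 1, OF has_vector_derivative_id s in_closure[OF a]] by (simp add: vel_def)
    moreover have "(p has_derivative (\<lambda>h. \<gamma> (Y s a) \<bullet> h)) (at (Y s a))"
      using P[OF Diff_interior(2)[OF Y_Diff[OF s] open_dom a]] by (simp add: gderiv_def inner_commute)
    ultimately show ?thesis by (rule has_real_derivative_along[rotated])
  qed
  define \<beta> where "\<beta> n q = real (Suc n) * arctan (q / real (Suc n))" for n q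
  define \<beta>' where "\<beta>' n q = inverse (1 + (q / real (Suc n))\<^sup>2)" for n q
  have d\<beta>: "(\<beta> n has_real_derivative \<beta>' n q) (at q)" for n q
    unfolding \<beta>_def \<beta>'_def by (auto intro!: derivative_eq_intros simp del: of_nat_Suc)
  have \<beta>'1: "0 \<le> \<beta>' n q" "\<beta>' n q \<le> 1" for n q
    by (simp_all add: \<beta>'_def inverse_le_1_iff del: of_nat_Suc)
  have \<beta>b: "\<bar>\<beta> n q\<bar> \<le> real (Suc n) * (pi / 2)" for n q
  proof -
    have "\<bar>arctan (q / real (Suc n))\<bar> \<le> pi / 2"
      using arctan_lbound[of "q / real (Suc n)"] arctan_ubound[of "q / real (Suc n)"] by linarith
    then show ?thesis unfolding \<beta>_def abs_mult by (simp del: of_nat_Suc)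
  qed
  have dbp: "((\<lambda>s. \<beta> n (p (Y s a))) has_real_derivative \<beta>' n (p (Y s a)) * (\<gamma> (Y s a) \<bullet> vel (s, a))) (at s)"
    if "s \<in> {-\<delta><..<\<delta>}" "a \<in> \<Omega>" for s a n
    by (rule DERIV_chain2[OF d\<beta> dp[OF that]])
  \<comment> \<open>Every \<open>Y s\<close> transports \<open>\<rho>0\<close> to the same density
    \<open>r\<close>, so this integral does not depend on \<open>s\<close>. Truncation guarantees
    that it exists.\<close>
  have const: "(\<lambda>a. \<beta> n (p (Y s a)) * \<rho>0 a) integrable_on \<Omega> \<and>
      integral \<Omega> (\<lambda>a. \<beta> n (p (Y s a)) * \<rho>0 a) = integral \<Omega> (\<lambda>x. \<beta> n (p x) * r x)"
    if s: "s \<in> {-\<delta><..<\<delta>}" for s n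
  proof -
    have c\<beta>: "continuous_on UNIV (\<beta> n)"
      by (intro continuous_at_imp_continuous_on ballI DERIV_isCont[OF d\<beta>])
    have rint: "r integrable_on \<Omega>" by (rule integrable_continuous_dom(2)[OF continuous_on_data(3)])
    have "(\<lambda>x. \<beta> n (p x) * r x) absolutely_integrable_on \<Omega>"
    proof (rule measurable_bounded_by_integrable_imp_absolutely_integrable[where g = "\<lambda>x. (real (Suc n) * (pi / 2)) * r x"])
      have "continuous_on \<Omega> (\<lambda>x. \<beta> n (p x) * r x)"
        by (intro continuous_on_mult continuous_on_compose2[OF c\<beta> pc] continuous_on_subset[OF continuous_on_data(3) closure_subset]) simp
      then show "(\<lambda>x. \<beta> n (p x) * r x) \<in> borel_measurable (lebesgue_on \<Omega>)"
        by (rule continuous_imp_measurable_on_sets_lebesgue[OF _ open_sets_lebesgue[OF open_dom]])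
      show "(\<lambda>x. (real (Suc n) * (pi / 2)) * r x) integrable_on \<Omega>"
        using integrable_cmul[OF rint, of "real (Suc n) * (pi / 2)"] by simp
      show "norm (\<beta> n (p x) * r x) \<le> (real (Suc n) * (pi / 2)) * r x" if "x \<in> \<Omega>" for x
        using mult_right_mono[OF \<beta>b[of n "p x"], of "r x"] r_pos[OF X that] by (simp add: abs_mult del: of_nat_Suc)
    qed (rule open_sets_lebesgue[OF open_dom])
    note cov = Diff_change_of_variables[OF Y_Diff[OF s] open_dom disjI1[OF this]]
    have eq: "\<bar>det (jacobian (Y s) (at a))\<bar> * (\<beta> n (p (Y s a)) * r (Y s a)) = \<beta> n (p (Y s a)) * \<rho>0 a"
      if "a \<in> \<Omega>" for a using YM[OF s] that by (simp add: lake_iff)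
    have "(\<lambda>a. \<bar>det (jacobian (Y s) (at a))\<bar> * (\<beta> n (p (Y s a)) * r (Y s a))) integrable_on \<Omega>"
      using cov(2) set_lebesgue_integral_eq_integral(1) by blast
    then have "(\<lambda>a. \<beta> n (p (Y s a)) * \<rho>0 a) integrable_on \<Omega>"
      by (rule integrable_eq) (rule eq)
    moreover have "integral \<Omega> (\<lambda>a. \<beta> n (p (Y s a)) * \<rho>0 a) = integral \<Omega> (\<lambda>x. \<beta> n (p x) * r x)"
      unfolding cov(3) by (rule integral_cong[symmetric]) (rule eq)
    ultimately show ?thesis by blast
  qed
  have dom: "(\<lambda>a. (B * V) * \<rho>0 a) integrable_on \<Omega>"
    by (rule integrable_continuous_dom(2)) (intro continuous_on_mult continuous_on_const continuous_on_data)
  have step: "integral \<Omega> (\<lambda>a. \<beta>' n (p (Y 0 a)) * (\<gamma> (Y 0 a) \<bullet> vel (0, a)) * \<rho>0 a) = 0 \<and>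
      (\<lambda>a. \<beta>' n (p (Y 0 a)) * (\<gamma> (Y 0 a) \<bullet> vel (0, a)) * \<rho>0 a) integrable_on \<Omega>" for n
  proof -
    \<comment> \<open>The derivative of the constant integral is computed along this sequence by
      dominated convergence. It stays in the half interval, where the velocity has the bound
      \<open>V\<close>.\<close>
    define s where "s k = \<delta> / 2 / real (Suc k)" for k
    have sk: "0 < s k" "s k \<le> \<delta> / 2" for k
      using \<delta> by (auto simp: s_def field_simps simp del: of_nat_Suc)
    have sk': "s k \<in> {-\<delta><..<\<delta>}" for k using \<delta> sk(1)[of k] sk(2)[of k] by simp
    have s0: "s \<longlonglongrightarrow> 0"
      unfolding s_def by (rule LIMSEQ_Suc[OF lim_const_over_n])
    define h where "h k a = (\<beta> n (p (Y (s k) a)) - \<beta> n (p (Y 0 a))) / s k * \<rho>0 a" for k a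
    have hint: "h k integrable_on \<Omega>" "integral \<Omega> (h k) = 0" for k
    proof -
      have i: "(\<lambda>a. \<beta> n (p (Y (s k) a)) * \<rho>0 a) integrable_on \<Omega>" "(\<lambda>a. \<beta> n (p (Y 0 a)) * \<rho>0 a) integrable_on \<Omega>"
        using const[OF sk'] const[OF 0] by blast+
      have h: "h k = (\<lambda>a. inverse (s k) *\<^sub>R (\<beta> n (p (Y (s k) a)) * \<rho>0 a - \<beta> n (p (Y 0 a)) * \<rho>0 a))"
        by (simp add: h_def fun_eq_iff field_simps)
      show "h k integrable_on \<Omega>" unfolding h by (intro integrable_cmul integrable_diff i)
      show "integral \<Omega> (h k) = 0"
        unfolding h integral_cmul integral_diff[OF i] using const[OF sk'] const[OF 0] by simp
    qed
    have hb: "norm (h k a) \<le> (B * V) * \<rho>0 a" if a: "a \<in> \<Omega>" for k a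
    proof -
      have "norm (\<beta> n (p (Y (s k) a)) - \<beta> n (p (Y 0 a))) \<le> (B * V) * (s k - 0)"
      proof (rule norm_increment_le)
        fix q assume q: "q \<in> {0..s k}"
        then have q': "q \<in> {-\<delta><..<\<delta>}" "q \<in> {-\<delta>/2..\<delta>/2}" using sk[of k] \<delta> by auto
        show "((\<lambda>s. \<beta> n (p (Y s a))) has_vector_derivative \<beta>' n (p (Y q a)) * (\<gamma> (Y q a) \<bullet> vel (q, a))) (at q)"
          using dbp[OF q'(1) a] by (simp add: has_real_derivative_iff_has_vector_derivative)
        have "\<bar>\<gamma> (Y q a) \<bullet> vel (q, a)\<bar> \<le> norm (\<gamma> (Y q a)) * norm (vel (q, a))" by (rule Cauchy_Schwarz_ineq2)
        also have "\<dots> \<le> B * V"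
          using \<gamma>B[OF Diff_interior(2)[OF Y_Diff[OF q'(1)] open_dom a]] V(2)[OF q'(2) in_closure[OF a]] B(1)
          by (intro mult_mono) auto
        finally have "\<bar>\<gamma> (Y q a) \<bullet> vel (q, a)\<bar> \<le> B * V" .
        then have "\<beta>' n (p (Y q a)) * \<bar>\<gamma> (Y q a) \<bullet> vel (q, a)\<bar> \<le> 1 * (B * V)"
          using \<beta>'1 by (intro mult_mono) auto
        then show "norm (\<beta>' n (p (Y q a)) * (\<gamma> (Y q a) \<bullet> vel (q, a))) \<le> B * V"
          using \<beta>'1(1) by (simp add: abs_mult)
      qed (use sk[of k] in auto)
      then have "\<bar>\<beta> n (p (Y (s k) a)) - \<beta> n (p (Y 0 a))\<bar> / s k \<le> B * V"
        using sk[of k] by (simp add: divide_le_eq)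
      then have "\<bar>\<beta> n (p (Y (s k) a)) - \<beta> n (p (Y 0 a))\<bar> / s k * \<rho>0 a \<le> (B * V) * \<rho>0 a"
        using \<rho>_pos[OF a] by (intro mult_right_mono) auto
      then show ?thesis using sk[of k] \<rho>_pos[OF a] by (simp add: h_def abs_mult)
    qed
    have conv: "(\<lambda>k. h k a) \<longlonglongrightarrow> \<beta>' n (p (Y 0 a)) * (\<gamma> (Y 0 a) \<bullet> vel (0, a)) * \<rho>0 a" if a: "a \<in> \<Omega>" for a
    proof -
      have "((\<lambda>q. (\<beta> n (p (Y q a)) - \<beta> n (p (Y 0 a))) / (q - 0)) \<longlongrightarrow> \<beta>' n (p (Y 0 a)) * (\<gamma> (Y 0 a) \<bullet> vel (0, a))) (at 0)"
        using dbp[OF 0 a] unfolding has_field_derivative_iff by simp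
      moreover have "filterlim s (at 0) sequentially"
        unfolding filterlim_at using s0 sk(1) by (auto simp: less_imp_neq[symmetric])
      ultimately have "(\<lambda>k. (\<beta> n (p (Y (s k) a)) - \<beta> n (p (Y 0 a))) / (s k - 0)) \<longlonglongrightarrow>
          \<beta>' n (p (Y 0 a)) * (\<gamma> (Y 0 a) \<bullet> vel (0, a))" by (rule filterlim_compose)
      then show ?thesis unfolding h_def by (intro tendsto_mult tendsto_const) simp
    qed
    note dc = dominated_convergence[where f = h and g = "\<lambda>a. \<beta>' n (p (Y 0 a)) * (\<gamma> (Y 0 a) \<bullet> vel (0, a)) * \<rho>0 a",
        OF hint(1) dom]
    have "(\<lambda>k. integral \<Omega> (h k)) \<longlonglongrightarrow> integral \<Omega> (\<lambda>a. \<beta>' n (p (Y 0 a)) * (\<gamma> (Y 0 a) \<bullet> vel (0, a)) * \<rho>0 a)"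
      by (rule dc(2)) (use hb conv in auto)
    then have "integral \<Omega> (\<lambda>a. \<beta>' n (p (Y 0 a)) * (\<gamma> (Y 0 a) \<bullet> vel (0, a)) * \<rho>0 a) = 0"
      unfolding hint(2) by (simp add: LIMSEQ_const_iff)
    moreover have "(\<lambda>a. \<beta>' n (p (Y 0 a)) * (\<gamma> (Y 0 a) \<bullet> vel (0, a)) * \<rho>0 a) integrable_on \<Omega>"
      by (rule dc(1)) (use hb conv in auto)
    ultimately show ?thesis by blast
  qed
  let ?k = "\<lambda>n a. \<beta>' n (p (Y 0 a)) * (\<gamma> (Y 0 a) \<bullet> vel (0, a)) * \<rho>0 a"
  \<comment> \<open>A second dominated convergence removes the truncation; the factors
    \<open>\<beta>'\<close> lie between 0 and 1, so the same majorant serves again.\<close>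
  have "(\<lambda>n. integral \<Omega> (?k n)) \<longlonglongrightarrow> integral \<Omega> (\<lambda>a. (f a \<bullet> \<xi> a) * \<rho>0 a)"
  proof (rule dominated_convergence(2)[where h = "\<lambda>a. (B * V) * \<rho>0 a"])
    show "?k n integrable_on \<Omega>" for n using step by blast
    show "(\<lambda>a. (B * V) * \<rho>0 a) integrable_on \<Omega>" by (rule dom)
    show "norm (?k n a) \<le> (B * V) * \<rho>0 a" if a: "a \<in> \<Omega>" for n a
    proof -
      have "\<bar>\<gamma> (Y 0 a) \<bullet> vel (0, a)\<bar> \<le> norm (\<gamma> (Y 0 a)) * norm (vel (0, a))" by (rule Cauchy_Schwarz_ineq2)
      also have "\<dots> \<le> B * V"
        using \<gamma>B[OF Diff_interior(2)[OF Y_Diff[OF 0] open_dom a]] V(2)[OF _ in_closure[OF a], of 0] B(1) \<delta>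
        by (intro mult_mono) auto
      finally have "\<beta>' n (p (Y 0 a)) * \<bar>\<gamma> (Y 0 a) \<bullet> vel (0, a)\<bar> \<le> 1 * (B * V)"
        using \<beta>'1 by (intro mult_mono) auto
      then have "\<beta>' n (p (Y 0 a)) * \<bar>\<gamma> (Y 0 a) \<bullet> vel (0, a)\<bar> * \<rho>0 a \<le> (B * V) * \<rho>0 a"
        using \<rho>_pos[OF a] by (intro mult_right_mono) auto
      then show ?thesis using \<beta>'1(1) \<rho>_pos[OF a] by (simp add: abs_mult)
    qed
    show "(\<lambda>n. ?k n a) \<longlonglongrightarrow> (f a \<bullet> \<xi> a) * \<rho>0 a" if a: "a \<in> \<Omega>" for a
    proof -
      have "(\<lambda>n. p (Y 0 a) / real (Suc n)) \<longlonglongrightarrow> 0" by (rule LIMSEQ_Suc[OF lim_const_over_n])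
      then have "(\<lambda>n. \<beta>' n (p (Y 0 a))) \<longlonglongrightarrow> inverse (1 + 0\<^sup>2)"
        unfolding \<beta>'_def by (intro tendsto_inverse tendsto_add tendsto_const tendsto_power) auto
      then have "(\<lambda>n. ?k n a) \<longlonglongrightarrow> inverse (1 + 0\<^sup>2) * (\<gamma> (Y 0 a) \<bullet> vel (0, a)) * \<rho>0 a"
        by (intro tendsto_mult tendsto_const)
      then show ?thesis using f(2)[OF a] \<xi>v[OF in_closure[OF a]] Y0[OF in_closure[OF a]] by simp
    qed
  qed
  moreover have "integral \<Omega> (?k n) = 0" for n using step by blast
  ultimately show ?thesis unfolding weighted_metric_def by (simp add: LIMSEQ_const_iff)
qed

section \<open>Potentials of fields orthogonal to divergence-free fields\<close>

definition seg_integral :: "(plane \<Rightarrow> plane) \<Rightarrow> plane \<Rightarrow> plane \<Rightarrow> real" where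
  "seg_integral A p q = integral {0..1} (\<lambda>\<tau>. A (p + \<tau> *\<^sub>R (q - p)) \<bullet> (q - p))"

fun polygon_integral :: "(plane \<Rightarrow> plane) \<Rightarrow> plane list \<Rightarrow> real" where
  "polygon_integral A (p # q # ps) = seg_integral A p q + polygon_integral A (q # ps)"
| "polygon_integral A _ = 0"

fun polygon_set :: "plane list \<Rightarrow> plane set" where
  "polygon_set (p # q # ps) = closed_segment p q \<union> polygon_set (q # ps)"
| "polygon_set [p] = {p}"
| "polygon_set [] = {}"

lemma seg_integral_refl [simp]: "seg_integral A p p = 0"
  by (simp add: seg_integral_def)

lemma polygon_integral_append:
  "xs \<noteq> [] \<Longrightarrow> ys \<noteq> [] \<Longrightarrow> polygon_integral A (xs @ ys) =
     polygon_integral A xs + seg_integral A (last xs) (hd ys) + polygon_integral A ys"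
proof (induction xs rule: induct_list012)
  case (2 x)
  then show ?case by (cases ys) auto
qed auto

lemma polygon_set_append:
  "xs \<noteq> [] \<Longrightarrow> ys \<noteq> [] \<Longrightarrow> polygon_set (xs @ ys) =
     polygon_set xs \<union> closed_segment (last xs) (hd ys) \<union> polygon_set ys"
proof (induction xs rule: induct_list012)
  case (2 x)
  then show ?case by (cases ys) auto
qed auto

lemma compact_polygon_set: "compact (polygon_set xs)"
  by (induction xs rule: induct_list012) (auto intro: compact_Un)

lemma mem_polygon_set: "p \<in> set xs \<Longrightarrow> p \<in> polygon_set xs"
  by (induction xs rule: induct_list012) auto

lemma segment_point: "\<tau> \<in> {0..1} \<Longrightarrow> p + \<tau> *\<^sub>R (q - p) \<in> closed_segment p q" for p q :: "'a::real_vector"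
  by (auto simp: closed_segment_def algebra_simps intro!: exI[of _ \<tau>])

lemma seg_integral_cong:
  assumes "\<And>x. x \<in> closed_segment p q \<Longrightarrow> A x = B x"
  shows "seg_integral A p q = seg_integral B p q"
  unfolding seg_integral_def by (rule integral_cong) (simp add: assms segment_point)

lemma polygon_integral_cong:
  "(\<And>x. x \<in> polygon_set xs \<Longrightarrow> A x = B x) \<Longrightarrow> polygon_integral A xs = polygon_integral B xs"
proof (induction xs rule: induct_list012)
  case (3 x y zs)
  then show ?case using seg_integral_cong[of x y A B] by simp
qed auto

lemma seg_integrable:
  fixes A :: "plane \<Rightarrow> plane"
  assumes "continuous_on (closed_segment p q) A"
  shows "(\<lambda>\<tau>. A (p + \<tau> *\<^sub>R (q - p)) \<bullet> v) integrable_on {0..1}"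
proof (rule integrable_continuous_real)
  have "continuous_on {0..1} (\<lambda>\<tau>. p + \<tau> *\<^sub>R (q - p))"
    by (intro continuous_intros)
  then have "continuous_on {0..1} (\<lambda>\<tau>. A (p + \<tau> *\<^sub>R (q - p)))"
    by (rule continuous_on_compose2[OF assms]) (auto intro: segment_point)
  then show "continuous_on {0..1} (\<lambda>\<tau>. A (p + \<tau> *\<^sub>R (q - p)) \<bullet> v)"
    by (intro continuous_on_inner continuous_on_const)
qed

text \<open>The vector measure carried by the oriented segment, smeared with the mollifier \<eta>.
  Pairing with it approximates the line integral along the segment.\<close>

definition seg_field :: "(plane \<Rightarrow> real) \<Rightarrow> plane \<Rightarrow> plane \<Rightarrow> plane \<Rightarrow> plane" where
  "seg_field \<eta> p q x = integral {0..1} (\<lambda>\<tau>. \<eta> (x - (p + \<tau> *\<^sub>R (q - p)))) *\<^sub>R (q - p)"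

fun polygon_field :: "(plane \<Rightarrow> real) \<Rightarrow> plane list \<Rightarrow> plane \<Rightarrow> plane" where
  "polygon_field \<eta> (p # q # ps) x = seg_field \<eta> p q x + polygon_field \<eta> (q # ps) x"
| "polygon_field \<eta> _ x = 0"

lemma unit_interval_integral_has_derivative:
  fixes F :: "plane \<times> real \<Rightarrow> real"
  assumes "Cinf_on UNIV F"
  shows "((\<lambda>x. integral {0..1} (\<lambda>\<tau>. F (x, \<tau>))) has_derivative
     (\<lambda>v. integral {0..1} (\<lambda>\<tau>. frechet_derivative F (at (x, \<tau>)) (v, 0)))) (at x)"
  by (rule has_derivative_parameter_integral[OF open_UNIV _ compact_Icc order_refl])
    (use assms in \<open>auto simp: Cinf_on_def\<close>)

lemma Cinf_on_unit_interval_integral: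
  fixes F :: "plane \<times> real \<Rightarrow> real"
  assumes "Cinf_on UNIV F"
  shows "Cinf_on UNIV (\<lambda>x. integral {0..1} (\<lambda>\<tau>. F (x, \<tau>)))"
proof -
  have "Ck_on k UNIV (\<lambda>x. integral {0..1} (\<lambda>\<tau>. F (x, \<tau>)))" for k
    using assms
  proof (induction k arbitrary: F)
    case 0
    show ?case unfolding Ck_on.simps
      by (intro continuous_at_imp_continuous_on ballI
          has_derivative_continuous[OF unit_interval_integral_has_derivative[OF 0]])
  next
    case (Suc k)
    show ?case
      by (rule Ck_on_SucI[OF open_UNIV unit_interval_integral_has_derivative[OF Suc.prems]])
        (rule Suc.IH[OF Cinf_on_derivative[OF Suc.prems]])
  qed
  then show ?thesis by (simp add: Cinf_on_def)
qed

context
  fixes \<eta> :: "plane \<Rightarrow> real"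
  assumes \<eta>: "Cinf_on UNIV \<eta>"
begin

lemma smooth_shifted: "Cinf_on UNIV (\<lambda>z :: plane \<times> real. \<eta> (fst z - (p + snd z *\<^sub>R (q - p))))"
  by (rule Cinf_on_compose[OF \<eta> open_UNIV open_UNIV UNIV_I])
    (intro Cinf_on_diff Cinf_on_add Cinf_on_scaleR Cinf_on_const Cinf_on_fst Cinf_on_snd Cinf_on_ident open_UNIV)

lemma smooth_seg_field: "Cinf_on UNIV (seg_field \<eta> p q)"
  using Cinf_on_scaleR[OF open_UNIV Cinf_on_unit_interval_integral[OF smooth_shifted] Cinf_on_const]
  unfolding seg_field_def[abs_def] by simp

text \<open>Moving \<open>x\<close> in the direction \<open>q - p\<close> undoes moving along the
  segment, so the integrand is an exact derivative in \<tau> and only the smeared endpoints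
  remain.\<close>

lemma divergence_seg_field: "divergence (seg_field \<eta> p q) x = \<eta> (x - p) - \<eta> (x - q)"
proof -
  let ?F = "\<lambda>z :: plane \<times> real. \<eta> (fst z - (p + snd z *\<^sub>R (q - p)))"
  let ?m = "\<lambda>x. integral {0..1} (\<lambda>\<tau>. ?F (x, \<tau>))"
  have dm: "(?m has_derivative (\<lambda>v. integral {0..1} (\<lambda>\<tau>. frechet_derivative ?F (at (x, \<tau>)) (v, 0)))) (at x)"
    by (rule unit_interval_integral_has_derivative[OF smooth_shifted])
  have "divergence (seg_field \<eta> p q) x = divergence (\<lambda>x. ?m x *\<^sub>R (q - p)) x"
    by (simp add: seg_field_def[abs_def])
  also have "\<dots> = frechet_derivative ?m (at x) (q - p) + ?m x * divergence (\<lambda>x. q - p) x"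
    by (rule divergence_scaleR) (use dm in \<open>auto simp: differentiable_def\<close>)
  also have "divergence (\<lambda>x. q - p) x = 0" by (simp add: divergence_def)
  also have "frechet_derivative ?m (at x) (q - p) = integral {0..1} (\<lambda>\<tau>. frechet_derivative ?F (at (x, \<tau>)) (q - p, 0))"
    using fun_cong[OF frechet_derivative_at[OF dm], of "q - p"] by simp
  also have "((\<lambda>\<tau>. frechet_derivative ?F (at (x, \<tau>)) (q - p, 0)) has_integral
      (- \<eta> (x - (p + 1 *\<^sub>R (q - p))) - (- \<eta> (x - (p + 0 *\<^sub>R (q - p)))))) {0..1}"
  proof (rule fundamental_theorem_of_calculus)
    fix \<tau> :: real
    let ?y = "x - (p + \<tau> *\<^sub>R (q - p))"
    have d: "(\<eta> has_derivative frechet_derivative \<eta> (at ?y)) (at ?y)" by (rule Cinf_on_has_derivative[OF \<eta> UNIV_I])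
    have "((\<lambda>z::plane \<times> real. fst z - (p + snd z *\<^sub>R (q - p))) has_derivative (\<lambda>v. fst v - snd v *\<^sub>R (q - p))) (at (x, \<tau>))"
      by (auto intro!: derivative_eq_intros)
    from has_derivative_compose[OF this, of \<eta>] d
    have "(?F has_derivative (\<lambda>v. frechet_derivative \<eta> (at ?y) (fst v - snd v *\<^sub>R (q - p)))) (at (x, \<tau>))" by simp
    from fun_cong[OF frechet_derivative_at[OF this], of "(q - p, 0)"]
    have e: "frechet_derivative ?F (at (x, \<tau>)) (q - p, 0) = frechet_derivative \<eta> (at ?y) (q - p)" by simp
    have "((\<lambda>\<tau>. x - (p + \<tau> *\<^sub>R (q - p))) has_derivative (\<lambda>h. - (h *\<^sub>R (q - p)))) (at \<tau>)"
      by (auto intro!: derivative_eq_intros)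
    from has_derivative_minus[OF has_derivative_compose[OF this d]]
    have "((\<lambda>\<tau>. - \<eta> (x - (p + \<tau> *\<^sub>R (q - p)))) has_derivative
        (\<lambda>h. h *\<^sub>R frechet_derivative \<eta> (at ?y) (q - p))) (at \<tau>)"
      using linear_neg[OF has_derivative_linear[OF d]] linear_scale[OF has_derivative_linear[OF d]] by simp
    then show "((\<lambda>\<tau>. - \<eta> (x - (p + \<tau> *\<^sub>R (q - p)))) has_vector_derivative
        frechet_derivative ?F (at (x, \<tau>)) (q - p, 0)) (at \<tau> within {0..1})"
      unfolding e has_vector_derivative_def by (rule has_derivative_at_withinI)
  qed simp
  then have "integral {0..1} (\<lambda>\<tau>. frechet_derivative ?F (at (x, \<tau>)) (q - p, 0)) = \<eta> (x - p) - \<eta> (x - q)"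
    by (simp add: integral_unique)
  finally show ?thesis by simp
qed

lemma smooth_polygon_field: "Cinf_on UNIV (polygon_field \<eta> xs)"
proof (induction xs rule: induct_list012)
  case (3 p q ps)
  show ?case using Cinf_on_add[OF open_UNIV smooth_seg_field 3(2)] by simp
qed (simp_all add: Cinf_on_const)

text \<open>The endpoint contributions telescope; for a closed polygon the field is
  divergence-free.\<close>

lemma divergence_polygon_field:
  "xs \<noteq> [] \<Longrightarrow> divergence (polygon_field \<eta> xs) x = \<eta> (x - hd xs) - \<eta> (x - last xs)"
proof (induction xs rule: induct_list012)
  case (3 p q ps)
  have "divergence (\<lambda>x. seg_field \<eta> p q x + polygon_field \<eta> (q # ps) x) x =
      divergence (seg_field \<eta> p q) x + divergence (polygon_field \<eta> (q # ps)) x"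
    unfolding divergence_def
      frechet_derivative_at[OF has_derivative_add[OF Cinf_on_has_derivative[OF smooth_seg_field UNIV_I]
        Cinf_on_has_derivative[OF smooth_polygon_field UNIV_I]], symmetric]
    by (simp add: sum.distrib)
  then show ?case using 3(2) by (simp add: divergence_seg_field)
next
  case (2 p)
  have "polygon_field \<eta> [p] = (\<lambda>x. 0)" by (simp add: fun_eq_iff)
  then show ?case by (simp add: divergence_def)
qed simp

end

lemma polygon_field_zero:
  assumes "\<And>y. norm y \<ge> \<epsilon> \<Longrightarrow> \<eta> y = 0"
  shows "(\<And>z. z \<in> polygon_set xs \<Longrightarrow> dist x z \<ge> \<epsilon>) \<Longrightarrow> polygon_field \<eta> xs x = 0"
proof (induction xs rule: induct_list012)
  case (3 p q ps)
  have "integral {0..1} (\<lambda>\<tau>. \<eta> (x - (p + \<tau> *\<^sub>R (q - p)))) = integral {0..1::real} (\<lambda>\<tau>. 0)"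
  proof (rule integral_cong)
    fix \<tau> :: real assume "\<tau> \<in> {0..1}"
    then have "dist x (p + \<tau> *\<^sub>R (q - p)) \<ge> \<epsilon>" using 3(3) segment_point[of \<tau> p q] by simp
    then show "\<eta> (x - (p + \<tau> *\<^sub>R (q - p))) = 0" by (intro assms) (simp add: dist_norm)
  qed
  then show ?case using 3 by (simp add: seg_field_def)
qed auto

section \<open>Mollified line integrals\<close>

lemma integral_eq_of_support:
  fixes f :: "'a::euclidean_space \<Rightarrow> real"
  assumes "K \<subseteq> S" "K \<subseteq> T" "\<And>x. x \<notin> K \<Longrightarrow> f x = 0"
  shows "integral S f = integral T f"
proof -
  have "(\<lambda>x. if x \<in> S then f x else 0) = (\<lambda>x. if x \<in> T then f x else 0)"
    using assms by (auto simp: fun_eq_iff)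
  then show ?thesis using integral_restrict_UNIV[of S f] integral_restrict_UNIV[of T f] by simp
qed

lemma bump_integral_shift:
  fixes y :: plane
  assumes e: "\<epsilon> > 0" and B: "ball y \<epsilon> \<subseteq> B"
  shows "integral B (\<lambda>x. bump \<epsilon> 0 (x - y)) = integral (ball 0 \<epsilon>) (bump \<epsilon> (0::plane))"
proof -
  have int: "bump \<epsilon> (0::plane) absolutely_integrable_on ball 0 \<epsilon>"
    by (rule absolutely_integrable_continuous_subset_compact[OF compact_cball ball_subset_cball])
      (auto intro: open_sets_lebesgue continuous_on_subset[OF Cinf_on_continuous[OF Cinf_on_bump]])
  have "integral B (\<lambda>x. bump \<epsilon> 0 (x - y)) = integral (ball y \<epsilon>) (\<lambda>x. bump \<epsilon> 0 (x - y))"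
    by (rule integral_eq_of_support[OF B order_refl], rule bump_eq_0[OF e])
      (simp add: dist_norm norm_minus_commute)
  also have "ball y \<epsilon> = (\<lambda>x. x + y) ` ball 0 \<epsilon>"
  proof (rule set_eqI)
    show "x \<in> ball y \<epsilon> \<longleftrightarrow> x \<in> (\<lambda>x. x + y) ` ball 0 \<epsilon>" for x
      by (auto simp: image_iff dist_norm norm_minus_commute intro!: bexI[of _ "x - y"])
  qed
  also have "integral \<dots> (\<lambda>x. bump \<epsilon> 0 (x - y)) = integral (ball 0 \<epsilon>) (bump \<epsilon> (0::plane))"
  proof -
    have d1: "det (matrix (\<lambda>v::plane. v)) = 1" by (simp add: det_matrix det2_def axis_def)
    have "(\<lambda>x. \<bar>det (matrix (\<lambda>v::plane. v))\<bar> * bump \<epsilon> 0 ((x + y) - y)) absolutely_integrable_on ball 0 \<epsilon> \<and>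
        integral (ball 0 \<epsilon>) (\<lambda>x. \<bar>det (matrix (\<lambda>v::plane. v))\<bar> * bump \<epsilon> 0 ((x + y) - y)) = integral (ball 0 \<epsilon>) (bump \<epsilon> (0::plane))
      \<longleftrightarrow> (\<lambda>x. bump \<epsilon> 0 (x - y)) absolutely_integrable_on (\<lambda>x. x + y) ` ball 0 \<epsilon> \<and>
        integral ((\<lambda>x. x + y) ` ball 0 \<epsilon>) (\<lambda>x. bump \<epsilon> 0 (x - y)) = integral (ball 0 \<epsilon>) (bump \<epsilon> (0::plane))"
      by (rule change_of_variables_real[where X = "\<lambda>x. x + y" and X' = "\<lambda>_ v. v" and f = "\<lambda>x. bump \<epsilon> 0 (x - y)"])
        (auto intro!: open_sets_lebesgue derivative_eq_intros inj_onI)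
    then show ?thesis using int unfolding d1 by simp
  qed
  finally show ?thesis .
qed

lemma bump_integral_pos: "\<epsilon> > 0 \<Longrightarrow> integral (ball 0 \<epsilon>) (bump \<epsilon> (0::plane)) > 0"
proof -
  assume e: "\<epsilon> > 0"
  have c: "continuous_on UNIV (bump \<epsilon> (0::plane))" by (rule Cinf_on_continuous[OF Cinf_on_bump])
  have "bump \<epsilon> (0::plane) absolutely_integrable_on ball 0 \<epsilon>"
    by (rule absolutely_integrable_continuous_subset_compact[OF compact_cball ball_subset_cball])
      (auto intro: open_sets_lebesgue continuous_on_subset[OF c])
  then have i: "bump \<epsilon> (0::plane) integrable_on ball 0 \<epsilon>" by (rule set_lebesgue_integral_eq_integral(1))
  have "integral (ball 0 \<epsilon>) (bump \<epsilon> (0::plane)) \<ge> 0" by (rule integral_nonneg[OF i]) (rule bump_nonneg)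
  moreover have "integral (ball 0 \<epsilon>) (bump \<epsilon> (0::plane)) \<noteq> 0"
  proof
    assume "integral (ball 0 \<epsilon>) (bump \<epsilon> (0::plane)) = 0"
    then have "bump \<epsilon> (0::plane) 0 = 0"
      by (intro integral_zero_imp_zero[OF open_ball continuous_on_subset[OF c subset_UNIV] i bump_nonneg]) (use e in auto)
    then show False using bump_pos_iff[OF e, of 0 "0::plane"] e by simp
  qed
  ultimately show ?thesis by linarith
qed

text \<open>Exchanging the order of integration leaves, for each point of the segment, an average of
  \<open>A\<close> over its \<epsilon>-neighbourhood. It differs from the value at that point by at
  most the oscillation \<kappa>.\<close>

lemma seg_field_approx:
  fixes A :: "plane \<Rightarrow> plane"
  assumes A: "continuous_on UNIV A" and \<eta>c: "continuous_on UNIV \<eta>" and \<eta>n: "\<And>y. \<eta> y \<ge> 0"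
    and \<eta>1: "\<And>y. y \<in> closed_segment p q \<Longrightarrow> integral (cbox a b) (\<lambda>x. \<eta> (x - y)) = 1"
    and \<eta>0: "\<And>y. norm y \<ge> \<epsilon> \<Longrightarrow> \<eta> y = 0"
    and \<kappa>: "\<And>x y. y \<in> closed_segment p q \<Longrightarrow> dist x y < \<epsilon> \<Longrightarrow> norm (A x - A y) \<le> \<kappa>"
  shows "\<bar>integral (cbox a b) (\<lambda>x. A x \<bullet> seg_field \<eta> p q x) - seg_integral A p q\<bar> \<le> \<kappa> * norm (q - p)"
proof -
  let ?\<gamma> = "\<lambda>\<tau>. p + \<tau> *\<^sub>R (q - p)"
  let ?h = "\<lambda>x \<tau>. (A x \<bullet> (q - p)) * \<eta> (x - ?\<gamma> \<tau>)"
  have ch: "continuous_on S (\<lambda>z. ?h (fst z) (snd z))" for S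
    by (intro continuous_on_mult continuous_on_inner continuous_on_const
        continuous_on_compose2[OF A, of _ fst] continuous_on_compose2[OF \<eta>c, of _ "\<lambda>z. fst z - ?\<gamma> (snd z)"])
      (auto intro!: continuous_intros)
  have ch1: "continuous_on S (\<lambda>x. ?h x \<tau>)" for S \<tau>
    using continuous_on_compose2[OF ch[of UNIV], of S "\<lambda>x. (x, \<tau>)"] by (simp add: continuous_on_Pair continuous_on_id continuous_on_const)
  have ch2: "continuous_on S (\<lambda>\<tau>. ?h x \<tau>)" for S x
    using continuous_on_compose2[OF ch[of UNIV], of S "\<lambda>\<tau>. (x, \<tau>)"] by (simp add: continuous_on_Pair continuous_on_id continuous_on_const)
  have "A x \<bullet> seg_field \<eta> p q x = integral (cbox 0 1) (?h x)" for x
    by (simp add: seg_field_def mult.commute)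
  then have "integral (cbox a b) (\<lambda>x. A x \<bullet> seg_field \<eta> p q x) = integral (cbox a b) (\<lambda>x. integral (cbox 0 1) (?h x))"
    by simp
  also have "\<dots> = integral (cbox 0 1) (\<lambda>\<tau>. integral (cbox a b) (\<lambda>x. ?h x \<tau>))"
    by (rule integral_swap_continuous) (use ch in \<open>simp add: case_prod_unfold\<close>)
  finally have swap: "integral (cbox a b) (\<lambda>x. A x \<bullet> seg_field \<eta> p q x) =
      integral {0..1} (\<lambda>\<tau>. integral (cbox a b) (\<lambda>x. ?h x \<tau>))" by simp
  have cS: "continuous_on {0..1} (\<lambda>\<tau>. integral (cbox a b) (\<lambda>x. ?h x \<tau>))"
  proof (rule integral_continuous_on_param)
    have "continuous_on ({0..1} \<times> cbox a b) ((\<lambda>z. ?h (fst z) (snd z)) \<circ> (\<lambda>z. (snd z, fst z)))"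
      by (intro continuous_on_compose ch) (auto intro!: continuous_intros)
    then show "continuous_on ({0..1} \<times> cbox a b) (\<lambda>(\<tau>, x). ?h x \<tau>)" by (simp add: o_def case_prod_unfold)
  qed
  have i1: "(\<lambda>\<tau>. integral (cbox a b) (\<lambda>x. ?h x \<tau>)) integrable_on {0..1}"
    by (rule integrable_continuous_real[OF cS])
  have i2: "(\<lambda>\<tau>. A (?\<gamma> \<tau>) \<bullet> (q - p)) integrable_on {0..1}"
    by (rule seg_integrable[OF continuous_on_subset[OF A]]) simp
  have pt: "norm (integral (cbox a b) (\<lambda>x. ?h x \<tau>) - A (?\<gamma> \<tau>) \<bullet> (q - p)) \<le> \<kappa> * norm (q - p)"
    if \<tau>: "\<tau> \<in> {0..1}" for \<tau>
  proof -
    note y = segment_point[OF \<tau>, of p q]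
    have c\<eta>: "continuous_on S (\<lambda>x. \<eta> (x - ?\<gamma> \<tau>))" for S
      by (rule continuous_on_compose2[OF \<eta>c]) (auto intro!: continuous_intros)
    have i\<eta>: "(\<lambda>x. \<eta> (x - ?\<gamma> \<tau>)) integrable_on cbox a b" by (rule integrable_continuous[OF c\<eta>])
    have ih: "(\<lambda>x. ?h x \<tau>) integrable_on cbox a b" by (rule integrable_continuous[OF ch1])
    have ic: "(\<lambda>x. (A (?\<gamma> \<tau>) \<bullet> (q - p)) * \<eta> (x - ?\<gamma> \<tau>)) integrable_on cbox a b"
      using integrable_cmul[OF i\<eta>, of "A (?\<gamma> \<tau>) \<bullet> (q - p)"] by simp
    have "A (?\<gamma> \<tau>) \<bullet> (q - p) = integral (cbox a b) (\<lambda>x. (A (?\<gamma> \<tau>) \<bullet> (q - p)) * \<eta> (x - ?\<gamma> \<tau>))"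
      using \<eta>1[OF y] by simp
    then have "norm (integral (cbox a b) (\<lambda>x. ?h x \<tau>) - A (?\<gamma> \<tau>) \<bullet> (q - p)) =
        norm (integral (cbox a b) (\<lambda>x. ?h x \<tau> - (A (?\<gamma> \<tau>) \<bullet> (q - p)) * \<eta> (x - ?\<gamma> \<tau>)))"
      by (simp only: integral_diff[OF ih ic])
    also have "\<dots> \<le> integral (cbox a b) (\<lambda>x. (\<kappa> * norm (q - p)) * \<eta> (x - ?\<gamma> \<tau>))"
    proof (rule integral_norm_bound_integral[OF integrable_diff[OF ih ic]])
      show "(\<lambda>x. (\<kappa> * norm (q - p)) * \<eta> (x - ?\<gamma> \<tau>)) integrable_on cbox a b"
        using integrable_cmul[OF i\<eta>, of "\<kappa> * norm (q - p)"] by simp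
      fix x
      have "?h x \<tau> - (A (?\<gamma> \<tau>) \<bullet> (q - p)) * \<eta> (x - ?\<gamma> \<tau>) = ((A x - A (?\<gamma> \<tau>)) \<bullet> (q - p)) * \<eta> (x - ?\<gamma> \<tau>)"
        by (simp only: inner_diff_left left_diff_distrib)
      then have "norm (?h x \<tau> - (A (?\<gamma> \<tau>) \<bullet> (q - p)) * \<eta> (x - ?\<gamma> \<tau>)) = \<bar>(A x - A (?\<gamma> \<tau>)) \<bullet> (q - p)\<bar> * \<eta> (x - ?\<gamma> \<tau>)"
        by (simp only: real_norm_def abs_mult abs_of_nonneg[OF \<eta>n])
      also have "\<dots> \<le> (\<kappa> * norm (q - p)) * \<eta> (x - ?\<gamma> \<tau>)"
      proof (cases "dist x (?\<gamma> \<tau>) < \<epsilon>")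
        case True
        have "\<bar>(A x - A (?\<gamma> \<tau>)) \<bullet> (q - p)\<bar> \<le> norm (A x - A (?\<gamma> \<tau>)) * norm (q - p)" by (rule Cauchy_Schwarz_ineq2)
        also have "\<dots> \<le> \<kappa> * norm (q - p)" by (rule mult_right_mono[OF \<kappa>[OF y True] norm_ge_zero])
        finally show ?thesis by (rule mult_right_mono[OF _ \<eta>n])
      next
        case False
        then show ?thesis using \<eta>0[of "x - ?\<gamma> \<tau>"] by (simp add: dist_norm)
      qed
      finally show "norm (?h x \<tau> - (A (?\<gamma> \<tau>) \<bullet> (q - p)) * \<eta> (x - ?\<gamma> \<tau>)) \<le> (\<kappa> * norm (q - p)) * \<eta> (x - ?\<gamma> \<tau>)" .
    qed
    also have "\<dots> = \<kappa> * norm (q - p)" using \<eta>1[OF y] by simp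
    finally show ?thesis .
  qed
  have e: "integral (cbox a b) (\<lambda>x. A x \<bullet> seg_field \<eta> p q x) - seg_integral A p q =
      integral {0..1} (\<lambda>\<tau>. integral (cbox a b) (\<lambda>x. ?h x \<tau>) - A (?\<gamma> \<tau>) \<bullet> (q - p))"
    unfolding swap seg_integral_def by (rule integral_diff[OF i1 i2, symmetric])
  have "norm (integral {0..1} (\<lambda>\<tau>. integral (cbox a b) (\<lambda>x. ?h x \<tau>) - A (?\<gamma> \<tau>) \<bullet> (q - p))) \<le>
      integral {0..1} (\<lambda>\<tau>::real. \<kappa> * norm (q - p))"
    by (rule integral_norm_bound_integral[OF integrable_diff[OF i1 i2] _ pt]) (auto intro: integrable_continuous_real continuous_on_const)
  also have "\<dots> = \<kappa> * norm (q - p)" by simp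
  finally show ?thesis unfolding e real_norm_def .
qed

fun polygon_length :: "plane list \<Rightarrow> real" where
  "polygon_length (p # q # ps) = norm (q - p) + polygon_length (q # ps)"
| "polygon_length _ = 0"

lemma polygon_length_nonneg: "polygon_length xs \<ge> 0"
  by (induction xs rule: induct_list012) auto

lemma polygon_field_approx:
  fixes A :: "plane \<Rightarrow> plane"
  assumes A: "continuous_on UNIV A" and \<eta>s: "Cinf_on UNIV \<eta>" and \<eta>n: "\<And>y. \<eta> y \<ge> 0"
    and \<eta>0: "\<And>y. norm y \<ge> \<epsilon> \<Longrightarrow> \<eta> y = 0"
  shows "(\<And>y. y \<in> polygon_set xs \<Longrightarrow> integral (cbox a b) (\<lambda>x. \<eta> (x - y)) = 1) \<Longrightarrow>
    (\<And>x y. y \<in> polygon_set xs \<Longrightarrow> dist x y < \<epsilon> \<Longrightarrow> norm (A x - A y) \<le> \<kappa>) \<Longrightarrow>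
    \<bar>integral (cbox a b) (\<lambda>x. A x \<bullet> polygon_field \<eta> xs x) - polygon_integral A xs\<bar> \<le> \<kappa> * polygon_length xs"
proof (induction xs rule: induct_list012)
  case (3 p q ps)
  have c: "(\<lambda>x. A x \<bullet> v x) integrable_on cbox a b" if "Cinf_on UNIV v" for v
    by (rule integrable_continuous)
      (intro continuous_on_inner continuous_on_subset[OF A] continuous_on_subset[OF Cinf_on_continuous[OF that]] subset_UNIV)
  have 1: "\<bar>integral (cbox a b) (\<lambda>x. A x \<bullet> seg_field \<eta> p q x) - seg_integral A p q\<bar> \<le> \<kappa> * norm (q - p)"
    by (rule seg_field_approx[OF A Cinf_on_continuous[OF \<eta>s] \<eta>n _ \<eta>0]) (use 3 in auto)
  have 2: "\<bar>integral (cbox a b) (\<lambda>x. A x \<bullet> polygon_field \<eta> (q # ps) x) - polygon_integral A (q # ps)\<bar>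
      \<le> \<kappa> * polygon_length (q # ps)"
    by (rule 3(2)) (use 3 in auto)
  have "integral (cbox a b) (\<lambda>x. A x \<bullet> polygon_field \<eta> (p # q # ps) x) =
      integral (cbox a b) (\<lambda>x. A x \<bullet> seg_field \<eta> p q x) + integral (cbox a b) (\<lambda>x. A x \<bullet> polygon_field \<eta> (q # ps) x)"
    using integral_add[OF c[OF smooth_seg_field[OF \<eta>s, of p q]] c[OF smooth_polygon_field[OF \<eta>s, of "q # ps"]]]
    by (simp add: inner_add_right)
  then show ?case using 1 2 by (simp add: distrib_left)
qed auto

text \<open>Testing with the field obtained by smearing a closed polygon shows that the circulation
  around the polygon vanishes.\<close>

lemma closed_polygon_integral_zero:
  assumes "open \<Omega>" "Cinf_on \<Omega> A"
    and orth: "\<And>v S. Cinf_on UNIV v \<Longrightarrow> compact S \<Longrightarrow> S \<subseteq> \<Omega> \<Longrightarrow> (\<And>x. x \<notin> S \<Longrightarrow> v x = 0) \<Longrightarrow>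
        (\<And>x. divergence v x = 0) \<Longrightarrow> integral \<Omega> (\<lambda>x. A x \<bullet> v x) = 0"
    and xs: "xs \<noteq> []" "polygon_set xs \<subseteq> \<Omega>" "hd xs = last xs"
  shows "polygon_integral A xs = 0"
proof -
  define K where "K = polygon_set xs"
  have cK: "compact K" by (simp add: K_def compact_polygon_set)
  obtain r0 K' where r0: "r0 > 0" "compact K'" "K' \<subseteq> \<Omega>" "\<And>x. x \<in> K \<Longrightarrow> cball x r0 \<subseteq> K'"
    by (rule compact_neighbourhood[OF cK xs(2)[folded K_def] assms(1)]) (rule that)
  obtain \<theta> :: "plane \<Rightarrow> real" and L where \<theta>: "Cinf_on UNIV \<theta>" "\<And>x. x \<in> K' \<Longrightarrow> \<theta> x = 1"
    "compact L" "L \<subseteq> \<Omega>" "\<And>x. x \<notin> L \<Longrightarrow> \<theta> x = 0"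
    by (rule smooth_cutoff[OF r0(2) assms(1) r0(3)]) (rule that)
  \<comment> \<open>A continuous field on the plane that agrees with \<open>A\<close> near the
    polygon, so that the approximation can take place in a box containing all supports.\<close>
  define B where "B x = (if x \<in> \<Omega> then \<theta> x *\<^sub>R A x else 0)" for x
  have "Cinf_on UNIV B"
    unfolding B_def[abs_def]
    by (rule Cinf_on_extend_zero[OF assms(1) compact_imp_closed[OF \<theta>(3)] \<theta>(4)])
      (use \<theta>(5) in \<open>auto intro!: Cinf_on_scaleR assms Cinf_on_subset[OF \<theta>(1)]\<close>)
  then have cB: "continuous_on UNIV B" by (rule Cinf_on_continuous)
  have BA: "B x = A x" if "x \<in> K'" for x using that r0(3) \<theta>(2) by (auto simp: B_def)
  have KK': "K \<subseteq> K'"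
  proof
    show "y \<in> K'" if "y \<in> K" for y using subsetD[OF r0(4)[OF that], of y] r0(1) by simp
  qed
  obtain a where a: "K' \<subseteq> cbox (- a) a"
    using bounded_subset_cbox_symmetric[OF compact_imp_bounded[OF r0(2)]] by blast
  have "\<bar>polygon_integral A xs\<bar> \<le> \<kappa> * polygon_length xs" if \<kappa>: "\<kappa> > 0" for \<kappa>
  proof -
    have "uniformly_continuous_on (cbox (- a) a) B"
      by (rule compact_uniformly_continuous[OF continuous_on_subset[OF cB subset_UNIV] compact_cbox])
    from this[unfolded uniformly_continuous_on_def, rule_format, OF \<kappa>]
    obtain d where d: "d > 0" "\<And>x y. x \<in> cbox (- a) a \<Longrightarrow> y \<in> cbox (- a) a \<Longrightarrow> dist y x < d \<Longrightarrow> dist (B y) (B x) < \<kappa>"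
      by auto
    \<comment> \<open>The bound \<open>r0\<close> keeps the smeared polygon inside
      \<open>K'\<close>; the bound \<open>d\<close> makes the oscillation of the field at this scale
      less than \<kappa>.\<close>
    define \<epsilon> where "\<epsilon> = min r0 d"
    have \<epsilon>: "\<epsilon> > 0" "\<epsilon> \<le> r0" "\<epsilon> \<le> d" using r0(1) d(1) by (auto simp: \<epsilon>_def)
    define I where "I = integral (ball 0 \<epsilon>) (bump \<epsilon> (0::plane))"
    have I: "I > 0" using bump_integral_pos[OF \<epsilon>(1)] by (simp add: I_def)
    define \<eta> where "\<eta> x = inverse I * bump \<epsilon> 0 x" for x :: plane
    have \<eta>s: "Cinf_on UNIV \<eta>" unfolding \<eta>_def[abs_def] by (intro Cinf_on_mult Cinf_on_const Cinf_on_bump open_UNIV)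
    have \<eta>n: "\<eta> x \<ge> 0" for x using I bump_nonneg[of \<epsilon> 0 x] by (simp add: \<eta>_def)
    have \<eta>0: "\<eta> y = 0" if "norm y \<ge> \<epsilon>" for y using bump_eq_0[OF \<epsilon>(1), of y 0] that by (simp add: \<eta>_def)
    have near: "ball y \<epsilon> \<subseteq> K'" if "y \<in> K" for y
      by (rule order_trans[OF ball_subset_cball order_trans[OF subset_cball[OF \<epsilon>(2)] r0(4)[OF that]]])
    have \<eta>1: "integral (cbox (- a) a) (\<lambda>x. \<eta> (x - y)) = 1" if "y \<in> K" for y
      using bump_integral_shift[OF \<epsilon>(1) order_trans[OF near[OF that] a]] I
      by (simp add: \<eta>_def I_def)
    let ?v = "polygon_field \<eta> xs"
    have v0: "?v x = 0" if "x \<notin> K'" for x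
    proof (rule polygon_field_zero[OF \<eta>0])
      fix z assume "z \<in> polygon_set xs"
      then have "cball z r0 \<subseteq> K'" using r0(4) by (simp add: K_def)
      then have "x \<notin> cball z r0" using that by blast
      then show "\<epsilon> \<le> dist x z" using \<epsilon>(2) by (simp add: dist_commute)
    qed
    have "divergence ?v x = 0" for x
      unfolding divergence_polygon_field[OF \<eta>s xs(1)] xs(3) by simp
    then have "integral \<Omega> (\<lambda>x. A x \<bullet> ?v x) = 0"
      by (intro orth[OF smooth_polygon_field[OF \<eta>s] r0(2,3) v0])
    moreover have "integral \<Omega> (\<lambda>x. A x \<bullet> ?v x) = integral \<Omega> (\<lambda>x. B x \<bullet> ?v x)"
    proof (rule integral_cong)
      show "A x \<bullet> ?v x = B x \<bullet> ?v x" for x using BA[of x] v0[of x] by (cases "x \<in> K'") auto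
    qed
    moreover have "\<dots> = integral (cbox (- a) a) (\<lambda>x. B x \<bullet> ?v x)"
      by (rule integral_eq_of_support[OF r0(3) a]) (simp add: v0)
    ultimately have z: "integral (cbox (- a) a) (\<lambda>x. B x \<bullet> ?v x) = 0" by simp
    have "\<bar>integral (cbox (- a) a) (\<lambda>x. B x \<bullet> ?v x) - polygon_integral B xs\<bar> \<le> \<kappa> * polygon_length xs"
    proof (rule polygon_field_approx[OF cB \<eta>s \<eta>n \<eta>0])
      show "integral (cbox (- a) a) (\<lambda>x. \<eta> (x - y)) = 1" if "y \<in> polygon_set xs" for y
        using \<eta>1 that by (simp add: K_def)
      show "norm (B x - B y) \<le> \<kappa>" if y: "y \<in> polygon_set xs" and xy: "dist x y < \<epsilon>" for x y
      proof -
        have "x \<in> ball y \<epsilon>" using xy by (simp add: dist_commute)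
        then have "x \<in> K'" "y \<in> K'" using near[of y] KK' y by (auto simp: K_def)
        then show ?thesis using d(2)[of y x] a xy \<epsilon>(3) by (auto simp: dist_norm subset_iff less_imp_le)
      qed
    qed
    moreover have "polygon_integral B xs = polygon_integral A xs"
      by (rule polygon_integral_cong) (use BA KK' in \<open>auto simp: K_def\<close>)
    ultimately show ?thesis using z by simp
  qed note bound = this
  show ?thesis
  proof (rule ccontr)
    assume "polygon_integral A xs \<noteq> 0"
    then have pos: "\<bar>polygon_integral A xs\<bar> > 0" by simp
    let ?l = "polygon_length xs"
    have l: "?l \<ge> 0" by (rule polygon_length_nonneg)
    \<comment> \<open>This \<kappa> bounds the circulation by half of itself; adding 1 to the length
      keeps the quotient meaningful for a polygon of length 0.\<close>
    have "\<bar>polygon_integral A xs\<bar> \<le> (\<bar>polygon_integral A xs\<bar> / (2 * (?l + 1))) * ?l"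
      by (rule bound) (use pos l in simp)
    also have "\<dots> \<le> (\<bar>polygon_integral A xs\<bar> / (2 * (?l + 1))) * (?l + 1)"
      using l by (intro mult_left_mono) auto
    also have "\<dots> = \<bar>polygon_integral A xs\<bar> / 2" using l by (simp add: field_simps)
    finally show False using pos by simp
  qed
qed

text \<open>Polygons in both directions are supplied because closed polygons will be formed by
  concatenation. The same conjunction makes the relation symmetric, as the connectedness argument
  requires.\<close>

lemma polygon_connected:
  assumes "open \<Omega>" "connected \<Omega>" "x \<in> \<Omega>" "y \<in> \<Omega>"
  obtains xs ys where "xs \<noteq> []" "hd xs = x" "last xs = y" "polygon_set xs \<subseteq> \<Omega>"
    "ys \<noteq> []" "hd ys = y" "last ys = x" "polygon_set ys \<subseteq> \<Omega>"
proof -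
  define R1 where "R1 x y \<longleftrightarrow> (\<exists>xs. xs \<noteq> [] \<and> hd xs = x \<and> last xs = y \<and> polygon_set xs \<subseteq> \<Omega>)" for x y
  have tr: "R1 x z" if xy: "R1 x y" and yz: "R1 y z" for x y z
  proof -
    obtain xs where xs: "xs \<noteq> []" "hd xs = x" "last xs = y" "polygon_set xs \<subseteq> \<Omega>"
      using xy unfolding R1_def by (elim exE conjE)
    obtain ys where ys: "ys \<noteq> []" "hd ys = y" "last ys = z" "polygon_set ys \<subseteq> \<Omega>"
      using yz unfolding R1_def by (elim exE conjE)
    have "y \<in> \<Omega>" using mem_polygon_set[of y ys] ys by (metis hd_in_set subsetD)
    then have "polygon_set (xs @ ys) \<subseteq> \<Omega>" using xs ys by (simp add: polygon_set_append)
    then show ?thesis unfolding R1_def using xs ys by (intro exI[of _ "xs @ ys"]) auto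
  qed
  have tr': "R1 x z \<and> R1 z x" if "R1 x y \<and> R1 y x" "R1 y z \<and> R1 z y" for x y z
    using that tr[of x y z] tr[of z y x] by simp
  have "R1 x y \<and> R1 y x"
  proof (rule connected_equivalence_relation[OF assms(2-4), where R = "\<lambda>x y. R1 x y \<and> R1 y x"])
    fix a assume a: "a \<in> \<Omega>"
    obtain e where e: "e > 0" "ball a e \<subseteq> \<Omega>" using assms(1) a open_contains_ball by blast
    have "R1 a z \<and> R1 z a" if z: "z \<in> ball a e" for z
    proof -
      have "closed_segment a z \<subseteq> ball a e"
        by (rule closed_segment_subset) (use z e(1) in auto)
      then have s: "closed_segment a z \<subseteq> \<Omega>" by (rule order_trans[OF _ e(2)])
      have "z \<in> \<Omega>" using z e(2) by (rule rev_subsetD)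
      then have "polygon_set [a, z] \<subseteq> \<Omega>" "polygon_set [z, a] \<subseteq> \<Omega>"
        using s a unfolding polygon_set.simps closed_segment_commute[of z a] by simp_all
      then show ?thesis unfolding R1_def
        by (intro conjI exI[of _ "[a, z]"] exI[of _ "[z, a]"]) simp_all
    qed
    moreover have "openin (top_of_set \<Omega>) (ball a e)" using e(2) by (simp add: open_subset)
    ultimately show "\<exists>T. openin (top_of_set \<Omega>) T \<and> a \<in> T \<and> (\<forall>x\<in>T. R1 a x \<and> R1 x a)"
      using e(1) by (intro exI[of _ "ball a e"]) auto
  qed (simp, rule tr')
  then show ?thesis unfolding R1_def by (elim conjE exE) (rule that)
qed

section \<open>Time-dependent potentials\<close>

lemma polygon_integral_time_derivative:
  fixes A :: "real \<times> plane \<Rightarrow> plane"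
  assumes "open I" "open \<Omega>" "Cinf_on (I \<times> \<Omega>) A" "t \<in> I"
  shows "polygon_set xs \<subseteq> \<Omega> \<Longrightarrow> ((\<lambda>t. polygon_integral (\<lambda>y. A (t, y)) xs) has_real_derivative
     polygon_integral (\<lambda>y. frechet_derivative A (at (t, y)) (1, 0)) xs) (at t)"
proof (induction xs rule: induct_list012)
  case (3 p q ps)
  define \<gamma> where "\<gamma> z = (fst z, p + snd z *\<^sub>R (q - p))" for z :: "real \<times> real"
  define S where "S = \<gamma> -` (I \<times> \<Omega>)"
  have c\<gamma>: "continuous_on UNIV \<gamma>" unfolding \<gamma>_def by (intro continuous_intros)
  have S: "open S" unfolding S_def by (rule open_vimage[OF open_Times[OF assms(1,2)] c\<gamma>])
  have s\<gamma>: "Cinf_on S \<gamma>"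
    unfolding \<gamma>_def[abs_def]
    by (intro Cinf_on_Pair Cinf_on_add Cinf_on_scaleR Cinf_on_const Cinf_on_fst Cinf_on_snd Cinf_on_ident S)
  have sA: "Cinf_on S (\<lambda>z. A (\<gamma> z))"
    by (rule Cinf_on_compose[OF assms(3) open_Times[OF assms(1,2)] S _ s\<gamma>]) (simp add: S_def)
  let ?F = "\<lambda>z. A (\<gamma> z) \<bullet> (q - p)"
  have sF: "Cinf_on S ?F" by (intro Cinf_on_inner Cinf_on_const S sA)
  have sub: "{t} \<times> {0..1} \<subseteq> S"
  proof safe
    fix \<tau> :: real assume "\<tau> \<in> {0..1}"
    then have "p + \<tau> *\<^sub>R (q - p) \<in> \<Omega>" using segment_point[of \<tau> p q] 3(3) by auto
    then show "(t, \<tau>) \<in> S" using assms(4) by (simp add: S_def \<gamma>_def)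
  qed
  have "((\<lambda>t. integral {0..1} (\<lambda>\<tau>. ?F (t, \<tau>))) has_derivative
      (\<lambda>v. integral {0..1} (\<lambda>\<tau>. frechet_derivative ?F (at (t, \<tau>)) (v, 0)))) (at t)"
    by (rule has_derivative_parameter_integral[OF S _ compact_Icc order_refl _ sub])
      (use sF in \<open>auto simp: Cinf_on_def\<close>)
  from has_real_derivative_along[where c = "\<lambda>t. t", OF this has_vector_derivative_id]
  have "((\<lambda>t. integral {0..1} (\<lambda>\<tau>. ?F (t, \<tau>))) has_real_derivative
      integral {0..1} (\<lambda>\<tau>. frechet_derivative ?F (at (t, \<tau>)) (1, 0))) (at t)" .
  also have "integral {0..1} (\<lambda>\<tau>. frechet_derivative ?F (at (t, \<tau>)) (1, 0)) =
      seg_integral (\<lambda>y. frechet_derivative A (at (t, y)) (1, 0)) p q"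
    unfolding seg_integral_def
  proof (rule integral_cong)
    fix \<tau> :: real assume "\<tau> \<in> {0..1}"
    then have z: "\<gamma> (t, \<tau>) \<in> I \<times> \<Omega>" using subsetD[OF sub, of "(t, \<tau>)"] by (simp add: S_def)
    have dA: "(A has_derivative frechet_derivative A (at (\<gamma> (t, \<tau>)))) (at (\<gamma> (t, \<tau>)))"
      by (rule Cinf_on_has_derivative[OF assms(3) z])
    have "(\<gamma> has_derivative (\<lambda>v. (fst v, snd v *\<^sub>R (q - p)))) (at (t, \<tau>))"
      unfolding \<gamma>_def by (auto intro!: derivative_eq_intros)
    from has_derivative_inner_left[OF has_derivative_compose[OF this dA], of "q - p"]
    have "(?F has_derivative (\<lambda>v. frechet_derivative A (at (\<gamma> (t, \<tau>))) (fst v, snd v *\<^sub>R (q - p)) \<bullet> (q - p))) (at (t, \<tau>))" .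
    from fun_cong[OF frechet_derivative_at[OF this], of "(1, 0)"]
    show "frechet_derivative ?F (at (t, \<tau>)) (1, 0) =
        frechet_derivative A (at (t, p + \<tau> *\<^sub>R (q - p))) (1, 0) \<bullet> (q - p)"
      by (simp add: \<gamma>_def)
  qed
  finally have "((\<lambda>t. seg_integral (\<lambda>y. A (t, y)) p q) has_real_derivative
      seg_integral (\<lambda>y. frechet_derivative A (at (t, y)) (1, 0)) p q) (at t)"
    by (simp add: seg_integral_def \<gamma>_def)
  from DERIV_add[OF this 3(2)] 3(3) show ?case by simp
qed auto

text \<open>The potential is the integral along a polygon from \<open>x0\<close> to
  \<open>x\<close>, chosen for each \<open>x\<close> once and for all times. The choice is arbitrary
  in \<open>x\<close>, but closedness turns differences into integrals over short segments, which
  gives the spatial gradient. Its time derivative is the potential of the time derivative of the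
  field.\<close>

lemma potential_exists:
  fixes A :: "real \<times> plane \<Rightarrow> plane"
  assumes I: "open I" and \<Omega>: "open \<Omega>" "connected \<Omega>" "\<Omega> \<noteq> {}" and smooth: "Cinf_on (I \<times> \<Omega>) A"
    and closed: "\<And>t xs. t \<in> I \<Longrightarrow> xs \<noteq> [] \<Longrightarrow> polygon_set xs \<subseteq> \<Omega> \<Longrightarrow> hd xs = last xs \<Longrightarrow>
       polygon_integral (\<lambda>y. A (t, y)) xs = 0"
  obtains P :: "real \<times> plane \<Rightarrow> real" where "Cinf_on (I \<times> \<Omega>) P"
    "\<And>t x. t \<in> I \<Longrightarrow> x \<in> \<Omega> \<Longrightarrow> ((\<lambda>x. P (t, x)) has_derivative (\<lambda>h. A (t, x) \<bullet> h)) (at x)"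
proof -
  obtain x0 where x0: "x0 \<in> \<Omega>" using \<Omega>(3) by blast
  have "\<exists>xs ys. x \<in> \<Omega> \<longrightarrow> xs \<noteq> [] \<and> hd xs = x0 \<and> last xs = x \<and> polygon_set xs \<subseteq> \<Omega> \<and>
      ys \<noteq> [] \<and> hd ys = x \<and> last ys = x0 \<and> polygon_set ys \<subseteq> \<Omega>" for x
  proof (cases "x \<in> \<Omega>")
    case True
    show ?thesis by (rule polygon_connected[OF \<Omega>(1,2) x0 True]) blast
  qed blast
  then obtain c R where cR: "\<And>x. x \<in> \<Omega> \<Longrightarrow> c x \<noteq> [] \<and> hd (c x) = x0 \<and> last (c x) = x \<and> polygon_set (c x) \<subseteq> \<Omega> \<and>
      R x \<noteq> [] \<and> hd (R x) = x \<and> last (R x) = x0 \<and> polygon_set (R x) \<subseteq> \<Omega>"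
    by metis
  have oI\<Omega>: "open (I \<times> \<Omega>)" by (rule open_Times[OF I \<Omega>(1)])
  \<comment> \<open>This class is closed under time differentiation, so joint smoothness of the
    potential can be proved by induction for all its members at once.\<close>
  define good where "good A \<longleftrightarrow> Cinf_on (I \<times> \<Omega>) A \<and> (\<forall>t\<in>I. \<forall>xs. xs \<noteq> [] \<longrightarrow> polygon_set xs \<subseteq> \<Omega> \<longrightarrow> hd xs = last xs \<longrightarrow>
       polygon_integral (\<lambda>y. A (t, y)) xs = 0)" for A :: "real \<times> plane \<Rightarrow> plane"
  define Q where "Q A z = polygon_integral (\<lambda>y. A (fst z, y)) (c (snd z))" for A :: "real \<times> plane \<Rightarrow> plane" and z
  have diff: "Q A (t, y) - Q A (t, x) = seg_integral (\<lambda>y. A (t, y)) x y"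
    if A: "good A" and t: "t \<in> I" and xy: "closed_segment x y \<subseteq> \<Omega>" for A t x y
  proof -
    have x: "x \<in> \<Omega>" and y: "y \<in> \<Omega>" using xy by auto
    \<comment> \<open>Concatenation inserts the segment from \<open>x\<close> to \<open>y\<close>.
      This loop and the next one return by the same polygon \<open>R y\<close>, which cancels in the
      difference.\<close>
    have "polygon_integral (\<lambda>y. A (t, y)) (c x @ R y) = 0"
      using A t cR[OF x] cR[OF y] xy unfolding good_def by (auto simp: polygon_set_append)
    moreover have "polygon_integral (\<lambda>y. A (t, y)) (c y @ R y) = 0"
      using A t cR[OF y] y unfolding good_def by (auto simp: polygon_set_append)
    ultimately show ?thesis using cR[OF x] cR[OF y] by (simp add: polygon_integral_append Q_def)
  qed
  have dx: "((\<lambda>x. Q A (t, x)) has_derivative (\<lambda>h. A (t, x) \<bullet> h)) (at x)"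
    if A: "good A" and t: "t \<in> I" and x: "x \<in> \<Omega>" for A t x
    unfolding has_derivative_at_alt
  proof (intro conjI allI impI)
    show "bounded_linear (\<lambda>h. A (t, x) \<bullet> h)" by (rule bounded_linear_inner_right)
    fix e :: real assume e: "e > 0"
    have cA: "continuous_on \<Omega> (\<lambda>y. A (t, y))"
      by (rule continuous_on_compose2[OF Cinf_on_continuous, of "I \<times> \<Omega>" A])
        (use A t in \<open>auto simp: good_def intro!: continuous_intros\<close>)
    obtain d1 where d1: "d1 > 0" "ball x d1 \<subseteq> \<Omega>" using \<Omega>(1) x open_contains_ball by blast
    have "isCont (\<lambda>y. A (t, y)) x" using cA x \<Omega>(1) by (simp add: continuous_on_eq_continuous_at)
    then obtain d2 where d2: "d2 > 0" "\<And>y. dist y x < d2 \<Longrightarrow> dist (A (t, y)) (A (t, x)) < e"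
      unfolding continuous_at_eps_delta using e by blast
    show "\<exists>d>0. \<forall>y. norm (y - x) < d \<longrightarrow> norm (Q A (t, y) - Q A (t, x) - A (t, x) \<bullet> (y - x)) \<le> e * norm (y - x)"
    proof (intro exI[of _ "min d1 d2"] conjI allI impI)
      fix y assume y: "norm (y - x) < min d1 d2"
      have sub: "closed_segment x y \<subseteq> ball x (min d1 d2)"
        by (rule closed_segment_subset) (use y d1 d2 in \<open>auto simp: dist_norm norm_minus_commute\<close>)
      then have seg: "closed_segment x y \<subseteq> \<Omega>"
        using order_trans[OF subset_ball[of "min d1 d2" d1 x] d1(2)] by auto
      have i: "(\<lambda>\<tau>. A (t, x + \<tau> *\<^sub>R (y - x)) \<bullet> (y - x)) integrable_on {0..1}"
        by (rule seg_integrable[OF continuous_on_subset[OF cA seg]])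
      have ic: "(\<lambda>\<tau>::real. v) integrable_on {0..1}" for v :: real by (rule integrable_continuous_real) (rule continuous_on_const)
      have "norm (Q A (t, y) - Q A (t, x) - A (t, x) \<bullet> (y - x)) =
          norm (integral {0..1} (\<lambda>\<tau>. A (t, x + \<tau> *\<^sub>R (y - x)) \<bullet> (y - x) - A (t, x) \<bullet> (y - x)))"
        unfolding diff[OF A t seg] seg_integral_def integral_diff[OF i ic] by simp
      also have "\<dots> \<le> integral {0..1} (\<lambda>\<tau>::real. e * norm (y - x))"
      proof (rule integral_norm_bound_integral[OF integrable_diff[OF i ic] ic])
        fix \<tau> :: real assume "\<tau> \<in> {0..1}"
        then have "x + \<tau> *\<^sub>R (y - x) \<in> ball x (min d1 d2)" using sub segment_point[of \<tau> x y] by blast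
        then have "norm (A (t, x + \<tau> *\<^sub>R (y - x)) - A (t, x)) \<le> e"
          using d2(2)[of "x + \<tau> *\<^sub>R (y - x)"] unfolding mem_ball dist_commute[of x] by (simp add: dist_norm)
        then have "norm (A (t, x + \<tau> *\<^sub>R (y - x)) - A (t, x)) * norm (y - x) \<le> e * norm (y - x)"
          by (rule mult_right_mono) simp
        moreover have "norm (A (t, x + \<tau> *\<^sub>R (y - x)) \<bullet> (y - x) - A (t, x) \<bullet> (y - x)) \<le>
            norm (A (t, x + \<tau> *\<^sub>R (y - x)) - A (t, x)) * norm (y - x)"
          using Cauchy_Schwarz_ineq2[of "A (t, x + \<tau> *\<^sub>R (y - x)) - A (t, x)" "y - x"] by (simp add: inner_diff_left)
        ultimately show "norm (A (t, x + \<tau> *\<^sub>R (y - x)) \<bullet> (y - x) - A (t, x) \<bullet> (y - x)) \<le> e * norm (y - x)" by linarith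
      qed
      finally show "norm (Q A (t, y) - Q A (t, x) - A (t, x) \<bullet> (y - x)) \<le> e * norm (y - x)" by simp
    qed (use d1 d2 in simp)
  qed
  have dt: "((\<lambda>t. Q A (t, x)) has_real_derivative Q (\<lambda>z. frechet_derivative A (at z) (1, 0)) (t, x)) (at t)"
    if A: "good A" and t: "t \<in> I" and x: "x \<in> \<Omega>" for A t x
    using polygon_integral_time_derivative[OF I \<Omega>(1) _ t, of A "c x"] A cR[OF x] by (simp add: Q_def good_def)
  have good': "good (\<lambda>z. frechet_derivative A (at z) (1, 0))" if A: "good A" for A
    unfolding good_def
  proof (intro conjI ballI allI impI)
    show "Cinf_on (I \<times> \<Omega>) (\<lambda>z. frechet_derivative A (at z) (1, 0))"
      using A by (intro Cinf_on_derivative) (simp add: good_def)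
    fix t xs assume t: "t \<in> I" and xs: "xs \<noteq> []" "polygon_set xs \<subseteq> \<Omega>" "hd xs = last xs"
    have d: "((\<lambda>t. polygon_integral (\<lambda>y. A (t, y)) xs) has_real_derivative
        polygon_integral (\<lambda>y. frechet_derivative A (at (t, y)) (1, 0)) xs) (at t)"
      by (rule polygon_integral_time_derivative[OF I \<Omega>(1) _ t xs(2)]) (use A in \<open>simp add: good_def\<close>)
    have "((\<lambda>t. 0) has_real_derivative
        polygon_integral (\<lambda>y. frechet_derivative A (at (t, y)) (1, 0)) xs) (at t)"
      by (rule has_field_derivative_transform_within_open[OF d I t]) (use A xs in \<open>simp add: good_def\<close>)
    then show "polygon_integral (\<lambda>y. frechet_derivative A (at (t, y)) (1, 0)) xs = 0"
      using DERIV_unique[OF _ DERIV_const] by blast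
  qed
  have dtx: "(Q A has_derivative (\<lambda>v. fst v * Q (\<lambda>z. frechet_derivative A (at z) (1, 0)) z + A z \<bullet> snd v)) (at z)"
    if A: "good A" and zI: "z \<in> I \<times> \<Omega>" for A z
  proof -
    obtain t x where z: "z = (t, x)" "t \<in> I" "x \<in> \<Omega>" using zI by auto
    obtain e where e: "e > 0" "ball x e \<subseteq> \<Omega>" using \<Omega>(1) z(3) open_contains_ball by blast
    obtain e1 where e1: "e1 > 0" "ball t e1 \<subseteq> I" using I z(2) open_contains_ball by blast
    let ?q = "Q (\<lambda>z. frechet_derivative A (at z) (1, 0)) (t, x)"
    \<comment> \<open>Here the spatial derivative is the continuous one, being given by
      \<open>A\<close>; the time derivative need only exist at the point.\<close>
    have "((\<lambda>(s, y). Q A (s, y)) has_derivative (\<lambda>(s, y). s * ?q + blinfun_inner_right (A (t, x)) y))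
        (at (t, x) within ball t e1 \<times> ball x e)"
    proof (rule has_derivative_partialsI)
      show "((\<lambda>s. Q A (s, x)) has_derivative (\<lambda>s. s * ?q)) (at t within ball t e1)"
        using dt[OF A z(2,3)] by (simp add: has_field_derivative_def mult.commute[of _ ?q] has_derivative_at_withinI)
      show "((\<lambda>y. Q A (s, y)) has_derivative blinfun_apply (blinfun_inner_right (A (s, y)))) (at y within ball x e)"
        if "s \<in> ball t e1" "y \<in> ball x e" for s y
      proof (rule has_derivative_at_withinI)
        have "s \<in> I" "y \<in> \<Omega>" using that e e1 by auto
        from dx[OF A this] show "((\<lambda>y. Q A (s, y)) has_derivative blinfun_apply (blinfun_inner_right (A (s, y)))) (at y)"
          by (simp add: blinfun_inner_right.rep_eq)
      qed
      have "isCont A (t, x)"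
        using A zI oI\<Omega> Cinf_on_continuous[of "I \<times> \<Omega>" A] z by (simp add: good_def continuous_on_eq_continuous_at)
      then have "isCont (\<lambda>z. blinfun_inner_right (A z)) (t, x)"
        by (rule bounded_linear.isCont[OF bounded_linear_blinfun_inner_right])
      then have "continuous (at (t, x) within ball t e1 \<times> ball x e) (\<lambda>z. blinfun_inner_right (A z))"
        by (rule continuous_at_imp_continuous_at_within)
      then show "continuous (at (t, x) within ball t e1 \<times> ball x e) (\<lambda>(s, y). blinfun_inner_right (A (s, y)))"
        by (simp add: case_prod_unfold)
    qed (use e in auto)
    moreover have "at (t, x) within ball t e1 \<times> ball x e = at (t, x)"
      by (rule at_within_open) (use e e1 in \<open>auto intro: open_Times\<close>)
    ultimately show ?thesis by (simp add: z case_prod_unfold blinfun_inner_right.rep_eq)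
  qed
  have Ck: "Ck_on k (I \<times> \<Omega>) (Q A)" if "good A" for k A
    using that
  proof (induction k arbitrary: A)
    case 0
    show ?case unfolding Ck_on.simps
      by (intro continuous_at_imp_continuous_on ballI has_derivative_continuous[OF dtx[OF 0]])
  next
    case (Suc k)
    show ?case
    proof (rule Ck_on_SucI[OF oI\<Omega> dtx[OF Suc.prems]])
      fix v :: "real \<times> plane"
      have "Ck_on k (I \<times> \<Omega>) (\<lambda>z. A z \<bullet> snd v)"
        using Suc.prems by (intro Ck_on_compose_linear[OF bounded_linear_inner_left oI\<Omega>]) (simp add: good_def Cinf_on_def)
      then show "Ck_on k (I \<times> \<Omega>) (\<lambda>z. fst v * Q (\<lambda>z. frechet_derivative A (at z) (1, 0)) z + A z \<bullet> snd v)"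
        by (intro Ck_on_add oI\<Omega> Ck_on_compose_linear[OF bounded_linear_mult_right oI\<Omega> Suc.IH[OF good'[OF Suc.prems]]])
    qed
  qed
  have gA: "good A" using smooth closed by (simp add: good_def)
  show ?thesis
    by (rule that[of "Q A"]) (use Ck[OF gA] dx[OF gA] in \<open>auto simp: Cinf_on_def\<close>)
qed

section \<open>The lake equation\<close>

context fluid_curve
begin

text \<open>The test field is w = v / r, so that r w = v is divergence-free and w composed with X is
  tangent to the lake manifold. In the metric the mass factor r times the Jacobian cancels the
  division and performs the change of variables.\<close>

lemma acceleration_orthogonal:
  assumes t: "t \<in> I" and X: "X t \<in> M" and normal: "acceleration X t \<in> normal_forces \<Omega> \<rho>0 M (X t)"
    and v: "Cinf_on UNIV v" "compact S" "S \<subseteq> \<Omega>" "\<And>x. x \<notin> S \<Longrightarrow> v x = 0"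
    and div: "\<And>x. divergence v x = 0"
  shows "integral \<Omega> (\<lambda>x. A (t, x) \<bullet> v x) = 0"
proof -
  define w where "w x = (if x \<in> \<Omega> then inverse (r x) *\<^sub>R v x else 0)" for x
  have r: "r x > 0" if "x \<in> \<Omega>" for x by (rule r_pos[OF X that])
  have rw: "r x *\<^sub>R w x = v x" if "x \<in> \<Omega>" for x using r[OF that] that by (simp add: w_def)
  have w0: "w x = 0" if "x \<notin> S" for x using v(4)[OF that] by (simp add: w_def)
  have sr: "Cinf_on \<Omega> r" by (rule Cinf_on_subset[OF smooth_r]) (use dom_T0 in auto)
  have sw: "Cinf_on UNIV w"
    unfolding w_def[abs_def]
  proof (rule Cinf_on_extend_zero[OF open_dom compact_imp_closed[OF v(2)] v(3)])
    show "Cinf_on \<Omega> (\<lambda>x. inverse (r x) *\<^sub>R v x)"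
    proof (rule Cinf_on_scaleR[OF open_dom Cinf_on_inverse[OF open_dom sr] Cinf_on_subset[OF v(1)]])
      show "r x \<noteq> 0" if "x \<in> \<Omega>" for x using r[OF that] by simp
    qed simp
  qed (simp add: v(4))
  have tw: "tangent_to_boundary \<Omega> w"
    by (rule tangent_to_boundary_zero) (use closure_open_frontier(2)[OF open_dom] in \<open>auto simp: w_def\<close>)
  obtain \<phi> where \<phi>: "flow w \<phi>" by (rule flow_exists[OF sw v(2) w0])
  have dw: "divergence (\<lambda>y. r y *\<^sub>R w y) x = 0" if x: "x \<in> \<Omega>" for x
  proof -
    have "divergence v x = divergence (\<lambda>y. r y *\<^sub>R w y) x"
      by (rule divergence_cong[OF open_dom x rw[symmetric] Cinf_on_differentiable[OF v(1) UNIV_I]])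
    then show ?thesis using div by simp
  qed
  define \<nu> where "\<nu> a = w (X t a)" for a
  have "\<nu> \<in> tangent_space \<Omega> M (X t)"
    by (rule flow_tangent[OF X sw tw \<phi> dw]) (simp_all add: \<nu>_def)
  then have "weighted_metric \<Omega> \<rho>0 (acceleration X t) \<nu> = 0"
    using normal by (simp add: normal_forces_def)
  then have 0: "integral \<Omega> (\<lambda>a. (acceleration X t a \<bullet> \<nu> a) * \<rho>0 a) = 0" by (simp add: weighted_metric_def)
  note XD = lake_Diff[OF X]
  have c: "continuous_on (closure \<Omega>) (\<lambda>a. (acceleration X t a \<bullet> \<nu> a) * \<rho>0 a)"
    unfolding \<nu>_def
    by (intro continuous_on_mult continuous_on_inner smooth_on_continuous smooth_acceleration t continuous_on_data
        continuous_on_compose2[OF Cinf_on_continuous[OF sw] smooth_on_continuous[OF DiffD(1)[OF XD]]] subset_UNIV)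
  have e: "\<bar>det (jacobian (X t) (at a))\<bar> * (A (t, X t a) \<bullet> v (X t a)) = (acceleration X t a \<bullet> \<nu> a) * \<rho>0 a"
    if a: "a \<in> \<Omega>" for a
  proof -
    have "\<rho>0 a = r (X t a) * \<bar>det (jacobian (X t) (at a))\<bar>" using X a by (simp add: lake_iff)
    then show ?thesis using A_X[OF t a] rw[OF Diff_interior(2)[OF XD open_dom a], symmetric]
      by (simp add: \<nu>_def)
  qed
  have "(\<lambda>a. \<bar>det (jacobian (X t) (at a))\<bar> * (A (t, X t a) \<bullet> v (X t a))) absolutely_integrable_on \<Omega> \<longleftrightarrow>
      (\<lambda>a. (acceleration X t a \<bullet> \<nu> a) * \<rho>0 a) absolutely_integrable_on \<Omega>"
    by (rule set_integrable_cong[OF refl refl]) (rule e)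
  then have ai: "(\<lambda>a. \<bar>det (jacobian (X t) (at a))\<bar> * (A (t, X t a) \<bullet> v (X t a))) absolutely_integrable_on \<Omega>"
    using integrable_continuous_dom(1)[OF c] by simp
  have "integral \<Omega> (\<lambda>x. A (t, x) \<bullet> v x) =
      integral \<Omega> (\<lambda>a. \<bar>det (jacobian (X t) (at a))\<bar> * (A (t, X t a) \<bullet> v (X t a)))"
    by (rule Diff_change_of_variables(3)[where f = "\<lambda>x. A (t, x) \<bullet> v x", OF XD open_dom disjI2[OF ai]])
  also have "\<dots> = integral \<Omega> (\<lambda>a. (acceleration X t a \<bullet> \<nu> a) * \<rho>0 a)"
    by (rule integral_cong) (rule e)
  finally show ?thesis using 0 by simp
qed

lemma smooth_A_space:
  assumes "t \<in> I"
  shows "Cinf_on \<Omega> (\<lambda>x. A (t, x))"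
  by (rule Cinf_on_compose[OF smooth_A open_P\<Omega> open_dom])
    (use assms in \<open>auto intro!: Cinf_on_Pair Cinf_on_const Cinf_on_ident open_dom\<close>)

lemma geodesic_pressure:
  assumes g: "geodesic \<Omega> \<rho>0 M I X"
  obtains P :: "real \<times> plane \<Rightarrow> real" where "Cinf_on (I \<times> \<Omega>) P"
    "\<And>t x. t \<in> I \<Longrightarrow> x \<in> \<Omega> \<Longrightarrow> ((\<lambda>x. P (t, x)) has_derivative (\<lambda>h. A (t, x) \<bullet> h)) (at x)"
proof (rule potential_exists[OF open_P open_dom connected_dom nonempty_dom smooth_A])
  fix t xs assume t: "t \<in> I" and xs: "xs \<noteq> []" "polygon_set xs \<subseteq> \<Omega>" "hd xs = last xs"
  have Xt: "X t \<in> M" "acceleration X t \<in> normal_forces \<Omega> \<rho>0 M (X t)" using g t by (simp_all add: geodesic_def)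
  show "polygon_integral (\<lambda>y. A (t, y)) xs = 0"
    by (rule closed_polygon_integral_zero[OF open_dom smooth_A_space[OF t] _ xs])
      (rule acceleration_orthogonal[OF t Xt])
qed (rule that)

lemma gderiv_pressure:
  assumes t: "t \<in> I" and x: "x \<in> \<Omega>"
  shows "GDERIV p x :> - (vector_derivative (\<lambda>s. u s x) (at t) + frechet_derivative (u t) (at x) (u t x)) \<longleftrightarrow>
     ((\<lambda>x. - p x) has_derivative (\<lambda>h. A (t, x) \<bullet> h)) (at x)"
proof -
  have "GDERIV p x :> - A (t, x) \<longleftrightarrow> (p has_derivative (\<lambda>h. - (A (t, x) \<bullet> h))) (at x)"
    by (simp add: gderiv_def inner_commute)
  also have "\<dots> \<longleftrightarrow> ((\<lambda>x. - p x) has_derivative (\<lambda>h. A (t, x) \<bullet> h)) (at x)"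
    using has_derivative_minus[of p "\<lambda>h. - (A (t, x) \<bullet> h)" "at x"]
      has_derivative_minus[of "\<lambda>x. - p x" "\<lambda>h. A (t, x) \<bullet> h" "at x"] by auto
  finally show ?thesis by (simp only: material_derivative[OF t x])
qed

text \<open>The continuity constraint expresses that the curve stays in the lake manifold. The
  momentum equation expresses normality: normal accelerations have a pressure by closedness, and
  pressure gradients are normal by \<open>gradient_normal\<close>.\<close>

lemma geodesic_iff_lake_equation:
  assumes I: "is_interval I" and t0: "t0 \<in> I"
  shows "geodesic \<Omega> \<rho>0 M I X \<longleftrightarrow> X t0 \<in> M \<and> lake_equation \<Omega> b H I u"
proof
  assume g: "geodesic \<Omega> \<rho>0 M I X"
  then have XM: "\<forall>t\<in>I. X t \<in> M" by (simp add: geodesic_def)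
  obtain P :: "real \<times> plane \<Rightarrow> real" where P: "Cinf_on (I \<times> \<Omega>) P"
    "\<And>t x. t \<in> I \<Longrightarrow> x \<in> \<Omega> \<Longrightarrow> ((\<lambda>x. P (t, x)) has_derivative (\<lambda>h. A (t, x) \<bullet> h)) (at x)"
    by (rule geodesic_pressure[OF g]) (rule that)
  have "lake_equation \<Omega> b H I u"
    unfolding lake_equation_def
  proof (intro conjI exI[of _ "\<lambda>t x. - P (t, x)"] ballI)
    show "smooth_on (I \<times> \<Omega>) (\<lambda>(t, x). u t x)"
      unfolding smooth_on_open[OF open_P\<Omega>] case_prod_unfold by (rule smooth_u)
    show "smooth_on (I \<times> \<Omega>) (\<lambda>(t, x). - P (t, x))"
      unfolding smooth_on_open[OF open_P\<Omega>] case_prod_unfold using Cinf_on_uminus[OF open_P\<Omega> P(1)] by simp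
    show "GDERIV (\<lambda>x. - P (t, x)) x :>
        - (vector_derivative (\<lambda>s. u s x) (at t) + frechet_derivative (u t) (at x) (u t x))"
      if "t \<in> I" "x \<in> \<Omega>" for t x
      unfolding gderiv_pressure[OF that] using P(2)[OF that] by simp
    show "divergence (\<lambda>y. (H + b y) *\<^sub>R u t y) x = 0" if "t \<in> I" "x \<in> \<Omega>" for t x
      using stays_in_lake_iff[OF I t0] XM that by simp
  qed
  then show "X t0 \<in> M \<and> lake_equation \<Omega> b H I u" using XM t0 by simp
next
  assume L: "X t0 \<in> M \<and> lake_equation \<Omega> b H I u"
  then have XM: "X t \<in> M" if "t \<in> I" for t
    using stays_in_lake_iff[OF I t0] that by (simp add: lake_equation_def)
  obtain P :: "real \<Rightarrow> plane \<Rightarrow> real" where P: "\<forall>t\<in>I. \<forall>x\<in>\<Omega>. GDERIV (P t) x :>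
      - (vector_derivative (\<lambda>s. u s x) (at t) + frechet_derivative (u t) (at x) (u t x))"
    using L unfolding lake_equation_def by (elim conjE exE)
  show "geodesic \<Omega> \<rho>0 M I X"
    unfolding geodesic_def normal_forces_def
  proof (intro ballI conjI CollectI)
    fix t assume t: "t \<in> I"
    show "X t \<in> M" by (rule XM[OF t])
    show "smooth_on (closure \<Omega>) (acceleration X t)" by (rule smooth_acceleration[OF t])
    fix \<xi> assume \<xi>: "\<xi> \<in> tangent_space \<Omega> M (X t)"
    show "weighted_metric \<Omega> \<rho>0 (acceleration X t) \<xi> = 0"
    proof (rule gradient_normal[OF XM[OF t] _ smooth_on_continuous[OF smooth_acceleration[OF t]] _ \<xi>])
      show "GDERIV (\<lambda>x. - P t x) x :> A (t, x)" if x: "x \<in> \<Omega>" for x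
        using P t x gderiv_pressure[OF t x, of "P t"] by (simp add: gderiv_def inner_commute)
      show "A (t, X t a) = acceleration X t a" if "a \<in> \<Omega>" for a by (rule A_X[OF t that])
    qed
  qed
qed

end

section \<open>The formal gradient and the Takens limit system\<close>

context fluid
begin

text \<open>For terms constant on the lake manifold, testing a formal gradient against a curve whose
  velocity is that gradient shows that its norm is zero. It then vanishes in \<Omega> and, by
  continuity, on the closure.\<close>

lemma is_formal_gradient_const:
  assumes X: "X \<in> M" and V: "\<And>i X Y. X \<in> M \<Longrightarrow> Y \<in> M \<Longrightarrow> V i X = V i Y"
  shows "is_formal_gradient \<Omega> \<rho>0 M V X (\<lambda>a. 0)"
    and "is_formal_gradient \<Omega> \<rho>0 M V X G \<Longrightarrow> a \<in> closure \<Omega> \<Longrightarrow> G a = 0"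
proof -
  have V': "((\<lambda>s. V i (Y s)) has_real_derivative 0) (at 0)" if "curve_through \<Omega> M X Y" for Y i
  proof -
    obtain \<delta> where \<delta>: "\<delta> > 0" "\<And>s. s \<in> {-\<delta><..<\<delta>} \<Longrightarrow> Y s \<in> M"
      using \<open>curve_through \<Omega> M X Y\<close> unfolding curve_through_def by blast
    show ?thesis
      by (rule has_field_derivative_transform_within_open[OF DERIV_const[of "V i X"], of "{-\<delta><..<\<delta>}"])
        (use \<delta> V[OF X] in auto)
  qed
  have "(\<lambda>a. 0) \<in> tangent_space \<Omega> M X"
  proof -
    have "smooth_on ({-1<..<1::real} \<times> closure \<Omega>) (\<lambda>z. X (snd z))"
      by (rule smooth_on_compose[OF DiffD(1)[OF lake_Diff[OF X]] smooth_onI[OF open_UNIV subset_UNIV Cinf_on_linear[OF bounded_linear_snd] refl]]) auto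
    then have "curve_through \<Omega> M X (\<lambda>s. X)"
      unfolding curve_through_def smooth_curve_def case_prod_unfold
      using X lake_Diff[OF X] by (intro exI[of _ 1]) auto
    then show ?thesis unfolding tangent_space_def velocity_def by (intro CollectI exI[of _ "\<lambda>s. X"]) simp
  qed
  then show "is_formal_gradient \<Omega> \<rho>0 M V X (\<lambda>a. 0)"
    unfolding is_formal_gradient_def using V'
    by (intro conjI allI impI exI[of _ "\<lambda>i. 0"]) (simp_all add: weighted_metric_def)
  assume G: "is_formal_gradient \<Omega> \<rho>0 M V X G" and a: "a \<in> closure \<Omega>"
  then have "G \<in> tangent_space \<Omega> M X" by (simp add: is_formal_gradient_def)
  then obtain Y where Y: "curve_through \<Omega> M X Y" "\<And>a. a \<in> closure \<Omega> \<Longrightarrow> G a = velocity Y 0 a"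
    unfolding tangent_space_def by blast
  obtain d where d: "\<And>i. ((\<lambda>s. V i (Y s)) has_real_derivative d i) (at 0)"
    "d sums weighted_metric \<Omega> \<rho>0 G (velocity Y 0)"
    using G Y(1) unfolding is_formal_gradient_def by blast
  have "d i = 0" for i by (rule DERIV_unique[OF d(1) V'[OF Y(1)]])
  then have "d = (\<lambda>i. 0)" by (simp add: fun_eq_iff)
  then have "weighted_metric \<Omega> \<rho>0 G (velocity Y 0) = 0"
    using sums_unique2[OF d(2)] sums_zero by simp
  moreover have "weighted_metric \<Omega> \<rho>0 G (velocity Y 0) = weighted_metric \<Omega> \<rho>0 G G"
    unfolding weighted_metric_def by (rule integral_cong) (simp add: Y(2) dom_closure)
  ultimately have GG: "weighted_metric \<Omega> \<rho>0 G G = 0" by simp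
  have c: "continuous_on (closure \<Omega>) G"
    by (rule tangent_space_continuous) fact
  show "G a = 0"
    by (rule continuous_constant_on_closure[OF c _ a]) (rule metric_zero_imp_zero[OF c GG])
qed

text \<open>The formal gradient is zero on the closed domain but arbitrary elsewhere, so smoothness
  and orthogonality of the acceleration are transferred through their values on the closure.\<close>

lemma takens_limit_system_const:
  assumes V: "\<And>i X Y. X \<in> M \<Longrightarrow> Y \<in> M \<Longrightarrow> V i X = V i Y"
  shows "takens_limit_system \<Omega> \<rho>0 M V I X \<longleftrightarrow> geodesic \<Omega> \<rho>0 M I X"
proof -
  have "(\<exists>G. is_formal_gradient \<Omega> \<rho>0 M V (X t) G \<and> (\<lambda>a. acceleration X t a + G a) \<in> normal_forces \<Omega> \<rho>0 M (X t)) \<longleftrightarrow>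
      acceleration X t \<in> normal_forces \<Omega> \<rho>0 M (X t)" if Xt: "X t \<in> M" for t
  proof
    assume "\<exists>G. is_formal_gradient \<Omega> \<rho>0 M V (X t) G \<and> (\<lambda>a. acceleration X t a + G a) \<in> normal_forces \<Omega> \<rho>0 M (X t)"
    then obtain G where G: "is_formal_gradient \<Omega> \<rho>0 M V (X t) G"
      and n: "(\<lambda>a. acceleration X t a + G a) \<in> normal_forces \<Omega> \<rho>0 M (X t)" by (elim exE conjE)
    have e: "acceleration X t a + G a = acceleration X t a" if "a \<in> closure \<Omega>" for a
      using is_formal_gradient_const(2)[OF Xt V G that] by simp
    have s: "smooth_on (closure \<Omega>) (acceleration X t)"
      by (rule smooth_on_cong[of _ "\<lambda>a. acceleration X t a + G a"]) (use n e in \<open>auto simp: normal_forces_def\<close>)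
    have "weighted_metric \<Omega> \<rho>0 (acceleration X t) \<xi> = weighted_metric \<Omega> \<rho>0 (\<lambda>a. acceleration X t a + G a) \<xi>" for \<xi>
      unfolding weighted_metric_def by (rule integral_cong) (simp only: e[OF dom_closure])
    then show "acceleration X t \<in> normal_forces \<Omega> \<rho>0 M (X t)" using n s by (simp add: normal_forces_def)
  next
    assume "acceleration X t \<in> normal_forces \<Omega> \<rho>0 M (X t)"
    then show "\<exists>G. is_formal_gradient \<Omega> \<rho>0 M V (X t) G \<and> (\<lambda>a. acceleration X t a + G a) \<in> normal_forces \<Omega> \<rho>0 M (X t)"
      using is_formal_gradient_const(1)[OF Xt V] by (intro exI[of _ "\<lambda>a. 0"]) simp
  qed
  then show ?thesis unfolding takens_limit_system_def geodesic_def by blast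
qed

lemma geodesic_iff:
  assumes "open I" "is_interval I" "smooth_curve \<Omega> I X" "t0 \<in> I"
  shows "geodesic \<Omega> \<rho>0 M I X \<longleftrightarrow> X t0 \<in> M \<and> lake_equation \<Omega> b H I (eulerian_velocity \<Omega> X)"
proof -
  obtain G T where "deformation \<Omega> I X G T"
    by (rule smooth_curve_deformation[OF open_dom bounded_dom assms(1,3)])
  then interpret fluid_curve \<Omega> \<rho>0 b \<rho>e be T0 I X G T
    unfolding fluid_curve_def by (rule fluid_deformationI)
  show ?thesis by (rule geodesic_iff_lake_equation[OF assms(2,4)])
qed

end

theorem theorem6p1:
  fixes \<Omega> :: "(real ^ 2) set" and \<rho>0 b :: "real ^ 2 \<Rightarrow> real"
  assumes "open \<Omega>" and "connected \<Omega>" and "\<Omega> \<noteq> {}" and "bounded \<Omega>"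
    and "smooth_on (closure \<Omega>) \<rho>0" and "\<And>x. x \<in> \<Omega> \<Longrightarrow> \<rho>0 x > 0"
    and "smooth_on (closure \<Omega>) b"
  shows
    "constraining \<Omega> \<rho>0 (potential \<Omega> \<rho>0 b) (lake_manifold \<Omega> \<rho>0 b) \<and>
     (\<forall>I X. \<forall>t0\<in>I. open I \<and> is_interval I \<and> smooth_curve \<Omega> I X \<longrightarrow>
        (geodesic \<Omega> \<rho>0 (lake_manifold \<Omega> \<rho>0 b) I X \<longleftrightarrow>
         X t0 \<in> lake_manifold \<Omega> \<rho>0 b \<and>
         lake_equation \<Omega> b (mean_height \<Omega> \<rho>0 b) I (eulerian_velocity \<Omega> X))) \<and>
     (\<forall>X\<in>lake_manifold \<Omega> \<rho>0 b. \<forall>Y\<in>lake_manifold \<Omega> \<rho>0 b.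
        (\<forall>n \<mu>. eigenvalue_system \<Omega> \<rho>0 (potential \<Omega> \<rho>0 b) (lake_manifold \<Omega> \<rho>0 b) X n \<mu> \<longleftrightarrow>
               eigenvalue_system \<Omega> \<rho>0 (potential \<Omega> \<rho>0 b) (lake_manifold \<Omega> \<rho>0 b) Y n \<mu>) \<and>
        (\<forall>i. eigval \<Omega> \<rho>0 (potential \<Omega> \<rho>0 b) (lake_manifold \<Omega> \<rho>0 b) i X =
             eigval \<Omega> \<rho>0 (potential \<Omega> \<rho>0 b) (lake_manifold \<Omega> \<rho>0 b) i Y)) \<and>
     (\<forall>c :: nat \<Rightarrow> real. (\<forall>i. c i \<ge> 0) \<longrightarrow>
        (let V = homogenized_potential \<Omega> \<rho>0 (potential \<Omega> \<rho>0 b) (lake_manifold \<Omega> \<rho>0 b) c in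
         (\<forall>X\<in>lake_manifold \<Omega> \<rho>0 b. \<forall>Y\<in>lake_manifold \<Omega> \<rho>0 b. \<forall>i. V i X = V i Y) \<and>
         (\<forall>I X. \<forall>t0\<in>I. open I \<and> is_interval I \<and> smooth_curve \<Omega> I X \<longrightarrow>
            (takens_limit_system \<Omega> \<rho>0 (lake_manifold \<Omega> \<rho>0 b) V I X \<longleftrightarrow>
             X t0 \<in> lake_manifold \<Omega> \<rho>0 b \<and>
             lake_equation \<Omega> b (mean_height \<Omega> \<rho>0 b) I (eulerian_velocity \<Omega> X)))))"
proof -
  obtain S1 \<rho>e where 1: "open S1" "closure \<Omega> \<subseteq> S1" "Cinf_on S1 \<rho>e" "\<forall>x\<in>closure \<Omega>. \<rho>0 x = \<rho>e x"
    using assms(5) unfolding smooth_on_Cinf_on by (elim exE conjE)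
  obtain S2 be where 2: "open S2" "closure \<Omega> \<subseteq> S2" "Cinf_on S2 be" "\<forall>x\<in>closure \<Omega>. b x = be x"
    using assms(7) unfolding smooth_on_Cinf_on by (elim exE conjE)
  interpret fluid \<Omega> \<rho>0 b \<rho>e be "S1 \<inter> S2"
  proof
    show "Cinf_on (S1 \<inter> S2) \<rho>e" by (rule Cinf_on_subset[OF 1(3)]) simp
    show "Cinf_on (S1 \<inter> S2) be" by (rule Cinf_on_subset[OF 2(3)]) simp
  qed (use assms 1 2 in auto)
  have V: "homogenized_potential \<Omega> \<rho>0 U M c i X = homogenized_potential \<Omega> \<rho>0 U M c i Y"
    if "X \<in> M" "Y \<in> M" for c i X Y
    using eigval_const[OF that] by (simp add: homogenized_potential_def)
  show ?thesis
    unfolding Let_def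
  proof (intro conjI allI ballI impI)
    show "constraining \<Omega> \<rho>0 U M" by (rule lake_constraining)
    show "geodesic \<Omega> \<rho>0 M I X \<longleftrightarrow> X t0 \<in> M \<and> lake_equation \<Omega> b H I (eulerian_velocity \<Omega> X)"
      if "t0 \<in> I" "open I \<and> is_interval I \<and> smooth_curve \<Omega> I X" for I X t0
      using geodesic_iff[of I X t0] that by simp
    show "takens_limit_system \<Omega> \<rho>0 M (homogenized_potential \<Omega> \<rho>0 U M c) I X \<longleftrightarrow>
        X t0 \<in> M \<and> lake_equation \<Omega> b H I (eulerian_velocity \<Omega> X)"
      if "t0 \<in> I" "open I \<and> is_interval I \<and> smooth_curve \<Omega> I X" for c I X t0
    proof -
      have "takens_limit_system \<Omega> \<rho>0 M (homogenized_potential \<Omega> \<rho>0 U M c) I X \<longleftrightarrow> geodesic \<Omega> \<rho>0 M I X"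
        by (rule takens_limit_system_const) (rule V)
      also have "\<dots> \<longleftrightarrow> X t0 \<in> M \<and> lake_equation \<Omega> b H I (eulerian_velocity \<Omega> X)"
        using geodesic_iff[of I X t0] that by simp
      finally show ?thesis .
    qed
    show "eigenvalue_system \<Omega> \<rho>0 U M X n \<mu> \<longleftrightarrow> eigenvalue_system \<Omega> \<rho>0 U M Y n \<mu>"
      if "X \<in> M" "Y \<in> M" for X Y n \<mu>
      using eigenvalue_system_const[OF that] by simp
    show "eigval \<Omega> \<rho>0 U M i X = eigval \<Omega> \<rho>0 U M i Y" if "X \<in> M" "Y \<in> M" for X Y i
      by (rule eigval_const[OF that])
    show "homogenized_potential \<Omega> \<rho>0 U M c i X = homogenized_potential \<Omega> \<rho>0 U M c i Y"
      if "X \<in> M" "Y \<in> M" for c i X Y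
      by (rule V[OF that])
  qed
qed

end
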